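(* Let $0<\alpha<10$, $0<\kappa<1$, $\beta:=\kappa/\alpha^2$ and $0<c\le\min(10^{-3}\beta^{16/3},10^{-4})$ be given. Consider the (simplified) linearized equations \begin{align*} \partial_t w&=\alpha\,\partial_x j-\big(2c\sin(x)\,\partial_y\Delta_t^{-1}w\big)_{\neq},\\ \partial_t j&=\kappa\Delta_t j+\alpha\,\partial_x w-2\,\partial_x\partial_y^t\Delta_t^{-1}j \end{align*} on $\mathbb{T}\times\mathbb{R}$. Then there exists a constant $C$ such that for any initial data $w_0,j_0$ whose Fourier transform satisfies $$\sum_k\int \exp(C\sqrt{|\xi|})\big(|\mathcal{F}w_0(k,\xi)|^2+|\mathcal{F}j_0(k,\xi)|^2\big)\,d\xi<\infty,$$ the corresponding solution satisfies, for all $t>0$, $$\sum_k\int \exp(\tfrac{C}{2}\sqrt{|\xi|})\big(|\mathcal{F}w(t,k,\xi)|^2+|\mathcal{F}j(t,k,\xi)|^2\big)\,d\xi<\infty.$$ Moreover, there exist $0<C^*<C$ and initial data $w_0,j_0$ such that $$\sum_k\int \exp(C^*\sqrt{|\xi|})\big(|\mathcal{F}w_0(k,\xi)|^2+|\mathcal{F}j_0(k,\xi)|^2\big)\,d\xi<\infty,$$ but such that the corresponding solution $(w,j)$ grows unbounded in Sobolev regularity as $t\to\infty$, that is, $\limsup_{t\to\infty}\|(w,j)(t)\|_{H^s}=\infty$ for every $s\ge 0$ (with the convention that the norm is $\infty$ if $(w,j)(t)\notin H^s$).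
   Context: $(x,y)\in\mathbb{T}\times\mathbb{R}$; $\mathcal{F}$ denotes the Fourier transform, with $k\in\mathbb{Z}$ dual to $x$ and $\xi\in\mathbb{R}$ dual to $y$. Notation: $\partial_y^t=\partial_y-t\partial_x$, $\Delta_t=\partial_x^2+(\partial_y-t\partial_x)^2$, and $(\cdot)_{\neq}$ denotes the projection removing the $x$-average (the $k=0$ mode). The $x$-averages of the perturbations $w,j$ are kept fixed by the model; they are taken to be zero, so only modes $k\ne0$ are present. The equations are a simplified version of the linearization, in vorticity $w$ and current $j$ and in the coordinates $(x-ty,y)$, of the 2D MHD equations with resistivity $\kappa$ and no viscosity around a traveling wave $W=-1+f(t)\cos(x)$, $J=-g(t)\sin(x)$ perturbing $V=(y,0)$, $B=(\alpha,0)$, where $f,g$ have been replaced by their asymptotic values $2c$ and $0$. *)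

theory Defs
  imports "HOL-Probability.Probability"
begin

text \<open>
  The circle is \<open>\<real>/2\<pi>\<int>\<close>, represented by the fundamental domain \<open>[0, 2\<pi>)\<close>. A function on the
  cylinder is a function on the plane of which only the values on \<open>[0, 2\<pi>) \<times> \<real>\<close> matter.
\<close>

definition cyl :: "(real \<times> real) measure" where
  "cyl = restrict_space lborel {0..<2 * pi} \<Otimes>\<^sub>M lborel"

definition L2_cyl :: "(real \<times> real \<Rightarrow> real) set" where
  "L2_cyl = {u \<in> borel_measurable cyl. integrable cyl (\<lambda>z. (u z)\<^sup>2)}"

definition L2_dist_sq :: "(real \<times> real \<Rightarrow> real) \<Rightarrow> (real \<times> real \<Rightarrow> real) \<Rightarrow> ennreal" where
  "L2_dist_sq u v = (\<integral>\<^sup>+z. ennreal ((u z - v z)\<^sup>2) \<partial>cyl)"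

definition zero_x_average :: "(real \<times> real \<Rightarrow> real) \<Rightarrow> bool" where
  "zero_x_average u \<longleftrightarrow> (AE y in lborel. (LINT x|restrict_space lborel {0..<2 * pi}. u (x, y)) = 0)"

text \<open>
  For a square integrable function the Fourier integral need not converge absolutely in \<open>y\<close>;
  the transform is the limit in \<open>L\<^sup>2(d\<xi>)\<close> of the integrals truncated to \<open>\<bar>y\<bar> \<le> R\<close>, so it
  is determined up to null sets of \<open>\<xi>\<close>. The factor \<open>1/(2\<pi>)\<close> makes the transform unitary.
\<close>

definition truncated_fourier ::
  "real \<Rightarrow> (real \<times> real \<Rightarrow> real) \<Rightarrow> int \<Rightarrow> real \<Rightarrow> complex" where
  "truncated_fourier R u k \<xi> =
     complex_of_real (1 / (2 * pi)) *
     (LINT z|cyl. complex_of_real (indicator {-R..R} (snd z) * u z) *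
        cis (- (real_of_int k * fst z + \<xi> * snd z)))"

definition has_fourier :: "(real \<times> real \<Rightarrow> real) \<Rightarrow> (int \<Rightarrow> real \<Rightarrow> complex) \<Rightarrow> bool" where
  "has_fourier u U \<longleftrightarrow>
     (\<forall>k. U k \<in> borel_measurable borel \<and>
       ((\<lambda>R. \<integral>\<^sup>+\<xi>. ennreal ((cmod (U k \<xi> - truncated_fourier R u k \<xi>))\<^sup>2) \<partial>lborel) \<longlongrightarrow> 0) at_top)"

definition fourier :: "(real \<times> real \<Rightarrow> real) \<Rightarrow> int \<Rightarrow> real \<Rightarrow> complex" where
  "fourier u = (SOME U. has_fourier u U)"

definition gevrey_energy ::
  "real \<Rightarrow> (real \<times> real \<Rightarrow> real) \<Rightarrow> (real \<times> real \<Rightarrow> real) \<Rightarrow> ennreal" where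
  "gevrey_energy C w j =
     (\<integral>\<^sup>+k. (\<integral>\<^sup>+\<xi>. ennreal (exp (C * sqrt \<bar>\<xi>\<bar>) *
        ((cmod (fourier w k \<xi>))\<^sup>2 + (cmod (fourier j k \<xi>))\<^sup>2)) \<partial>lborel) \<partial>count_space UNIV)"

text \<open>The norm of a pair in \<open>H\<^sup>s\<close>, which is \<open>\<infinity>\<close> for pairs outside \<open>H\<^sup>s\<close>.\<close>

definition sobolev_norm ::
  "real \<Rightarrow> (real \<times> real \<Rightarrow> real) \<Rightarrow> (real \<times> real \<Rightarrow> real) \<Rightarrow> ennreal" where
  "sobolev_norm s w j =
     (let E = (\<integral>\<^sup>+k. (\<integral>\<^sup>+\<xi>. ennreal ((1 + (real_of_int k)\<^sup>2 + \<xi>\<^sup>2) powr s *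
        ((cmod (fourier w k \<xi>))\<^sup>2 + (cmod (fourier j k \<xi>))\<^sup>2)) \<partial>lborel) \<partial>count_space UNIV)
      in if E = \<infinity> then \<infinity> else ennreal (sqrt (enn2real E)))"

text \<open>
  The operators of the equations are Fourier multipliers and act on transforms:
  \<open>dx\<close>, \<open>dy\<close>, \<open>dyt t\<close> and \<open>lap t\<close> are \<open>\<partial>\<^sub>x\<close>, \<open>\<partial>\<^sub>y\<close>, \<open>\<partial>\<^sub>y - t \<partial>\<^sub>x\<close> and
  \<open>\<partial>\<^sub>x\<^sup>2 + (\<partial>\<^sub>y - t \<partial>\<^sub>x)\<^sup>2\<close>. The inverse \<open>lap_inv t\<close> is meaningful for \<open>k \<noteq> 0\<close> only.
\<close>

definition dx :: "(int \<Rightarrow> real \<Rightarrow> complex) \<Rightarrow> int \<Rightarrow> real \<Rightarrow> complex" where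
  "dx U = (\<lambda>k \<xi>. \<i> * of_int k * U k \<xi>)"

definition dy :: "(int \<Rightarrow> real \<Rightarrow> complex) \<Rightarrow> int \<Rightarrow> real \<Rightarrow> complex" where
  "dy U = (\<lambda>k \<xi>. \<i> * of_real \<xi> * U k \<xi>)"

definition dyt :: "real \<Rightarrow> (int \<Rightarrow> real \<Rightarrow> complex) \<Rightarrow> int \<Rightarrow> real \<Rightarrow> complex" where
  "dyt t U = (\<lambda>k \<xi>. dy U k \<xi> - of_real t * dx U k \<xi>)"

definition lap :: "real \<Rightarrow> (int \<Rightarrow> real \<Rightarrow> complex) \<Rightarrow> int \<Rightarrow> real \<Rightarrow> complex" where
  "lap t U = (\<lambda>k \<xi>. dx (dx U) k \<xi> + dyt t (dyt t U) k \<xi>)"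

definition lap_inv :: "real \<Rightarrow> (int \<Rightarrow> real \<Rightarrow> complex) \<Rightarrow> int \<Rightarrow> real \<Rightarrow> complex" where
  "lap_inv t U = (\<lambda>k \<xi>. - U k \<xi> / of_real ((real_of_int k)\<^sup>2 + (\<xi> - real_of_int k * t)\<^sup>2))"

definition nonzero_modes :: "(int \<Rightarrow> real \<Rightarrow> complex) \<Rightarrow> int \<Rightarrow> real \<Rightarrow> complex" where
  "nonzero_modes U = (\<lambda>k \<xi>. if k = 0 then 0 else U k \<xi>)"

text \<open>On the transform side, multiplication by \<open>sin x\<close> is a difference of shifts in \<open>k\<close>; see \<open>has_fourier_sin_mult\<close> below.\<close>

definition sin_mult :: "(int \<Rightarrow> real \<Rightarrow> complex) \<Rightarrow> int \<Rightarrow> real \<Rightarrow> complex" where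
  "sin_mult U = (\<lambda>k \<xi>. (U (k - 1) \<xi> - U (k + 1) \<xi>) / (2 * \<i>))"

lemma lap_lap_inv:
  assumes "k \<noteq> 0"
  shows "lap t (lap_inv t U) k \<xi> = U k \<xi>" "lap_inv t (lap t U) k \<xi> = U k \<xi>"
proof -
  let ?p = "(real_of_int k)\<^sup>2 + (\<xi> - real_of_int k * t)\<^sup>2"
  have p: "complex_of_real ?p \<noteq> 0"
    using assms by (simp only: of_real_eq_0_iff sum_power2_eq_zero_iff) simp
  have lap: "lap t V k \<xi> = - of_real ?p * V k \<xi>" for V
    by (simp add: lap_def dyt_def dx_def dy_def power2_eq_square algebra_simps)
  have inv: "lap_inv t V k \<xi> = - V k \<xi> / of_real ?p" for V
    by (simp only: lap_inv_def)
  have cancel: "- q * (- v / q) = v" "- (- q * v) / q = v" if "q \<noteq> 0" for q v :: complex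
    using that by simp_all
  show "lap t (lap_inv t U) k \<xi> = U k \<xi>" "lap_inv t (lap t U) k \<xi> = U k \<xi>"
    unfolding lap inv by (simp_all only: cancel[OF p])
qed

lemma measurable_cyl:
  "fst \<in> borel_measurable cyl" "snd \<in> borel_measurable cyl" "cis \<in> borel_measurable borel"
proof -
  have sets: "sets cyl = sets (restrict_space borel {0..<2 * pi} \<Otimes>\<^sub>M borel)"
    unfolding cyl_def by (intro sets_pair_measure_cong sets_restrict_space_cong) simp_all
  have "fst \<in> cyl \<rightarrow>\<^sub>M restrict_space borel {0..<2 * pi}"
    unfolding measurable_cong_sets[OF sets refl] by measurable
  then show "fst \<in> borel_measurable cyl"
    by (simp add: measurable_restrict_space2_iff)
  show "snd \<in> borel_measurable cyl"
    unfolding measurable_cong_sets[OF sets refl] by measurable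
  show "cis \<in> borel_measurable borel"
    by (intro borel_measurable_continuous_onI) (simp add: cis_conv_exp continuous_intros)
qed

lemma integrable_truncated_fourier:
  assumes "u \<in> L2_cyl"
  shows "integrable cyl (\<lambda>z. complex_of_real (indicator {-R..R} (snd z) * u z) *
           cis (- (real_of_int k * fst z + \<xi> * snd z)))"
proof -
  have [measurable]: "u \<in> borel_measurable cyl" and u2: "integrable cyl (\<lambda>z. (u z)\<^sup>2)"
    using assms by (auto simp: L2_cyl_def)
  note [measurable] = measurable_cyl
  have "integrable cyl (\<lambda>z. indicator ({0..<2 * pi} \<times> {-R..R}) z :: real)"
  proof -
    have "emeasure cyl ({0..<2 * pi} \<times> {-R..R}) < \<infinity>"
      unfolding cyl_def
      by (subst lborel.emeasure_pair_measure_Times)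
         (auto simp: sets_restrict_space_iff emeasure_restrict_space ennreal_mult_less_top
             emeasure_lborel_Icc_eq)
    moreover have "{0..<2 * pi} \<times> {-R..R} \<in> sets cyl"
      unfolding cyl_def by (intro pair_measureI) (auto simp: sets_restrict_space_iff)
    ultimately show ?thesis
      by (intro integrable_real_indicator) auto
  qed
  moreover
  have "space cyl = {0..<2 * pi} \<times> UNIV"
    by (simp add: cyl_def space_pair_measure space_restrict_space)
  then have "integrable cyl (\<lambda>z. indicator ({0..<2 * pi} \<times> {-R..R}) z :: real) \<longleftrightarrow>
      integrable cyl (\<lambda>z. indicator {-R..R} (snd z) :: real)"
    by (intro Bochner_Integration.integrable_cong) (auto simp: indicator_def)
  ultimately have "integrable cyl (\<lambda>z. indicator {-R..R} (snd z) :: real)"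
    by blast
  then have "integrable cyl (\<lambda>z. indicator {-R..R} (snd z) + (u z)\<^sup>2)"
    using u2 by simp
  then show ?thesis
  proof (rule Bochner_Integration.integrable_bound)
    have "\<bar>a\<bar> \<le> 1 + a\<^sup>2" for a :: real
      using sum_squares_bound[of 1 "\<bar>a\<bar>"] by (simp add: power2_eq_square)
    then show "AE z in cyl. norm (complex_of_real (indicator {-R..R} (snd z) * u z) *
        cis (- (real_of_int k * fst z + \<xi> * snd z))) \<le> norm (indicator {-R..R} (snd z) + (u z)\<^sup>2)"
      by (intro AE_I2) (auto simp: norm_mult indicator_def)
  qed measurable
qed

lemma measurable_truncated_fourier:
  assumes "u \<in> L2_cyl"
  shows "truncated_fourier R u k \<in> borel_measurable borel"
proof -
  interpret T: sigma_finite_measure "restrict_space lborel {0..<2 * pi :: real}"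
    by (intro sigma_finite_measure_restrict_space sigma_finite_lborel) simp
  interpret pair_sigma_finite "restrict_space lborel {0..<2 * pi :: real}" "lborel :: real measure"
    by unfold_locales
  interpret cyl: sigma_finite_measure cyl
    unfolding cyl_def by unfold_locales
  note [measurable] = measurable_cyl
  have [measurable]: "u \<in> borel_measurable cyl"
    using assms by (auto simp: L2_cyl_def)
  show ?thesis
    unfolding truncated_fourier_def by measurable
qed

lemma truncated_fourier_sin:
  assumes "u \<in> L2_cyl"
  shows "truncated_fourier R (\<lambda>z. sin (fst z) * u z) k \<xi> = sin_mult (truncated_fourier R u) k \<xi>"
proof -
  let ?f = "\<lambda>l z. complex_of_real (indicator {-R..R} (snd z) * u z) *
              cis (- (real_of_int l * fst z + \<xi> * snd z))"
  have sin: "complex_of_real (sin x) = (cis x - cis (- x)) / (2 * \<i>)" for x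
    by (simp add: complex_eq_iff)
  have "complex_of_real (indicator {-R..R} (snd z) * (sin (fst z) * u z)) *
      cis (- (real_of_int k * fst z + \<xi> * snd z)) = (?f (k - 1) z - ?f (k + 1) z) / (2 * \<i>)" for z
  proof -
    have "cis (- (real_of_int (k - 1) * fst z + \<xi> * snd z)) =
        cis (fst z) * cis (- (real_of_int k * fst z + \<xi> * snd z))"
      and "cis (- (real_of_int (k + 1) * fst z + \<xi> * snd z)) =
        cis (- fst z) * cis (- (real_of_int k * fst z + \<xi> * snd z))"
      by (simp_all add: cis_mult algebra_simps)
    then show ?thesis
      by (simp add: sin algebra_simps diff_divide_distrib)
  qed
  then have "truncated_fourier R (\<lambda>z. sin (fst z) * u z) k \<xi> =
      complex_of_real (1 / (2 * pi)) * (LINT z|cyl. (?f (k - 1) z - ?f (k + 1) z) / (2 * \<i>))"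
    unfolding truncated_fourier_def by presburger
  also have "(LINT z|cyl. (?f (k - 1) z - ?f (k + 1) z) / (2 * \<i>)) =
      ((LINT z|cyl. ?f (k - 1) z) - (LINT z|cyl. ?f (k + 1) z)) / (2 * \<i>)"
    by (subst Bochner_Integration.integral_diff[symmetric,
          OF integrable_truncated_fourier[OF assms] integrable_truncated_fourier[OF assms]])
       (rule integral_divide_zero)
  finally show ?thesis
    unfolding sin_mult_def truncated_fourier_def by (simp only: right_diff_distrib times_divide_eq_right)
qed

lemma has_fourier_sin_mult:
  assumes "u \<in> L2_cyl" "has_fourier u U"
  shows "has_fourier (\<lambda>z. sin (fst z) * u z) (sin_mult U)"
  unfolding has_fourier_def
proof (intro allI conjI)
  fix k
  have [measurable]: "U l \<in> borel_measurable borel" for l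
    using assms by (auto simp: has_fourier_def)
  show "sin_mult U k \<in> borel_measurable borel"
    unfolding sin_mult_def by measurable
  let ?T = "\<lambda>R. truncated_fourier R u"
  let ?d = "\<lambda>R l \<xi>. ennreal ((cmod (U l \<xi> - ?T R l \<xi>))\<^sup>2)"
  have meas [measurable]: "?T R l \<in> borel_measurable borel" for R l
    using assms(1) by (rule measurable_truncated_fourier)
  have bound: "ennreal ((cmod (sin_mult U k \<xi> - truncated_fourier R (\<lambda>z. sin (fst z) * u z) k \<xi>))\<^sup>2)
      \<le> ?d R (k - 1) \<xi> + ?d R (k + 1) \<xi>" for R \<xi>
  proof -
    let ?a = "U (k - 1) \<xi> - ?T R (k - 1) \<xi>" and ?b = "U (k + 1) \<xi> - ?T R (k + 1) \<xi>"
    have "sin_mult U k \<xi> - truncated_fourier R (\<lambda>z. sin (fst z) * u z) k \<xi> = (?a - ?b) / (2 * \<i>)"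
      unfolding truncated_fourier_sin[OF assms(1)] sin_mult_def by (simp add: field_simps)
    then have "cmod (sin_mult U k \<xi> - truncated_fourier R (\<lambda>z. sin (fst z) * u z) k \<xi>)
        \<le> (cmod ?a + cmod ?b) / 2"
      using norm_triangle_ineq4[of ?a ?b] by (simp add: norm_divide norm_mult)
    then have "(cmod (sin_mult U k \<xi> - truncated_fourier R (\<lambda>z. sin (fst z) * u z) k \<xi>))\<^sup>2
        \<le> ((cmod ?a + cmod ?b) / 2)\<^sup>2"
      by (intro power_mono) auto
    also have "\<dots> \<le> (cmod ?a)\<^sup>2 + (cmod ?b)\<^sup>2"
    proof -
      have "((x + y) / 2)\<^sup>2 \<le> x\<^sup>2 + y\<^sup>2" for x y :: real
        using sum_squares_bound[of x y] by (simp add: power_divide power2_sum) (smt (verit) zero_le_power2)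
      then show ?thesis .
    qed
    finally show ?thesis
      by (simp flip: ennreal_plus add: ennreal_leI)
  qed
  have lim: "((\<lambda>R. (\<integral>\<^sup>+\<xi>. ?d R l \<xi> \<partial>lborel)) \<longlongrightarrow> 0) at_top" for l
    using assms by (auto simp: has_fourier_def)
  show "((\<lambda>R. \<integral>\<^sup>+\<xi>. ennreal ((cmod (sin_mult U k \<xi> -
      truncated_fourier R (\<lambda>z. sin (fst z) * u z) k \<xi>))\<^sup>2) \<partial>lborel) \<longlongrightarrow> 0) at_top"
  proof (rule tendsto_sandwich[OF _ _ tendsto_const])
    show "((\<lambda>R. (\<integral>\<^sup>+\<xi>. ?d R (k - 1) \<xi> \<partial>lborel) + (\<integral>\<^sup>+\<xi>. ?d R (k + 1) \<xi> \<partial>lborel)) \<longlongrightarrow> 0) at_top"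
      using tendsto_add[OF lim[of "k - 1"] lim[of "k + 1"]] by simp
    show "\<forall>\<^sub>F R in at_top. (\<integral>\<^sup>+\<xi>. ennreal ((cmod (sin_mult U k \<xi> -
        truncated_fourier R (\<lambda>z. sin (fst z) * u z) k \<xi>))\<^sup>2) \<partial>lborel)
        \<le> (\<integral>\<^sup>+\<xi>. ?d R (k - 1) \<xi> \<partial>lborel) + (\<integral>\<^sup>+\<xi>. ?d R (k + 1) \<xi> \<partial>lborel)"
    proof (rule always_eventually, rule allI)
      fix R
      show "(\<integral>\<^sup>+\<xi>. ennreal ((cmod (sin_mult U k \<xi> -
          truncated_fourier R (\<lambda>z. sin (fst z) * u z) k \<xi>))\<^sup>2) \<partial>lborel)
          \<le> (\<integral>\<^sup>+\<xi>. ?d R (k - 1) \<xi> \<partial>lborel) + (\<integral>\<^sup>+\<xi>. ?d R (k + 1) \<xi> \<partial>lborel)"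
        by (subst nn_integral_add[symmetric]) (auto intro!: nn_integral_mono bound)
    qed
  qed simp
qed

text \<open>
  A solution is a continuous curve in \<open>L\<^sup>2\<close> such that the equations hold after Fourier
  transform. \<open>W t\<close> and \<open>J t\<close> are representatives of the transforms, chosen such that for
  each \<open>k\<close> and almost every \<open>\<xi>\<close> the equations hold at every time; at \<open>t = 0\<close> the time
  derivative is one-sided.
\<close>

definition is_solution ::
  "real \<Rightarrow> real \<Rightarrow> real \<Rightarrow> (real \<times> real \<Rightarrow> real) \<Rightarrow> (real \<times> real \<Rightarrow> real) \<Rightarrow>
   (real \<Rightarrow> real \<times> real \<Rightarrow> real) \<Rightarrow> (real \<Rightarrow> real \<times> real \<Rightarrow> real) \<Rightarrow> bool" where
  "is_solution \<alpha> \<kappa> c w0 j0 w j \<longleftrightarrow>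
     (AE z in cyl. w 0 z = w0 z) \<and> (AE z in cyl. j 0 z = j0 z) \<and>
     (\<forall>t\<ge>0. w t \<in> L2_cyl \<and> j t \<in> L2_cyl \<and> zero_x_average (w t) \<and> zero_x_average (j t) \<and>
        ((\<lambda>\<tau>. L2_dist_sq (w \<tau>) (w t)) \<longlongrightarrow> 0) (at t within {0..}) \<and>
        ((\<lambda>\<tau>. L2_dist_sq (j \<tau>) (j t)) \<longlongrightarrow> 0) (at t within {0..})) \<and>
     (\<exists>W J. (\<forall>t\<ge>0. has_fourier (w t) (W t) \<and> has_fourier (j t) (J t)) \<and>
        (\<forall>k. AE \<xi> in lborel. \<forall>t\<ge>0.
          ((\<lambda>\<tau>. W \<tau> k \<xi>) has_vector_derivative
             of_real \<alpha> * dx (J t) k \<xi>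
             - nonzero_modes (\<lambda>k \<xi>. of_real (2 * c) * sin_mult (dy (lap_inv t (W t))) k \<xi>) k \<xi>)
            (at t within {0..}) \<and>
          ((\<lambda>\<tau>. J \<tau> k \<xi>) has_vector_derivative
             of_real \<kappa> * lap t (J t) k \<xi> + of_real \<alpha> * dx (W t) k \<xi>
             - 2 * dx (dyt t (lap_inv t (J t))) k \<xi>)
            (at t within {0..})))"

end

(*
  On the Fourier side the equations decouple in the frequency xi and become, for each xi, a chain of
  ODEs in k in which mode k acts on its two neighbours with strength c xi / p_k,
  p_k = k^2 + (xi - k t)^2.  Up to time t one has p_k >= xi^2 / (1 + t^2), so the coupling is bounded
  uniformly in xi and k; this gives existence and the propagation of every Gevrey weight.

  For the instability, mode k is resonant near t = xi / k, and there it is damped only by the factor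
  exp(-pi / beta) while it forces k - 1 with total strength pi c xi / k^2.  For k of size sqrt(c xi)
  a resonance therefore at least doubles the amplitude when passing it on from k to k - 1, provided
  all other modes stay in a cone around mode k.  About sqrt(c xi) / 100 such steps in succession give
  the growth exp(2 sg sqrt(xi)), which beats the decay exp(-sg sqrt(xi)) of the Gevrey data.
*)
theory Submission
  imports Defs
begin

section \<open>Fourier transform on the line and on the circle\<close>

text \<open>The exchange between vorticity and current has size \<alpha> k, unbounded along the
  chain. In the energy it cancels by skew symmetry. In the construction of solutions the current is
  eliminated, so that two factors \<alpha> k meet the damping \<kappa> k^2. Uniqueness is not shown;
  instead every solution is shown to have bounded modes on compact time intervals at almost every
  frequency, which is what the energy estimate and the growth argument ask for. At a resonance
  forcing and damping act at the same time, so the amplification of a neighbour has to be computed: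
  it is \<open>LL k\<close> * \<beta> * (1 - exp (- x / \<beta>)), where x is the increment of the
  arctangent, close to pi. Replacing x by 3 gives the guaranteed factor \<open>LL k * b\<close>. A
  resonance feeds k + 1 as strongly as k - 1, so the cone cannot ask for decay away from k, only for
  a bound by 3 times the amplitude of the active mode. All times depend on the integer part N of the
  frequency only, so a whole unit interval of frequencies grows simultaneously, as a lower bound for
  a norm requires. The seed sits in the highest mode of the window at time 0, and modes above it
  resonate earlier; weighted bounds show that they do no harm.\<close>

lemmas cis_measurable [measurable] = measurable_cyl(3)

abbreviation nsq :: "'a::real_normed_vector \<Rightarrow> ennreal" where
  "nsq x \<equiv> ennreal ((norm x)\<^sup>2)"

lemma cnj_measurable [measurable]: "cnj \<in> borel_measurable borel"
  by (intro borel_measurable_continuous_onI continuous_intros)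

lemma integral_norm_bound_ennreal2:
  fixes f :: "'a \<Rightarrow> 'b::{banach, second_countable_topology}"
  shows "ennreal (norm (integral\<^sup>L M f)) \<le> (\<integral>\<^sup>+x. ennreal (norm (f x)) \<partial>M)"
  by (cases "integrable M f") (auto simp: integral_norm_bound_ennreal not_integrable_integral_eq)

text \<open>As the kernel is bounded by one, \<open>a x * b y\<close> dominates and Fubini applies.
  The multiplication formula and the Gaussian regularisation in \<open>Ft_bessel\<close> are both
  instances.\<close>

lemma integral_exchange_kernel:
  fixes a b :: "real \<Rightarrow> complex" and k :: "real \<Rightarrow> real \<Rightarrow> complex"
  assumes a: "integrable lborel a" and b: "integrable lborel b"
    and k: "(\<lambda>(x, y). k x y) \<in> borel_measurable (lborel \<Otimes>\<^sub>M lborel)"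
    and bd: "\<And>x y. cmod (k x y) \<le> 1"
  shows "(LINT x|lborel. a x * (LINT y|lborel. b y * k x y)) =
         (LINT y|lborel. b y * (LINT x|lborel. a x * k x y))"
proof -
  have [measurable]: "a \<in> borel_measurable lborel" "b \<in> borel_measurable lborel"
    using a b by auto
  note k[measurable]
  have ab: "integrable (lborel \<Otimes>\<^sub>M lborel) (\<lambda>(x, y). a x * b y)"
    using a b by (intro lborel_pair.Fubini_integrable) (auto simp: norm_mult)
  have int: "integrable (lborel \<Otimes>\<^sub>M lborel) (\<lambda>(x, y). a x * b y * k x y)"
    by (rule Bochner_Integration.integrable_bound[OF ab])
       (auto simp: norm_mult case_prod_beta intro!: AE_I2 mult_left_le bd)
  have "(LINT y|lborel. LINT x|lborel. a x * b y * k x y) =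
      (LINT x|lborel. LINT y|lborel. a x * b y * k x y)"
    using lborel_pair.Fubini_integral[OF int] by simp
  moreover have "(LINT y|lborel. a x * b y * k x y) = a x * (LINT y|lborel. b y * k x y)" for x
    by (subst integral_mult_right_zero[symmetric]) (simp add: mult.assoc)
  moreover have "(LINT x|lborel. a x * b y * k x y) = b y * (LINT x|lborel. a x * k x y)" for y
    by (subst integral_mult_right_zero[symmetric]) (simp add: mult_ac)
  ultimately show ?thesis by simp
qed

section \<open>Transform of integrable functions on the line: Bessel inequality and
  injectivity\<close>

definition Ft :: "(real \<Rightarrow> complex) \<Rightarrow> real \<Rightarrow> complex" where
  "Ft f \<xi> = (LINT y|lborel. f y * cis (- (\<xi> * y)))"

lemma Ft_measurable [measurable]:
  assumes [measurable]: "f \<in> borel_measurable borel"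
  shows "Ft f \<in> borel_measurable borel"
  unfolding Ft_def by measurable

lemma integrable_mult_cis:
  assumes "integrable lborel f"
  shows "integrable lborel (\<lambda>y. f y * cis (r * y))" "integrable lborel (\<lambda>y. f y * cis (- (r * y)))"
  using assms by (auto intro!: Bochner_Integration.integrable_bound[OF assms] AE_I2 simp: norm_mult)

lemma Ft_bound:
  assumes "integrable lborel f"
  shows "cmod (Ft f \<xi>) \<le> (LINT y|lborel. cmod (f y))"
  unfolding Ft_def by (rule order_trans[OF integral_norm_bound]) (simp add: norm_mult)

lemma Ft_multiplication:
  assumes "integrable lborel f" "integrable lborel g"
  shows "(LINT \<xi>|lborel. g \<xi> * Ft f \<xi>) = (LINT y|lborel. f y * Ft g y)"
  unfolding Ft_def
  by (subst integral_exchange_kernel[OF assms(2,1)]) (auto simp: mult.commute)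

lemma gaussian_integrable:
  assumes "0 < (e::real)"
  shows "integrable lborel (\<lambda>x. exp (- (e * (x - m))\<^sup>2 / 2))"
proof -
  have "integrable lborel (\<lambda>x. sqrt (2 * pi * (1/e)\<^sup>2) * normal_density m (1 / e) x)"
    using assms by (intro integrable_mult_right integrable_normal_density) auto
  moreover have "sqrt (2 * pi * (1/e)\<^sup>2) * normal_density m (1 / e) x = exp (- (e * (x - m))\<^sup>2 / 2)" for x
    using assms by (simp add: normal_density_def power_mult_distrib power_divide real_sqrt_mult real_sqrt_divide)
  ultimately show ?thesis by simp
qed

text \<open>After the substitution x = m + y / e this is the characteristic function of the standard
  normal distribution. A Gaussian of width 1 / e is sent to a normal density of standard deviation
  e, modulated according to its centre m.\<close>

lemma Ft_gaussian:
  assumes "0 < (e::real)"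
  shows "Ft (\<lambda>x. of_real (exp (- (e * (x - m))\<^sup>2 / 2))) \<xi> =
    of_real (2 * pi * normal_density 0 e \<xi>) * cis (- (\<xi> * m))"
proof -
  have 1: "(LINT x|lborel. of_real (exp (- x\<^sup>2 / 2)) * cis (t * x)) =
      of_real (sqrt (2 * pi) * exp (- t\<^sup>2 / 2))" for t
  proof -
    have "char std_normal_distribution t = of_real (exp (- t\<^sup>2 / 2))"
      by (simp add: char_std_normal_distribution)
    then have "(LINT x|lborel. std_normal_density x *\<^sub>R cis (t * x)) = of_real (exp (- t\<^sup>2 / 2))"
      unfolding char_def
      by (subst (asm) integral_density) (auto simp: cis_conv_exp std_normal_density_def)
    moreover have "(LINT x|lborel. of_real (exp (- x\<^sup>2 / 2)) * cis (t * x)) =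
        (LINT x|lborel. of_real (sqrt (2 * pi)) * (std_normal_density x *\<^sub>R cis (t * x)))"
      by (rule Bochner_Integration.integral_cong) (auto simp: std_normal_density_def scaleR_conv_of_real)
    ultimately show ?thesis by (simp only: integral_mult_right_zero of_real_mult)
  qed
  have "Ft (\<lambda>x. of_real (exp (- (e * (x - m))\<^sup>2 / 2))) \<xi> =
     \<bar>1/e\<bar> *\<^sub>R (LINT x|lborel. of_real (exp (- (e * (m + (1/e) * x - m))\<^sup>2 / 2)) * cis (- (\<xi> * (m + (1/e) * x))))"
    unfolding Ft_def using assms by (subst lborel_integral_real_affine[where c="1/e" and t=m]) auto
  also have "(LINT x|lborel. of_real (exp (- (e * (m + (1/e) * x - m))\<^sup>2 / 2)) * cis (- (\<xi> * (m + (1/e) * x)))) =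
     (LINT x|lborel. cis (- (\<xi> * m)) * (of_real (exp (- x\<^sup>2 / 2)) * cis ((- \<xi> / e) * x)))"
  proof (rule Bochner_Integration.integral_cong[OF refl])
    fix x
    have "cis (- (\<xi> * (m + (1/e) * x))) = cis (- (\<xi> * m)) * cis ((- \<xi> / e) * x)"
      by (simp add: cis_mult algebra_simps)
    moreover have "e * (m + (1/e) * x - m) = x" using assms by simp
    ultimately show "of_real (exp (- (e * (m + (1/e) * x - m))\<^sup>2 / 2)) * cis (- (\<xi> * (m + (1/e) * x))) =
      cis (- (\<xi> * m)) * (of_real (exp (- x\<^sup>2 / 2)) * cis ((- \<xi> / e) * x))"
      by (simp only: mult_ac)
  qed
  also have "... = cis (- (\<xi> * m)) * of_real (sqrt (2 * pi) * exp (- (- \<xi> / e)\<^sup>2 / 2))"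
    by (subst integral_mult_right_zero) (simp only: 1)
  finally have "Ft (\<lambda>x. of_real (exp (- (e * (x - m))\<^sup>2 / 2))) \<xi> =
     \<bar>1/e\<bar> *\<^sub>R (cis (- (\<xi> * m)) * of_real (sqrt (2 * pi) * exp (- (- \<xi> / e)\<^sup>2 / 2)))" .
  moreover have "\<bar>1/e\<bar> * (sqrt (2 * pi) * exp (- (- \<xi> / e)\<^sup>2 / 2)) = 2 * pi * normal_density 0 e \<xi>"
  proof -
    have "sqrt (2 * pi * e\<^sup>2) = sqrt (2 * pi) * e" using assms by (simp add: real_sqrt_mult)
    moreover have "sqrt (2 * pi) * sqrt (2 * pi) = 2 * pi" by simp
    ultimately show ?thesis using assms
      by (simp add: normal_density_def power_divide field_simps)
  qed
  ultimately show ?thesis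
    by (metis (no_types, lifting) mult.commute mult.left_commute of_real_mult scaleR_conv_of_real)
qed

text \<open>A Gaussian weight makes the squared transform integrable. The multiplication formula
  turns the weighted integral into the pairing of f with its convolution by a normal density, which
  has mass one, and the weight is removed by Fatou. This inequality, instead of the full Plancherel
  identity, carries all of the L2 theory below.\<close>

lemma Ft_bessel:
  assumes f: "integrable lborel f"
  shows "(\<integral>\<^sup>+\<xi>. nsq (Ft f \<xi>) \<partial>lborel) \<le> ennreal (2 * pi) * (\<integral>\<^sup>+y. nsq (f y) \<partial>lborel)"
proof -
  let ?G = "\<lambda>e x y. 2 * pi * normal_density 0 e (x - y)"
  have [measurable]: "f \<in> borel_measurable borel" using f by auto
  define N where "N = (\<integral>\<^sup>+y. nsq (f y) \<partial>lborel)"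
  define g where "g e \<xi> = exp (- (e * (\<xi> - 0))\<^sup>2 / 2)" for e \<xi> :: real
  have main: "(\<integral>\<^sup>+\<xi>. ennreal (g e \<xi> * (cmod (Ft f \<xi>))\<^sup>2) \<partial>lborel) \<le> ennreal (2 * pi) * N" if e: "0 < e" for e
  proof -
    have [measurable]: "g e \<in> borel_measurable borel" unfolding g_def by measurable
    have gi: "integrable lborel (g e)" unfolding g_def by (rule gaussian_integrable[OF e])
    define K where "K = (LINT y|lborel. cmod (f y))"
    have bd: "cmod (Ft f \<xi>) \<le> K" for \<xi> unfolding K_def by (rule Ft_bound[OF f])
    have K0: "0 \<le> K" unfolding K_def by simp
    have gfi: "integrable lborel (\<lambda>\<xi>. of_real (g e \<xi>) * cnj (Ft f \<xi>))"
    proof (rule Bochner_Integration.integrable_bound[where f="\<lambda>\<xi>. K * g e \<xi>"])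
      show "integrable lborel (\<lambda>\<xi>. K * g e \<xi>)" using gi by simp
    next
      show "(\<lambda>\<xi>. of_real (g e \<xi>) * cnj (Ft f \<xi>)) \<in> borel_measurable lborel" by measurable
      show "AE \<xi> in lborel. norm (of_real (g e \<xi>) * cnj (Ft f \<xi>)) \<le> norm (K * g e \<xi>)"
        using bd K0 by (auto simp: norm_mult g_def mult.commute intro!: mult_right_mono)
    qed
    have gi2: "integrable lborel (\<lambda>\<xi>. g e \<xi> * (cmod (Ft f \<xi>))\<^sup>2)"
    proof (rule Bochner_Integration.integrable_bound[where f="\<lambda>\<xi>. K\<^sup>2 * g e \<xi>"])
      show "integrable lborel (\<lambda>\<xi>. K\<^sup>2 * g e \<xi>)" using gi by simp
    next
      show "AE \<xi> in lborel. norm (g e \<xi> * (cmod (Ft f \<xi>))\<^sup>2) \<le> norm (K\<^sup>2 * g e \<xi>)"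
        using bd K0 by (auto simp: g_def mult.commute intro!: mult_right_mono power_mono)
    qed measurable
    have ci: "integrable lborel (\<lambda>y. cnj (f y))" using f by (simp add: complex_integrable_cnj)
    \<comment> \<open>Conjugation reverses the phase, so the Gaussian is transformed at the
      difference x - y: the outcome is a convolution with a normal density.\<close>
    have Ftg: "Ft (\<lambda>\<xi>. of_real (g e \<xi>) * cnj (Ft f \<xi>)) x =
      (LINT y|lborel. cnj (f y) * of_real (?G e x y))" for x
    proof -
      have "Ft (\<lambda>\<xi>. of_real (g e \<xi>) * cnj (Ft f \<xi>)) x =
         (LINT \<xi>|lborel. of_real (g e \<xi>) * (LINT y|lborel. cnj (f y) * cis (- ((x - y) * \<xi>))))"
        unfolding Ft_def
      proof (rule Bochner_Integration.integral_cong[OF refl])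
        fix \<xi>
        have "cnj (LINT y|lborel. f y * cis (- (\<xi> * y))) * cis (- (x * \<xi>)) = (LINT y|lborel. cnj (f y) * cis (- ((x - y) * \<xi>)))"
          unfolding Bochner_Integration.integral_cnj[symmetric]
          by (subst integral_mult_left_zero[symmetric])
             (rule Bochner_Integration.integral_cong, auto simp: cis_cnj cis_mult algebra_simps)
        then show "of_real (g e \<xi>) * cnj (LINT y|lborel. f y * cis (- (\<xi> * y))) * cis (- (x * \<xi>)) =
            of_real (g e \<xi>) * (LINT y|lborel. cnj (f y) * cis (- ((x - y) * \<xi>)))" by (simp add: mult.assoc)
      qed
      also have "... = (LINT y|lborel. cnj (f y) * (LINT \<xi>|lborel. of_real (g e \<xi>) * cis (- ((x - y) * \<xi>))))"
        by (rule integral_exchange_kernel[OF _ ci]) (use gi in auto)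
      also have "(\<lambda>y. LINT \<xi>|lborel. of_real (g e \<xi>) * cis (- ((x - y) * \<xi>))) =
          (\<lambda>y. of_real (?G e x y))"
        using Ft_gaussian[OF e, of 0 "x - y" for y] by (simp only: Ft_def g_def) simp
      finally show ?thesis .
    qed
    have nd: "(\<integral>\<^sup>+y. ennreal (normal_density 0 e (x - y)) \<partial>lborel) = 1" for x
    proof -
      have "(\<integral>\<^sup>+y. ennreal (normal_density 0 e (x - y)) \<partial>lborel) = (\<integral>\<^sup>+y. ennreal (normal_density x e y) \<partial>lborel)"
        by (simp add: normal_density_def power2_commute)
      also have "... = 1"
        using e by (subst nn_integral_eq_integral) (auto simp: integrable_normal_density integral_normal_density)
      finally show ?thesis .
    qed
    have nd': "(\<integral>\<^sup>+x. ennreal (normal_density 0 e (x - y)) \<partial>lborel) = 1" for y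
      using nd[of y] by (simp add: normal_density_def power2_commute)
    have "of_real (LINT \<xi>|lborel. g e \<xi> * (cmod (Ft f \<xi>))\<^sup>2) = (LINT \<xi>|lborel. of_real (g e \<xi>) * cnj (Ft f \<xi>) * Ft f \<xi>)"
      unfolding integral_complex_of_real[symmetric]
      by (intro Bochner_Integration.integral_cong) (auto simp: complex_norm_square mult_ac simp del: of_real_power)
    also have "... = (LINT x|lborel. f x * (LINT y|lborel. cnj (f y) * of_real (?G e x y)))"
      by (subst Ft_multiplication[OF f gfi]) (simp only: Ftg)
    finally have eq: "of_real (LINT \<xi>|lborel. g e \<xi> * (cmod (Ft f \<xi>))\<^sup>2) = \<dots>" .
    have "(\<integral>\<^sup>+\<xi>. ennreal (g e \<xi> * (cmod (Ft f \<xi>))\<^sup>2) \<partial>lborel) = ennreal (LINT \<xi>|lborel. g e \<xi> * (cmod (Ft f \<xi>))\<^sup>2)"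
      by (subst nn_integral_eq_integral[OF gi2]) (auto simp: g_def)
    also have "... \<le> ennreal (cmod (of_real (LINT \<xi>|lborel. g e \<xi> * (cmod (Ft f \<xi>))\<^sup>2)))"
      by (intro ennreal_leI) simp
    also have "... \<le> (\<integral>\<^sup>+x. ennreal (cmod (f x * (LINT y|lborel. cnj (f y) * of_real (?G e x y)))) \<partial>lborel)"
      unfolding eq by (rule integral_norm_bound_ennreal2)
    also have "... \<le> (\<integral>\<^sup>+x. \<integral>\<^sup>+y. ennreal (2 * pi) * ennreal (((cmod (f x))\<^sup>2 / 2 + (cmod (f y))\<^sup>2 / 2) * normal_density 0 e (x - y)) \<partial>lborel \<partial>lborel)"
    proof (rule nn_integral_mono)
      fix x
      have "ennreal (cmod (f x * (LINT y|lborel. cnj (f y) * of_real (?G e x y)))) =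
         ennreal (cmod (f x)) * ennreal (cmod (LINT y|lborel. cnj (f y) * of_real (?G e x y)))"
        by (simp add: norm_mult ennreal_mult)
      also have "... \<le> ennreal (cmod (f x)) * (\<integral>\<^sup>+y. ennreal (cmod (cnj (f y) * of_real (?G e x y))) \<partial>lborel)"
        by (intro mult_left_mono integral_norm_bound_ennreal2) auto
      also have "... = (\<integral>\<^sup>+y. ennreal (cmod (f x)) * ennreal (cmod (cnj (f y) * of_real (?G e x y))) \<partial>lborel)"
        by (subst nn_integral_cmult) auto
      also have "... \<le> (\<integral>\<^sup>+y. ennreal (2 * pi) * ennreal (((cmod (f x))\<^sup>2 / 2 + (cmod (f y))\<^sup>2 / 2) * normal_density 0 e (x - y)) \<partial>lborel)"
      proof (rule nn_integral_mono)
        fix y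
        \<comment> \<open>The arithmetic-geometric mean splits the symmetric kernel into two halves;
          in each of them one variable occurs in the density alone and integrates to one.\<close>
        have "cmod (f x) * cmod (f y) \<le> (cmod (f x))\<^sup>2 / 2 + (cmod (f y))\<^sup>2 / 2"
          using sum_squares_bound[of "cmod (f x)" "cmod (f y)"] by simp
        then have "cmod (f x) * (cmod (f y) * (?G e x y)) \<le>
           2 * pi * (((cmod (f x))\<^sup>2 / 2 + (cmod (f y))\<^sup>2 / 2) * normal_density 0 e (x - y))"
          using mult_right_mono[of "cmod (f x) * cmod (f y)" "(cmod (f x))\<^sup>2 / 2 + (cmod (f y))\<^sup>2 / 2" "2 * pi * normal_density 0 e (x - y)"]
          by (simp add: mult_ac)
        then show "ennreal (cmod (f x)) * ennreal (cmod (cnj (f y) * of_real (?G e x y))) \<le>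
           ennreal (2 * pi) * ennreal (((cmod (f x))\<^sup>2 / 2 + (cmod (f y))\<^sup>2 / 2) * normal_density 0 e (x - y))"
          by (simp add: norm_mult ennreal_mult[symmetric] ennreal_leI)
      qed
      finally show "ennreal (cmod (f x * (LINT y|lborel. cnj (f y) * of_real (?G e x y)))) \<le> \<dots>" .
    qed
    also have "... = ennreal (2 * pi) * (\<integral>\<^sup>+x. \<integral>\<^sup>+y. ennreal ((cmod (f x))\<^sup>2 / 2) * ennreal (normal_density 0 e (x - y))
        + ennreal ((cmod (f y))\<^sup>2 / 2) * ennreal (normal_density 0 e (x - y)) \<partial>lborel \<partial>lborel)"
    proof -
      have pw: "ennreal ((a\<^sup>2 / 2 + b\<^sup>2 / 2) * normal_density 0 e z) =
          ennreal (a\<^sup>2 / 2) * ennreal (normal_density 0 e z) + ennreal (b\<^sup>2 / 2) * ennreal (normal_density 0 e z)" for a b z :: real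
        by (simp add: distrib_right ennreal_mult[symmetric] ennreal_plus[symmetric] del: ennreal_plus)
      show ?thesis unfolding pw by (simp add: nn_integral_cmult)
    qed
    also have "(\<integral>\<^sup>+x. \<integral>\<^sup>+y. ennreal ((cmod (f x))\<^sup>2 / 2) * ennreal (normal_density 0 e (x - y))
        + ennreal ((cmod (f y))\<^sup>2 / 2) * ennreal (normal_density 0 e (x - y)) \<partial>lborel \<partial>lborel) =
        (\<integral>\<^sup>+x. ennreal ((cmod (f x))\<^sup>2 / 2) \<partial>lborel) + (\<integral>\<^sup>+x. \<integral>\<^sup>+y. ennreal ((cmod (f y))\<^sup>2 / 2) * ennreal (normal_density 0 e (x - y)) \<partial>lborel \<partial>lborel)"
      by (simp add: nn_integral_add nn_integral_cmult nd)
    also have "(\<integral>\<^sup>+x. \<integral>\<^sup>+y. ennreal ((cmod (f y))\<^sup>2 / 2) * ennreal (normal_density 0 e (x - y)) \<partial>lborel \<partial>lborel)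
        = (\<integral>\<^sup>+y. \<integral>\<^sup>+x. ennreal ((cmod (f y))\<^sup>2 / 2) * ennreal (normal_density 0 e (x - y)) \<partial>lborel \<partial>lborel)"
      by (rule lborel_pair.Fubini') measurable
    also have "... = (\<integral>\<^sup>+x. ennreal ((cmod (f x))\<^sup>2 / 2) \<partial>lborel)"
      by (simp add: nn_integral_cmult nd')
    also have "(\<integral>\<^sup>+x. ennreal ((cmod (f x))\<^sup>2 / 2) \<partial>lborel) + (\<integral>\<^sup>+x. ennreal ((cmod (f x))\<^sup>2 / 2) \<partial>lborel) = N"
      unfolding N_def by (subst nn_integral_add[symmetric]) (auto simp: ennreal_plus[symmetric] simp del: ennreal_plus)
    finally show ?thesis .
  qed
  have "(\<integral>\<^sup>+\<xi>. nsq (Ft f \<xi>) \<partial>lborel) =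
      (\<integral>\<^sup>+\<xi>. liminf (\<lambda>n. ennreal (g (1 / real (Suc n)) \<xi> * (cmod (Ft f \<xi>))\<^sup>2)) \<partial>lborel)"
  proof (rule nn_integral_cong)
    fix \<xi>
    have "(\<lambda>n. g (1 / real (Suc n)) \<xi> * (cmod (Ft f \<xi>))\<^sup>2) \<longlonglongrightarrow> exp (- (0 * (\<xi> - 0))\<^sup>2 / 2) * (cmod (Ft f \<xi>))\<^sup>2"
    proof -
      have "(\<lambda>n. 1 / real (Suc n)) \<longlonglongrightarrow> 0"
        using LIMSEQ_inverse_real_of_nat by (simp add: inverse_eq_divide)
      then show ?thesis unfolding g_def by (intro tendsto_intros) auto
    qed
    then have "(\<lambda>n. ennreal (g (1 / real (Suc n)) \<xi> * (cmod (Ft f \<xi>))\<^sup>2)) \<longlonglongrightarrow> nsq (Ft f \<xi>)"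
      by (intro tendsto_ennrealI) simp
    then show "nsq (Ft f \<xi>) = liminf (\<lambda>n. ennreal (g (1 / real (Suc n)) \<xi> * (cmod (Ft f \<xi>))\<^sup>2))"
      by (intro lim_imp_Liminf[symmetric]) auto
  qed
  also have "... \<le> liminf (\<lambda>n. \<integral>\<^sup>+\<xi>. ennreal (g (1 / real (Suc n)) \<xi> * (cmod (Ft f \<xi>))\<^sup>2) \<partial>lborel)"
    by (rule nn_integral_liminf) (auto simp: g_def)
  also have "... \<le> ennreal (2 * pi) * N"
  proof (rule Liminf_le)
    show "\<forall>\<^sub>F n in sequentially. (\<integral>\<^sup>+\<xi>. ennreal (g (1 / real (Suc n)) \<xi> * (cmod (Ft f \<xi>))\<^sup>2) \<partial>lborel) \<le> ennreal (2 * pi) * N"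
      by (intro always_eventually allI main) simp
  qed simp
  finally show ?thesis unfolding N_def .
qed

text \<open>The positive and the negative part of \<open>f\<close> have the same mass
  \<open>m\<close>, so after division by \<open>m\<close> they are densities of two probability
  measures. These coincide if their distribution functions or their characteristic functions do, and
  densities are unique almost everywhere. The first alternative serves the circle, the second the
  line.\<close>

lemma ae_zero_of_distribution:
  fixes f :: "real \<Rightarrow> real"
  assumes f: "integrable lborel f" and tot: "(LINT y|lborel. f y) = 0"
    and H: "(\<forall>a. (LINT y|lborel. indicator {..a} y * f y) = 0) \<or>
            (\<forall>t. (LINT y|lborel. complex_of_real (f y) * cis (t * y)) = 0)"
  shows "AE y in lborel. f y = 0"
proof -
  have [measurable]: "f \<in> borel_measurable borel" using f by auto
  define p where "p s y = max (s * f y) 0" for s y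
  have [measurable]: "p s \<in> borel_measurable borel" for s unfolding p_def by measurable
  have pi: "integrable lborel (p s)" for s unfolding p_def using f by auto
  have p0: "0 \<le> p s y" for s y unfolding p_def by simp
  have fp: "f y = p 1 y - p (-1) y" for y unfolding p_def by auto
  define m where "m = (LINT y|lborel. p 1 y)"
  have m': "m = (LINT y|lborel. p (-1) y)"
    using tot pi unfolding m_def fp by simp
  have m: "(LINT y|lborel. p s y) = m" if "s \<in> {1, -1}" for s using that m_def m' by auto
  have m0: "0 \<le> m" unfolding m_def using p0 by simp
  show ?thesis
  proof (cases "m = 0")
    case True
    then have "AE y in lborel. p 1 y = 0" "AE y in lborel. p (-1) y = 0"
      using integral_nonneg_eq_0_iff_AE[OF pi] p0 m by auto
    then show ?thesis by eventually_elim (simp add: fp)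
  next
    case False
    define D where "D s = density lborel (\<lambda>y. ennreal (p s y / m))" for s
    have rd: "real_distribution (D s)" if s: "s \<in> {1, -1}" for s
    proof -
      have "emeasure (D s) UNIV = (\<integral>\<^sup>+y. ennreal (p s y / m) \<partial>lborel)"
        unfolding D_def by (subst emeasure_density) auto
      also have "... = ennreal (LINT y|lborel. p s y / m)"
        using pi p0 m0 by (intro nn_integral_eq_integral) auto
      also have "... = 1" using m[OF s] False by simp
      finally show ?thesis
        by (intro real_distribution.intro prob_spaceI real_distribution_axioms.intro) (auto simp: D_def)
    qed
    have "D 1 = D (-1)"
      using H
    proof
      assume H: "\<forall>a. (LINT y|lborel. indicator {..a} y * f y) = 0"
      have cd: "cdf (D s) a = (LINT y|lborel. indicator {..a} y * p s y) / m" if s: "s \<in> {1,-1}" for s a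
      proof -
        have "cdf (D s) a = (LINT y|D s. indicator {..a} y)"
          unfolding cdf_def D_def by (simp add: emeasure_density)
        also have "... = (LINT y|lborel. (p s y / m) *\<^sub>R indicator {..a} y)"
          unfolding D_def using p0 m0 by (subst integral_density) auto
        also have "... = (LINT y|lborel. (indicator {..a} y * p s y) / m)"
          by (rule Bochner_Integration.integral_cong) auto
        finally show ?thesis by simp
      qed
      have "cdf (D 1) = cdf (D (-1))"
      proof
        fix a
        have i: "integrable lborel (\<lambda>y. indicator {..a} y * p s y)" for s
          using integrable_mult_indicator[OF _ pi, of "{..a}" s] by simp
        have "(LINT y|lborel. indicator {..a} y * p 1 y) - (LINT y|lborel. indicator {..a} y * p (-1) y) = 0"
          using H[rule_format, of a] by (subst Bochner_Integration.integral_diff[symmetric, OF i i]) (simp add: fp algebra_simps)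
        then show "cdf (D 1) a = cdf (D (-1)) a" by (simp add: cd)
      qed
      then show ?thesis by (intro cdf_unique rd) auto
    next
      assume H: "\<forall>t. (LINT y|lborel. complex_of_real (f y) * cis (t * y)) = 0"
      have cd: "char (D s) t = (LINT y|lborel. complex_of_real (p s y) * cis (t * y)) / of_real m" if s: "s \<in> {1,-1}" for s t
      proof -
        have "char (D s) t = (LINT y|lborel. (p s y / m) *\<^sub>R cis (t * y))"
          unfolding D_def char_def using p0 m0 by (subst integral_density) (auto simp: cis_conv_exp)
        also have "... = (LINT y|lborel. (complex_of_real (p s y) * cis (t * y)) / of_real m)"
          by (rule Bochner_Integration.integral_cong) (auto simp: scaleR_conv_of_real)
        finally show ?thesis by simp
      qed
      have "char (D 1) = char (D (-1))"
      proof
        fix t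
        have i: "integrable lborel (\<lambda>y. complex_of_real (p s y) * cis (t * y))" for s
          by (rule integrable_mult_cis) (use pi in simp)
        have "(LINT y|lborel. complex_of_real (p 1 y) * cis (t * y)) - (LINT y|lborel. complex_of_real (p (-1) y) * cis (t * y)) = 0"
          using H[rule_format, of t] by (subst Bochner_Integration.integral_diff[symmetric, OF i i]) (simp add: fp algebra_simps)
        then show "char (D 1) t = char (D (-1)) t" by (simp add: cd)
      qed
      then show ?thesis by (intro Levy_uniqueness rd) auto
    qed
    then have "AE y in lborel. ennreal (p 1 y / m) = ennreal (p (-1) y / m)"
      unfolding D_def by (subst (asm) sigma_finite_measure.density_unique_iff[OF sigma_finite_lborel]) auto
    then show ?thesis
      by eventually_elim (use p0 m0 False in \<open>simp add: fp\<close>)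
  qed
qed

text \<open>Re g is half the sum of g and its conjugate, and the integrals of both against
  \<open>cis\<close> are values of \<open>Ft g\<close> or conjugates of such values. The imaginary
  part of f is the real part of -i f.\<close>

lemma Ft_zero_imp_ae_zero:
  assumes f: "integrable lborel f" and z: "\<And>\<xi>. Ft f \<xi> = 0"
  shows "AE y in lborel. f y = 0"
proof -
  have re: "AE y in lborel. Re (g y) = 0" if g: "integrable lborel g" and z: "\<And>\<xi>. Ft g \<xi> = 0" for g
  proof (rule ae_zero_of_distribution)
    show "integrable lborel (\<lambda>y. Re (g y))" using g by auto
    have *: "(LINT y|lborel. complex_of_real (Re (g y)) * cis (t * y)) = 0" for t
    proof -
      have "(LINT y|lborel. complex_of_real (Re (g y)) * cis (t * y)) =
          (LINT y|lborel. (g y * cis (- (-t * y)) + cnj (g y * cis (- (t * y)))) / 2)"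
      proof (rule Bochner_Integration.integral_cong[OF refl])
        fix y
        have "complex_of_real (Re (g y)) = (g y + cnj (g y)) / 2" by (simp add: complex_add_cnj)
        then show "complex_of_real (Re (g y)) * cis (t * y) = (g y * cis (- (-t * y)) + cnj (g y * cis (- (t * y)))) / 2"
          by (simp only: complex_cnj_mult cis_cnj) (simp add: distrib_right)
      qed
      also have "... = (Ft g (-t) + cnj (Ft g t)) / 2"
        unfolding Ft_def Bochner_Integration.integral_cnj[symmetric] integral_divide_zero
        using integrable_mult_cis[OF g]
        by (subst Bochner_Integration.integral_add) (auto simp: complex_integrable_cnj simp del: complex_cnj_mult)
      finally show ?thesis by (simp add: z)
    qed
    show "(LINT y|lborel. Re (g y)) = 0"
    proof -
      have "complex_of_real (LINT y|lborel. Re (g y)) = (LINT y|lborel. complex_of_real (Re (g y)) * cis (0 * y))"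
        by (simp add: integral_complex_of_real)
      then show ?thesis using *[of 0] by simp
    qed
    show "(\<forall>a. (LINT y|lborel. indicator {..a} y * Re (g y)) = 0) \<or>
      (\<forall>t. (LINT y|lborel. complex_of_real (Re (g y)) * cis (t * y)) = 0)" using * by blast
  qed
  have "Ft (\<lambda>y. - \<i> * f y) \<xi> = 0" for \<xi>
  proof -
    have "Ft (\<lambda>y. - \<i> * f y) \<xi> = - \<i> * Ft f \<xi>"
      unfolding Ft_def by (subst integral_mult_right_zero[symmetric]) (simp add: mult.assoc)
    then show ?thesis by (simp add: z)
  qed
  then have "AE y in lborel. Re (- \<i> * f y) = 0" by (intro re) (use f in auto)
  moreover have "AE y in lborel. Re (f y) = 0" by (intro re f z)
  ultimately show ?thesis by eventually_elim (simp add: complex_eq_iff)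
qed

section \<open>Completeness of L2\<close>

lemma tendsto_0_if_ennreal_le:
  fixes f :: "'a \<Rightarrow> ennreal"
  assumes "\<And>e. 0 < e \<Longrightarrow> \<forall>\<^sub>F n in F. f n \<le> ennreal e"
  shows "(f \<longlongrightarrow> 0) F"
proof (rule order_tendstoI)
  fix a :: ennreal assume "0 < a"
  obtain e where e: "0 < e" "ennreal e < a"
  proof (cases a)
    case (real r)
    then show ?thesis using \<open>0 < a\<close> that[of "r / 2"] by (simp add: ennreal_less_iff)
  next
    case top
    then show ?thesis using that[of 1] by simp
  qed
  show "\<forall>\<^sub>F n in F. f n < a"
    using assms[OF e(1)] by eventually_elim (use e(2) in auto)
qed auto

text \<open>Riesz-Fischer: a fast subsequence converges almost everywhere, and Fatou upgrades this
  to convergence of the whole sequence in the mean.\<close>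

lemma L2_complete:
  fixes f :: "nat \<Rightarrow> 'a \<Rightarrow> 'b::{banach, second_countable_topology}"
  assumes [measurable]: "\<And>n. f n \<in> borel_measurable M"
    and cauchy: "\<And>e. 0 < e \<Longrightarrow> \<exists>N. \<forall>m\<ge>N. \<forall>n\<ge>N. (\<integral>\<^sup>+x. nsq (f m x - f n x) \<partial>M) \<le> ennreal e"
  obtains g where "g \<in> borel_measurable M" "(\<lambda>n. \<integral>\<^sup>+x. nsq (f n x - g x) \<partial>M) \<longlonglongrightarrow> 0"
    "AE x in M. \<exists>r. strict_mono r \<and> (\<lambda>j. f (r j) x) \<longlonglongrightarrow> g x"
proof -
  \<comment> \<open>The rate 1/8 leaves room for the weight 2^j: the weighted squared increments
    still have integrals of size (1/4)^j, so at almost every point the increments themselves are at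
    most a constant times 2^(-j/2) and can be summed.\<close>
  have "\<forall>j. \<exists>N. \<forall>m\<ge>N. \<forall>n\<ge>N. (\<integral>\<^sup>+x. nsq (f m x - f n x) \<partial>M) \<le> ennreal ((1/8) ^ j)"
    using cauchy by simp
  then obtain N where N: "\<And>j m n. m \<ge> N j \<Longrightarrow> n \<ge> N j \<Longrightarrow>
      (\<integral>\<^sup>+x. nsq (f m x - f n x) \<partial>M) \<le> ennreal ((1/8) ^ j)" by metis
  define r where "r j = (\<Sum>i\<le>j. Suc (N i))" for j
  have rN: "N j \<le> r j" "N j \<le> r (Suc j)" for j
  proof -
    have "N j \<le> Suc (N j)" by simp
    also have "... \<le> r j" unfolding r_def by (rule member_le_sum) auto
    finally show "N j \<le> r j" .
    then show "N j \<le> r (Suc j)" by (simp add: r_def)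
  qed
  have rm: "strict_mono r" by (rule strict_mono_Suc_iff[THEN iffD2]) (simp add: r_def)
  define h where "h j = f (r j)" for j
  have [measurable]: "h j \<in> borel_measurable M" for j unfolding h_def by measurable
  have hb: "(\<integral>\<^sup>+x. nsq (h (Suc j) x - h j x) \<partial>M) \<le> ennreal ((1/8) ^ j)" for j
    unfolding h_def by (intro N rN)
  have "(\<integral>\<^sup>+x. (\<Sum>j. ennreal (2 ^ j) * nsq (h (Suc j) x - h j x)) \<partial>M) =
      (\<Sum>j. ennreal (2 ^ j) * (\<integral>\<^sup>+x. nsq (h (Suc j) x - h j x) \<partial>M))"
    by (subst nn_integral_suminf) (auto simp: nn_integral_cmult)
  also have "... \<le> (\<Sum>j. ennreal ((1/4) ^ j))"
  proof (intro suminf_le)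
    fix j
    have "ennreal (2 ^ j) * (\<integral>\<^sup>+x. nsq (h (Suc j) x - h j x) \<partial>M) \<le> ennreal (2 ^ j) * ennreal ((1/8) ^ j)"
      by (intro mult_left_mono hb) auto
    also have "... = ennreal ((1/4) ^ j)"
      by (simp add: ennreal_mult[symmetric] power_mult_distrib[symmetric])
    finally show "ennreal (2 ^ j) * (\<integral>\<^sup>+x. nsq (h (Suc j) x - h j x) \<partial>M) \<le> ennreal ((1/4) ^ j)" .
  qed auto
  also have "... = ennreal (\<Sum>j. (1/4) ^ j)"
    by (intro suminf_ennreal2) (auto intro: summable_geometric)
  also have "... < \<infinity>" by simp
  finally have "AE x in M. (\<Sum>j. ennreal (2 ^ j) * nsq (h (Suc j) x - h j x)) \<noteq> \<infinity>"
    by (intro nn_integral_noteq_infinite) auto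
  then have conv: "AE x in M. convergent (\<lambda>j. h j x)"
  proof eventually_elim
    fix x
    assume fin: "(\<Sum>j. ennreal (2 ^ j) * nsq (h (Suc j) x - h j x)) \<noteq> \<infinity>"
    then obtain K where K: "0 \<le> K" "(\<Sum>j. ennreal (2 ^ j) * nsq (h (Suc j) x - h j x)) = ennreal K"
      by (cases "\<Sum>j. ennreal (2 ^ j) * nsq (h (Suc j) x - h j x)" rule: ennreal_cases) auto
    have "norm (h (Suc j) x - h j x) \<le> sqrt K * (1 / sqrt 2) ^ j" for j
    proof -
      have "ennreal (2 ^ j) * nsq (h (Suc j) x - h j x) \<le> ennreal K"
        unfolding K(2)[symmetric]
        using sum_le_suminf[of "\<lambda>j. ennreal (2 ^ j) * nsq (h (Suc j) x - h j x)" "{j}"] by auto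
      then have "2 ^ j * (norm (h (Suc j) x - h j x))\<^sup>2 \<le> K"
        using K(1) by (simp add: ennreal_mult[symmetric])
      then have "2 ^ j * (norm (h (Suc j) x - h j x))\<^sup>2 * (1/2) ^ j \<le> K * (1/2) ^ j"
        by (rule mult_right_mono) simp
      then have "(norm (h (Suc j) x - h j x))\<^sup>2 \<le> K * (1/2) ^ j"
        by (simp add: power_one_over)
      then have "norm (h (Suc j) x - h j x) \<le> sqrt (K * (1/2) ^ j)"
        by (rule real_le_rsqrt)
      also have "... = sqrt K * (1 / sqrt 2) ^ j"
        by (simp add: real_sqrt_mult real_sqrt_power real_sqrt_divide)
      finally show ?thesis .
    qed
    moreover have "summable (\<lambda>j. sqrt K * (1 / sqrt 2) ^ j)"
      by (intro summable_mult summable_geometric) simp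
    ultimately have "summable (\<lambda>j. h (Suc j) x - h j x)"
      using summable_comparison_test'[of "\<lambda>j. sqrt K * (1 / sqrt 2) ^ j" 0 "\<lambda>j. h (Suc j) x - h j x"] by blast
    then have "convergent (\<lambda>n. \<Sum>j<n. h (Suc j) x - h j x)"
      by (simp add: summable_iff_convergent)
    then have "convergent (\<lambda>n. h n x - h 0 x)"
      by (simp add: sum_lessThan_telescope[of "\<lambda>j. h j x"])
    then have "convergent (\<lambda>n. h n x - h 0 x + h 0 x)"
      by (intro convergent_add convergent_const)
    then show "convergent (\<lambda>j. h j x)" by simp
  qed
  define g where "g x = lim (\<lambda>j. h j x)" for x
  have gm [measurable]: "g \<in> borel_measurable M"
    unfolding g_def by (rule borel_measurable_lim_metric) measurable
  have conv': "AE x in M. (\<lambda>j. h j x) \<longlonglongrightarrow> g x"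
    using conv by eventually_elim (simp add: g_def convergent_LIMSEQ_iff)
  have "(\<lambda>n. \<integral>\<^sup>+x. nsq (f n x - g x) \<partial>M) \<longlonglongrightarrow> 0"
  proof (rule tendsto_0_if_ennreal_le)
    fix e :: real assume e: "0 < e"
    obtain N0 where N0: "\<And>m n. m \<ge> N0 \<Longrightarrow> n \<ge> N0 \<Longrightarrow> (\<integral>\<^sup>+x. nsq (f m x - f n x) \<partial>M) \<le> ennreal e"
      using cauchy[OF e] by blast
    have "(\<integral>\<^sup>+x. nsq (f n x - g x) \<partial>M) \<le> ennreal e" if n: "n \<ge> N0" for n
    proof -
      have "(\<integral>\<^sup>+x. nsq (f n x - g x) \<partial>M) \<le> (\<integral>\<^sup>+x. liminf (\<lambda>j. nsq (f n x - h j x)) \<partial>M)"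
      proof (rule nn_integral_mono_AE)
        show "AE x in M. nsq (f n x - g x) \<le> liminf (\<lambda>j. nsq (f n x - h j x))"
          using conv'
        proof eventually_elim
          fix x assume "(\<lambda>j. h j x) \<longlonglongrightarrow> g x"
          then have "(\<lambda>j. nsq (f n x - h j x)) \<longlonglongrightarrow> nsq (f n x - g x)"
            by (intro tendsto_ennrealI tendsto_intros)
          then have "liminf (\<lambda>j. nsq (f n x - h j x)) = nsq (f n x - g x)"
            by (intro lim_imp_Liminf) simp_all
          then show "nsq (f n x - g x) \<le> liminf (\<lambda>j. nsq (f n x - h j x))"
            by simp
        qed
      qed
      also have "... \<le> liminf (\<lambda>j. \<integral>\<^sup>+x. nsq (f n x - h j x) \<partial>M)"
        by (rule nn_integral_liminf) auto
      also have "... \<le> ennreal e"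
      proof (rule Liminf_le)
        show "\<forall>\<^sub>F j in sequentially. (\<integral>\<^sup>+x. nsq (f n x - h j x) \<partial>M) \<le> ennreal e"
          using eventually_ge_at_top[of N0]
          by eventually_elim (use n seq_suble[OF rm] order_trans in \<open>auto simp: h_def intro!: N0\<close>)
      qed simp
      finally show ?thesis .
    qed
    then show "\<forall>\<^sub>F n in sequentially. (\<integral>\<^sup>+x. nsq (f n x - g x) \<partial>M) \<le> ennreal e"
      unfolding eventually_sequentially by blast
  qed
  moreover have "AE x in M. \<exists>r. strict_mono r \<and> (\<lambda>j. f (r j) x) \<longlonglongrightarrow> g x"
    using conv' by eventually_elim (use rm in \<open>auto simp: h_def\<close>)
  ultimately show ?thesis using that gm by blast
qed

section \<open>Fourier coefficients on the circle\<close>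

abbreviation circle :: "real measure" where
  "circle \<equiv> restrict_space lborel {0..<2 * pi}"

lemma space_circle: "space circle = {0..<2 * pi}"
  by (simp add: space_restrict_space)

lemma finite_measure_circle: "finite_measure circle"
  by (intro finite_measureI) (simp add: emeasure_restrict_space space_restrict_space)

lemma integrable_circle_bounded_mult:
  fixes v :: "real \<Rightarrow> real" and b :: "real \<Rightarrow> 'b::{banach, second_countable_topology, real_normed_algebra_1}"
  assumes v: "integrable circle v" and [measurable]: "b \<in> borel_measurable borel"
    and bd: "\<And>x. norm (b x) \<le> B"
  shows "integrable circle (\<lambda>x. of_real (v x) * b x)"
proof (rule Bochner_Integration.integrable_bound[where f="\<lambda>x. B * v x"])
  have [measurable]: "v \<in> borel_measurable circle" using v by auto
  have "b \<in> borel_measurable circle"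
    by (rule measurable_restrict_space1) simp
  then show "(\<lambda>x. of_real (v x) * b x) \<in> borel_measurable circle" by measurable
  show "integrable circle (\<lambda>x. B * v x)" using v by simp
  have "0 \<le> B" using bd[of 0] norm_ge_zero order_trans by blast
  show "AE x in circle. norm (of_real (v x) * b x) \<le> norm (B * v x)"
  proof (rule AE_I2)
    fix x
    have "norm (of_real (v x) * b x) \<le> norm (of_real (v x) :: 'b) * norm (b x)" by (rule norm_mult_ineq)
    also have "... \<le> \<bar>v x\<bar> * B" using bd[of x] by (simp add: mult_left_mono)
    also have "... = norm (B * v x)" using \<open>0 \<le> B\<close> by (simp add: abs_mult)
    finally show "norm (of_real (v x) * b x) \<le> norm (B * v x)" .
  qed
qed

definition fcoeff :: "(real \<Rightarrow> real) \<Rightarrow> int \<Rightarrow> complex" where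
  "fcoeff v k = (LINT x|circle. complex_of_real (v x) * cis (- (real_of_int k * x)))"

lemma integrable_fcoeff:
  "integrable circle v \<Longrightarrow> integrable circle (\<lambda>x. complex_of_real (v x) * cis (r * x))"
  "integrable circle v \<Longrightarrow> integrable circle (\<lambda>x. complex_of_real (v x) * cis (- (r * x)))"
  by (rule integrable_circle_bounded_mult[where B=1]; simp)+

text \<open>A real linear function of \<open>cis x\<close> is A e^(ix) + B e^(-ix), so
  multiplication by it only shifts and combines coefficients. The induction varies \<open>v\<close>
  because the factors of a product are absorbed one after the other.\<close>

lemma polynomial_times_zero_fcoeff:
  assumes "real_polynomial_function p"
  shows "integrable circle v \<Longrightarrow> (\<And>k. fcoeff v k = 0) \<Longrightarrow>
    integrable circle (\<lambda>x. v x * p (cis x)) \<and> (\<forall>k. fcoeff (\<lambda>x. v x * p (cis x)) k = 0)"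
  using assms
proof (induction p arbitrary: v rule: real_polynomial_function.induct)
  case (linear h)
  define A B where "A = (of_real (h 1) - \<i> * of_real (h \<i>)) / (2::complex)"
    and "B = (of_real (h 1) + \<i> * of_real (h \<i>)) / (2::complex)"
  interpret h: bounded_linear h by fact
  have hc: "h (cis x) = cos x * h 1 + sin x * h \<i>" for x
  proof -
    have "cis x = cos x *\<^sub>R 1 + sin x *\<^sub>R \<i>" by (simp add: complex_eq_iff)
    then show ?thesis by (simp add: h.add h.scaleR)
  qed
  have "complex_of_real (h (cis x)) = A * cis x + B * cis (- x)" for x
    unfolding hc A_def B_def by (simp add: complex_eq_iff field_simps)
  then have eq: "complex_of_real (v x * h (cis x)) * cis (- (real_of_int k * x)) =
      A * (complex_of_real (v x) * cis (- (real_of_int (k - 1) * x))) + B * (complex_of_real (v x) * cis (- (real_of_int (k + 1) * x)))" for x k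
  proof -
    have "cis (- (real_of_int (k - 1) * x)) = cis x * cis (- (real_of_int k * x))"
      "cis (- (real_of_int (k + 1) * x)) = cis (- x) * cis (- (real_of_int k * x))"
      by (simp_all add: cis_mult algebra_simps)
    then show ?thesis
      using \<open>complex_of_real (h (cis x)) = A * cis x + B * cis (- x)\<close>
      by (simp add: algebra_simps)
  qed
  have "fcoeff (\<lambda>x. v x * h (cis x)) k = A * fcoeff v (k - 1) + B * fcoeff v (k + 1)" for k
    unfolding fcoeff_def eq
    by (subst Bochner_Integration.integral_add)
       (auto intro!: integrable_mult_right integrable_fcoeff linear(2))
  moreover have "integrable circle (\<lambda>x. of_real (v x) * h (cis x))"
  proof (rule integrable_circle_bounded_mult[OF linear(2)])
    show "(\<lambda>x. h (cis x)) \<in> borel_measurable borel"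
      unfolding hc by measurable
    show "norm (h (cis x)) \<le> norm (h 1) + norm (h \<i>)" for x
      unfolding hc
      by (rule order_trans[OF norm_triangle_ineq add_mono]) (auto simp: abs_mult intro!: mult_left_le_one_le)
  qed
  ultimately show ?case using linear(3) by simp
next
  case (const c)
  have "fcoeff (\<lambda>x. v x * c) k = of_real c * fcoeff v k" for k
    unfolding fcoeff_def by (subst integral_mult_right_zero[symmetric]) (simp add: mult_ac)
  then show ?case using const by simp
next
  case (add p q)
  have ip: "integrable circle (\<lambda>x. v x * p (cis x))" "integrable circle (\<lambda>x. v x * q (cis x))"
    and z: "\<And>k. fcoeff (\<lambda>x. v x * p (cis x)) k = 0" "\<And>k. fcoeff (\<lambda>x. v x * q (cis x)) k = 0"
    using add by blast+
  have "fcoeff (\<lambda>x. v x * (p (cis x) + q (cis x))) k = fcoeff (\<lambda>x. v x * p (cis x)) k + fcoeff (\<lambda>x. v x * q (cis x)) k" for k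
    unfolding fcoeff_def
    by (subst Bochner_Integration.integral_add[symmetric, OF integrable_fcoeff(2)[OF ip(1)] integrable_fcoeff(2)[OF ip(2)]])
       (simp add: algebra_simps)
  then show ?case using z ip by (auto simp: algebra_simps)
next
  case (mult p q)
  have ip: "integrable circle (\<lambda>x. v x * p (cis x))" and z: "\<And>k. fcoeff (\<lambda>x. v x * p (cis x)) k = 0"
    using mult by blast+
  show ?case using mult.IH(2)[OF ip z] by (simp add: mult.assoc)
qed

text \<open>Stone-Weierstrass on the unit circle: polynomials in the real and imaginary part of
  \<open>cis x\<close> approximate \<open>g\<close> uniformly, and \<open>v\<close> is
  integrable.\<close>

lemma continuous_times_zero_fcoeff:
  fixes g :: "complex \<Rightarrow> real"
  assumes v: "integrable circle v" "\<And>k. fcoeff v k = 0" and g: "continuous_on (sphere 0 1) g"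
  shows "(LINT x|circle. v x * g (cis x)) = 0"
proof -
  have gc: "continuous_on UNIV (\<lambda>x. g (cis x))"
    by (rule continuous_on_compose2[OF g]) (auto intro!: continuous_intros simp: cis_conv_exp)
  have "compact (g ` sphere 0 1)" by (intro compact_continuous_image g) simp
  then obtain G where G: "\<And>z. z \<in> sphere 0 1 \<Longrightarrow> norm (g z) \<le> G"
    by (meson bounded_iff compact_imp_bounded image_eqI)
  have ig: "integrable circle (\<lambda>x. v x * g (cis x))"
    using integrable_circle_bounded_mult[OF v(1), of "\<lambda>x. g (cis x)" G] G gc
    by (auto intro: borel_measurable_continuous_onI)
  define I where "I = (LINT x|circle. \<bar>v x\<bar>)"
  have I0: "0 \<le> I" unfolding I_def by simp
  have bnd: "\<bar>LINT x|circle. v x * g (cis x)\<bar> \<le> e * I" if e: "0 < e" for e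
  proof -
    obtain p where p: "real_polynomial_function p" "\<And>z. z \<in> sphere 0 1 \<Longrightarrow> \<bar>g z - p z\<bar> < e"
      using Stone_Weierstrass_real_polynomial_function[OF compact_sphere g e] by blast
    have ip: "integrable circle (\<lambda>x. v x * p (cis x))" and "fcoeff (\<lambda>x. v x * p (cis x)) 0 = 0"
      using polynomial_times_zero_fcoeff[OF p(1) v] by auto
    then have "(LINT x|circle. v x * p (cis x)) = 0"
      unfolding fcoeff_def by (simp add: integral_complex_of_real del: of_real_mult)
    then have "(LINT x|circle. v x * g (cis x)) = (LINT x|circle. v x * g (cis x) - v x * p (cis x))"
      using ig ip by simp
    also have "\<bar>\<dots>\<bar> \<le> (LINT x|circle. \<bar>v x * g (cis x) - v x * p (cis x)\<bar>)"
      by (rule integral_abs_bound)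
    also have "... \<le> (LINT x|circle. e * \<bar>v x\<bar>)"
    proof (rule integral_mono)
      fix x
      have "\<bar>g (cis x) - p (cis x)\<bar> \<le> e" using p(2)[of "cis x"] by simp
      then have "\<bar>v x\<bar> * \<bar>g (cis x) - p (cis x)\<bar> \<le> \<bar>v x\<bar> * e" by (rule mult_left_mono) simp
      then show "\<bar>v x * g (cis x) - v x * p (cis x)\<bar> \<le> e * \<bar>v x\<bar>"
        by (simp add: abs_mult[symmetric] right_diff_distrib mult.commute[of e])
    qed (use ig ip v in auto)
    also have "... = e * I" by (simp add: I_def)
    finally show ?thesis .
  qed
  then have "\<bar>LINT x|circle. v x * g (cis x)\<bar> \<le> 0 + e" if "0 < e" for e
  proof -
    have "\<bar>LINT x|circle. v x * g (cis x)\<bar> \<le> (e / (I + 1)) * I"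
      by (rule bnd) (use that I0 in simp)
    also have "... \<le> e" using that I0 by (simp add: field_simps)
    finally show ?thesis by simp
  qed
  then have "\<bar>LINT x|circle. v x * g (cis x)\<bar> \<le> 0" by (rule field_le_epsilon)
  then show ?thesis by simp
qed

lemma cis_inj_on: "inj_on cis {0..<2 * pi}"
proof (rule inj_onI)
  fix x y assume xy: "x \<in> {0..<2 * pi}" "y \<in> {0..<2 * pi}" "cis x = cis y"
  have "Arg2pi (cis x) = x" "Arg2pi (cis y) = y"
    using Arg2pi_exp[of "\<i> * of_real x"] Arg2pi_exp[of "\<i> * of_real y"] xy(1,2) by (simp_all add: cis_conv_exp)
  then show "x = y" by (metis xy(3))
qed

text \<open>The indicator of an arc is a pointwise limit of continuous functions on the circle, so
  all integrals of \<open>v\<close> over initial segments of the fundamental domain vanish, and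
  \<open>ae_zero_of_distribution\<close> applies in its first form.\<close>

lemma zero_fcoeff_imp_ae_zero:
  assumes v: "integrable circle v" and z: "\<And>k. fcoeff v k = 0"
  shows "AE x in circle. v x = 0"
proof -
  have [measurable]: "v \<in> borel_measurable circle" using v by auto
  define V where "V x = indicator {0..<2 * pi} x * v x" for x
  have VI: "integrable lborel V"
    using v unfolding V_def by (subst (asm) integrable_restrict_space) auto
  have eqI: "(LINT x|lborel. b x * V x) = (LINT x|circle. b x * v x)" for b :: "real \<Rightarrow> real"
    unfolding V_def by (subst integral_restrict_space) (auto simp: mult_ac)
  have tot: "(LINT x|circle. v x) = 0"
    using z[of 0] by (simp add: fcoeff_def integral_complex_of_real)
  have seg: "(LINT x|circle. indicator {..a} x * v x) = 0" if a: "0 \<le> a" "a < 2 * pi" for a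
  proof -
    define K where "K = cis ` {0..a}"
    have Kc: "closed K" "K \<noteq> {}" unfolding K_def using a
      by (auto intro!: compact_imp_closed compact_continuous_image continuous_intros simp: cis_conv_exp)
    have inK: "cis x \<in> K \<longleftrightarrow> x \<le> a" if "x \<in> {0..<2 * pi}" for x
    proof -
      have "{0..a} \<subseteq> {0..<2 * pi}" using a by auto
      then show ?thesis unfolding K_def
        using inj_on_image_mem_iff[OF cis_inj_on that, of "{0..a}"] that by simp
    qed
    \<comment> \<open>Tents around the closed arc, shrinking to its indicator. Near 2 pi the point
      \<open>cis x\<close> comes back to the arc at 1; this is harmless because only pointwise
      convergence on the half-open domain is needed.\<close>
    define g where "g n z = max 0 (1 - real n * infdist z K)" for n z
    have gz: "(LINT x|circle. v x * g n (cis x)) = 0" for n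
      by (rule continuous_times_zero_fcoeff[OF v z]) (auto simp: g_def intro!: continuous_intros)
    have "(\<lambda>n. LINT x|circle. v x * g n (cis x)) \<longlonglongrightarrow> (LINT x|circle. indicator {..a} x * v x)"
    proof (rule integral_dominated_convergence[where w="\<lambda>x. \<bar>v x\<bar>"])
      have [measurable]: "(\<lambda>x. g n (cis x)) \<in> borel_measurable circle" for n
      proof -
        have "continuous_on UNIV (\<lambda>x. g n (cis x))"
          unfolding g_def cis_conv_exp by (intro continuous_intros)
        then show ?thesis
          by (intro measurable_restrict_space1) (simp add: borel_measurable_continuous_onI)
      qed
      show "(\<lambda>x. v x * g n (cis x)) \<in> borel_measurable circle" for n by measurable
      have "indicator {..a} \<in> borel_measurable (circle :: real measure)"
        by (intro measurable_restrict_space1) auto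
      then show "(\<lambda>x. indicator {..a} x * v x) \<in> borel_measurable circle" by measurable
      show "integrable circle (\<lambda>x. \<bar>v x\<bar>)" using v by simp
      show "AE x in circle. norm (v x * g n (cis x)) \<le> \<bar>v x\<bar>" for n
        by (auto intro!: AE_I2 mult_right_le_one_le simp: abs_mult g_def infdist_nonneg)
      show "AE x in circle. (\<lambda>n. v x * g n (cis x)) \<longlonglongrightarrow> indicator {..a} x * v x"
      proof (rule AE_I2)
        fix x assume "x \<in> space circle"
        then have x: "x \<in> {0..<2 * pi}" by (simp add: space_circle)
        have "(\<lambda>n. g n (cis x)) \<longlonglongrightarrow> indicator {..a} x"
        proof (cases "x \<le> a")
          case True
          then have "infdist (cis x) K = 0" using inK[OF x] by simp
          then show ?thesis using True by (simp add: g_def)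
        next
          case False
          then have "0 < infdist (cis x) K"
            using inK[OF x] Kc by (metis in_closed_iff_infdist_zero infdist_nonneg less_eq_real_def)
          then obtain N where "1 < real N * infdist (cis x) K"
            using reals_Archimedean3 by blast
          then have "g n (cis x) = 0" if "n \<ge> N" for n
          proof -
            have "real N * infdist (cis x) K \<le> real n * infdist (cis x) K"
              by (rule mult_right_mono) (use that in \<open>auto simp: infdist_nonneg\<close>)
            then show ?thesis using \<open>1 < real N * infdist (cis x) K\<close> by (auto simp: g_def)
          qed
          then have "\<forall>\<^sub>F n in sequentially. g n (cis x) = 0"
            by (auto simp: eventually_sequentially)
          then show ?thesis using False by (simp add: tendsto_eventually)
        qed
        then show "(\<lambda>n. v x * g n (cis x)) \<longlonglongrightarrow> indicator {..a} x * v x"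
          by (subst mult.commute[of "indicator {..a} x"]) (rule tendsto_mult_left)
      qed
    qed
    then show ?thesis unfolding gz by (simp add: LIMSEQ_const_iff)
  qed
  have "AE x in lborel. V x = 0"
  proof (rule ae_zero_of_distribution[OF VI])
    show "(LINT x|lborel. V x) = 0" using eqI[of "\<lambda>_. 1"] tot by simp
    have "(LINT x|lborel. indicator {..a} x * V x) = 0" for a
    proof -
      consider "a < 0" | "0 \<le> a" "a < 2 * pi" | "2 * pi \<le> a" by linarith
      then show ?thesis
      proof cases
        case 1
        then have "(\<lambda>x. indicator {..a} x * V x) = (\<lambda>x. 0)" by (auto simp: V_def indicator_def fun_eq_iff)
        then show ?thesis by simp
      next
        case 2 then show ?thesis using seg eqI by simp
      next
        case 3
        then have "(LINT x|circle. indicator {..a} x * v x) = (LINT x|circle. v x)"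
          by (intro Bochner_Integration.integral_cong) (auto simp: space_circle)
        then show ?thesis using tot eqI by simp
      qed
    qed
    then show "(\<forall>a. (LINT y|lborel. indicator {..a} y * V y) = 0) \<or>
      (\<forall>t. (LINT y|lborel. complex_of_real (V y) * cis (t * y)) = 0)" by blast
  qed
  then show ?thesis
    by (subst AE_restrict_space_iff) (auto simp: V_def elim!: eventually_mono)
qed

lemma integral_cis_circle:
  "(LINT x|circle. cis (real_of_int k * x)) = (if k = 0 then 2 * pi else 0)"
proof (cases "k = 0")
  case True
  have "measure circle (space circle) = 2 * pi"
    by (simp add: measure_restrict_space space_restrict_space)
  then show ?thesis using True by (simp add: space_circle scaleR_conv_of_real)
next
  case False
  define F where "F x = cis (real_of_int k * x) / (\<i> * of_int k)" for x
  have d: "(F has_vector_derivative cis (real_of_int k * x)) (at x within S)" for x S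
  proof -
    have "((\<lambda>z. exp (\<i> * of_int k * z) / (\<i> * of_int k)) has_field_derivative exp (\<i> * of_int k * of_real x)) (at (of_real x))"
      using False by (auto intro!: derivative_eq_intros)
    from has_vector_derivative_real_field[OF this, of S] show ?thesis
      by (simp add: F_def[abs_def] cis_conv_exp mult_ac)
  qed
  have "(LINT x|circle. cis (real_of_int k * x)) = (LINT x|lborel. indicator {0..<2 * pi} x *\<^sub>R cis (real_of_int k * x))"
    by (subst integral_restrict_space) auto
  also have "... = (LINT x|lborel. indicator {0..2 * pi} x *\<^sub>R cis (real_of_int k * x))"
  proof (intro integral_cong_AE)
    show "AE x in lborel. indicator {0..<2 * pi} x *\<^sub>R cis (real_of_int k * x) = indicator {0..2 * pi} x *\<^sub>R cis (real_of_int k * x)"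
      using AE_lborel_singleton[of "2 * pi"] by eventually_elim (auto simp: indicator_def)
  qed measurable
  also have "... = F (2 * pi) - F 0"
  proof (rule integral_FTC_Icc)
    show "continuous_on {0..2 * pi} (\<lambda>x. cis (real_of_int k * x))"
      unfolding cis_conv_exp by (intro continuous_intros)
  qed (simp_all add: d)
  also have "... = 0"
  proof -
    have "cis (2 * pi * real_of_int k) = 1" by (rule cis_multiple_2pi) simp
    then have "cis (real_of_int k * (2 * pi)) = 1" by (simp only: mult.commute)
    then show ?thesis by (simp add: F_def)
  qed
  finally show ?thesis using False by simp
qed

section \<open>Square integrable functions\<close>

definition sqn :: "'a measure \<Rightarrow> ('a \<Rightarrow> 'b::real_normed_vector) \<Rightarrow> ennreal" where
  "sqn M f = (\<integral>\<^sup>+x. nsq (f x) \<partial>M)"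

text \<open>The factor 2 lost here is the origin of the constants in \<open>Ft_limit_bound\<close>
  and \<open>has_fourier_bound\<close>. Bounds up to a constant suffice, so the sharp identities are
  not pursued.\<close>

lemma norm_add_sq_le: "(norm (a + b))\<^sup>2 \<le> 2 * (norm a)\<^sup>2 + 2 * (norm (b::'a::real_normed_vector))\<^sup>2"
proof -
  have "(norm (a + b))\<^sup>2 \<le> (norm a + norm b)\<^sup>2" by (intro power_mono norm_triangle_ineq) auto
  also have "... \<le> 2 * (norm a)\<^sup>2 + 2 * (norm b)\<^sup>2"
    using sum_squares_bound[of "norm a" "norm b"] by (simp add: power2_sum)
  finally show ?thesis .
qed

lemma sqn_add:
  fixes f g :: "'a \<Rightarrow> 'b::{real_normed_vector, second_countable_topology}"
  assumes [measurable]: "f \<in> borel_measurable M" "g \<in> borel_measurable M"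
  shows "sqn M (\<lambda>x. f x + g x) \<le> 2 * sqn M f + 2 * sqn M g"
proof -
  have "sqn M (\<lambda>x. f x + g x) \<le> (\<integral>\<^sup>+x. 2 * nsq (f x) + 2 * nsq (g x) \<partial>M)"
    unfolding sqn_def
  proof (rule nn_integral_mono)
    fix x
    have "nsq (f x + g x) \<le> ennreal (2 * (norm (f x))\<^sup>2 + 2 * (norm (g x))\<^sup>2)"
      by (intro ennreal_leI norm_add_sq_le)
    then show "nsq (f x + g x) \<le> 2 * nsq (f x) + 2 * nsq (g x)"
      by (simp add: ennreal_mult)
  qed
  also have "... = 2 * sqn M f + 2 * sqn M g"
    unfolding sqn_def by (simp add: nn_integral_add nn_integral_cmult)
  finally show ?thesis .
qed

lemma sqn_minus: "sqn M (\<lambda>x. - f x) = sqn M f"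
  by (simp add: sqn_def)

lemma sqn_minus_commute: "sqn M (\<lambda>x. f x - g x) = sqn M (\<lambda>x. g x - f x)"
  by (simp add: sqn_def norm_minus_commute)

lemma sqn_diff:
  fixes f g :: "'a \<Rightarrow> 'b::{real_normed_vector, second_countable_topology}"
  assumes [measurable]: "f \<in> borel_measurable M" "g \<in> borel_measurable M"
  shows "sqn M (\<lambda>x. f x - g x) \<le> 2 * sqn M f + 2 * sqn M g"
  using sqn_add[of f M "\<lambda>x. - g x"] by (simp add: sqn_minus)

lemma sqn_triangle:
  fixes f g h :: "'a \<Rightarrow> 'b::{real_normed_vector, second_countable_topology}"
  assumes [measurable]: "f \<in> borel_measurable M" "g \<in> borel_measurable M" "h \<in> borel_measurable M"
  shows "sqn M (\<lambda>x. f x - h x) \<le> 2 * sqn M (\<lambda>x. f x - g x) + 2 * sqn M (\<lambda>x. g x - h x)"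
  using sqn_add[of "\<lambda>x. f x - g x" M "\<lambda>x. g x - h x"] by simp

lemma sqn_le_of_diff:
  fixes f g :: "'a \<Rightarrow> 'b::{real_normed_vector, second_countable_topology}"
  assumes [measurable]: "f \<in> borel_measurable M" "g \<in> borel_measurable M"
  shows "sqn M f \<le> 2 * sqn M (\<lambda>x. f x - g x) + 2 * sqn M g"
  using sqn_add[of "\<lambda>x. f x - g x" M g] by simp

lemma sqn_mono:
  "(\<And>x. x \<in> space M \<Longrightarrow> norm (f x) \<le> norm (g x)) \<Longrightarrow> sqn M f \<le> sqn M g"
  unfolding sqn_def by (intro nn_integral_mono ennreal_leI power_mono) auto

lemma sqn_cong_AE: "(AE x in M. f x = g x) \<Longrightarrow> sqn M f = sqn M g"
  unfolding sqn_def by (intro nn_integral_cong_AE) auto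

lemma sqn_cong: "(\<And>x. x \<in> space M \<Longrightarrow> f x = g x) \<Longrightarrow> sqn M f = sqn M g"
  unfolding sqn_def by (intro nn_integral_cong) auto

lemma finite_of_le_mult:
  fixes a b :: ennreal
  shows "a \<le> ennreal c * b \<Longrightarrow> b < \<infinity> \<Longrightarrow> a < \<infinity>"
  using le_less_trans[of a "ennreal c * b" top] by (auto simp: ennreal_mult_less_top)

lemma sqn_zero [simp]: "sqn M (\<lambda>x. 0) = 0"
  by (simp add: sqn_def)

lemma sqn_scale:
  fixes f :: "'a \<Rightarrow> complex"
  assumes [measurable]: "f \<in> borel_measurable M"
  shows "sqn M (\<lambda>x. c * f x) = ennreal ((cmod c)\<^sup>2) * sqn M f"
  unfolding sqn_def by (simp add: norm_mult power_mult_distrib ennreal_mult nn_integral_cmult)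

lemma sqn_eq_0_iff:
  fixes f :: "'a \<Rightarrow> 'b::{real_normed_vector, second_countable_topology}"
  assumes [measurable]: "f \<in> borel_measurable M"
  shows "sqn M f = 0 \<longleftrightarrow> (AE x in M. f x = 0)"
  unfolding sqn_def by (subst nn_integral_0_iff_AE) auto

lemma sqn_prod_bound:
  fixes f g :: "'a \<Rightarrow> complex"
  assumes [measurable]: "f \<in> borel_measurable M" "g \<in> borel_measurable M"
  shows "(\<integral>\<^sup>+x. ennreal (norm (f x * g x)) \<partial>M)\<^sup>2 \<le> sqn M f * sqn M g"
  using Cauchy_Schwarz_nn_integral[of "\<lambda>x. ennreal (norm (f x))" M "\<lambda>x. ennreal (norm (g x))"]
  by (simp add: sqn_def norm_mult ennreal_mult ennreal_power)

lemma integrable_mult_sqn: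
  fixes f g :: "'a \<Rightarrow> complex"
  assumes [measurable]: "f \<in> borel_measurable M" "g \<in> borel_measurable M"
    and fin: "sqn M f < \<infinity>" "sqn M g < \<infinity>"
  shows "integrable M (\<lambda>x. f x * g x)"
proof (rule integrableI_bounded)
  have "(\<integral>\<^sup>+x. ennreal (norm (f x * g x)) \<partial>M)\<^sup>2 < \<infinity>"
    using sqn_prod_bound[of f M g] fin ennreal_mult_less_top[of "sqn M f" "sqn M g"]
    by (auto simp: less_top[symmetric] top_unique)
  then show "(\<integral>\<^sup>+x. ennreal (norm (f x * g x)) \<partial>M) < \<infinity>"
    by (simp add: power2_eq_square ennreal_mult_less_top less_top[symmetric] ennreal_mult_eq_top_iff)
qed measurable

lemma integral_mult_tendsto_0:
  fixes f :: "nat \<Rightarrow> 'a \<Rightarrow> complex"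
  assumes [measurable]: "\<And>n. f n \<in> borel_measurable M" "g \<in> borel_measurable M"
    and f: "(\<lambda>n. sqn M (f n)) \<longlonglongrightarrow> 0" and g: "sqn M g < \<infinity>"
  shows "(\<lambda>n. LINT x|M. f n x * g x) \<longlonglongrightarrow> 0"
proof -
  have "(\<lambda>n. sqn M g * sqn M (f n)) \<longlonglongrightarrow> sqn M g * 0"
    using g by (intro ennreal_tendsto_cmult f) simp
  then have fg: "(\<lambda>n. sqn M (f n) * sqn M g) \<longlonglongrightarrow> 0"
    by (simp only: mult.commute[of "sqn M g"] mult_zero_right mult_zero_left)
  have lim: "(\<lambda>n. (\<integral>\<^sup>+x. ennreal (norm (f n x * g x)) \<partial>M)\<^sup>2) \<longlonglongrightarrow> 0"
    by (rule tendsto_sandwich[OF _ _ tendsto_const fg]) (auto intro!: always_eventually sqn_prod_bound)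
  have "(\<lambda>n. nsq (LINT x|M. f n x * g x)) \<longlonglongrightarrow> 0"
  proof (rule tendsto_sandwich[OF _ _ tendsto_const lim])
    show "\<forall>\<^sub>F n in sequentially. nsq (LINT x|M. f n x * g x) \<le> (\<integral>\<^sup>+x. ennreal (norm (f n x * g x)) \<partial>M)\<^sup>2"
      by (intro always_eventually allI)
         (subst ennreal_power[symmetric], simp, intro power_mono integral_norm_bound_ennreal2, simp)
  qed auto
  then have "(\<lambda>n. (norm (LINT x|M. f n x * g x))\<^sup>2) \<longlonglongrightarrow> 0"
    by (subst (asm) ennreal_0[symmetric], subst (asm) tendsto_ennreal_iff) auto
  then have "(\<lambda>n. norm (LINT x|M. f n x * g x)) \<longlonglongrightarrow> 0"
    using tendsto_real_sqrt[of "\<lambda>n. (norm (LINT x|M. f n x * g x))\<^sup>2" 0 sequentially] by simp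
  then show ?thesis by (rule tendsto_norm_zero_cancel)
qed

section \<open>Transform of square integrable functions on the line as an L2 limit\<close>

definition trunc :: "real \<Rightarrow> (real \<Rightarrow> complex) \<Rightarrow> real \<Rightarrow> complex" where
  "trunc R a y = indicator {-R..R} y * a y"

lemma trunc_measurable [measurable]:
  assumes [measurable]: "a \<in> borel_measurable borel" shows "trunc R a \<in> borel_measurable borel"
  unfolding trunc_def by measurable

lemma integrable_trunc:
  assumes [measurable]: "a \<in> borel_measurable borel" and fin: "sqn lborel a < \<infinity>"
  shows "integrable lborel (trunc R a)"
proof -
  have "sqn lborel (\<lambda>y::real. indicator {-R..R} y :: complex) = (\<integral>\<^sup>+y. indicator {-R..R} y \<partial>lborel)"
    unfolding sqn_def by (intro nn_integral_cong) (auto simp: indicator_def)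
  also have "... < \<infinity>" by (simp add: emeasure_lborel_Icc_eq)
  finally show ?thesis
    unfolding trunc_def by (intro integrable_mult_sqn fin) auto
qed

lemma sqn_trunc_le: "sqn lborel (trunc R a) \<le> sqn lborel a"
  by (rule sqn_mono) (auto simp: trunc_def indicator_def)

lemma Ft_diff:
  assumes "integrable lborel f" "integrable lborel g"
  shows "Ft f \<xi> - Ft g \<xi> = Ft (\<lambda>y. f y - g y) \<xi>"
  unfolding Ft_def
  by (subst Bochner_Integration.integral_diff[symmetric, OF integrable_mult_cis(2)[OF assms(1)] integrable_mult_cis(2)[OF assms(2)]])
     (simp add: left_diff_distrib)

lemma sqn_Ft_le: "integrable lborel f \<Longrightarrow> sqn lborel (Ft f) \<le> ennreal (2 * pi) * sqn lborel f"
  unfolding sqn_def by (rule Ft_bessel)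

lemma sqn_Ft_trunc_diff:
  assumes [measurable]: "a \<in> borel_measurable borel" and fin: "sqn lborel a < \<infinity>" and R: "R \<le> R'"
  shows "sqn lborel (\<lambda>\<xi>. Ft (trunc R' a) \<xi> - Ft (trunc R a) \<xi>) \<le> ennreal (2 * pi) * sqn lborel (\<lambda>y. a y - trunc R a y)"
proof -
  have "sqn lborel (\<lambda>\<xi>. Ft (trunc R' a) \<xi> - Ft (trunc R a) \<xi>) = sqn lborel (Ft (\<lambda>y. trunc R' a y - trunc R a y))"
    by (intro sqn_cong Ft_diff integrable_trunc fin) measurable
  also have "... \<le> ennreal (2 * pi) * sqn lborel (\<lambda>y. trunc R' a y - trunc R a y)"
    by (intro sqn_Ft_le Bochner_Integration.integrable_diff integrable_trunc fin) auto
  also have "... \<le> ennreal (2 * pi) * sqn lborel (\<lambda>y. a y - trunc R a y)"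
    using R by (intro mult_left_mono sqn_mono) (auto simp: trunc_def indicator_def)
  finally show ?thesis .
qed

lemma sqn_trunc_tendsto:
  assumes [measurable]: "a \<in> borel_measurable borel" and fin: "sqn lborel a < \<infinity>"
  shows "((\<lambda>R. sqn lborel (\<lambda>y. a y - trunc R a y)) \<longlongrightarrow> 0) at_top"
proof (rule tendsto_0_if_ennreal_le)
  fix e :: real assume e: "0 < e"
  have "(\<lambda>n. sqn lborel (\<lambda>y. a y - trunc (real n) a y)) \<longlonglongrightarrow> (\<integral>\<^sup>+y. 0 \<partial>(lborel :: real measure))"
    unfolding sqn_def
  proof (rule nn_integral_dominated_convergence[where w="\<lambda>y. nsq (a y)"])
    show "AE y in lborel. nsq (a y - trunc (real n) a y) \<le> nsq (a y)" for n
      by (auto intro!: AE_I2 simp: trunc_def indicator_def)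
    show "(\<integral>\<^sup>+y. nsq (a y) \<partial>lborel) < \<infinity>" using fin by (simp add: sqn_def)
    show "AE y in lborel. (\<lambda>n. nsq (a y - trunc (real n) a y)) \<longlonglongrightarrow> 0"
    proof (rule AE_I2)
      fix y :: real
      obtain N where "\<bar>y\<bar> \<le> real N" using real_arch_simple by blast
      then have "\<forall>\<^sub>F n in sequentially. nsq (a y - trunc (real n) a y) = 0"
        unfolding eventually_sequentially by (intro exI[of _ N]) (auto simp: trunc_def indicator_def)
      then show "(\<lambda>n. nsq (a y - trunc (real n) a y)) \<longlonglongrightarrow> 0"
        by (rule tendsto_eventually)
    qed
  qed measurable
  then have "\<forall>\<^sub>F n in sequentially. sqn lborel (\<lambda>y. a y - trunc (real n) a y) < ennreal e"
    using e by (intro order_tendstoD(2)) auto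
  then obtain n where n: "sqn lborel (\<lambda>y. a y - trunc (real n) a y) < ennreal e"
    by (auto simp: eventually_sequentially)
  show "\<forall>\<^sub>F R in at_top. sqn lborel (\<lambda>y. a y - trunc R a y) \<le> ennreal e"
    using eventually_ge_at_top[of "real n"]
  proof eventually_elim
    fix R assume R: "real n \<le> R"
    have "sqn lborel (\<lambda>y. a y - trunc R a y) \<le> sqn lborel (\<lambda>y. a y - trunc (real n) a y)"
      using R by (intro sqn_mono) (auto simp: trunc_def indicator_def)
    then show "sqn lborel (\<lambda>y. a y - trunc R a y) \<le> ennreal e" using n by simp
  qed
qed

text \<open>By Bessel the transforms of two truncations differ by at most a tail of
  \<open>a\<close>. Completeness gives a limit along integers, and the same tail bound extends the
  convergence to real R.\<close>

lemma Ft_trunc_limit: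
  assumes [measurable]: "a \<in> borel_measurable borel" and fin: "sqn lborel a < \<infinity>"
  obtains V where "V \<in> borel_measurable borel"
    "((\<lambda>R. sqn lborel (\<lambda>\<xi>. V \<xi> - Ft (trunc R a) \<xi>)) \<longlongrightarrow> 0) at_top"
proof -
  define d where "d R = ennreal (2 * pi) * sqn lborel (\<lambda>y. a y - trunc R a y)" for R
  have "(d \<longlongrightarrow> ennreal (2 * pi) * 0) at_top"
    unfolding d_def by (intro ennreal_tendsto_cmult sqn_trunc_tendsto fin) auto
  then have d0: "(d \<longlongrightarrow> 0) at_top" by simp
  have pair: "sqn lborel (\<lambda>\<xi>. Ft (trunc R' a) \<xi> - Ft (trunc R a) \<xi>) \<le> d R" if "R \<le> R'" for R R'
    unfolding d_def by (rule sqn_Ft_trunc_diff[OF _ fin that]) measurable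
  obtain V where V [measurable]: "V \<in> borel_measurable lborel" and
    lim: "(\<lambda>n. sqn lborel (\<lambda>\<xi>. Ft (trunc (real n) a) \<xi> - V \<xi>)) \<longlonglongrightarrow> 0"
    unfolding sqn_def
  proof (rule L2_complete[of "\<lambda>n. Ft (trunc (real n) a)" lborel])
    fix e :: real assume e: "0 < e"
    have "\<forall>\<^sub>F R in at_top. d R < ennreal e" using d0 e by (intro order_tendstoD(2)) auto
    then obtain R0 where R0: "\<And>R. R \<ge> R0 \<Longrightarrow> d R < ennreal e"
      by (auto simp: eventually_at_top_linorder)
    obtain N where N: "R0 \<le> real N" using real_arch_simple by blast
    show "\<exists>N. \<forall>m\<ge>N. \<forall>n\<ge>N. (\<integral>\<^sup>+x. nsq (Ft (trunc (real m) a) x - Ft (trunc (real n) a) x) \<partial>lborel) \<le> ennreal e"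
      unfolding sqn_def[symmetric]
    proof (intro exI[of _ N] allI impI)
      fix m n assume mn: "N \<le> m" "N \<le> n"
      show "sqn lborel (\<lambda>\<xi>. Ft (trunc (real m) a) \<xi> - Ft (trunc (real n) a) \<xi>) \<le> ennreal e"
      proof (cases "m \<le> n")
        case True
        then have "sqn lborel (\<lambda>\<xi>. Ft (trunc (real n) a) \<xi> - Ft (trunc (real m) a) \<xi>) \<le> d (real m)"
          by (intro pair) simp
        also have "... \<le> ennreal e" by (rule less_imp_le[OF R0]) (use N mn in linarith)
        finally show ?thesis by (subst sqn_minus_commute)
      next
        case False
        then have "sqn lborel (\<lambda>\<xi>. Ft (trunc (real m) a) \<xi> - Ft (trunc (real n) a) \<xi>) \<le> d (real n)"
          by (intro pair) simp
        also have "... \<le> ennreal e" by (rule less_imp_le[OF R0]) (use N mn in linarith)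
        finally show ?thesis .
      qed
    qed
  qed measurable
  have "((\<lambda>R. sqn lborel (\<lambda>\<xi>. V \<xi> - Ft (trunc R a) \<xi>)) \<longlongrightarrow> 0) at_top"
  proof (rule tendsto_0_if_ennreal_le)
    fix e :: real assume e: "0 < e"
    have "\<forall>\<^sub>F R in at_top. d R < ennreal (e / 4)" using d0 e by (intro order_tendstoD(2)) auto
    then obtain R0 where R0: "\<And>R. R \<ge> R0 \<Longrightarrow> d R < ennreal (e / 4)"
      by (auto simp: eventually_at_top_linorder)
    have "\<forall>\<^sub>F n in sequentially. sqn lborel (\<lambda>\<xi>. Ft (trunc (real n) a) \<xi> - V \<xi>) < ennreal (e / 4)"
      using lim e by (intro order_tendstoD(2)) auto
    then obtain N where N: "\<And>n. n \<ge> N \<Longrightarrow> sqn lborel (\<lambda>\<xi>. Ft (trunc (real n) a) \<xi> - V \<xi>) < ennreal (e / 4)"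
      by (auto simp: eventually_sequentially)
    show "\<forall>\<^sub>F R in at_top. sqn lborel (\<lambda>\<xi>. V \<xi> - Ft (trunc R a) \<xi>) \<le> ennreal e"
      using eventually_ge_at_top[of R0]
    proof eventually_elim
      fix R assume R: "R0 \<le> R"
      obtain n0 where n0: "R \<le> real n0" using real_arch_simple by blast
      define n where "n = max N n0"
      have n: "R \<le> real n" "N \<le> n" using n0 by (auto simp: n_def)
      have "sqn lborel (\<lambda>\<xi>. V \<xi> - Ft (trunc R a) \<xi>) \<le> 2 * sqn lborel (\<lambda>\<xi>. V \<xi> - Ft (trunc (real n) a) \<xi>)
          + 2 * sqn lborel (\<lambda>\<xi>. Ft (trunc (real n) a) \<xi> - Ft (trunc R a) \<xi>)"
        by (rule sqn_triangle) measurable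
      also have "... \<le> 2 * ennreal (e / 4) + 2 * ennreal (e / 4)"
      proof (intro add_mono mult_left_mono)
        show "sqn lborel (\<lambda>\<xi>. V \<xi> - Ft (trunc (real n) a) \<xi>) \<le> ennreal (e / 4)"
          by (subst sqn_minus_commute) (rule less_imp_le[OF N[OF n(2)]])
        show "sqn lborel (\<lambda>\<xi>. Ft (trunc (real n) a) \<xi> - Ft (trunc R a) \<xi>) \<le> ennreal (e / 4)"
          using pair[OF n(1)] R0[OF R] by order
      qed auto
      also have "... = ennreal e" using e
        by (simp add: ennreal_numeral[symmetric] ennreal_mult[symmetric] ennreal_plus[symmetric] del: ennreal_plus ennreal_numeral)
      finally show "sqn lborel (\<lambda>\<xi>. V \<xi> - Ft (trunc R a) \<xi>) \<le> ennreal e" .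
    qed
  qed
  moreover have "V \<in> borel_measurable borel" using V by simp
  ultimately show ?thesis using that by blast
qed

lemma Ft_limit_bound:
  assumes [measurable]: "a \<in> borel_measurable borel" "V \<in> borel_measurable borel" and fin: "sqn lborel a < \<infinity>"
    and lim: "((\<lambda>R. sqn lborel (\<lambda>\<xi>. V \<xi> - Ft (trunc R a) \<xi>)) \<longlongrightarrow> 0) at_top"
  shows "sqn lborel V \<le> ennreal (4 * pi) * sqn lborel a"
proof (rule tendsto_lowerbound)
  show "((\<lambda>R. 2 * sqn lborel (\<lambda>\<xi>. V \<xi> - Ft (trunc R a) \<xi>) + ennreal (4 * pi) * sqn lborel a) \<longlongrightarrow> ennreal (4 * pi) * sqn lborel a) at_top"
    using tendsto_add[OF ennreal_tendsto_cmult[OF _ lim, of 2] tendsto_const[of "ennreal (4 * pi) * sqn lborel a"]] by simp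
  show "\<forall>\<^sub>F R in at_top. sqn lborel V \<le> 2 * sqn lborel (\<lambda>\<xi>. V \<xi> - Ft (trunc R a) \<xi>) + ennreal (4 * pi) * sqn lborel a"
  proof (intro always_eventually allI)
    fix R
    have "sqn lborel V \<le> 2 * sqn lborel (\<lambda>\<xi>. V \<xi> - Ft (trunc R a) \<xi>) + 2 * sqn lborel (Ft (trunc R a))"
      by (rule sqn_le_of_diff) measurable
    also have "sqn lborel (Ft (trunc R a)) \<le> ennreal (2 * pi) * sqn lborel a"
      using order_trans[OF sqn_Ft_le[OF integrable_trunc[OF _ fin]] mult_left_mono[OF sqn_trunc_le]] by simp
    also have "2 * (ennreal (2 * pi) * sqn lborel a) = ennreal (4 * pi) * sqn lborel a"
      by (simp add: mult.assoc[symmetric] ennreal_mult[symmetric] ennreal_numeral[symmetric] del: ennreal_numeral)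
    finally show "sqn lborel V \<le> 2 * sqn lborel (\<lambda>\<xi>. V \<xi> - Ft (trunc R a) \<xi>) + ennreal (4 * pi) * sqn lborel a"
      by (simp add: add_left_mono mult_left_mono)
  qed
qed simp

text \<open>Identifies an L2 limit by integrals against test functions: the multiplication formula
  holds for each truncation, and both of its sides pass to the limit by Cauchy-Schwarz.\<close>

lemma Ft_limit_test:
  assumes [measurable]: "a \<in> borel_measurable borel" "V \<in> borel_measurable borel" and fin: "sqn lborel a < \<infinity>"
    and lim: "((\<lambda>R. sqn lborel (\<lambda>\<xi>. V \<xi> - Ft (trunc R a) \<xi>)) \<longlongrightarrow> 0) at_top"
    and h: "integrable lborel h" "sqn lborel h < \<infinity>"
  shows "(LINT \<xi>|lborel. V \<xi> * h \<xi>) = (LINT y|lborel. a y * Ft h y)"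
proof -
  have [measurable]: "h \<in> borel_measurable borel" using h by auto
  have Vfin: "sqn lborel V < \<infinity>"
    using Ft_limit_bound[OF assms(1-4)] fin by (auto simp: ennreal_mult_less_top intro: le_less_trans)
  have Fh: "sqn lborel (Ft h) < \<infinity>"
    using sqn_Ft_le[OF h(1)] h(2) by (auto simp: ennreal_mult_less_top intro: le_less_trans)
  have Fc: "sqn lborel (Ft (trunc R a)) < \<infinity>" for R
    by (rule finite_of_le_mult[OF order_trans[OF sqn_Ft_le[OF integrable_trunc[OF _ fin]] mult_left_mono[OF sqn_trunc_le]] fin]) auto
  have lim': "filterlim real at_top sequentially" by (rule filterlim_real_sequentially)
  have "(\<lambda>n. LINT \<xi>|lborel. (V \<xi> - Ft (trunc (real n) a) \<xi>) * h \<xi>) \<longlonglongrightarrow> 0"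
    by (rule integral_mult_tendsto_0[OF _ _ filterlim_compose[OF lim lim'] h(2)]) measurable
  moreover have "(LINT \<xi>|lborel. (V \<xi> - Ft (trunc (real n) a) \<xi>) * h \<xi>) =
      (LINT \<xi>|lborel. V \<xi> * h \<xi>) - (LINT y|lborel. trunc (real n) a y * Ft h y)" for n
  proof -
    have "(LINT \<xi>|lborel. (V \<xi> - Ft (trunc (real n) a) \<xi>) * h \<xi>) =
        (LINT \<xi>|lborel. V \<xi> * h \<xi>) - (LINT \<xi>|lborel. Ft (trunc (real n) a) \<xi> * h \<xi>)"
      unfolding left_diff_distrib
      by (intro Bochner_Integration.integral_diff integrable_mult_sqn Vfin Fc h) auto
    also have "(LINT \<xi>|lborel. Ft (trunc (real n) a) \<xi> * h \<xi>) = (LINT y|lborel. trunc (real n) a y * Ft h y)"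
      using Ft_multiplication[OF integrable_trunc[OF _ fin, of "real n"] h(1)] by (simp add: mult.commute)
    finally show ?thesis .
  qed
  ultimately have 1: "(\<lambda>n. (LINT \<xi>|lborel. V \<xi> * h \<xi>) - (LINT y|lborel. trunc (real n) a y * Ft h y)) \<longlonglongrightarrow> 0"
    by simp
  have "(\<lambda>n. LINT y|lborel. (a y - trunc (real n) a y) * Ft h y) \<longlonglongrightarrow> 0"
    by (rule integral_mult_tendsto_0[OF _ _ filterlim_compose[OF sqn_trunc_tendsto[OF _ fin] lim'] Fh]) measurable
  moreover have "(LINT y|lborel. (a y - trunc (real n) a y) * Ft h y) =
      (LINT y|lborel. a y * Ft h y) - (LINT y|lborel. trunc (real n) a y * Ft h y)" for n
    unfolding left_diff_distrib
    by (intro Bochner_Integration.integral_diff integrable_mult_sqn fin Fh le_less_trans[OF sqn_trunc_le]) auto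
  ultimately have 2: "(\<lambda>n. (LINT y|lborel. a y * Ft h y) - (LINT y|lborel. trunc (real n) a y * Ft h y)) \<longlonglongrightarrow> 0"
    by simp
  have "(LINT \<xi>|lborel. V \<xi> * h \<xi>) - (LINT y|lborel. a y * Ft h y) = 0"
    using tendsto_diff[OF 1 2] by (simp add: LIMSEQ_const_iff)
  then show ?thesis by simp
qed

lemma gauss_L2: "sqn lborel (\<lambda>x. complex_of_real (exp (- (1 * (x - m))\<^sup>2 / 2)) * cis (r * x)) < \<infinity>"
proof -
  have "sqn lborel (\<lambda>x. complex_of_real (exp (- (1 * (x - m))\<^sup>2 / 2)) * cis (r * x)) \<le> (\<integral>\<^sup>+x. ennreal (exp (- (1 * (x - m))\<^sup>2 / 2)) \<partial>lborel)"
    unfolding sqn_def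
  proof (intro nn_integral_mono ennreal_leI)
    fix x :: real
    have "exp (- (1 * (x - m))\<^sup>2 / 2) \<le> 1" by simp
    then show "(cmod (complex_of_real (exp (- (1 * (x - m))\<^sup>2 / 2)) * cis (r * x)))\<^sup>2 \<le> exp (- (1 * (x - m))\<^sup>2 / 2)"
      by (simp add: norm_mult power2_eq_square mult_left_le del: one_le_exp_iff)
  qed
  also have "... < \<infinity>"
    using gaussian_integrable[of 1 m] by (subst nn_integral_eq_integral) auto
  finally show ?thesis .
qed

text \<open>Tested against a Gaussian centred at m, the limit formula says that the transform of
  \<open>a\<close> times a fixed Gaussian vanishes at m. This product is integrable although
  \<open>a\<close> need not be, so injectivity for integrable functions applies, and the Gaussian
  can be divided out.\<close>

lemma Ft_limit_zero:
  assumes [measurable]: "a \<in> borel_measurable borel" and fin: "sqn lborel a < \<infinity>"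
    and lim: "((\<lambda>R. sqn lborel (Ft (trunc R a))) \<longlongrightarrow> 0) at_top"
  shows "AE y in lborel. a y = 0"
proof -
  define g where "g y = complex_of_real (2 * pi * normal_density 0 1 y)" for y
  have "sqn lborel g < \<infinity>"
  proof -
    have "sqn lborel (\<lambda>y. complex_of_real (2 * pi / sqrt (2 * pi)) * (complex_of_real (exp (- (1 * (y - 0))\<^sup>2 / 2)) * cis (0 * y))) < \<infinity>"
      by (subst sqn_scale) (use gauss_L2[of 0 0] in \<open>auto simp: ennreal_mult_less_top\<close>)
    moreover have "complex_of_real (2 * pi / sqrt (2 * pi)) * (complex_of_real (exp (- (1 * (y - 0))\<^sup>2 / 2)) * cis (0 * y)) = g y" for y
      by (simp add: g_def std_normal_density_def)
    ultimately show ?thesis by simp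
  qed
  moreover have "g \<in> borel_measurable borel" unfolding g_def by measurable
  ultimately have ag: "integrable lborel (\<lambda>y. a y * g y)"
    by (intro integrable_mult_sqn fin) auto
  have "Ft (\<lambda>y. a y * g y) m = 0" for m
  proof -
    have gi: "integrable lborel (\<lambda>x. complex_of_real (exp (- (1 * (x - m))\<^sup>2 / 2)))"
      using gaussian_integrable[of 1 m] by (simp only: complex_of_real_integrable_eq)
    have lim': "((\<lambda>R. sqn lborel (\<lambda>\<xi>. 0 - Ft (trunc R a) \<xi>)) \<longlongrightarrow> 0) at_top"
      using lim by (simp add: sqn_minus)
    have "(LINT \<xi>|lborel. 0 * complex_of_real (exp (- (1 * (\<xi> - m))\<^sup>2 / 2))) =
        (LINT y|lborel. a y * Ft (\<lambda>x. complex_of_real (exp (- (1 * (x - m))\<^sup>2 / 2))) y)"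
      by (rule Ft_limit_test[OF _ _ fin lim' gi]) (use gauss_L2[of m 0] in auto)
    also have "... = (LINT y|lborel. a y * (of_real (2 * pi * normal_density 0 1 y) * cis (- (y * m))))"
      by (subst Ft_gaussian) auto
    also have "... = Ft (\<lambda>y. a y * g y) m"
      unfolding Ft_def g_def by (simp add: mult_ac)
    finally show ?thesis by simp
  qed
  then have "AE y in lborel. a y * g y = 0" by (rule Ft_zero_imp_ae_zero[OF ag])
  then show ?thesis
  proof eventually_elim
    fix y assume "a y * g y = 0"
    moreover have "g y \<noteq> 0" using normal_density_pos[of 1 0 y] by (simp add: g_def)
    ultimately show "a y = 0" by simp
  qed
qed

lemma Ft_reflect: "Ft (\<lambda>y. f (- y)) \<xi> = Ft f (- \<xi>)"
  unfolding Ft_def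
  by (subst lborel_integral_real_affine[where c="-1" and t=0]) auto

text \<open>Up to the factor 2 pi, \<open>b\<close> is the inverse transform of \<open>U\<close>.
  Its own transform V exists as an L2 limit; V and 2 pi U have the same pairings with all modulated
  Gaussians, so their difference times a Gaussian has vanishing transform.\<close>

lemma Ft_inversion:
  assumes U: "integrable lborel U" "sqn lborel U < \<infinity>"
  defines "b \<equiv> (\<lambda>y. Ft U (- y))"
  shows "((\<lambda>R. sqn lborel (\<lambda>\<xi>. of_real (2 * pi) * U \<xi> - Ft (trunc R b) \<xi>)) \<longlongrightarrow> 0) at_top"
proof -
  have [measurable]: "U \<in> borel_measurable borel" using U by auto
  have [measurable]: "b \<in> borel_measurable borel" unfolding b_def by measurable
  have b_alt: "b = Ft (\<lambda>y. U (- y))" unfolding b_def by (simp add: Ft_reflect fun_eq_iff)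
  have Ui: "integrable lborel (\<lambda>y. U (- y))"
    using lborel_integrable_real_affine[OF U(1), of "-1" 0] by simp
  have "sqn lborel (\<lambda>y. U (- y)) = sqn lborel U"
    unfolding sqn_def using nn_integral_real_affine[of "\<lambda>y. nsq (U y)" "-1" 0] by simp
  then have bfin: "sqn lborel b < \<infinity>"
    using sqn_Ft_le[OF Ui] U(2) unfolding b_alt by (auto simp: ennreal_mult_less_top intro: le_less_trans)
  obtain V where V [measurable]: "V \<in> borel_measurable borel"
    and lim: "((\<lambda>R. sqn lborel (\<lambda>\<xi>. V \<xi> - Ft (trunc R b) \<xi>)) \<longlongrightarrow> 0) at_top"
    using Ft_trunc_limit[OF _ bfin] by auto
  have Vfin: "sqn lborel V < \<infinity>"
    using Ft_limit_bound[OF _ V bfin lim] bfin by (auto simp: ennreal_mult_less_top intro: le_less_trans)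
  define D where "D \<xi> = V \<xi> - of_real (2 * pi) * U \<xi>" for \<xi>
  have [measurable]: "D \<in> borel_measurable borel" unfolding D_def by measurable
  define g where "g \<xi> = complex_of_real (exp (- (1 * (\<xi> - 0))\<^sup>2 / 2))" for \<xi>
  have [measurable]: "g \<in> borel_measurable borel" unfolding g_def by measurable
  have gL2: "sqn lborel (\<lambda>\<xi>. g \<xi> * cis (r * \<xi>)) < \<infinity>" for r using gauss_L2[of 0 r] by (simp add: g_def)
  have gI: "integrable lborel g"
    unfolding g_def using gaussian_integrable[of 1 0] by (simp only: complex_of_real_integrable_eq)
  have gIr: "integrable lborel (\<lambda>\<xi>. g \<xi> * cis (r * \<xi>))" for r by (rule integrable_mult_cis(1)[OF gI])
  have VI: "integrable lborel (\<lambda>\<xi>. V \<xi> * (g \<xi> * cis (r * \<xi>)))" for r by (intro integrable_mult_sqn Vfin gL2) auto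
  have UI: "integrable lborel (\<lambda>\<xi>. U \<xi> * (g \<xi> * cis (r * \<xi>)))" for r by (intro integrable_mult_sqn U(2) gL2) auto
  \<comment> \<open>The transform is moved over twice, from V to the test function and then onto
    \<open>U\<close>. The test function stays Gaussian, and each of the two passes contributes a
    factor sqrt (2 pi).\<close>
  have key: "(LINT \<xi>|lborel. V \<xi> * (g \<xi> * cis (r * \<xi>))) = of_real (2 * pi) * (LINT \<xi>|lborel. U \<xi> * (g \<xi> * cis (r * \<xi>)))" for r
  proof -
    have Ftg: "Ft (\<lambda>\<xi>. g \<xi> * cis (r * \<xi>)) y = of_real (2 * pi * normal_density 0 1 (y - r))" for y
    proof -
      have "Ft (\<lambda>\<xi>. g \<xi> * cis (r * \<xi>)) y = Ft g (y - r)"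
        unfolding Ft_def by (intro Bochner_Integration.integral_cong) (auto simp: cis_mult algebra_simps)
      then show ?thesis unfolding g_def by (subst (asm) Ft_gaussian) auto
    qed
    define G where "G y = complex_of_real (exp (- (1 * (y - (- r)))\<^sup>2 / 2))" for y
    have GI: "integrable lborel G"
      unfolding G_def using gaussian_integrable[of 1 "-r"] by (simp only: complex_of_real_integrable_eq)
    have ng: "complex_of_real (2 * pi * normal_density 0 1 (- y - r)) = of_real (sqrt (2 * pi)) * G y" for y
    proof -
      define s where "s = sqrt (2 * pi)"
      have s: "2 * pi = s * s" "s > 0" by (simp_all add: s_def)
      have "(- y - r)\<^sup>2 = (1 * (y - (- r)))\<^sup>2" by (simp add: power2_eq_square algebra_simps)
      then have "normal_density 0 1 (- y - r) = 1 / s * exp (- (1 * (y - (- r)))\<^sup>2 / 2)"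
        unfolding std_normal_density_def s_def by (simp only:)
      then have "2 * pi * normal_density 0 1 (- y - r) = sqrt (2 * pi) * exp (- (1 * (y - (- r)))\<^sup>2 / 2)"
        unfolding s(1) using s(2) by simp
      then show ?thesis by (simp add: G_def)
    qed
    have "(LINT \<xi>|lborel. V \<xi> * (g \<xi> * cis (r * \<xi>))) = (LINT y|lborel. b y * Ft (\<lambda>\<xi>. g \<xi> * cis (r * \<xi>)) y)"
      by (rule Ft_limit_test[OF _ V bfin lim gIr gL2]) measurable
    also have "... = (LINT y|lborel. Ft U (- y) * of_real (2 * pi * normal_density 0 1 (y - r)))"
      unfolding b_def Ftg ..
    also have "... = (LINT y|lborel. Ft U y * of_real (2 * pi * normal_density 0 1 (- y - r)))"
      by (subst lborel_integral_real_affine[where c="-1" and t=0]) auto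
    also have "... = of_real (sqrt (2 * pi)) * (LINT y|lborel. G y * Ft U y)"
      unfolding ng by (subst integral_mult_right_zero[symmetric]) (simp add: mult_ac)
    also have "(LINT y|lborel. G y * Ft U y) = (LINT \<xi>|lborel. U \<xi> * Ft G \<xi>)"
      by (rule Ft_multiplication[OF U(1) GI])
    also have "... = (LINT \<xi>|lborel. of_real (sqrt (2 * pi)) * (U \<xi> * (g \<xi> * cis (r * \<xi>))))"
    proof (intro Bochner_Integration.integral_cong refl)
      fix \<xi>
      have "Ft G \<xi> = of_real (2 * pi * normal_density 0 1 \<xi>) * cis (\<xi> * r)"
        unfolding G_def by (subst Ft_gaussian) auto
      moreover have "2 * pi * normal_density 0 1 \<xi> = sqrt (2 * pi) * exp (- (1 * (\<xi> - 0))\<^sup>2 / 2)"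
        using arg_cong[OF ng[of "- \<xi> - r"], of Re] unfolding G_def by (simp add: power2_commute)
      ultimately have "Ft G \<xi> = of_real (sqrt (2 * pi) * exp (- (1 * (\<xi> - 0))\<^sup>2 / 2)) * cis (\<xi> * r)"
        by (simp only:)
      then show "U \<xi> * Ft G \<xi> = of_real (sqrt (2 * pi)) * (U \<xi> * (g \<xi> * cis (r * \<xi>)))"
        by (simp add: g_def mult_ac)
    qed
    also have "... = of_real (sqrt (2 * pi)) * (LINT \<xi>|lborel. U \<xi> * (g \<xi> * cis (r * \<xi>)))"
      by (rule integral_mult_right_zero)
    finally show ?thesis
    proof -
      have "complex_of_real (sqrt (2 * pi)) * of_real (sqrt (2 * pi)) = of_real (2 * pi)"
        by (simp only: of_real_mult[symmetric] real_sqrt_mult_self) simp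
      moreover assume "(LINT \<xi>|lborel. V \<xi> * (g \<xi> * cis (r * \<xi>))) =
        of_real (sqrt (2 * pi)) * (of_real (sqrt (2 * pi)) * (LINT \<xi>|lborel. U \<xi> * (g \<xi> * cis (r * \<xi>))))"
      ultimately show ?thesis by (metis mult.assoc)
    qed
  qed
  have "Ft (\<lambda>\<xi>. D \<xi> * g \<xi>) r = 0" for r
  proof -
    have "Ft (\<lambda>\<xi>. D \<xi> * g \<xi>) r = (LINT \<xi>|lborel. V \<xi> * (g \<xi> * cis ((- r) * \<xi>)) - of_real (2 * pi) * (U \<xi> * (g \<xi> * cis ((- r) * \<xi>))))"
      unfolding Ft_def D_def by (intro Bochner_Integration.integral_cong refl) (simp add: algebra_simps)
    also have "... = (LINT \<xi>|lborel. V \<xi> * (g \<xi> * cis ((- r) * \<xi>))) - of_real (2 * pi) * (LINT \<xi>|lborel. U \<xi> * (g \<xi> * cis ((- r) * \<xi>)))"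
      by (subst Bochner_Integration.integral_diff[OF VI integrable_mult_right[OF UI]]) (simp only: integral_mult_right_zero)
    finally show ?thesis by (simp only: key) simp
  qed
  moreover have "integrable lborel (\<lambda>\<xi>. D \<xi> * g \<xi>)"
    using Bochner_Integration.integrable_diff[OF VI[of 0] integrable_mult_right[OF UI[of 0], of "of_real (2 * pi)"]]
    by (simp add: D_def algebra_simps)
  ultimately have "AE \<xi> in lborel. D \<xi> * g \<xi> = 0" by (intro Ft_zero_imp_ae_zero)
  then have "AE \<xi> in lborel. V \<xi> = of_real (2 * pi) * U \<xi>" by eventually_elim (simp add: D_def g_def)
  then have "sqn lborel (\<lambda>\<xi>. of_real (2 * pi) * U \<xi> - Ft (trunc R b) \<xi>) = sqn lborel (\<lambda>\<xi>. V \<xi> - Ft (trunc R b) \<xi>)" for R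
    by (intro sqn_cong_AE) auto
  then show ?thesis using lim by simp
qed

section \<open>Sums over the modes and Bessel inequality on the circle\<close>

abbreviation zsum :: "(int \<Rightarrow> ennreal) \<Rightarrow> ennreal" where
  "zsum f \<equiv> (\<integral>\<^sup>+k. f k \<partial>count_space UNIV)"

lemma zsum_conv_suminf: "zsum f = (\<Sum>i. f (int_decode i))"
  using nn_integral_bij_count_space[OF bij_int_decode, of f] by (simp add: nn_integral_count_space_nat)

lemma zsum_le_finite:
  assumes "\<And>F. finite F \<Longrightarrow> sum f F \<le> B"
  shows "zsum f \<le> B"
  unfolding zsum_conv_suminf
proof (rule suminf_le_const)
  fix n
  have "(\<Sum>i<n. f (int_decode i)) = sum f (int_decode ` {..<n})"
    by (subst sum.reindex) (auto intro: inj_onI simp: int_decode_eq)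
  also have "... \<le> B" by (rule assms) simp
  finally show "(\<Sum>i<n. f (int_decode i)) \<le> B" .
qed auto

lemma finite_sum_le_zsum: "finite F \<Longrightarrow> sum f F \<le> zsum f"
proof -
  assume F: "finite F"
  have "sum f F = (\<integral>\<^sup>+k. f k * indicator F k \<partial>count_space UNIV)"
    by (subst nn_integral_count_space'[OF F, where f="\<lambda>k. f k * indicator F k"]) (auto simp: F)
  also have "... \<le> zsum f" by (intro nn_integral_mono) (auto simp: indicator_def)
  finally show ?thesis .
qed

lemma member_le_zsum: "f k \<le> zsum f"
  using finite_sum_le_zsum[of "{k}" f] by simp

lemma zsum_swap:
  assumes "\<And>k. f k \<in> borel_measurable M"
  shows "(\<integral>\<^sup>+x. zsum (\<lambda>k. f k x) \<partial>M) = zsum (\<lambda>k. \<integral>\<^sup>+x. f k x \<partial>M)"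
  by (rule nn_integral_count_space_nn_integral) (use assms in auto)

lemma zsum_measurable [measurable]:
  assumes [measurable]: "\<And>k. f k \<in> borel_measurable M"
  shows "(\<lambda>x. zsum (\<lambda>k. f k x)) \<in> borel_measurable M"
  unfolding zsum_conv_suminf by measurable

lemma zsum_cmult: "zsum (\<lambda>k. c * f k) = c * zsum f"
  by (rule nn_integral_cmult) simp

lemma integrable_trig_sum:
  "integrable circle (\<lambda>x. \<Sum>k\<in>F. a k * cis (real_of_int k * x))"
proof (intro Bochner_Integration.integrable_sum integrable_mult_right)
  fix k
  interpret finite_measure circle by (rule finite_measure_circle)
  show "integrable circle (\<lambda>x. cis (real_of_int k * x))"
    by (rule integrable_const_bound[where B=1]) (auto intro!: measurable_restrict_space1)
qed

lemma trig_sum_norm: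
  assumes "finite F"
  shows "integrable circle (\<lambda>x. (cmod (\<Sum>k\<in>F. a k * cis (real_of_int k * x)))\<^sup>2)"
    "(LINT x|circle. (cmod (\<Sum>k\<in>F. a k * cis (real_of_int k * x)))\<^sup>2) = 2 * pi * (\<Sum>k\<in>F. (cmod (a k))\<^sup>2)"
proof -
  interpret finite_measure circle by (rule finite_measure_circle)
  let ?p = "\<lambda>x. \<Sum>k\<in>F. a k * cis (real_of_int k * x)"
  have ci: "integrable circle (\<lambda>x. c * cis (real_of_int k * x))" for c k
    using integrable_trig_sum[of "\<lambda>_. c" "{k}"] by simp
  have sq: "complex_of_real ((cmod (?p x))\<^sup>2) = (\<Sum>k\<in>F. \<Sum>l\<in>F. (a k * cnj (a l)) * cis (real_of_int (k - l) * x))" for x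
  proof -
    have "complex_of_real ((cmod (?p x))\<^sup>2) = ?p x * cnj (?p x)" by (rule complex_norm_square)
    also have "... = (\<Sum>k\<in>F. \<Sum>l\<in>F. (a k * cis (real_of_int k * x)) * (cnj (a l) * cis (- (real_of_int l * x))))"
      by (simp add: sum_product cis_cnj)
    also have "... = (\<Sum>k\<in>F. \<Sum>l\<in>F. (a k * cnj (a l)) * cis (real_of_int (k - l) * x))"
    proof (intro sum.cong refl)
      fix k l
      have "cis (real_of_int (k - l) * x) = cis (real_of_int k * x) * cis (- (real_of_int l * x))"
        by (simp add: cis_mult algebra_simps)
      then show "(a k * cis (real_of_int k * x)) * (cnj (a l) * cis (- (real_of_int l * x))) =
          (a k * cnj (a l)) * cis (real_of_int (k - l) * x)" by (simp add: mult_ac)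
    qed
    finally show ?thesis .
  qed
  have int: "integrable circle (\<lambda>x. complex_of_real ((cmod (?p x))\<^sup>2))"
    unfolding sq by (intro Bochner_Integration.integrable_sum ci)
  then show "integrable circle (\<lambda>x. (cmod (?p x))\<^sup>2)" by (simp only: complex_of_real_integrable_eq)
  have "complex_of_real (LINT x|circle. (cmod (?p x))\<^sup>2) = (LINT x|circle. complex_of_real ((cmod (?p x))\<^sup>2))"
    by (rule integral_complex_of_real[symmetric])
  also have "... = (\<Sum>k\<in>F. \<Sum>l\<in>F. (a k * cnj (a l)) * (LINT x|circle. cis (real_of_int (k - l) * x)))"
    unfolding sq
    by (simp add: Bochner_Integration.integral_sum Bochner_Integration.integrable_sum ci del: of_int_diff)
  also have "... = (\<Sum>k\<in>F. \<Sum>l\<in>F. if k = l then of_real (2 * pi * (cmod (a k))\<^sup>2) else 0)"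
    unfolding integral_cis_circle
    by (intro sum.cong refl) (simp add: complex_norm_square[symmetric] mult_ac)
  also have "... = of_real (2 * pi * (\<Sum>k\<in>F. (cmod (a k))\<^sup>2))"
    using assms by (simp add: sum.delta sum_distrib_left)
  finally show "(LINT x|circle. (cmod (?p x))\<^sup>2) = 2 * pi * (\<Sum>k\<in>F. (cmod (a k))\<^sup>2)"
    by (simp only: of_real_eq_iff)
qed

lemma integrable_circle_of_sq:
  assumes [measurable]: "v \<in> borel_measurable circle" and v2: "integrable circle (\<lambda>x. (v x)\<^sup>2 :: real)"
  shows "integrable circle v"
proof -
  interpret finite_measure circle by (rule finite_measure_circle)
  show ?thesis
  proof (rule Bochner_Integration.integrable_bound[where f="\<lambda>x. 1 + (v x)\<^sup>2"])
    show "AE x in circle. norm (v x) \<le> norm (1 + (v x)\<^sup>2)"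
    proof (rule AE_I2)
      fix x
      show "norm (v x) \<le> norm (1 + (v x)\<^sup>2)"
        using sum_squares_bound[of 1 "\<bar>v x\<bar>"] by (simp add: power2_eq_square)
    qed
  qed (use v2 in auto)
qed

text \<open>The squared distance of \<open>v\<close> to a finite partial sum \<open>p\<close> of its
  Fourier series is nonnegative; in its expansion the mixed term is minus twice the squared norm of
  \<open>p\<close>.\<close>

lemma fcoeff_bessel:
  assumes [measurable]: "v \<in> borel_measurable circle" and v2: "integrable circle (\<lambda>x. (v x)\<^sup>2)"
  shows "zsum (\<lambda>k. nsq (fcoeff v k)) \<le> ennreal (2 * pi) * (\<integral>\<^sup>+x. ennreal ((v x)\<^sup>2) \<partial>circle)"
proof (rule zsum_le_finite)
  fix F :: "int set" assume F: "finite F"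
  have vi: "integrable circle v" by (rule integrable_circle_of_sq[OF _ v2]) measurable
  define c where "c k = fcoeff v k / (2 * pi)" for k
  define p where "p x = (\<Sum>k\<in>F. c k * cis (real_of_int k * x))" for x
  define S where "S = (\<Sum>k\<in>F. (cmod (fcoeff v k))\<^sup>2)"
  have p2: "integrable circle (\<lambda>x. (cmod (p x))\<^sup>2)" "(LINT x|circle. (cmod (p x))\<^sup>2) = S / (2 * pi)"
    using trig_sum_norm[OF F, of c] unfolding p_def
    by (simp_all add: c_def norm_divide S_def power_divide sum_divide_distrib[symmetric] power2_eq_square)
  have vp: "complex_of_real (v x) * cnj (p x) = (\<Sum>k\<in>F. cnj (c k) * (complex_of_real (v x) * cis (- (real_of_int k * x))))" for x
    unfolding p_def by (simp add: sum_distrib_left cis_cnj mult_ac)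
  have vpi: "integrable circle (\<lambda>x. complex_of_real (v x) * cnj (p x))"
    unfolding vp by (intro Bochner_Integration.integrable_sum integrable_mult_right integrable_fcoeff vi)
  have "(LINT x|circle. complex_of_real (v x) * cnj (p x)) = (\<Sum>k\<in>F. cnj (c k) * fcoeff v k)"
    unfolding vp fcoeff_def by (simp add: Bochner_Integration.integral_sum integrable_fcoeff vi)
  also have "... = of_real (S / (2 * pi))"
    unfolding S_def c_def of_real_divide of_real_sum sum_divide_distrib complex_norm_square
    by (intro sum.cong refl) (simp add: mult_ac)
  finally have vpv: "Re (LINT x|circle. complex_of_real (v x) * cnj (p x)) = S / (2 * pi)" by simp
  have sq: "(cmod (of_real (v x) - p x))\<^sup>2 = (v x)\<^sup>2 - 2 * Re (complex_of_real (v x) * cnj (p x)) + (cmod (p x))\<^sup>2" for x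
    by (simp add: cmod_power2) (simp add: power2_eq_square algebra_simps)
  have rei: "integrable circle (\<lambda>x. Re (complex_of_real (v x) * cnj (p x)))" using vpi by (rule integrable_Re)
  have "0 \<le> (LINT x|circle. (cmod (of_real (v x) - p x))\<^sup>2)" by simp
  also have "... = (LINT x|circle. (v x)\<^sup>2) - 2 * (S / (2 * pi)) + S / (2 * pi)"
    unfolding sq using v2 rei p2 vpv integral_Re[OF vpi] by simp
  finally have "S / (2 * pi) \<le> (LINT x|circle. (v x)\<^sup>2)" by simp
  then have "S \<le> 2 * pi * (LINT x|circle. (v x)\<^sup>2)" by (simp add: field_simps)
  then have "ennreal S \<le> ennreal (2 * pi) * ennreal (LINT x|circle. (v x)\<^sup>2)"
    by (simp add: ennreal_mult[symmetric] ennreal_leI)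
  then show "(\<Sum>k\<in>F. nsq (fcoeff v k)) \<le> ennreal (2 * pi) * (\<integral>\<^sup>+x. ennreal ((v x)\<^sup>2) \<partial>circle)"
    using v2 by (simp add: S_def sum_ennreal nn_integral_eq_integral)
qed

section \<open>The transform on the cylinder: existence, uniqueness, inversion\<close>

lemma pair_sigma_finite_cyl: "pair_sigma_finite circle (lborel :: real measure)"
  by (intro pair_sigma_finite.intro sigma_finite_measure_restrict_space sigma_finite_lborel) simp

lemma cyl_section_measurable:
  "u \<in> borel_measurable cyl \<Longrightarrow> (\<lambda>x. u (x, y)) \<in> borel_measurable circle"
  unfolding cyl_def by (rule measurable_Pair1) auto

lemma nn_integral_cyl:
  assumes [measurable]: "F \<in> borel_measurable cyl"
  shows "(\<integral>\<^sup>+z. F z \<partial>cyl) = (\<integral>\<^sup>+y. \<integral>\<^sup>+x. F (x, y) \<partial>circle \<partial>lborel)"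
    "(\<lambda>y. \<integral>\<^sup>+x. F (x, y) \<partial>circle) \<in> borel_measurable borel"
proof -
  interpret pair_sigma_finite circle "lborel :: real measure" by (rule pair_sigma_finite_cyl)
  have [measurable]: "F \<in> borel_measurable (circle \<Otimes>\<^sub>M lborel)" using assms by (simp add: cyl_def)
  show "(\<integral>\<^sup>+z. F z \<partial>cyl) = (\<integral>\<^sup>+y. \<integral>\<^sup>+x. F (x, y) \<partial>circle \<partial>lborel)"
    unfolding cyl_def by (rule nn_integral_snd[symmetric]) measurable
  have "(\<lambda>y. \<integral>\<^sup>+x. F (x, y) \<partial>circle) \<in> borel_measurable lborel"
    by (rule M1.borel_measurable_nn_integral) measurable
  then show "(\<lambda>y. \<integral>\<^sup>+x. F (x, y) \<partial>circle) \<in> borel_measurable borel" by simp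
qed

definition ycoef :: "(real \<times> real \<Rightarrow> real) \<Rightarrow> int \<Rightarrow> real \<Rightarrow> complex" where
  "ycoef u k y = fcoeff (\<lambda>x. u (x, y)) k"

lemma ycoef_measurable [measurable]:
  assumes "u \<in> borel_measurable cyl"
  shows "ycoef u k \<in> borel_measurable borel"
proof -
  interpret pair_sigma_finite circle "lborel :: real measure" by (rule pair_sigma_finite_cyl)
  have [measurable]: "u \<in> borel_measurable (circle \<Otimes>\<^sub>M lborel)" using assms by (simp add: cyl_def)
  have [measurable]: "(\<lambda>x. x) \<in> borel_measurable (circle :: real measure)"
    by (intro measurable_restrict_space1) simp
  have "(\<lambda>p. complex_of_real (u (snd p, fst p)) * cis (- (real_of_int k * snd p))) \<in> borel_measurable (lborel \<Otimes>\<^sub>M circle)"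
  proof -
    have [measurable]: "snd \<in> borel_measurable ((lborel :: real measure) \<Otimes>\<^sub>M (circle :: real measure))"
      using measurable_compose[OF measurable_snd \<open>(\<lambda>x. x) \<in> borel_measurable (circle :: real measure)\<close>] by simp
    have [measurable]: "(\<lambda>p. (snd p, fst p)) \<in> measurable ((lborel :: real measure) \<Otimes>\<^sub>M (circle :: real measure)) (circle \<Otimes>\<^sub>M lborel)"
      by (intro measurable_Pair measurable_snd measurable_fst)
    show ?thesis by measurable
  qed
  then have "(\<lambda>y. LINT x|circle. complex_of_real (u (x, y)) * cis (- (real_of_int k * x))) \<in> borel_measurable lborel"
    using M1.borel_measurable_lebesgue_integral[of "\<lambda>y x. complex_of_real (u (x, y)) * cis (- (real_of_int k * x))" lborel]
    by (simp add: case_prod_beta')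
  then show ?thesis by (simp add: ycoef_def[abs_def] fcoeff_def)
qed

lemma L2_cyl_iff: "u \<in> L2_cyl \<longleftrightarrow> u \<in> borel_measurable cyl \<and> sqn cyl u < \<infinity>"
proof -
  have "integrable cyl (\<lambda>z. (u z)\<^sup>2) \<longleftrightarrow> sqn cyl u < \<infinity>" if [measurable]: "u \<in> borel_measurable cyl"
    unfolding sqn_def by (subst integrable_iff_bounded) auto
  then show ?thesis by (auto simp: L2_cyl_def)
qed

lemma sqn_cyl:
  fixes u :: "real \<times> real \<Rightarrow> real"
  assumes [measurable]: "u \<in> borel_measurable cyl"
  shows "sqn cyl u = (\<integral>\<^sup>+y. \<integral>\<^sup>+x. ennreal ((u (x, y))\<^sup>2) \<partial>circle \<partial>lborel)"
  unfolding sqn_def by (subst nn_integral_cyl) auto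

lemma L2_cyl_sections:
  assumes "u \<in> L2_cyl"
  shows "AE y in lborel. integrable circle (\<lambda>x. (u (x, y))\<^sup>2)"
proof -
  have [measurable]: "u \<in> borel_measurable cyl" and fin: "sqn cyl u < \<infinity>" using assms by (auto simp: L2_cyl_iff)
  have "AE y in lborel. (\<integral>\<^sup>+x. ennreal ((u (x, y))\<^sup>2) \<partial>circle) \<noteq> \<infinity>"
    using fin unfolding sqn_cyl[OF assms[unfolded L2_cyl_iff, THEN conjunct1]]
    by (intro nn_integral_noteq_infinite) (auto intro!: nn_integral_cyl(2)[of "\<lambda>z. ennreal ((u z)\<^sup>2)", simplified])
  then show ?thesis
  proof eventually_elim
    fix y assume "(\<integral>\<^sup>+x. ennreal ((u (x, y))\<^sup>2) \<partial>circle) \<noteq> \<infinity>"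
    then show "integrable circle (\<lambda>x. (u (x, y))\<^sup>2)"
      using cyl_section_measurable[of u y] by (subst integrable_iff_bounded) (auto simp: less_top)
  qed
qed

lemma ycoef_bessel:
  assumes u: "u \<in> L2_cyl"
  shows "zsum (\<lambda>k. sqn lborel (ycoef u k)) \<le> ennreal (2 * pi) * sqn cyl u"
proof -
  have um [measurable]: "u \<in> borel_measurable cyl" using u by (auto simp: L2_cyl_iff)
  have [measurable]: "(\<lambda>y. \<integral>\<^sup>+x. ennreal ((u (x, y))\<^sup>2) \<partial>circle) \<in> borel_measurable borel"
    by (rule nn_integral_cyl(2)) measurable
  have "zsum (\<lambda>k. sqn lborel (ycoef u k)) = (\<integral>\<^sup>+y. zsum (\<lambda>k. nsq (ycoef u k y)) \<partial>lborel)"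
    unfolding sqn_def by (rule zsum_swap[symmetric]) measurable
  also have "... \<le> (\<integral>\<^sup>+y. ennreal (2 * pi) * (\<integral>\<^sup>+x. ennreal ((u (x, y))\<^sup>2) \<partial>circle) \<partial>lborel)"
  proof (rule nn_integral_mono_AE)
    show "AE y in lborel. zsum (\<lambda>k. nsq (ycoef u k y)) \<le> ennreal (2 * pi) * (\<integral>\<^sup>+x. ennreal ((u (x, y))\<^sup>2) \<partial>circle)"
      using L2_cyl_sections[OF u]
      by eventually_elim (use fcoeff_bessel cyl_section_measurable[OF um] in \<open>simp add: ycoef_def\<close>)
  qed
  also have "... = ennreal (2 * pi) * sqn cyl u"
    by (subst sqn_cyl) (auto simp: nn_integral_cmult)
  finally show ?thesis .
qed

lemma ycoef_L2:
  assumes u: "u \<in> L2_cyl"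
  shows "sqn lborel (ycoef u k) < \<infinity>"
  by (rule finite_of_le_mult[OF order_trans[OF member_le_zsum ycoef_bessel[OF u]]])
     (use u in \<open>simp add: L2_cyl_iff\<close>)

text \<open>The truncation in y makes Fubini legitimate. The theory on the cylinder is thereby
  reduced to coefficients in x at fixed height, followed by the transform on the line of each
  coefficient \<open>ycoef u k\<close>.\<close>

lemma truncated_fourier_Ft:
  assumes u: "u \<in> L2_cyl"
  shows "truncated_fourier R u k \<xi> = of_real (1 / (2 * pi)) * Ft (trunc R (ycoef u k)) \<xi>"
proof -
  interpret pair_sigma_finite circle "lborel :: real measure" by (rule pair_sigma_finite_cyl)
  let ?f = "\<lambda>x y. complex_of_real (indicator {-R..R} y * u (x, y)) * cis (- (real_of_int k * x + \<xi> * y))"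
  have "integrable (circle \<Otimes>\<^sub>M lborel) (case_prod ?f)"
    using integrable_truncated_fourier[OF u, of R k \<xi>] by (simp add: cyl_def case_prod_beta')
  then have "(LINT y|lborel. LINT x|circle. ?f x y) = (LINT z|cyl. case_prod ?f z)"
    unfolding cyl_def by (rule integral_snd)
  moreover have "(LINT x|circle. ?f x y) = trunc R (ycoef u k) y * cis (- (\<xi> * y))" for y
  proof -
    have "(LINT x|circle. ?f x y) = (LINT x|circle. (complex_of_real (u (x, y)) * cis (- (real_of_int k * x))) * (indicator {-R..R} y * cis (- (\<xi> * y))))"
    proof (intro Bochner_Integration.integral_cong refl)
      fix x
      have "cis (- (real_of_int k * x + \<xi> * y)) = cis (- (real_of_int k * x)) * cis (- (\<xi> * y))"
        by (simp add: cis_mult)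
      then show "?f x y = (complex_of_real (u (x, y)) * cis (- (real_of_int k * x))) * (indicator {-R..R} y * cis (- (\<xi> * y)))"
        by (simp add: indicator_def mult_ac)
    qed
    then show ?thesis by (simp add: trunc_def ycoef_def fcoeff_def)
  qed
  ultimately show ?thesis
    unfolding truncated_fourier_def Ft_def by (simp add: case_prod_beta')
qed

lemma truncated_fourier_L2:
  assumes u: "u \<in> L2_cyl" and "U \<in> borel_measurable borel"
  shows "sqn lborel (\<lambda>\<xi>. U \<xi> - truncated_fourier R u k \<xi>) =
    ennreal ((1 / (2 * pi))\<^sup>2) * sqn lborel (\<lambda>\<xi>. of_real (2 * pi) * U \<xi> - Ft (trunc R (ycoef u k)) \<xi>)"
proof -
  have [measurable]: "U \<in> borel_measurable borel" "u \<in> borel_measurable cyl" using assms by (auto simp: L2_cyl_iff)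
  have "sqn lborel (\<lambda>\<xi>. U \<xi> - truncated_fourier R u k \<xi>) =
     sqn lborel (\<lambda>\<xi>. of_real (1 / (2 * pi)) * (of_real (2 * pi) * U \<xi> - Ft (trunc R (ycoef u k)) \<xi>))"
    by (rule sqn_cong) (simp add: truncated_fourier_Ft[OF u] field_simps)
  also have "... = ennreal ((1 / (2 * pi))\<^sup>2) * sqn lborel (\<lambda>\<xi>. of_real (2 * pi) * U \<xi> - Ft (trunc R (ycoef u k)) \<xi>)"
    by (subst sqn_scale) (auto simp: norm_divide norm_mult)
  finally show ?thesis .
qed

abbreviation tf_err where
  "tf_err U u k R \<equiv> sqn lborel (\<lambda>\<xi>. U k \<xi> - truncated_fourier R u k \<xi>)"

lemma has_fourier_sqn:
  "has_fourier u U \<longleftrightarrow> (\<forall>k. U k \<in> borel_measurable borel \<and>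
     ((\<lambda>R. tf_err U u k R) \<longlongrightarrow> 0) at_top)"
  by (simp add: has_fourier_def sqn_def)

lemma has_fourier_iff:
  assumes u: "u \<in> L2_cyl"
  shows "has_fourier u U \<longleftrightarrow> (\<forall>k. U k \<in> borel_measurable borel \<and>
     ((\<lambda>R. sqn lborel (\<lambda>\<xi>. of_real (2 * pi) * U k \<xi> - Ft (trunc R (ycoef u k)) \<xi>)) \<longlongrightarrow> 0) at_top)"
proof -
  have "((\<lambda>R. tf_err U u k R) \<longlongrightarrow> 0) at_top \<longleftrightarrow>
     ((\<lambda>R. sqn lborel (\<lambda>\<xi>. of_real (2 * pi) * U k \<xi> - Ft (trunc R (ycoef u k)) \<xi>)) \<longlongrightarrow> 0) at_top"
    (is "(?f \<longlongrightarrow> 0) _ \<longleftrightarrow> (?g \<longlongrightarrow> 0) _") if U: "U k \<in> borel_measurable borel" for k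
  proof
    have c: "ennreal ((2 * pi)\<^sup>2) * (ennreal ((1 / (2 * pi))\<^sup>2) * x) = x" for x
      by (simp add: mult.assoc[symmetric] ennreal_mult[symmetric] power2_eq_square)
    have "?g = (\<lambda>R. ennreal ((2 * pi)\<^sup>2) * ?f R)"
      by (rule ext) (simp only: truncated_fourier_L2[OF u U] c)
    moreover assume "(?f \<longlongrightarrow> 0) at_top"
    then have "((\<lambda>R. ennreal ((2 * pi)\<^sup>2) * ?f R) \<longlongrightarrow> ennreal ((2 * pi)\<^sup>2) * 0) at_top"
      by (intro ennreal_tendsto_cmult) auto
    ultimately show "(?g \<longlongrightarrow> 0) at_top" by simp
  next
    assume "(?g \<longlongrightarrow> 0) at_top"
    then have "((\<lambda>R. ennreal ((1 / (2 * pi))\<^sup>2) * ?g R) \<longlongrightarrow> ennreal ((1 / (2 * pi))\<^sup>2) * 0) at_top"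
      by (intro ennreal_tendsto_cmult) auto
    then show "(?f \<longlongrightarrow> 0) at_top" by (simp add: truncated_fourier_L2[OF u U])
  qed
  then show ?thesis unfolding has_fourier_sqn by blast
qed

lemma has_fourier_exists:
  assumes u: "u \<in> L2_cyl"
  shows "\<exists>U. has_fourier u U"
proof -
  have [measurable]: "u \<in> borel_measurable cyl" using u by (auto simp: L2_cyl_iff)
  have "\<exists>V. V \<in> borel_measurable borel \<and> ((\<lambda>R. sqn lborel (\<lambda>\<xi>. V \<xi> - Ft (trunc R (ycoef u k)) \<xi>)) \<longlongrightarrow> 0) at_top" for k
    using Ft_trunc_limit[OF _ ycoef_L2[OF u], of k] by (metis ycoef_measurable u L2_cyl_iff)
  then obtain V where V: "\<And>k. V k \<in> borel_measurable borel"
    "\<And>k. ((\<lambda>R. sqn lborel (\<lambda>\<xi>. V k \<xi> - Ft (trunc R (ycoef u k)) \<xi>)) \<longlongrightarrow> 0) at_top" by metis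
  note V(1)[measurable]
  have "has_fourier u (\<lambda>k \<xi>. of_real (1 / (2 * pi)) * V k \<xi>)"
    unfolding has_fourier_iff[OF u] using V(2) by auto
  then show ?thesis by blast
qed

lemma has_fourier_fourier: "u \<in> L2_cyl \<Longrightarrow> has_fourier u (fourier u)"
  unfolding fourier_def by (rule someI_ex[OF has_fourier_exists])

lemma has_fourier_unique:
  assumes u: "u \<in> L2_cyl" and "has_fourier u U" "has_fourier u V"
  shows "AE \<xi> in lborel. U k \<xi> = V k \<xi>"
proof -
  have [measurable]: "U k \<in> borel_measurable borel" "V k \<in> borel_measurable borel"
    using assms by (auto simp: has_fourier_def)
  have [measurable]: "truncated_fourier R u k \<in> borel_measurable borel" for R
    by (rule measurable_truncated_fourier[OF u])
  have "sqn lborel (\<lambda>\<xi>. U k \<xi> - V k \<xi>) \<le> 0"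
  proof (rule tendsto_lowerbound)
    show "((\<lambda>R. 2 * tf_err U u k R + 2 * tf_err V u k R) \<longlongrightarrow> 0) at_top"
    proof -
      have "((\<lambda>R. tf_err U u k R) \<longlongrightarrow> 0) at_top"
        "((\<lambda>R. tf_err V u k R) \<longlongrightarrow> 0) at_top"
        using assms(2,3) by (simp_all add: has_fourier_sqn)
      from tendsto_add[OF ennreal_tendsto_cmult[OF _ this(1), of 2] ennreal_tendsto_cmult[OF _ this(2), of 2]]
      show ?thesis by simp
    qed
    show "\<forall>\<^sub>F R in at_top. sqn lborel (\<lambda>\<xi>. U k \<xi> - V k \<xi>) \<le> 2 * tf_err U u k R + 2 * tf_err V u k R"
    proof (intro always_eventually allI)
      fix R
      have "sqn lborel (\<lambda>\<xi>. U k \<xi> - V k \<xi>) \<le> 2 * tf_err U u k R + 2 * sqn lborel (\<lambda>\<xi>. truncated_fourier R u k \<xi> - V k \<xi>)"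
        by (rule sqn_triangle) measurable
      also have "sqn lborel (\<lambda>\<xi>. truncated_fourier R u k \<xi> - V k \<xi>) = tf_err V u k R"
        by (rule sqn_minus_commute)
      finally show "sqn lborel (\<lambda>\<xi>. U k \<xi> - V k \<xi>) \<le> 2 * tf_err U u k R + 2 * tf_err V u k R" .
    qed
  qed simp
  then have "AE \<xi> in lborel. U k \<xi> - V k \<xi> = 0" by (subst (asm) le_zero_eq, subst (asm) sqn_eq_0_iff) auto
  then show ?thesis by eventually_elim simp
qed

lemma fourier_ae_eq:
  "u \<in> L2_cyl \<Longrightarrow> has_fourier u U \<Longrightarrow> AE \<xi> in lborel. fourier u k \<xi> = U k \<xi>"
  by (rule has_fourier_unique[OF _ has_fourier_fourier])

lemma has_fourier_bound:
  assumes u: "u \<in> L2_cyl" and U: "has_fourier u U"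
  shows "zsum (\<lambda>k. sqn lborel (U k)) \<le> 2 * sqn cyl u"
proof -
  have [measurable]: "u \<in> borel_measurable cyl" using u by (auto simp: L2_cyl_iff)
  have Um [measurable]: "U k \<in> borel_measurable borel" for k using U by (auto simp: has_fourier_def)
  have "sqn lborel (U k) \<le> ennreal (1 / pi) * sqn lborel (ycoef u k)" for k
  proof -
    have "sqn lborel (\<lambda>\<xi>. of_real (2 * pi) * U k \<xi>) \<le> ennreal (4 * pi) * sqn lborel (ycoef u k)"
      by (rule Ft_limit_bound[OF _ _ ycoef_L2[OF u]]) (use U has_fourier_iff[OF u] in auto)
    then have le: "ennreal ((2 * pi)\<^sup>2) * sqn lborel (U k) \<le> ennreal (4 * pi) * sqn lborel (ycoef u k)"
      by (subst (asm) sqn_scale) (auto simp: norm_mult)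
    have "sqn lborel (U k) = ennreal (1 / (2 * pi)\<^sup>2) * (ennreal ((2 * pi)\<^sup>2) * sqn lborel (U k))"
      by (simp add: mult.assoc[symmetric] ennreal_mult[symmetric])
    also have "... \<le> ennreal (1 / (2 * pi)\<^sup>2) * (ennreal (4 * pi) * sqn lborel (ycoef u k))"
      by (intro mult_left_mono le) simp
    also have "... = ennreal (1 / pi) * sqn lborel (ycoef u k)"
      by (simp add: mult.assoc[symmetric] ennreal_mult[symmetric] power2_eq_square)
    finally show ?thesis .
  qed
  then have "zsum (\<lambda>k. sqn lborel (U k)) \<le> zsum (\<lambda>k. ennreal (1 / pi) * sqn lborel (ycoef u k))"
    by (intro nn_integral_mono)
  also have "... \<le> ennreal (1 / pi) * (ennreal (2 * pi) * sqn cyl u)"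
    unfolding zsum_cmult by (intro mult_left_mono ycoef_bessel u) simp
  also have "... = 2 * sqn cyl u"
    by (simp add: mult.assoc[symmetric] ennreal_mult[symmetric] ennreal_numeral[symmetric] del: ennreal_numeral)
  finally show ?thesis .
qed

text \<open>One direction is injectivity of the limit transform, the other the bound by the norm of
  the coefficient.\<close>

lemma has_fourier_zero_mode:
  assumes u: "u \<in> L2_cyl" and U: "has_fourier u U"
  shows "(AE \<xi> in lborel. U k \<xi> = 0) \<longleftrightarrow> (AE y in lborel. ycoef u k y = 0)"
proof -
  have [measurable]: "u \<in> borel_measurable cyl" using u by (auto simp: L2_cyl_iff)
  have Um [measurable]: "U k \<in> borel_measurable borel" using U by (auto simp: has_fourier_def)
  have lim: "((\<lambda>R. sqn lborel (\<lambda>\<xi>. of_real (2 * pi) * U k \<xi> - Ft (trunc R (ycoef u k)) \<xi>)) \<longlongrightarrow> 0) at_top"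
    using U has_fourier_iff[OF u] by auto
  show ?thesis
  proof
    assume z: "AE \<xi> in lborel. U k \<xi> = 0"
    have "sqn lborel (\<lambda>\<xi>. of_real (2 * pi) * U k \<xi> - Ft (trunc R (ycoef u k)) \<xi>) = sqn lborel (\<lambda>\<xi>. - Ft (trunc R (ycoef u k)) \<xi>)" for R
      by (rule sqn_cong_AE) (use z in eventually_elim, simp)
    then show "AE y in lborel. ycoef u k y = 0"
      by (intro Ft_limit_zero[OF _ ycoef_L2[OF u]]) (use lim in \<open>simp_all add: sqn_minus\<close>)
  next
    assume z: "AE y in lborel. ycoef u k y = 0"
    have "sqn lborel (\<lambda>\<xi>. of_real (2 * pi) * U k \<xi>) \<le> ennreal (4 * pi) * sqn lborel (ycoef u k)"
      by (rule Ft_limit_bound[OF _ _ ycoef_L2[OF u] lim]) auto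
    also have "sqn lborel (ycoef u k) = 0" using z by (subst sqn_eq_0_iff) auto
    finally have "sqn lborel (\<lambda>\<xi>. of_real (2 * pi) * U k \<xi>) = 0" by simp
    then show "AE \<xi> in lborel. U k \<xi> = 0" by (subst (asm) sqn_eq_0_iff) auto
  qed
qed

lemma zero_x_average_iff:
  assumes u: "u \<in> L2_cyl" and U: "has_fourier u U"
  shows "zero_x_average u \<longleftrightarrow> (AE \<xi> in lborel. U 0 \<xi> = 0)"
proof -
  have "ycoef u 0 y = complex_of_real (LINT x|circle. u (x, y))" for y
    by (simp add: ycoef_def fcoeff_def integral_complex_of_real)
  then show ?thesis unfolding has_fourier_zero_mode[OF u U] zero_x_average_def by simp
qed

text \<open>There are only countably many k, so at almost every height all coefficients vanish
  together, and uniqueness on the circle applies to the slice.\<close>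

lemma has_fourier_injective:
  assumes u: "u \<in> L2_cyl" and U: "has_fourier u U" and z: "\<And>k. AE \<xi> in lborel. U k \<xi> = 0"
  shows "AE z in cyl. u z = 0"
proof -
  have um [measurable]: "u \<in> borel_measurable cyl" using u by (auto simp: L2_cyl_iff)
  have "AE y in lborel. ycoef u k y = 0" for k
    using has_fourier_zero_mode[OF u U] z by blast
  then have "AE y in lborel. \<forall>k. ycoef u k y = 0" by (simp add: AE_all_countable)
  with L2_cyl_sections[OF u] have "AE y in lborel. (\<integral>\<^sup>+x. ennreal ((u (x, y))\<^sup>2) \<partial>circle) = 0"
  proof eventually_elim
    fix y assume a: "integrable circle (\<lambda>x. (u (x, y))\<^sup>2)" "\<forall>k. ycoef u k y = 0"
    have "integrable circle (\<lambda>x. u (x, y))"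
      by (rule integrable_circle_of_sq[OF cyl_section_measurable[OF um] a(1)])
    then have "AE x in circle. u (x, y) = 0"
      by (rule zero_fcoeff_imp_ae_zero) (use a(2) in \<open>simp add: ycoef_def\<close>)
    then show "(\<integral>\<^sup>+x. ennreal ((u (x, y))\<^sup>2) \<partial>circle) = 0"
      using cyl_section_measurable[OF um] by (subst nn_integral_0_iff_AE) auto
  qed
  then have "sqn cyl u = 0"
    unfolding sqn_cyl[OF um] using nn_integral_cyl(2)[of "\<lambda>z. ennreal ((u z)\<^sup>2)"]
    by (subst nn_integral_0_iff_AE) auto
  then show ?thesis by (subst (asm) sqn_eq_0_iff) auto
qed

lemma has_fourier_cong_AE:
  assumes U: "has_fourier u U" and "\<And>k. V k \<in> borel_measurable borel" "\<And>k. AE \<xi> in lborel. U k \<xi> = V k \<xi>"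
  shows "has_fourier u V"
proof -
  have "tf_err U u k R = tf_err V u k R" for k R
    by (rule sqn_cong_AE) (use assms(3)[of k] in \<open>eventually_elim, simp\<close>)
  then show ?thesis using assms unfolding has_fourier_sqn by simp
qed

lemma truncated_fourier_diff:
  assumes "u \<in> L2_cyl" "v \<in> L2_cyl"
  shows "truncated_fourier R (\<lambda>z. u z - v z) k \<xi> = truncated_fourier R u k \<xi> - truncated_fourier R v k \<xi>"
  unfolding truncated_fourier_def right_diff_distrib[symmetric]
  by (subst Bochner_Integration.integral_diff[symmetric, OF integrable_truncated_fourier[OF assms(1)] integrable_truncated_fourier[OF assms(2)]])
     (simp add: algebra_simps)

lemma L2_cyl_diff:
  assumes "u \<in> L2_cyl" "v \<in> L2_cyl"
  shows "(\<lambda>z. u z - v z) \<in> L2_cyl"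
proof -
  have "sqn cyl (\<lambda>z. u z - v z) \<le> 2 * sqn cyl u + 2 * sqn cyl v"
    by (rule sqn_diff) (use assms in \<open>auto simp: L2_cyl_iff\<close>)
  also have "... < \<infinity>" using assms by (auto simp: L2_cyl_iff ennreal_mult_less_top)
  finally show ?thesis using assms by (auto simp: L2_cyl_iff)
qed

lemma has_fourier_diff:
  assumes u: "u \<in> L2_cyl" and v: "v \<in> L2_cyl" and U: "has_fourier u U" and V: "has_fourier v V"
  shows "has_fourier (\<lambda>z. u z - v z) (\<lambda>k \<xi>. U k \<xi> - V k \<xi>)"
  unfolding has_fourier_sqn
proof (intro allI conjI)
  fix k
  have [measurable]: "U k \<in> borel_measurable borel" "V k \<in> borel_measurable borel"
    using assms by (auto simp: has_fourier_def)
  show "(\<lambda>\<xi>. U k \<xi> - V k \<xi>) \<in> borel_measurable borel" by measurable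
  have [measurable]: "truncated_fourier R u k \<in> borel_measurable borel" "truncated_fourier R v k \<in> borel_measurable borel" for R
    using measurable_truncated_fourier u v by auto
  have lim: "((\<lambda>R. 2 * tf_err U u k R + 2 * tf_err V v k R) \<longlongrightarrow> 0) at_top"
  proof -
    have "((\<lambda>R. tf_err U u k R) \<longlongrightarrow> 0) at_top"
      "((\<lambda>R. tf_err V v k R) \<longlongrightarrow> 0) at_top"
      using U V by (simp_all add: has_fourier_sqn)
    from tendsto_add[OF ennreal_tendsto_cmult[OF _ this(1), of 2] ennreal_tendsto_cmult[OF _ this(2), of 2]]
    show ?thesis by simp
  qed
  show "((\<lambda>R. sqn lborel (\<lambda>\<xi>. U k \<xi> - V k \<xi> - truncated_fourier R (\<lambda>z. u z - v z) k \<xi>)) \<longlongrightarrow> 0) at_top"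
  proof (rule tendsto_sandwich[OF _ _ tendsto_const lim])
    show "\<forall>\<^sub>F R in at_top. sqn lborel (\<lambda>\<xi>. U k \<xi> - V k \<xi> - truncated_fourier R (\<lambda>z. u z - v z) k \<xi>)
      \<le> 2 * tf_err U u k R + 2 * tf_err V v k R"
    proof (intro always_eventually allI)
      fix R
      have "sqn lborel (\<lambda>\<xi>. U k \<xi> - V k \<xi> - truncated_fourier R (\<lambda>z. u z - v z) k \<xi>) =
        sqn lborel (\<lambda>\<xi>. (U k \<xi> - truncated_fourier R u k \<xi>) - (V k \<xi> - truncated_fourier R v k \<xi>))"
        by (rule sqn_cong) (simp add: truncated_fourier_diff[OF u v])
      also have "... \<le> 2 * tf_err U u k R + 2 * tf_err V v k R"
        by (rule sqn_diff) measurable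
      finally show "sqn lborel (\<lambda>\<xi>. U k \<xi> - V k \<xi> - truncated_fourier R (\<lambda>z. u z - v z) k \<xi>) \<le> \<dots>" .
    qed
  qed auto
qed

text \<open>Expresses that \<open>u\<close> is real valued. Together with uniqueness it yields the
  conjugate symmetry of the transform.\<close>

lemma has_fourier_reflect:
  assumes u: "u \<in> L2_cyl" and U: "has_fourier u U"
  shows "has_fourier u (\<lambda>k \<xi>. cnj (U (- k) (- \<xi>)))"
  unfolding has_fourier_sqn
proof (intro allI conjI)
  fix k
  have [measurable]: "U (- k) \<in> borel_measurable borel" using U by (auto simp: has_fourier_def)
  show "(\<lambda>\<xi>. cnj (U (- k) (- \<xi>))) \<in> borel_measurable borel" by measurable
  have [measurable]: "truncated_fourier R u (- k) \<in> borel_measurable borel" for R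
    using measurable_truncated_fourier u by auto
  have "truncated_fourier R u k \<xi> = cnj (truncated_fourier R u (- k) (- \<xi>))" for R \<xi>
    unfolding truncated_fourier_def complex_cnj_mult Bochner_Integration.integral_cnj[symmetric]
    by (simp add: cis_cnj algebra_simps)
  then have "sqn lborel (\<lambda>\<xi>. cnj (U (- k) (- \<xi>)) - truncated_fourier R u k \<xi>) =
      sqn lborel (\<lambda>\<xi>. U (- k) \<xi> - truncated_fourier R u (- k) \<xi>)" for R
    unfolding sqn_def
    using nn_integral_real_affine[of "\<lambda>\<xi>. nsq (U (- k) \<xi> - truncated_fourier R u (- k) \<xi>)" "-1" 0]
    by (simp flip: complex_cnj_diff)
  then show "((\<lambda>R. sqn lborel (\<lambda>\<xi>. cnj (U (- k) (- \<xi>)) - truncated_fourier R u k \<xi>)) \<longlongrightarrow> 0) at_top"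
    using U by (simp add: has_fourier_sqn)
qed

lemma zsum_tail_tendsto:
  assumes "zsum s < \<infinity>"
  shows "(\<lambda>n. zsum (\<lambda>k. s k * indicator (- {- int n..int n}) k)) \<longlonglongrightarrow> 0"
proof -
  have "(\<lambda>n. zsum (\<lambda>k. s k * indicator (- {- int n..int n}) k)) \<longlonglongrightarrow> zsum (\<lambda>k. 0)"
  proof (rule nn_integral_dominated_convergence[where w=s])
    show "AE k in count_space UNIV. s k * indicator (- {- int n..int n}) k \<le> s k" for n
      by (intro AE_I2) (auto simp: indicator_def)
    show "AE k in count_space UNIV. (\<lambda>n. s k * indicator (- {- int n..int n}) k) \<longlonglongrightarrow> 0"
    proof (rule AE_I2)
      fix k :: int
      have "\<forall>\<^sub>F n in sequentially. s k * indicator (- {- int n..int n}) k = 0"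
        unfolding eventually_sequentially by (intro exI[of _ "nat \<bar>k\<bar>"]) (auto simp: indicator_def)
      then show "(\<lambda>n. s k * indicator (- {- int n..int n}) k) \<longlonglongrightarrow> 0" by (rule tendsto_eventually)
    qed
  qed (use assms in auto)
  then show ?thesis by simp
qed

text \<open>Integrability of every mode makes the inverse transform in y an honest integral
  \<open>b k\<close>. Partial sums over symmetric ranges of k are real by the symmetry and Cauchy in
  L2 by square summability; their limit has the prescribed modes and a norm controlled by
  them.\<close>

lemma fourier_inverse:
  assumes Ui: "\<And>k. integrable lborel (U k)" and S: "zsum (\<lambda>k. sqn lborel (U k)) < \<infinity>"
    and sym: "\<And>k \<xi>. U (- k) (- \<xi>) = cnj (U k \<xi>)"
  obtains v where "v \<in> L2_cyl" "has_fourier v U" "sqn cyl v \<le> 2 * zsum (\<lambda>k. sqn lborel (U k))"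
proof -
  have Um [measurable]: "U k \<in> borel_measurable borel" for k using Ui[of k] by auto
  define s where "s k = sqn lborel (U k)" for k
  have sfin: "s k < \<infinity>" for k using member_le_zsum[of s k] S by (auto simp: s_def intro: le_less_trans)
  define b where "b k y = Ft (U k) (- y)" for k y
  have bm [measurable]: "b k \<in> borel_measurable borel" for k unfolding b_def by measurable
  have b_alt: "b k = Ft (\<lambda>y. U k (- y))" for k unfolding b_def by (simp add: Ft_reflect fun_eq_iff)
  have Ui': "integrable lborel (\<lambda>y. U k (- y))" for k
    using lborel_integrable_real_affine[OF Ui, of "-1" k 0] by simp
  have "sqn lborel (\<lambda>y. U k (- y)) = s k" for k
    unfolding sqn_def s_def using nn_integral_real_affine[of "\<lambda>y. nsq (U k y)" "-1" 0] by simp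
  then have bs: "sqn lborel (b k) \<le> ennreal (2 * pi) * s k" for k
    using sqn_Ft_le[OF Ui', of k] unfolding b_alt by simp
  have bsym: "b (- k) y = cnj (b k y)" for k y
  proof -
    have "b (- k) y = (LINT \<xi>|lborel. U (- k) (- \<xi>) * cis (- (- y * (- \<xi>))))"
      unfolding b_def Ft_def by (subst lborel_integral_real_affine[where c="-1" and t=0]) auto
    also have "... = cnj (b k y)"
      unfolding b_def Ft_def Bochner_Integration.integral_cnj[symmetric] sym
      by (intro Bochner_Integration.integral_cong) (auto simp: cis_cnj)
    finally show ?thesis .
  qed
  define P where "P F z = (\<Sum>k\<in>F. (b k (snd z) / (2 * pi)) * cis (real_of_int k * fst z))" for F z
  note [measurable] = measurable_cyl
  have Pm [measurable]: "P F \<in> borel_measurable cyl" for F unfolding P_def by measurable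
  have sqP: "sqn cyl (P F) \<le> sum s F" if F: "finite F" for F
  proof -
    have "sqn cyl (P F) = (\<integral>\<^sup>+y. \<integral>\<^sup>+x. nsq (P F (x, y)) \<partial>circle \<partial>lborel)"
      unfolding sqn_def by (subst nn_integral_cyl) auto
    also have "... = (\<integral>\<^sup>+y. (\<Sum>k\<in>F. ennreal (1 / (2 * pi)) * nsq (b k y)) \<partial>lborel)"
    proof (rule nn_integral_cong)
      fix y
      have "(\<integral>\<^sup>+x. nsq (P F (x, y)) \<partial>circle) = ennreal (2 * pi * (\<Sum>k\<in>F. (cmod (b k y / (2 * pi)))\<^sup>2))"
        using trig_sum_norm[OF F, of "\<lambda>k. b k y / (2 * pi)"] unfolding P_def
        by (subst nn_integral_eq_integral) auto
      also have "2 * pi * (\<Sum>k\<in>F. (cmod (b k y / (2 * pi)))\<^sup>2) = (\<Sum>k\<in>F. 1 / (2 * pi) * (cmod (b k y))\<^sup>2)"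
        unfolding sum_distrib_left by (intro sum.cong refl) (simp add: norm_divide power_divide power2_eq_square)
      finally show "(\<integral>\<^sup>+x. nsq (P F (x, y)) \<partial>circle) = (\<Sum>k\<in>F. ennreal (1 / (2 * pi)) * nsq (b k y))"
        by (simp add: sum_ennreal[symmetric] ennreal_mult[symmetric] del: sum_ennreal)
    qed
    also have "... = (\<Sum>k\<in>F. ennreal (1 / (2 * pi)) * sqn lborel (b k))"
      unfolding sqn_def by (simp add: nn_integral_sum nn_integral_cmult)
    also have "... \<le> (\<Sum>k\<in>F. ennreal (1 / (2 * pi)) * (ennreal (2 * pi) * s k))"
      by (intro sum_mono mult_left_mono bs) auto
    also have "... = sum s F"
      by (simp add: mult.assoc[symmetric] ennreal_mult[symmetric])
    finally show ?thesis .
  qed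
  define I where "I n = {- int n..int n}" for n
  define v where "v n z = Re (P (I n) z)" for n z
  have vm [measurable]: "v n \<in> borel_measurable cyl" for n unfolding v_def by measurable
  \<comment> \<open>Pairing k with -k shows that the partial sum is already real, so taking the real
    part loses nothing.\<close>
  have vP: "complex_of_real (v n z) = P (I n) z" for n z
  proof -
    have "cnj (P (I n) z) = (\<Sum>k\<in>I n. (b (- k) (snd z) / (2 * pi)) * cis (real_of_int (- k) * fst z))"
      unfolding P_def by (simp add: bsym cis_cnj)
    also have "... = P (I n) z"
      unfolding P_def by (rule sum.reindex_bij_witness[of _ uminus uminus]) (auto simp: I_def)
    finally show ?thesis by (simp add: v_def complex_eq_iff)
  qed
  have sqv: "sqn cyl (v n) \<le> zsum s" for n
  proof -
    have "sqn cyl (v n) \<le> sqn cyl (P (I n))" by (rule sqn_mono) (simp add: v_def abs_Re_le_cmod)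
    also have "... \<le> sum s (I n)" by (rule sqP) (simp add: I_def)
    also have "... \<le> zsum s" by (rule finite_sum_le_zsum) (simp add: I_def)
    finally show ?thesis .
  qed
  have vL2: "v n \<in> L2_cyl" for n
    unfolding L2_cyl_iff using le_less_trans[OF sqv[of n]] S by (auto simp: s_def)
  have vdiff: "sqn cyl (\<lambda>z. v m z - v n z) \<le> zsum (\<lambda>k. s k * indicator (- I n) k)" if "n \<le> m" for m n
  proof -
    have "P (I m) z - P (I n) z = P (I m - I n) z" for z
      unfolding P_def using that by (subst sum_diff) (auto simp: I_def)
    then have "sqn cyl (\<lambda>z. v m z - v n z) \<le> sqn cyl (P (I m - I n))"
      by (intro sqn_mono) (simp add: v_def minus_complex.sel[symmetric] abs_Re_le_cmod del: minus_complex.sel)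
    also have "... \<le> sum s (I m - I n)" by (rule sqP) (simp add: I_def)
    also have "... = sum (\<lambda>k. s k * indicator (- I n) k) (I m - I n)" by (intro sum.cong) auto
    also have "... \<le> zsum (\<lambda>k. s k * indicator (- I n) k)" by (rule finite_sum_le_zsum) (simp add: I_def)
    finally show ?thesis .
  qed
  define d where "d n = zsum (\<lambda>k. s k * indicator (- I n) k)" for n
  have d0: "d \<longlonglongrightarrow> 0" unfolding d_def I_def by (rule zsum_tail_tendsto) (use S in \<open>simp add: s_def\<close>)
  obtain w where w [measurable]: "w \<in> borel_measurable cyl" and wlim: "(\<lambda>n. sqn cyl (\<lambda>z. v n z - w z)) \<longlonglongrightarrow> 0"
    unfolding sqn_def
  proof (rule L2_complete[of v cyl])
    fix e :: real assume e: "0 < e"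
    have "\<forall>\<^sub>F n in sequentially. d n < ennreal e" using d0 e by (intro order_tendstoD(2)) auto
    then obtain N where N: "\<And>n. n \<ge> N \<Longrightarrow> d n < ennreal e" by (auto simp: eventually_sequentially)
    show "\<exists>N. \<forall>m\<ge>N. \<forall>n\<ge>N. (\<integral>\<^sup>+z. nsq (v m z - v n z) \<partial>cyl) \<le> ennreal e"
      unfolding sqn_def[symmetric]
    proof (intro exI[of _ N] allI impI)
      fix m n assume mn: "N \<le> m" "N \<le> n"
      show "sqn cyl (\<lambda>z. v m z - v n z) \<le> ennreal e"
      proof (cases "n \<le> m")
        case True
        then show ?thesis using vdiff[OF True] N[OF mn(2)] unfolding d_def by order
      next
        case False
        then have "m \<le> n" by simp
        then have "sqn cyl (\<lambda>z. v n z - v m z) \<le> ennreal e" using vdiff[of m n, OF \<open>m \<le> n\<close>] N[OF mn(1)] unfolding d_def by order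
        then show ?thesis by (subst sqn_minus_commute)
      qed
    qed
  qed measurable
  have wb: "sqn cyl w \<le> 2 * zsum s"
  proof (rule tendsto_lowerbound)
    show "(\<lambda>n. 2 * sqn cyl (\<lambda>z. v n z - w z) + 2 * zsum s) \<longlonglongrightarrow> 2 * zsum s"
      using tendsto_add[OF ennreal_tendsto_cmult[OF _ wlim, of 2] tendsto_const[of "2 * zsum s"]] by simp
    show "\<forall>\<^sub>F n in sequentially. sqn cyl w \<le> 2 * sqn cyl (\<lambda>z. v n z - w z) + 2 * zsum s"
    proof (intro always_eventually allI)
      fix n
      have "sqn cyl w \<le> 2 * sqn cyl (\<lambda>z. w z - v n z) + 2 * sqn cyl (v n)" by (rule sqn_le_of_diff) measurable
      also have "... \<le> 2 * sqn cyl (\<lambda>z. v n z - w z) + 2 * zsum s"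
        by (subst sqn_minus_commute) (intro add_left_mono mult_left_mono sqv, simp)
      finally show "sqn cyl w \<le> 2 * sqn cyl (\<lambda>z. v n z - w z) + 2 * zsum s" .
    qed
  qed simp
  have wL2: "w \<in> L2_cyl"
    unfolding L2_cyl_iff using le_less_trans[OF wb] S w by (auto simp: s_def ennreal_mult_less_top)
  have yv: "ycoef (v n) k y = b k y" if "k \<in> I n" for n k y
  proof -
    have ci: "integrable circle (\<lambda>x. a * cis (real_of_int l * x))" for a l
      using integrable_trig_sum[of "\<lambda>_. a" "{l}"] by simp
    have "ycoef (v n) k y = (LINT x|circle. (\<Sum>l\<in>I n. (b l y / (2 * pi)) * cis (real_of_int (l - k) * x)))"
      unfolding ycoef_def fcoeff_def vP P_def
    proof (intro Bochner_Integration.integral_cong refl)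
      fix x
      have ce: "cis (real_of_int (l - k) * x) = cis (real_of_int l * x) * cis (- (real_of_int k * x))" for l
        by (simp add: cis_mult algebra_simps)
      then show "(\<Sum>l\<in>I n. b l (snd (x, y)) / (2 * pi) * cis (real_of_int l * fst (x, y))) * cis (- (real_of_int k * x)) =
          (\<Sum>l\<in>I n. (b l y / (2 * pi)) * cis (real_of_int (l - k) * x))"
        unfolding sum_distrib_right by (intro sum.cong refl) (simp only: ce fst_conv snd_conv mult.assoc)
    qed
    also have "... = (\<Sum>l\<in>I n. (b l y / (2 * pi)) * (LINT x|circle. cis (real_of_int (l - k) * x)))"
      by (simp add: Bochner_Integration.integral_sum ci del: of_int_diff)
    also have "... = (\<Sum>l\<in>I n. if l = k then b l y else 0)"
      unfolding integral_cis_circle by (intro sum.cong refl) simp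
    also have "... = b k y" using that by (simp add: sum.delta I_def)
    finally show ?thesis .
  qed
  \<comment> \<open>By Bessel, \<open>ycoef\<close> is continuous from L2 of the cylinder to L2 of
    the line, and the k-th coefficient of \<open>v n\<close> equals \<open>b k\<close> as soon as n
    is at least the modulus of k.\<close>
  have yw: "AE y in lborel. ycoef w k y = b k y" for k
  proof -
    have le: "sqn lborel (\<lambda>y. b k y - ycoef w k y) \<le> ennreal (2 * pi) * sqn cyl (\<lambda>z. v n z - w z)" if n: "k \<in> I n" for n
    proof -
      have "AE y in lborel. b k y - ycoef w k y = ycoef (\<lambda>z. v n z - w z) k y"
        using L2_cyl_sections[OF wL2] L2_cyl_sections[OF vL2[of n]]
      proof eventually_elim
        fix y assume a: "integrable circle (\<lambda>x. (w (x, y))\<^sup>2)" "integrable circle (\<lambda>x. (v n (x, y))\<^sup>2)"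
        have "integrable circle (\<lambda>x. w (x, y))" "integrable circle (\<lambda>x. v n (x, y))"
          using a by (auto intro!: integrable_circle_of_sq cyl_section_measurable)
        then show "b k y - ycoef w k y = ycoef (\<lambda>z. v n z - w z) k y"
          unfolding yv[OF n, symmetric] ycoef_def fcoeff_def
          by (subst Bochner_Integration.integral_diff[symmetric]) (auto intro!: integrable_fcoeff simp: left_diff_distrib)
      qed
      then have "sqn lborel (\<lambda>y. b k y - ycoef w k y) = sqn lborel (ycoef (\<lambda>z. v n z - w z) k)" by (rule sqn_cong_AE)
      also have "... \<le> ennreal (2 * pi) * sqn cyl (\<lambda>z. v n z - w z)"
        by (rule order_trans[OF member_le_zsum[of "\<lambda>k. sqn lborel (ycoef (\<lambda>z. v n z - w z) k)"] ycoef_bessel[OF L2_cyl_diff[OF vL2 wL2]]])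
      finally show ?thesis .
    qed
    have "sqn lborel (\<lambda>y. b k y - ycoef w k y) \<le> 0"
    proof (rule tendsto_lowerbound)
      show "(\<lambda>n. ennreal (2 * pi) * sqn cyl (\<lambda>z. v n z - w z)) \<longlonglongrightarrow> 0"
        using ennreal_tendsto_cmult[OF _ wlim, of "ennreal (2 * pi)"] by simp
      show "\<forall>\<^sub>F n in sequentially. sqn lborel (\<lambda>y. b k y - ycoef w k y) \<le> ennreal (2 * pi) * sqn cyl (\<lambda>z. v n z - w z)"
        unfolding eventually_sequentially by (intro exI[of _ "nat \<bar>k\<bar>"]) (auto intro!: le simp: I_def)
    qed simp
    then have "AE y in lborel. b k y - ycoef w k y = 0"
      by (subst (asm) le_zero_eq, subst (asm) sqn_eq_0_iff) auto
    then show ?thesis by eventually_elim simp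
  qed
  have "has_fourier w U"
    unfolding has_fourier_iff[OF wL2]
  proof (intro allI conjI Um)
    fix k
    have "Ft (trunc R (ycoef w k)) \<xi> = Ft (trunc R (b k)) \<xi>" for R \<xi>
      unfolding Ft_def using yw[of k]
      by (intro integral_cong_AE) (auto simp: trunc_def elim!: eventually_mono)
    then show "((\<lambda>R. sqn lborel (\<lambda>\<xi>. complex_of_real (2 * pi) * U k \<xi> - Ft (trunc R (ycoef w k)) \<xi>)) \<longlongrightarrow> 0) at_top"
      using Ft_inversion[OF Ui[of k]] sfin[of k] by (simp add: s_def b_def[abs_def])
  qed
  then show ?thesis using that wL2 wb unfolding s_def by blast
qed

text \<open>Replaces the second half of Plancherel: a function with the modes U - V and a controlled
  norm is built by \<open>fourier_inverse\<close> and identified with u - v by uniqueness.\<close>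

lemma L2_dist_le_fourier:
  assumes u: "u \<in> L2_cyl" "has_fourier u U" and v: "v \<in> L2_cyl" "has_fourier v V"
    and i: "\<And>k. integrable lborel (\<lambda>\<xi>. U k \<xi> - V k \<xi>)"
    and S: "zsum (\<lambda>k. sqn lborel (\<lambda>\<xi>. U k \<xi> - V k \<xi>)) < \<infinity>"
    and sym: "\<And>k \<xi>. U (- k) (- \<xi>) = cnj (U k \<xi>)" "\<And>k \<xi>. V (- k) (- \<xi>) = cnj (V k \<xi>)"
  shows "L2_dist_sq u v \<le> 2 * zsum (\<lambda>k. sqn lborel (\<lambda>\<xi>. U k \<xi> - V k \<xi>))"
proof -
  obtain w where w: "w \<in> L2_cyl" "has_fourier w (\<lambda>k \<xi>. U k \<xi> - V k \<xi>)"
    and wb: "sqn cyl w \<le> 2 * zsum (\<lambda>k. sqn lborel (\<lambda>\<xi>. U k \<xi> - V k \<xi>))"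
    using fourier_inverse[of "\<lambda>k \<xi>. U k \<xi> - V k \<xi>", OF i S] sym by auto
  have uv: "(\<lambda>z. u z - v z) \<in> L2_cyl" "has_fourier (\<lambda>z. u z - v z) (\<lambda>k \<xi>. U k \<xi> - V k \<xi>)"
    using u v by (auto intro: L2_cyl_diff has_fourier_diff)
  have "AE z in cyl. (u z - v z) - w z = 0"
    by (rule has_fourier_injective[OF L2_cyl_diff[OF uv(1) w(1)] has_fourier_diff[OF uv(1) w(1) uv(2) w(2)]]) simp
  then have "sqn cyl (\<lambda>z. u z - v z) = sqn cyl w" by (intro sqn_cong_AE) (auto elim!: eventually_mono)
  then show ?thesis using wb by (simp add: L2_dist_sq_def sqn_def)
qed

section \<open>The equations for a fixed frequency\<close>

lemma deriv_compare:
  fixes h g :: "real \<Rightarrow> real"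
  assumes ab: "0 \<le> a" "a \<le> b"
    and h: "\<And>t. t \<in> {a..b} \<Longrightarrow> (h has_real_derivative h' t) (at t within {0..})"
    and g: "\<And>t. t \<in> {a..b} \<Longrightarrow> (g has_real_derivative g' t) (at t within {0..})"
    and le: "\<And>t. t \<in> {a..b} \<Longrightarrow> h' t \<le> g' t"
  shows "h b - h a \<le> g b - g a"
proof -
  have "(\<lambda>t. g t - h t) a \<le> (\<lambda>t. g t - h t) b"
  proof (rule DERIV_nonneg_imp_increasing_open[OF ab(2)])
    fix x assume x: "a < x" "x < b"
    then have "at x within {0..} = at x" using ab(1) by (intro at_within_interior) auto
    then have "DERIV (\<lambda>t. g t - h t) x :> g' x - h' x"
      using DERIV_diff[OF g[of x] h[of x]] x by simp
    then show "\<exists>y. DERIV (\<lambda>t. g t - h t) x :> y \<and> 0 \<le> y" using le[of x] x by force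
  next
    show "continuous_on {a..b} (\<lambda>t. g t - h t)"
      unfolding continuous_on_eq_continuous_within
    proof
      fix x assume x: "x \<in> {a..b}"
      then have "continuous (at x within {0..}) (\<lambda>t. g t - h t)"
        by (intro DERIV_continuous[OF DERIV_diff[OF g h]]) auto
      then show "continuous (at x within {a..b}) (\<lambda>t. g t - h t)"
        by (rule continuous_within_subset) (use ab in auto)
    qed
  qed
  then show ?thesis by simp
qed

lemma deriv_compare_norm:
  fixes f :: "real \<Rightarrow> complex" and g :: "real \<Rightarrow> real"
  assumes ab: "0 \<le> a" "a \<le> b"
    and f: "\<And>t. t \<in> {a..b} \<Longrightarrow> (f has_vector_derivative f' t) (at t within {0..})"
    and g: "\<And>t. t \<in> {a..b} \<Longrightarrow> (g has_real_derivative g' t) (at t within {0..})"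
    and le: "\<And>t. t \<in> {a..b} \<Longrightarrow> cmod (f' t) \<le> g' t"
  shows "cmod (f b - f a) \<le> g b - g a"
proof (cases "a = b")
  case False
  then have "a < b" using ab by simp
  then show ?thesis
  proof (rule differentiable_bound_general)
    have "continuous (at x within {a..b}) f" if "x \<in> {a..b}" for x
      by (rule continuous_within_subset[OF has_vector_derivative_continuous[OF f]]) (use ab that in auto)
    then show "continuous_on {a..b} f" by (simp add: continuous_on_eq_continuous_within)
    have "continuous (at x within {a..b}) g" if "x \<in> {a..b}" for x
      by (rule continuous_within_subset[OF DERIV_continuous[OF g]]) (use ab that in auto)
    then show "continuous_on {a..b} g" by (simp add: continuous_on_eq_continuous_within)
    fix x assume x: "a < x" "x < b"
    then have *: "at x within {0..} = at x" using ab(1) by (intro at_within_interior) auto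
    show "(f has_vector_derivative f' x) (at x)" using f[of x] x * by simp
    show "(g has_vector_derivative g' x) (at x)" using g[of x] x * by (simp add: has_real_derivative_iff_has_vector_derivative)
    show "cmod (f' x) \<le> g' x" using le[of x] x by simp
  qed
qed simp

text \<open>Division by twice the square root of E turns a quadratic energy inequality into a linear
  one. Adding e^2 under the root avoids the zeros of E, and e then tends to 0.\<close>

lemma deriv_compare_sqrt:
  fixes E g :: "real \<Rightarrow> real"
  assumes ab: "0 \<le> a" "a \<le> b" and E0: "\<And>t. 0 \<le> E t"
    and E: "\<And>t. t \<in> {a..b} \<Longrightarrow> (E has_real_derivative E' t) (at t within {0..})"
    and g: "\<And>t. t \<in> {a..b} \<Longrightarrow> (g has_real_derivative g' t) (at t within {0..})"
    and le: "\<And>t. t \<in> {a..b} \<Longrightarrow> E' t \<le> 2 * sqrt (E t) * g' t" and g0: "\<And>t. t \<in> {a..b} \<Longrightarrow> 0 \<le> g' t"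
  shows "sqrt (E b) \<le> sqrt (E a) + (g b - g a)"
proof (rule field_le_epsilon)
  fix e :: real assume e: "0 < e"
  have pos: "0 < E t + e\<^sup>2" for t using E0[of t] e by (simp add: add_nonneg_pos)
  have "sqrt (E b + e\<^sup>2) - sqrt (E a + e\<^sup>2) \<le> g b - g a"
  proof (rule deriv_compare[OF ab _ g])
    fix t assume t: "t \<in> {a..b}"
    show "((\<lambda>t. sqrt (E t + e\<^sup>2)) has_real_derivative E' t * (inverse (sqrt (E t + e\<^sup>2)) / 2)) (at t within {0..})"
      using pos[of t] by (auto intro!: derivative_eq_intros E[OF t] simp: mult.commute)
    have "E' t * (inverse (sqrt (E t + e\<^sup>2)) / 2) \<le> (2 * sqrt (E t) * g' t) * (inverse (sqrt (E t + e\<^sup>2)) / 2)"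
      using pos[of t] by (intro mult_right_mono le[OF t]) auto
    also have "... = g' t * (sqrt (E t) / sqrt (E t + e\<^sup>2))" by (simp add: field_simps)
    also have "... \<le> g' t * 1"
      using pos[of t] by (intro mult_left_mono g0[OF t]) (auto simp: divide_le_eq_1)
    finally show "E' t * (inverse (sqrt (E t + e\<^sup>2)) / 2) \<le> g' t" by simp
  qed auto
  moreover have "sqrt (E b) \<le> sqrt (E b + e\<^sup>2)" by simp
  moreover have "sqrt (E a + e\<^sup>2) \<le> sqrt (E a) + e"
    using sqrt_add_le_add_sqrt[of "E a" "e\<^sup>2"] E0[of a] e by simp
  ultimately show "sqrt (E b) \<le> sqrt (E a) + (g b - g a) + e" by linarith
qed

lemma cmod_sq_has_derivative:
  assumes "(f has_vector_derivative f') (at t within S)"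
  shows "((\<lambda>t. (cmod (f t))\<^sup>2) has_real_derivative 2 * Re (cnj (f t) * f')) (at t within S)"
proof -
  have re: "((\<lambda>t. Re (f t)) has_real_derivative Re f') (at t within S)"
    using bounded_linear.has_vector_derivative[OF bounded_linear_Re assms]
    by (simp add: has_real_derivative_iff_has_vector_derivative)
  have im: "((\<lambda>t. Im (f t)) has_real_derivative Im f') (at t within S)"
    using bounded_linear.has_vector_derivative[OF bounded_linear_Im assms]
    by (simp add: has_real_derivative_iff_has_vector_derivative)
  have "((\<lambda>t. (Re (f t))\<^sup>2 + (Im (f t))\<^sup>2) has_real_derivative 2 * Re (cnj (f t) * f')) (at t within S)"
    by (rule derivative_eq_intros re im refl)+ (simp add: algebra_simps)
  then show ?thesis by (simp add: cmod_power2)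
qed

section \<open>The symbol of the Laplacian and the equations of the modes\<close>

definition psym :: "int \<Rightarrow> real \<Rightarrow> real \<Rightarrow> real" where
  "psym n \<xi> t = (real_of_int n)\<^sup>2 + (\<xi> - real_of_int n * t)\<^sup>2"

lemma psym_nonneg: "0 \<le> psym n \<xi> t" by (simp add: psym_def)

lemma psym_ge_1: "n \<noteq> 0 \<Longrightarrow> 1 \<le> psym n \<xi> t"
proof -
  assume "n \<noteq> 0"
  then have "1 \<le> n\<^sup>2" by (simp add: int_one_le_iff_zero_less)
  then have "1 \<le> (real_of_int n)\<^sup>2" by (metis of_int_1 of_int_le_iff of_int_power)
  then show ?thesis by (simp add: psym_def add_increasing2)
qed

lemma psym_ge_sq: "(real_of_int n)\<^sup>2 \<le> psym n \<xi> t" by (simp add: psym_def)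

text \<open>Cauchy-Schwarz for \<xi> = (\<xi> - n t) + t n; the difference of the two sides is a
  perfect square.\<close>

lemma psym_ge_freq: "\<xi>\<^sup>2 \<le> psym n \<xi> t * (1 + t\<^sup>2)"
proof -
  have "psym n \<xi> t * (1 + t\<^sup>2) - \<xi>\<^sup>2 = (real_of_int n - (\<xi> - real_of_int n * t) * t)\<^sup>2"
    by (simp add: psym_def power2_eq_square algebra_simps)
  then show ?thesis by (metis diff_ge_0_iff_ge zero_le_power2)
qed

lemma psym_cross: "\<bar>2 * real_of_int n * (\<xi> - real_of_int n * t)\<bar> \<le> psym n \<xi> t"
proof -
  have "2 * \<bar>real_of_int n\<bar> * \<bar>\<xi> - real_of_int n * t\<bar> \<le> \<bar>real_of_int n\<bar>\<^sup>2 + \<bar>\<xi> - real_of_int n * t\<bar>\<^sup>2"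
    by (rule sum_squares_bound)
  then show ?thesis by (simp add: psym_def abs_mult)
qed

lemma psym_has_derivative:
  "((\<lambda>t. psym n \<xi> t) has_real_derivative - (2 * real_of_int n * (\<xi> - real_of_int n * t))) (at t within S)"
  unfolding psym_def by (auto intro!: derivative_eq_intros simp: algebra_simps)

locale mhd =
  fixes \<alpha> \<kappa> c :: real
  assumes \<alpha>: "0 < \<alpha>" and \<kappa>: "0 < \<kappa>" and c: "0 < c"
begin

definition lam :: "int \<Rightarrow> real \<Rightarrow> real \<Rightarrow> real" where
  "lam n \<xi> t = \<kappa> * psym n \<xi> t + 2 * real_of_int n * (\<xi> - real_of_int n * t) / psym n \<xi> t"

text \<open>The i of \<open>dy\<close> cancels against the 2 i of the sine, and the sign of the
  inverse Laplacian against that of the equation, so the coefficient is real and 2 c becomes c. The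
  row n = 0 is removed by the projection.\<close>

definition coup :: "(int \<Rightarrow> complex) \<Rightarrow> int \<Rightarrow> real \<Rightarrow> real \<Rightarrow> complex" where
  "coup w n \<xi> t = (if n = 0 then 0 else of_real (c * \<xi>) *
     (w (n - 1) / of_real (psym (n - 1) \<xi> t) - w (n + 1) / of_real (psym (n + 1) \<xi> t)))"

definition ode :: "real \<Rightarrow> (int \<Rightarrow> real \<Rightarrow> complex) \<Rightarrow> (int \<Rightarrow> real \<Rightarrow> complex) \<Rightarrow> bool" where
  "ode \<xi> W J \<longleftrightarrow> (\<forall>n. \<forall>t\<ge>0.
     (W n has_vector_derivative \<i> * of_real (\<alpha> * real_of_int n) * J n t + coup (\<lambda>m. W m t) n \<xi> t) (at t within {0..}) \<and>
     (J n has_vector_derivative - of_real (lam n \<xi> t) * J n t + \<i> * of_real (\<alpha> * real_of_int n) * W n t) (at t within {0..}))"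

lemma eqn_w:
  "of_real \<alpha> * dx U n \<xi> - nonzero_modes (\<lambda>k \<xi>. of_real (2 * c) * sin_mult (dy (lap_inv t V)) k \<xi>) n \<xi> =
   \<i> * of_real (\<alpha> * real_of_int n) * U n \<xi> + coup (\<lambda>m. V m \<xi>) n \<xi> t"
proof -
  have li: "lap_inv t V m \<xi> = - (V m \<xi> / of_real (psym m \<xi> t))" for m by (simp only: lap_inv_def psym_def divide_minus_left)
  define a b where "a = V (n - 1) \<xi> / of_real (psym (n - 1) \<xi> t)" and "b = V (n + 1) \<xi> / of_real (psym (n + 1) \<xi> t)"
  have g: "of_real (2 * c) * ((\<i> * of_real \<xi> * (- a) - \<i> * of_real \<xi> * (- b)) / (2 * \<i>)) = of_real (c * \<xi>) * (b - a)"
    by (simp add: field_simps)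
  show ?thesis
    unfolding dx_def nonzero_modes_def sin_mult_def dy_def li a_def[symmetric] b_def[symmetric] g coup_def
    by (simp add: algebra_simps)
qed

lemma eqn_j:
  "of_real \<kappa> * lap t U n \<xi> + of_real \<alpha> * dx V n \<xi> - 2 * dx (dyt t (lap_inv t U)) n \<xi> =
   - of_real (lam n \<xi> t) * U n \<xi> + \<i> * of_real (\<alpha> * real_of_int n) * V n \<xi>"
proof -
  have 1: "lap t U n \<xi> = - of_real (psym n \<xi> t) * U n \<xi>"
    by (simp add: lap_def dyt_def dx_def dy_def psym_def power2_eq_square algebra_simps)
  have 2: "dx (dyt t (lap_inv t U)) n \<xi> = of_real (real_of_int n * (\<xi> - real_of_int n * t) / psym n \<xi> t) * U n \<xi>"
  proof -
    have li: "lap_inv t U m \<xi> = - (U m \<xi> / of_real (psym m \<xi> t))" for m by (simp only: lap_inv_def psym_def divide_minus_left)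
    show ?thesis by (simp add: dyt_def dx_def dy_def li algebra_simps diff_divide_distrib)
  qed
  show ?thesis unfolding 1 2 by (simp add: lam_def dx_def algebra_simps)
qed

text \<open>The part of \<open>lam\<close> that does not come from resistivity is the logarithmic
  derivative of \<open>psym\<close> up to sign, hence at most one in modulus by
  \<open>psym_cross\<close>.\<close>

lemma lam_ge: "\<kappa> * psym n \<xi> t - 1 \<le> lam n \<xi> t"
proof -
  have "\<bar>2 * real_of_int n * (\<xi> - real_of_int n * t) / psym n \<xi> t\<bar> \<le> 1"
    using psym_cross[of n \<xi> t] psym_nonneg[of n \<xi> t] by (auto simp: abs_divide divide_le_eq_1)
  then show ?thesis unfolding lam_def by linarith
qed

definition qq :: "int \<Rightarrow> real \<Rightarrow> real \<Rightarrow> real" where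
  "qq n \<xi> t = (if n = 0 then 0 else c * \<bar>\<xi>\<bar> / psym n \<xi> t)"

lemma qq_nonneg: "0 \<le> qq n \<xi> t" using c by (simp add: qq_def psym_nonneg)

text \<open>For \<bar>\<xi>\<bar> above one the frequency is bounded by its square and
  \<open>psym_ge_freq\<close> applies; for smaller frequencies \<open>psym\<close> is at least
  one.\<close>

lemma qq_le: "\<bar>t\<bar> \<le> T \<Longrightarrow> qq n \<xi> t \<le> c * (1 + T\<^sup>2)"
proof (cases "n = 0")
  case False
  assume t: "\<bar>t\<bar> \<le> T"
  have p: "1 \<le> psym n \<xi> t" using False by (rule psym_ge_1)
  have "\<bar>\<xi>\<bar> \<le> (1 + T\<^sup>2) * psym n \<xi> t"
  proof (cases "\<bar>\<xi>\<bar> \<le> 1")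
    case True
    have "1 * 1 \<le> (1 + T\<^sup>2) * psym n \<xi> t" by (intro mult_mono p) auto
    then show ?thesis using True by simp
  next
    case False
    then have "\<bar>\<xi>\<bar> * 1 \<le> \<bar>\<xi>\<bar> * \<bar>\<xi>\<bar>" by (intro mult_left_mono) auto
    then have "\<bar>\<xi>\<bar> \<le> \<xi>\<^sup>2" by (simp add: power2_eq_square)
    also have "... \<le> psym n \<xi> t * (1 + t\<^sup>2)" by (rule psym_ge_freq)
    also have "... \<le> psym n \<xi> t * (1 + T\<^sup>2)"
    proof -
      have "t\<^sup>2 \<le> T\<^sup>2" using power_mono[OF t, of 2] by simp
      then show ?thesis by (intro mult_left_mono psym_nonneg) auto
    qed
    finally show ?thesis by (simp add: mult.commute)
  qed
  then have "c * \<bar>\<xi>\<bar> \<le> c * (1 + T\<^sup>2) * psym n \<xi> t" using c by (simp add: mult.assoc)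
  then show ?thesis using False p by (simp add: qq_def divide_le_eq)
qed (use c in \<open>simp add: qq_def\<close>)

lemma coup_le:
  assumes "w 0 = 0"
  shows "cmod (coup w n \<xi> t) \<le> qq (n - 1) \<xi> t * cmod (w (n - 1)) + qq (n + 1) \<xi> t * cmod (w (n + 1))"
proof (cases "n = 0")
  case True
  then show ?thesis by (simp add: coup_def qq_nonneg)
next
  case False
  have *: "cmod (of_real (c * \<xi>) * (w m / of_real (psym m \<xi> t))) = qq m \<xi> t * cmod (w m)" for m
    using assms c psym_nonneg[of m \<xi> t] by (cases "m = 0") (auto simp: qq_def norm_mult norm_divide abs_mult)
  have "coup w n \<xi> t = of_real (c * \<xi>) * (w (n - 1) / of_real (psym (n - 1) \<xi> t)) - of_real (c * \<xi>) * (w (n + 1) / of_real (psym (n + 1) \<xi> t))"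
    using False by (simp add: coup_def right_diff_distrib)
  then have "cmod (coup w n \<xi> t) \<le> cmod (of_real (c * \<xi>) * (w (n - 1) / of_real (psym (n - 1) \<xi> t))) + cmod (of_real (c * \<xi>) * (w (n + 1) / of_real (psym (n + 1) \<xi> t)))"
    by (simp only: norm_triangle_ineq4)
  then show ?thesis unfolding * .
qed

lemma ode_w0:
  assumes "ode \<xi> W J" "W 0 0 = 0" "0 \<le> t"
  shows "W 0 t = 0"
proof -
  have "cmod (W 0 t - W 0 0) \<le> 0 - 0"
    by (rule deriv_compare_norm[where f'="\<lambda>t. 0" and g="\<lambda>t. 0" and g'="\<lambda>t. 0"])
       (use assms in \<open>auto simp: ode_def coup_def split: if_splits dest: spec[of _ 0]\<close>)
  then show ?thesis using assms by simp
qed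

definition en :: "(int \<Rightarrow> real \<Rightarrow> complex) \<Rightarrow> (int \<Rightarrow> real \<Rightarrow> complex) \<Rightarrow> int \<Rightarrow> real \<Rightarrow> real" where
  "en W J n t = (cmod (W n t))\<^sup>2 + (cmod (J n t))\<^sup>2"

abbreviation ode_at where
  "ode_at W J \<xi> \<equiv> ode \<xi> (\<lambda>n t. W n t \<xi>) (\<lambda>n t. J n t \<xi>)"

abbreviation en_at where
  "en_at W J \<xi> \<equiv> en (\<lambda>n t. W n t \<xi>) (\<lambda>n t. J n t \<xi>)"

abbreviation modes_bounded where
  "modes_bounded W J \<xi> \<equiv> \<forall>T\<ge>0. \<exists>K. \<forall>n t. 0 \<le> t \<longrightarrow> t \<le> T \<longrightarrow> en_at W J \<xi> n t \<le> K"

lemma en_nonneg: "0 \<le> en W J n t" by (simp add: en_def)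

lemma W_le_en: "cmod (W n t) \<le> sqrt (en W J n t)" "cmod (J n t) \<le> sqrt (en W J n t)"
  by (auto simp: en_def intro!: real_le_rsqrt)

text \<open>The exchange between \<open>W n\<close> and \<open>J n\<close> is skew and drops out, so
  no factor \<alpha> n survives in the energy balance.\<close>

lemma en_has_derivative:
  assumes "ode \<xi> W J" "0 \<le> t"
  shows "(en W J n has_real_derivative
     2 * Re (cnj (W n t) * coup (\<lambda>m. W m t) n \<xi> t) - 2 * lam n \<xi> t * (cmod (J n t))\<^sup>2) (at t within {0..})"
proof -
  have "((\<lambda>t. (cmod (W n t))\<^sup>2 + (cmod (J n t))\<^sup>2) has_real_derivative
     2 * Re (cnj (W n t) * (\<i> * of_real (\<alpha> * real_of_int n) * J n t + coup (\<lambda>m. W m t) n \<xi> t)) +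
     2 * Re (cnj (J n t) * (- of_real (lam n \<xi> t) * J n t + \<i> * of_real (\<alpha> * real_of_int n) * W n t))) (at t within {0..})"
    using assms by (intro DERIV_add cmod_sq_has_derivative) (auto simp: ode_def)
  also have "2 * Re (cnj (W n t) * (\<i> * of_real (\<alpha> * real_of_int n) * J n t + coup (\<lambda>m. W m t) n \<xi> t)) +
     2 * Re (cnj (J n t) * (- of_real (lam n \<xi> t) * J n t + \<i> * of_real (\<alpha> * real_of_int n) * W n t)) =
     2 * Re (cnj (W n t) * coup (\<lambda>m. W m t) n \<xi> t) - 2 * lam n \<xi> t * (cmod (J n t))\<^sup>2"
    by (simp add: cmod_power2) (simp add: power2_eq_square algebra_simps)
  finally show ?thesis by (simp add: en_def[abs_def])
qed

end

section \<open>A Gronwall estimate on the infinite chain\<close>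

definition nbsum :: "(int \<Rightarrow> real) \<Rightarrow> int \<Rightarrow> real" where
  "nbsum a n = a (n - 1) + a n + a (n + 1)"

lemma nbsum_iter_nonneg: "(\<And>n. 0 \<le> a n) \<Longrightarrow> 0 \<le> (nbsum ^^ i) a n"
  by (induction i arbitrary: n) (auto simp: nbsum_def)

lemma nbsum_iter_le: "(\<And>n. a n \<le> A) \<Longrightarrow> (nbsum ^^ i) a n \<le> 3 ^ i * A"
proof (induction i arbitrary: n)
  case (Suc i)
  have "(nbsum ^^ Suc i) a n = (nbsum ^^ i) a (n - 1) + (nbsum ^^ i) a n + (nbsum ^^ i) a (n + 1)" by (simp add: nbsum_def)
  also have "... \<le> 3 ^ i * A + 3 ^ i * A + 3 ^ i * A" using Suc by (intro add_mono) auto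
  finally show ?case by (simp add: mult_ac)
qed simp

lemma zsum_shift: "zsum (\<lambda>n. f (n + k)) = zsum f"
  using nn_integral_bij_count_space[of "\<lambda>n. n + k" UNIV UNIV f]
  by (simp add: bij_betw_def inj_def surj_plus_right)

lemma zsum_add: "zsum (\<lambda>n. f n + g n) = zsum f + zsum g"
  by (rule nn_integral_add) auto

lemma zsum_nbsum_iter:
  assumes "\<And>n. 0 \<le> a n"
  shows "zsum (\<lambda>n. ennreal ((nbsum ^^ i) a n)) = 3 ^ i * zsum (\<lambda>n. ennreal (a n))"
proof (induction i)
  case (Suc i)
  let ?b = "(nbsum ^^ i) a"
  have b: "0 \<le> ?b n" for n by (rule nbsum_iter_nonneg[OF assms])
  have "zsum (\<lambda>n. ennreal ((nbsum ^^ Suc i) a n)) = zsum (\<lambda>n. ennreal (?b (n + - 1)) + ennreal (?b n) + ennreal (?b (n + 1)))"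
    using b by (intro nn_integral_cong) (simp add: ennreal_plus nbsum_def)
  also have "... = 3 * zsum (\<lambda>n. ennreal (?b n))"
  proof -
    have "(3::ennreal) = 1 + 1 + 1" by simp
    then show ?thesis
      unfolding zsum_add zsum_shift[of "\<lambda>n. ennreal (?b n)"] by (simp only: distrib_right mult_1)
  qed
  finally show ?case by (simp add: Suc mult.assoc)
qed simp

text \<open>The exponential of x times the operator \<open>nbsum\<close>, applied to a: the solution
  at time x of the comparison system in which every mode grows at the rate of its neighbour
  sum.\<close>

definition maj :: "real \<Rightarrow> (int \<Rightarrow> real) \<Rightarrow> int \<Rightarrow> ennreal" where
  "maj x a n = (\<Sum>i. ennreal (x ^ i / fact i) * ennreal ((nbsum ^^ i) a n))"

text \<open>Shifts preserve the sum over all modes, so each \<open>nbsum\<close> multiplies it by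
  exactly 3, and the series adds up to exp (3 x).\<close>

lemma zsum_maj:
  assumes a: "\<And>n. 0 \<le> a n" and x: "0 \<le> x"
  shows "zsum (maj x a) = ennreal (exp (3 * x)) * zsum (\<lambda>n. ennreal (a n))"
proof -
  have "zsum (maj x a) = (\<Sum>i. ennreal (x ^ i / fact i) * (3 ^ i * zsum (\<lambda>n. ennreal (a n))))"
    unfolding maj_def by (subst nn_integral_suminf) (simp_all add: zsum_cmult zsum_nbsum_iter a)
  also have "... = (\<Sum>i. ennreal ((3 * x) ^ i / fact i) * zsum (\<lambda>n. ennreal (a n)))"
  proof (intro arg_cong[of _ _ suminf] ext)
    fix i
    have "(3::ennreal) ^ i = ennreal (3 ^ i)" by (simp add: ennreal_power[symmetric])
    moreover have "x ^ i / fact i * 3 ^ i = (3 * x) ^ i / fact i" by (simp add: power_mult_distrib)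
    ultimately show "ennreal (x ^ i / fact i) * (3 ^ i * zsum (\<lambda>n. ennreal (a n))) = ennreal ((3 * x) ^ i / fact i) * zsum (\<lambda>n. ennreal (a n))"
      using x by (simp add: mult.assoc[symmetric] ennreal_mult[symmetric] mult.commute[of "x ^ i"])
  qed
  also have "... = (\<Sum>i. ennreal ((3 * x) ^ i / fact i)) * zsum (\<lambda>n. ennreal (a n))" by simp
  also have "(\<Sum>i. ennreal ((3 * x) ^ i / fact i)) = ennreal (exp (3 * x))"
  proof -
    have "(\<lambda>i. (3 * x) ^ i / fact i) sums exp (3 * x)"
      using exp_converges[of "3 * x"] by (simp add: divide_inverse mult.commute scaleR_conv_of_real)
    then show ?thesis using x by (subst suminf_ennreal2) (auto simp: sums_iff)
  qed
  finally show ?thesis .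
qed

lemma maj_mono:
  assumes "\<And>n. 0 \<le> a n" "0 \<le> x" "x \<le> y"
  shows "maj x a n \<le> maj y a n"
  unfolding maj_def
  by (intro suminf_le mult_right_mono ennreal_leI divide_right_mono power_mono) (use assms in auto)

lemma maj_measurable:
  assumes "\<And>n. (\<lambda>\<xi>. a n \<xi>) \<in> borel_measurable M"
  shows "(\<lambda>\<xi>. maj x (\<lambda>n. a n \<xi>) n) \<in> borel_measurable M"
proof -
  have [measurable]: "(\<lambda>\<xi>. (nbsum ^^ i) (\<lambda>n. a n \<xi>) n) \<in> borel_measurable M" for i
  proof (induction i arbitrary: n)
    case (Suc i)
    note Suc[measurable]
    have "(nbsum ^^ Suc i) b n = (nbsum ^^ i) b (n - 1) + (nbsum ^^ i) b n + (nbsum ^^ i) b (n + 1)" for b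
      by (simp add: nbsum_def[of "(nbsum ^^ i) b"])
    then show ?case by simp
  qed (use assms in simp)
  show ?thesis unfolding maj_def by measurable
qed

lemma power_fact_has_derivative:
  "((\<lambda>t. (M * t) ^ Suc i / fact (Suc i)) has_real_derivative M * ((M * t) ^ i / fact i)) (at t within S)"
proof -
  have "((\<lambda>t. (M * t) ^ Suc i) has_real_derivative (1 + real i) * (M * (M * t) ^ i)) (at t within S)"
    by (rule DERIV_power_Suc) (auto intro!: derivative_eq_intros)
  from DERIV_cdivide[OF this, of "fact (Suc i)"]
  have "((\<lambda>t. (M * t) ^ Suc i / fact (Suc i)) has_real_derivative (real (Suc i) * (M * t) ^ i * M) / fact (Suc i)) (at t within S)"
    by (simp add: mult_ac del: fact_Suc power_Suc)
  also have "(real (Suc i) * (M * t) ^ i * M) / fact (Suc i) = M * ((M * t) ^ i / fact i)"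
    by (simp add: fact_Suc field_simps del: of_nat_Suc)
  finally show ?thesis .
qed

context mhd begin

lemma en_deriv_le:
  assumes o: "ode \<xi> W J" and w0: "W 0 0 = 0" and t: "0 \<le> t" "t \<le> T"
  shows "2 * Re (cnj (W n t) * coup (\<lambda>m. W m t) n \<xi> t) - 2 * lam n \<xi> t * (cmod (J n t))\<^sup>2
    \<le> (2 * c * (1 + T\<^sup>2) + 2) * nbsum (\<lambda>m. en W J m t) n"
proof -
  define Q where "Q = c * (1 + T\<^sup>2)"
  have Q0: "0 \<le> Q" using c by (simp add: Q_def)
  have q: "qq m \<xi> t \<le> Q" for m unfolding Q_def by (rule qq_le) (use t in auto)
  define x where "x m = cmod (W m t)" for m
  have x0: "0 \<le> x m" for m by (simp add: x_def)
  have xe: "(x m)\<^sup>2 \<le> en W J m t" for m by (simp add: x_def en_def)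
  have xy: "2 * x m * x n \<le> en W J m t + en W J n t" for m
    using sum_squares_bound[of "x m" "x n"] xe[of m] xe[of n] by linarith
  have "cmod (coup (\<lambda>m. W m t) n \<xi> t) \<le> qq (n - 1) \<xi> t * x (n - 1) + qq (n + 1) \<xi> t * x (n + 1)"
    unfolding x_def by (rule coup_le) (rule ode_w0[OF o w0 t(1)])
  also have "... \<le> Q * x (n - 1) + Q * x (n + 1)" by (intro add_mono mult_right_mono q x0)
  finally have cp: "cmod (coup (\<lambda>m. W m t) n \<xi> t) \<le> Q * x (n - 1) + Q * x (n + 1)" .
  have "Re (cnj (W n t) * coup (\<lambda>m. W m t) n \<xi> t) \<le> x n * cmod (coup (\<lambda>m. W m t) n \<xi> t)"
    using complex_Re_le_cmod[of "cnj (W n t) * coup (\<lambda>m. W m t) n \<xi> t"] by (simp add: norm_mult x_def)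
  also have "... \<le> x n * (Q * x (n - 1) + Q * x (n + 1))" by (intro mult_left_mono cp x0)
  finally have 1: "2 * Re (cnj (W n t) * coup (\<lambda>m. W m t) n \<xi> t) \<le> Q * (2 * x (n - 1) * x n) + Q * (2 * x (n + 1) * x n)"
    by (simp add: algebra_simps)
  have "Q * (2 * x (n - 1) * x n) + Q * (2 * x (n + 1) * x n) \<le>
      Q * (en W J (n - 1) t + en W J n t) + Q * (en W J (n + 1) t + en W J n t)"
    by (intro add_mono mult_left_mono xy Q0)
  also have "... = Q * nbsum (\<lambda>m. en W J m t) n + Q * en W J n t" by (simp add: algebra_simps nbsum_def)
  finally have 2: "2 * Re (cnj (W n t) * coup (\<lambda>m. W m t) n \<xi> t) \<le> Q * nbsum (\<lambda>m. en W J m t) n + Q * en W J n t"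
    using 1 by linarith
  have "- 1 \<le> lam n \<xi> t" using lam_ge[of n \<xi> t] psym_nonneg[of n \<xi> t] \<kappa> by (smt (verit) mult_nonneg_nonneg)
  then have "- 1 * (cmod (J n t))\<^sup>2 \<le> lam n \<xi> t * (cmod (J n t))\<^sup>2" by (rule mult_right_mono) simp
  moreover have "(cmod (J n t))\<^sup>2 \<le> en W J n t" by (simp add: en_def)
  ultimately have 3: "- 2 * lam n \<xi> t * (cmod (J n t))\<^sup>2 \<le> 2 * en W J n t" by simp
  have e: "en W J n t \<le> nbsum (\<lambda>m. en W J m t) n" by (simp add: en_nonneg nbsum_def)
  have "Q * en W J n t \<le> Q * nbsum (\<lambda>m. en W J m t) n" by (rule mult_left_mono[OF e Q0])
  then have "2 * Re (cnj (W n t) * coup (\<lambda>m. W m t) n \<xi> t) - 2 * lam n \<xi> t * (cmod (J n t))\<^sup>2 \<le>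
      Q * nbsum (\<lambda>m. en W J m t) n + Q * nbsum (\<lambda>m. en W J m t) n + 2 * nbsum (\<lambda>m. en W J m t) n"
    using 2 3 e by linarith
  also have "... = (2 * Q + 2) * nbsum (\<lambda>m. en W J m t) n" by (simp only: distrib_right mult_2)
  finally show ?thesis by (simp add: Q_def mult.assoc)
qed

text \<open>The bound \<open>K\<close> starts the iteration and excludes energy arriving from
  infinitely distant modes. Each step integrates the neighbour sum once in time, so after j steps
  \<open>K\<close> survives only in a remainder that is factorially small.\<close>

lemma energy_iter:
  assumes o: "ode \<xi> W J" and w0: "W 0 0 = 0"
    and K: "\<And>n t. 0 \<le> t \<Longrightarrow> t \<le> T \<Longrightarrow> en W J n t \<le> K"
  defines "M \<equiv> 2 * c * (1 + T\<^sup>2) + 2"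
  assumes t: "0 \<le> t" "t \<le> T"
  shows "en W J n t \<le> (\<Sum>i<j. (M * t) ^ i / fact i * (nbsum ^^ i) (\<lambda>m. en W J m 0) n) + K * ((3 * M * t) ^ j / fact j)"
  using t
proof (induction j arbitrary: n t)
  case 0
  then show ?case using K by simp
next
  case (Suc j)
  have M0: "0 \<le> M" using c by (simp add: M_def)
  let ?e = "\<lambda>m. en W J m 0"
  define R where "R j n t = (\<Sum>i<j. (M * t) ^ i / fact i * (nbsum ^^ i) ?e n) + K * ((3 * M * t) ^ j / fact j)" for j n t
  have R0: "R (Suc j) n t = ?e n + (\<Sum>i<j. (M * t) ^ Suc i / fact (Suc i) * (nbsum ^^ Suc i) ?e n) + K * ((3 * M * t) ^ Suc j / fact (Suc j))" for t
    unfolding R_def by (subst sum.lessThan_Suc_shift) simp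
  have "en W J n t - en W J n 0 \<le> R (Suc j) n t - R (Suc j) n 0"
  proof (rule deriv_compare[where h'="\<lambda>t. 2 * Re (cnj (W n t) * coup (\<lambda>m. W m t) n \<xi> t) - 2 * lam n \<xi> t * (cmod (J n t))\<^sup>2"
      and g'="\<lambda>t. M * nbsum (\<lambda>m. R j m t) n"])
    fix s assume s: "s \<in> {0..t}"
    show "(en W J n has_real_derivative 2 * Re (cnj (W n s) * coup (\<lambda>m. W m s) n \<xi> s) - 2 * lam n \<xi> s * (cmod (J n s))\<^sup>2) (at s within {0..})"
      using en_has_derivative[OF o] s by simp
    have "(R (Suc j) n has_real_derivative 0 + (\<Sum>i<j. M * ((M * s) ^ i / fact i) * (nbsum ^^ Suc i) ?e n)
        + K * ((3 * M) * ((3 * M * s) ^ j / fact j))) (at s within {0..})"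
      unfolding R0[abs_def]
      by (intro DERIV_add DERIV_const DERIV_sum DERIV_cmult_right DERIV_cmult power_fact_has_derivative)
    also have "0 + (\<Sum>i<j. M * ((M * s) ^ i / fact i) * (nbsum ^^ Suc i) ?e n) + K * ((3 * M) * ((3 * M * s) ^ j / fact j)) =
        M * nbsum (\<lambda>m. R j m s) n"
      by (simp add: R_def nbsum_def algebra_simps sum.distrib sum_distrib_left)
    finally show "(R (Suc j) n has_real_derivative M * nbsum (\<lambda>m. R j m s) n) (at s within {0..})" .
    have "nbsum (\<lambda>m. en W J m s) n \<le> nbsum (\<lambda>m. R j m s) n"
    proof -
      have "en W J m s \<le> R j m s" for m
        unfolding R_def using Suc.IH[of s m] s Suc.prems by simp
      then show ?thesis unfolding nbsum_def by (intro add_mono)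
    qed
    then have "M * nbsum (\<lambda>m. en W J m s) n \<le> M * nbsum (\<lambda>m. R j m s) n" by (rule mult_left_mono) (rule M0)
    moreover have "2 * Re (cnj (W n s) * coup (\<lambda>m. W m s) n \<xi> s) - 2 * lam n \<xi> s * (cmod (J n s))\<^sup>2 \<le> M * nbsum (\<lambda>m. en W J m s) n"
      unfolding M_def by (rule en_deriv_le[OF o w0]) (use s Suc.prems in auto)
    ultimately show "2 * Re (cnj (W n s) * coup (\<lambda>m. W m s) n \<xi> s) - 2 * lam n \<xi> s * (cmod (J n s))\<^sup>2 \<le> M * nbsum (\<lambda>m. R j m s) n"
      by linarith
  qed (use Suc.prems in auto)
  moreover have "R (Suc j) n 0 = en W J n 0" by (simp add: R0)
  ultimately show ?case unfolding R_def by simp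
qed

text \<open>Controls each single mode by the initial energies and not only the total. This is used
  again for the time-independent majorant in \<open>solution_exists\<close> and for the localisation
  of the modes in \<open>ee_weighted_bounded\<close>.\<close>

lemma en_le_maj:
  assumes o: "ode \<xi> W J" and w0: "W 0 0 = 0"
    and K: "\<And>n t. 0 \<le> t \<Longrightarrow> t \<le> T \<Longrightarrow> en W J n t \<le> K"
    and t: "0 \<le> t" "t \<le> T"
  shows "ennreal (en W J n t) \<le> maj ((2 * c * (1 + T\<^sup>2) + 2) * t) (\<lambda>m. en W J m 0) n"
proof -
  define M where "M = 2 * c * (1 + T\<^sup>2) + 2"
  have M0: "0 \<le> M * t" using c t by (simp add: M_def)
  let ?e = "\<lambda>m. en W J m 0"
  have e0: "0 \<le> (nbsum ^^ i) ?e n" for i n by (rule nbsum_iter_nonneg) (rule en_nonneg)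
  have K0: "0 \<le> K" using K[of 0 0] t en_nonneg[of W J 0 0] by linarith
  let ?s = "\<Sum>i. ennreal ((M * t) ^ i / fact i) * ennreal ((nbsum ^^ i) ?e n)"
  have "(\<lambda>j. ?s + ennreal (K * ((3 * M * t) ^ j / fact j))) \<longlonglongrightarrow> ?s + ennreal (K * 0)"
  proof (intro tendsto_add tendsto_const tendsto_ennrealI tendsto_mult)
    show "(\<lambda>j. (3 * M * t) ^ j / fact j) \<longlonglongrightarrow> 0"
      using summable_LIMSEQ_zero[OF summable_exp[of "3 * M * t"]] by (simp add: divide_inverse mult.commute)
  qed
  moreover have "ennreal (en W J n t) \<le> ?s + ennreal (K * ((3 * M * t) ^ j / fact j))" for j
  proof -
    have "ennreal (en W J n t) \<le> ennreal ((\<Sum>i<j. (M * t) ^ i / fact i * (nbsum ^^ i) ?e n) + K * ((3 * M * t) ^ j / fact j))"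
      using energy_iter[OF o w0 K t, of n j] unfolding M_def by (intro ennreal_leI) auto
    also have "... = (\<Sum>i<j. ennreal ((M * t) ^ i / fact i) * ennreal ((nbsum ^^ i) ?e n)) + ennreal (K * ((3 * M * t) ^ j / fact j))"
    proof -
      have p: "0 \<le> (M * t) ^ i / fact i * (nbsum ^^ i) ?e n" for i using M0 e0 by simp
      have "0 \<le> K * ((3 * M * t) ^ j / fact j)" using M0 K0 by (simp add: mult.assoc)
      then have "ennreal ((\<Sum>i<j. (M * t) ^ i / fact i * (nbsum ^^ i) ?e n) + K * ((3 * M * t) ^ j / fact j)) =
          ennreal (\<Sum>i<j. (M * t) ^ i / fact i * (nbsum ^^ i) ?e n) + ennreal (K * ((3 * M * t) ^ j / fact j))"
        by (intro ennreal_plus sum_nonneg p)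
      moreover have "ennreal (\<Sum>i<j. (M * t) ^ i / fact i * (nbsum ^^ i) ?e n) = (\<Sum>i<j. ennreal ((M * t) ^ i / fact i) * ennreal ((nbsum ^^ i) ?e n))"
      proof -
        have "ennreal (\<Sum>i<j. (M * t) ^ i / fact i * (nbsum ^^ i) ?e n) = (\<Sum>i<j. ennreal ((M * t) ^ i / fact i * (nbsum ^^ i) ?e n))"
          by (rule sum_ennreal[symmetric]) (rule p)
        also have "... = (\<Sum>i<j. ennreal ((M * t) ^ i / fact i) * ennreal ((nbsum ^^ i) ?e n))"
          using M0 e0 by (intro sum.cong refl ennreal_mult) auto
        finally show ?thesis .
      qed
      ultimately show ?thesis by simp
    qed
    also have "... \<le> ?s + ennreal (K * ((3 * M * t) ^ j / fact j))"
      by (intro add_right_mono sum_le_suminf) auto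
    finally show ?thesis .
  qed
  ultimately have "ennreal (en W J n t) \<le> ?s"
    by (intro tendsto_lowerbound[where F=sequentially]) (auto intro: always_eventually)
  then show ?thesis by (simp add: maj_def M_def)
qed

lemma energy_bound:
  assumes o: "ode \<xi> W J" and w0: "W 0 0 = 0"
    and K: "\<And>n t. 0 \<le> t \<Longrightarrow> t \<le> T \<Longrightarrow> en W J n t \<le> K"
    and t: "0 \<le> t" "t \<le> T"
  shows "zsum (\<lambda>n. ennreal (en W J n t)) \<le> ennreal (exp (3 * ((2 * c * (1 + T\<^sup>2) + 2) * t))) * zsum (\<lambda>n. ennreal (en W J n 0))"
proof -
  have "zsum (\<lambda>n. ennreal (en W J n t)) \<le> zsum (\<lambda>n. maj ((2 * c * (1 + T\<^sup>2) + 2) * t) (\<lambda>m. en W J m 0) n)"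
    by (intro nn_integral_mono en_le_maj[OF o w0 K t]) auto
  also have "... = ennreal (exp (3 * ((2 * c * (1 + T\<^sup>2) + 2) * t))) * zsum (\<lambda>n. ennreal (en W J n 0))"
    using c t by (intro zsum_maj en_nonneg) simp
  finally show ?thesis .
qed

end

section \<open>Picard iteration with the current eliminated\<close>

lemma integral_from_0_has_derivative:
  fixes f :: "real \<Rightarrow> 'a::banach"
  assumes f: "continuous_on {0..} f" and t: "0 \<le> t"
  shows "((\<lambda>t. integral {0..t} f) has_vector_derivative f t) (at t within {0..})"
proof -
  have "((\<lambda>t. integral {0..t} f) has_vector_derivative f t) (at t within {0..t + 1})"
    by (rule integral_has_vector_derivative) (use t in \<open>auto intro: continuous_on_subset[OF f]\<close>)
  moreover have "at t within {0..t + 1} = at t within {0..}"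
    by (rule at_within_nhd[where S="{..<t + 1}"]) auto
  ultimately show ?thesis by simp
qed

lemma has_vector_derivative_imp_continuous_on:
  assumes "\<And>t. t \<in> S \<Longrightarrow> (f has_vector_derivative f' t) (at t within S)"
  shows "continuous_on S f"
  using assms has_vector_derivative_continuous continuous_on_eq_continuous_within by blast

lemma continuous_on_integral_from_0:
  fixes f :: "real \<Rightarrow> complex"
  assumes f: "continuous_on {0..} f"
  shows "continuous_on {0..} (\<lambda>t. integral {0..t} f)"
  by (rule has_vector_derivative_imp_continuous_on) (use integral_from_0_has_derivative[OF f] in auto)

text \<open>Rounding time down to multiples of 1 / (m + 1) leaves countably many measurable slices,
  and continuity in time gives the limit. The \<open>max 0\<close> extends the function to negative
  times.\<close>

lemma caratheodory_measurable:
  fixes f :: "real \<Rightarrow> real \<Rightarrow> 'b::{second_countable_topology, metric_space}"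
  assumes m: "\<And>t. 0 \<le> t \<Longrightarrow> f t \<in> borel_measurable borel"
    and cont: "\<And>\<xi>. continuous_on {0..} (\<lambda>t. f t \<xi>)"
  shows "(\<lambda>p. f (max 0 (fst p)) (snd p)) \<in> borel_measurable (borel \<Otimes>\<^sub>M borel)"
proof -
  define r where "r m x = real_of_int \<lfloor>real (Suc m) * max 0 x\<rfloor> / real (Suc m)" for m :: nat and x :: real
  have meas: "(\<lambda>p. f (r m (fst p)) (snd p)) \<in> borel_measurable (borel \<Otimes>\<^sub>M borel)" for m
  proof -
    have "(\<lambda>p. (\<lambda>i p. f (real_of_int (max 0 i) / real (Suc m)) (snd p)) (\<lfloor>real (Suc m) * max 0 (fst p)\<rfloor>) p) \<in> borel_measurable (borel \<Otimes>\<^sub>M borel)"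
    proof (rule measurable_compose_countable[where f="\<lambda>i p. f (real_of_int (max 0 i) / real (Suc m)) (snd p)"
          and g="\<lambda>p. \<lfloor>real (Suc m) * max 0 (fst p)\<rfloor>"])
      fix i :: int
      show "(\<lambda>p. f (real_of_int (max 0 i) / real (Suc m)) (snd p)) \<in> borel_measurable (borel \<Otimes>\<^sub>M borel)"
        by (intro measurable_compose[OF measurable_snd] m) auto
      show "(\<lambda>p. \<lfloor>real (Suc m) * max 0 (fst p)\<rfloor>) \<in> measurable (borel \<Otimes>\<^sub>M borel) (count_space UNIV)"
        by measurable
    qed
    moreover have "max 0 \<lfloor>real (Suc m) * max 0 (fst p)\<rfloor> = \<lfloor>real (Suc m) * max 0 (fst p)\<rfloor>" for p :: "real \<times> real"
    proof -
      have "0 \<le> real (Suc m) * max 0 (fst p)" by simp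
      then have "0 \<le> \<lfloor>real (Suc m) * max 0 (fst p)\<rfloor>" by (simp only: zero_le_floor)
      then show ?thesis by simp
    qed
    ultimately show ?thesis by (simp only: r_def)
  qed
  have lim: "(\<lambda>m. f (r m (fst p)) (snd p)) \<longlonglongrightarrow> f (max 0 (fst p)) (snd p)" for p :: "real \<times> real"
  proof -
    have "(\<lambda>m. r m (fst p)) \<longlonglongrightarrow> max 0 (fst p)"
    proof (rule LIM_zero_cancel, rule Lim_null_comparison)
      show "(\<lambda>m. 1 / real (Suc m)) \<longlonglongrightarrow> 0" using LIMSEQ_inverse_real_of_nat by (simp add: inverse_eq_divide)
      show "\<forall>\<^sub>F m in sequentially. norm (r m (fst p) - max 0 (fst p)) \<le> 1 / real (Suc m)"
      proof (intro always_eventually allI)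
        fix m
        let ?x = "real (Suc m) * max 0 (fst p)"
        have "r m (fst p) - max 0 (fst p) = (real_of_int \<lfloor>?x\<rfloor> - ?x) / real (Suc m)"
          by (simp add: r_def diff_divide_distrib)
        moreover have "\<bar>real_of_int \<lfloor>?x\<rfloor> - ?x\<bar> \<le> 1" by linarith
        ultimately show "norm (r m (fst p) - max 0 (fst p)) \<le> 1 / real (Suc m)"
          by (simp add: abs_divide divide_right_mono)
      qed
    qed
    moreover have "0 \<le> r m (fst p)" for m
    proof -
      have "0 \<le> real (Suc m) * max 0 (fst p)" by simp
      then have "0 \<le> \<lfloor>real (Suc m) * max 0 (fst p)\<rfloor>" by (simp only: zero_le_floor)
      then show ?thesis unfolding r_def by simp
    qed
    ultimately show ?thesis
      by (intro continuous_on_tendsto_compose[OF cont]) auto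
  qed
  show ?thesis by (rule borel_measurable_LIMSEQ_metric[OF meas lim])
qed

lemma integral_from_0_measurable:
  fixes f :: "real \<Rightarrow> real \<Rightarrow> complex"
  assumes m: "\<And>t. 0 \<le> t \<Longrightarrow> f t \<in> borel_measurable borel"
    and cont: "\<And>\<xi>. continuous_on {0..} (\<lambda>t. f t \<xi>)"
  shows "(\<lambda>\<xi>. integral {0..t} (\<lambda>s. f s \<xi>)) \<in> borel_measurable borel"
proof -
  have eq: "integral {0..t} (\<lambda>s. f s \<xi>) = (LINT s|lborel. indicator {0..t} s *\<^sub>R f (max 0 s) \<xi>)" for \<xi>
  proof -
    have "set_integrable lborel {0..t} (\<lambda>s. f s \<xi>)"
      by (rule borel_integrable_atLeastAtMost') (auto intro: continuous_on_subset[OF cont])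
    from set_borel_integral_eq_integral(2)[OF this]
    have "integral {0..t} (\<lambda>s. f s \<xi>) = (LINT s|lborel. indicator {0..t} s *\<^sub>R f s \<xi>)"
      by (simp add: set_lebesgue_integral_def)
    also have "... = (LINT s|lborel. indicator {0..t} s *\<^sub>R f (max 0 s) \<xi>)"
      by (intro Bochner_Integration.integral_cong) (auto simp: indicator_def max_def)
    finally show ?thesis .
  qed
  have [measurable]: "(\<lambda>p. f (max 0 (fst p)) (snd p)) \<in> borel_measurable (borel \<Otimes>\<^sub>M borel)"
    by (rule caratheodory_measurable[OF m cont])
  have "(\<lambda>p. f (max 0 (fst (snd p, fst p))) (snd (snd p, fst p))) \<in> borel_measurable (borel \<Otimes>\<^sub>M lborel)"
    by (rule measurable_compose[OF _ \<open>(\<lambda>p. f (max 0 (fst p)) (snd p)) \<in> borel_measurable (borel \<Otimes>\<^sub>M borel)\<close>]) measurable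
  then have [measurable]: "(\<lambda>p. f (max 0 (snd p)) (fst p)) \<in> borel_measurable (borel \<Otimes>\<^sub>M lborel)" by simp
  show ?thesis unfolding eq by measurable
qed

lemma div_le_self: "0 \<le> x \<Longrightarrow> 1 \<le> m \<Longrightarrow> x / m \<le> (x::real)"
  using mult_left_mono[of 1 m x] by (simp add: divide_le_eq)

lemma cancel_abs: "1 \<le> m \<Longrightarrow> 0 < k \<Longrightarrow> a * m * e * y / (k * (m * m)) = a / k * e * y / (m::real)"
  by (simp add: field_simps)

context mhd begin

text \<open>The primitive of \<open>psym\<close> in time that vanishes at time 0, for n
  nonzero.\<close>

definition Th :: "int \<Rightarrow> real \<Rightarrow> real \<Rightarrow> real" where
  "Th n \<xi> t = (real_of_int n)\<^sup>2 * t - ((\<xi> - real_of_int n * t) ^ 3 - \<xi> ^ 3) / (3 * real_of_int n)"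

text \<open>\<open>Gf\<close> is the solution of the homogeneous equation \<open>G' = - lam G\<close>, since \<open>psym' / psym\<close> is the
  non-dissipative part of \<open>- lam\<close>.\<close>

definition Gf :: "int \<Rightarrow> real \<Rightarrow> real \<Rightarrow> real" where
  "Gf n \<xi> t = psym n \<xi> t * exp (- \<kappa> * Th n \<xi> t)"

lemma Gf_pos: "n \<noteq> 0 \<Longrightarrow> 0 < Gf n \<xi> t"
  using psym_ge_1[of n \<xi> t] by (simp add: Gf_def)

lemma Gf_has_derivative:
  assumes n: "n \<noteq> 0"
  shows "((\<lambda>t. Gf n \<xi> t) has_real_derivative - lam n \<xi> t * Gf n \<xi> t) (at t within S)"
proof -
  have p: "psym n \<xi> t \<noteq> 0" using psym_ge_1[OF n, of \<xi> t] by linarith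
  have "((\<lambda>t. Th n \<xi> t) has_real_derivative psym n \<xi> t) (at t within S)"
    unfolding Th_def using n
    by (auto intro!: derivative_eq_intros simp: psym_def)
  then have "((\<lambda>t. Gf n \<xi> t) has_real_derivative
      - (2 * real_of_int n * (\<xi> - real_of_int n * t)) * exp (- \<kappa> * Th n \<xi> t) +
      (exp (- \<kappa> * Th n \<xi> t) * (- \<kappa> * psym n \<xi> t)) * psym n \<xi> t) (at t within S)"
    unfolding Gf_def
    by (intro DERIV_mult psym_has_derivative DERIV_chain2[where f=exp] DERIV_exp DERIV_cmult)
  also have "- (2 * real_of_int n * (\<xi> - real_of_int n * t)) * exp (- \<kappa> * Th n \<xi> t) +
      (exp (- \<kappa> * Th n \<xi> t) * (- \<kappa> * psym n \<xi> t)) * psym n \<xi> t = - lam n \<xi> t * Gf n \<xi> t"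
    using p by (simp add: lam_def Gf_def field_simps)
  finally show ?thesis .
qed

text \<open>\<open>lam\<close> is at least \<kappa> n^2 - 1, so after multiplication by the
  exponential with that rate \<open>Gf\<close> is nonincreasing.\<close>

lemma Gf_ratio:
  assumes n: "n \<noteq> 0" and st: "0 \<le> s" "s \<le> t"
  shows "Gf n \<xi> t / Gf n \<xi> s \<le> exp ((1 - \<kappa> * (real_of_int n)\<^sup>2) * (t - s))"
proof -
  define b where "b = 1 - \<kappa> * (real_of_int n)\<^sup>2"
  define H where "H t = Gf n \<xi> t * exp (- b * t)" for t
  have "H t - H s \<le> 0 - 0"
  proof (rule deriv_compare[OF st, where g="\<lambda>_. 0" and g'="\<lambda>_. 0"])
    fix r assume r: "r \<in> {s..t}"
    show "(H has_real_derivative (- lam n \<xi> r - b) * H r) (at r within {0..})"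
      unfolding H_def by (auto intro!: derivative_eq_intros Gf_has_derivative[OF n] simp: algebra_simps)
    have "\<kappa> * (real_of_int n)\<^sup>2 \<le> \<kappa> * psym n \<xi> r" using \<kappa> psym_ge_sq by simp
    then have "- lam n \<xi> r - b \<le> 0" using lam_ge[of n \<xi> r] by (simp add: b_def)
    moreover have "0 \<le> H r" using Gf_pos[OF n, of \<xi> r] by (simp add: H_def)
    ultimately show "(- lam n \<xi> r - b) * H r \<le> 0" by (rule mult_nonpos_nonneg)
  qed auto
  then have "Gf n \<xi> t * exp (- b * t) * exp (b * t) \<le> Gf n \<xi> s * exp (- b * s) * exp (b * t)"
    by (intro mult_right_mono) (auto simp: H_def)
  then have "Gf n \<xi> t \<le> Gf n \<xi> s * exp (b * (t - s))"
    by (simp add: mult.assoc exp_add[symmetric] right_diff_distrib)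
  then show ?thesis using Gf_pos[OF n, of \<xi> s] by (simp add: b_def divide_le_eq mult.commute)
qed

text \<open>The current is eliminated: \<open>Jop j W\<close> solves its equation for a prescribed vorticity \<open>W\<close>.\<close>

definition Jop :: "complex \<Rightarrow> int \<Rightarrow> real \<Rightarrow> (real \<Rightarrow> complex) \<Rightarrow> real \<Rightarrow> complex" where
  "Jop j n \<xi> f t = (if n = 0 then 0 else of_real (Gf n \<xi> t) * (j / of_real (Gf n \<xi> 0) +
     integral {0..t} (\<lambda>s. \<i> * of_real (\<alpha> * real_of_int n) * f s / of_real (Gf n \<xi> s))))"

definition Rop :: "(int \<Rightarrow> complex) \<Rightarrow> real \<Rightarrow> (int \<Rightarrow> real \<Rightarrow> complex) \<Rightarrow> int \<Rightarrow> real \<Rightarrow> complex" where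
  "Rop j \<xi> w n t = \<i> * of_real (\<alpha> * real_of_int n) * Jop (j n) n \<xi> (w n) t + coup (\<lambda>m. w m t) n \<xi> t"

primrec picard :: "(int \<Rightarrow> complex) \<Rightarrow> (int \<Rightarrow> complex) \<Rightarrow> real \<Rightarrow> nat \<Rightarrow> int \<Rightarrow> real \<Rightarrow> complex" where
  "picard w0 j0 \<xi> 0 n t = 0"
| "picard w0 j0 \<xi> (Suc i) n t = w0 n + integral {0..t} (Rop j0 \<xi> (picard w0 j0 \<xi> i) n)"

lemma Gf_continuous: "continuous_on S (\<lambda>t. Gf n \<xi> t)"
  unfolding Gf_def Th_def psym_def
  by (cases "n = 0") (auto intro!: continuous_intros)

lemma Jop_integrand_continuous:
  assumes "n \<noteq> 0" "continuous_on {0..} f"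
  shows "continuous_on {0..} (\<lambda>s. \<i> * of_real (\<alpha> * real_of_int n) * f s / of_real (Gf n \<xi> s))"
  using assms Gf_pos[OF assms(1)] by (intro continuous_intros Gf_continuous) (auto simp: less_imp_neq[symmetric])

lemma Jop_has_derivative:
  assumes f: "continuous_on {0..} f" and t: "0 \<le> t"
  shows "(Jop j n \<xi> f has_vector_derivative (- of_real (lam n \<xi> t) * Jop j n \<xi> f t + \<i> * of_real (\<alpha> * real_of_int n) * f t)) (at t within {0..})"
proof (cases "n = 0")
  case True
  then show ?thesis by (simp add: Jop_def[abs_def])
next
  case False
  let ?I = "\<lambda>t. j / of_real (Gf n \<xi> 0) + integral {0..t} (\<lambda>s. \<i> * of_real (\<alpha> * real_of_int n) * f s / of_real (Gf n \<xi> s))"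
  have I: "(?I has_vector_derivative 0 + \<i> * of_real (\<alpha> * real_of_int n) * f t / of_real (Gf n \<xi> t)) (at t within {0..})"
    by (intro has_vector_derivative_add has_vector_derivative_const integral_from_0_has_derivative Jop_integrand_continuous False f t)
  have G: "((\<lambda>t. complex_of_real (Gf n \<xi> t)) has_vector_derivative of_real (- lam n \<xi> t * Gf n \<xi> t)) (at t within {0..})"
    using Gf_has_derivative[OF False, of \<xi> t "{0..}"] by (rule has_vector_derivative_of_real)
  have "((\<lambda>t. of_real (Gf n \<xi> t) * ?I t) has_vector_derivative
    of_real (Gf n \<xi> t) * (0 + \<i> * of_real (\<alpha> * real_of_int n) * f t / of_real (Gf n \<xi> t)) + of_real (- lam n \<xi> t * Gf n \<xi> t) * ?I t) (at t within {0..})"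
    by (rule has_vector_derivative_mult[OF G I])
  also have "of_real (Gf n \<xi> t) * (0 + \<i> * of_real (\<alpha> * real_of_int n) * f t / of_real (Gf n \<xi> t)) + of_real (- lam n \<xi> t * Gf n \<xi> t) * ?I t =
     - of_real (lam n \<xi> t) * (of_real (Gf n \<xi> t) * ?I t) + \<i> * of_real (\<alpha> * real_of_int n) * f t"
    using Gf_pos[OF False, of \<xi> t] by (simp add: mult.assoc)
  finally show ?thesis using False by (simp add: Jop_def[abs_def])
qed

lemma Jop_continuous: "continuous_on {0..} f \<Longrightarrow> continuous_on {0..} (Jop j n \<xi> f)"
  by (rule has_vector_derivative_imp_continuous_on) (use Jop_has_derivative in auto)

lemma psym_continuous: "continuous_on S (psym n \<xi>)"
  unfolding psym_def[abs_def] by (intro continuous_intros)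

lemma coup_continuous:
  assumes w: "\<And>m. continuous_on {0..} (w m)" and w0: "\<And>t. w 0 t = 0"
  shows "continuous_on {0..} (\<lambda>t. coup (\<lambda>m. w m t) n \<xi> t)"
proof -
  have A: "continuous_on {0..} (\<lambda>t. w m t / of_real (psym m \<xi> t))" for m
  proof (cases "m = 0")
    case False
    then show ?thesis using psym_ge_1[OF False, of \<xi>]
      by (intro continuous_intros w psym_continuous) (smt (verit) of_real_eq_0_iff)
  qed (simp add: w0)
  show ?thesis
  proof (cases "n = 0")
    case False
    then show ?thesis unfolding coup_def if_not_P[OF False]
      by (intro continuous_on_mult continuous_on_const continuous_on_diff A)
  qed (simp add: coup_def)
qed

lemma Rop_continuous:
  assumes w: "\<And>m. continuous_on {0..} (w m)" and w0: "\<And>t. w 0 t = 0"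
  shows "continuous_on {0..} (Rop j \<xi> w n)"
  unfolding Rop_def[abs_def] by (intro continuous_intros Jop_continuous coup_continuous w w0)

lemma Rop_0: "Rop j \<xi> w 0 t = 0" by (simp add: Rop_def coup_def)

lemma picard_0: "w0 0 = 0 \<Longrightarrow> picard w0 j0 \<xi> i 0 t = 0"
  by (cases i) (simp_all add: Rop_0[abs_def])

lemma picard_continuous: "w0 0 = 0 \<Longrightarrow> continuous_on {0..} (picard w0 j0 \<xi> i n)"
proof (induction i arbitrary: n)
  case 0
  then show ?case by (simp add: fun_eq_iff[symmetric])
next
  case (Suc i)
  then show ?case
    by (auto intro!: continuous_intros continuous_on_integral_from_0 Rop_continuous picard_0 simp: picard_0 fun_eq_iff[symmetric])
qed

text \<open>The factor \<alpha> n, unbounded along the chain, enters twice: in the source of the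
  current and in its feedback on the vorticity. The kernel decays at rate \<kappa> n^2 up to a
  factor exp T, so integrating it in time gains 1 / (\<kappa> n^2), and the feedback is bounded by
  \<alpha>^2 / \<kappa> uniformly in n and \<xi>.\<close>

lemma Jop_bound:
  assumes f: "continuous_on {0..} f" and t: "0 \<le> t" "t \<le> T" and y: "\<And>s. 0 \<le> s \<Longrightarrow> s \<le> t \<Longrightarrow> cmod (f s) \<le> y"
  shows "cmod (\<i> * of_real (\<alpha> * real_of_int n) * Jop 0 n \<xi> f t) \<le> \<alpha>\<^sup>2 / \<kappa> * exp T * y"
    "cmod (Jop 0 n \<xi> f t) \<le> \<alpha> / \<kappa> * exp T * y"
proof -
  have y0: "0 \<le> y" using y[of 0] t norm_ge_zero order_trans by blast
  have "cmod (\<i> * of_real (\<alpha> * real_of_int n) * Jop 0 n \<xi> f t) \<le> \<alpha>\<^sup>2 / \<kappa> * exp T * y \<and> cmod (Jop 0 n \<xi> f t) \<le> \<alpha> / \<kappa> * exp T * y"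
  proof (cases "n = 0")
    case True
    then show ?thesis using y0 \<kappa> \<alpha> by (simp add: Jop_def)
  next
    case n: False
    define k where "k = \<kappa> * (real_of_int n)\<^sup>2"
    have n1: "1 \<le> \<bar>real_of_int n\<bar>"
      using n by (simp flip: of_int_abs)
    then have "1 \<le> (real_of_int n)\<^sup>2" using power_mono[of 1 "\<bar>real_of_int n\<bar>" 2] by simp
    then have k0: "0 < k" using \<kappa> unfolding k_def by (intro mult_pos_pos) linarith+
    define g where "g s = \<i> * of_real (\<alpha> * real_of_int n) * f s / of_real (Gf n \<xi> s)" for s
    define A where "A = \<alpha> * \<bar>real_of_int n\<bar> * exp T * y"
    have A0: "0 \<le> A" using \<alpha> y0 by (simp add: A_def)
    have gc: "continuous_on {0..} g" unfolding g_def[abs_def] by (rule Jop_integrand_continuous[OF n f])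
    have "cmod (integral {0..t} g - integral {0..0} g) \<le> A / (k * Gf n \<xi> t) * exp (- k * (t - t)) - A / (k * Gf n \<xi> t) * exp (- k * (t - 0))"
    proof (rule deriv_compare_norm[where f'=g and g'="\<lambda>s. A / (k * Gf n \<xi> t) * (k * exp (- k * (t - s)))"])
      fix s assume s: "s \<in> {0..t}"
      show "((\<lambda>t. integral {0..t} g) has_vector_derivative g s) (at s within {0..})"
        by (rule integral_from_0_has_derivative[OF gc]) (use s in auto)
      show "((\<lambda>s. A / (k * Gf n \<xi> t) * exp (- k * (t - s))) has_real_derivative A / (k * Gf n \<xi> t) * (k * exp (- k * (t - s)))) (at s within {0..})"
        using Gf_pos[OF n, of \<xi> t] k0 by (auto intro!: derivative_eq_intros)
      have gp: "0 < Gf n \<xi> s" "0 < Gf n \<xi> t" using Gf_pos[OF n] by auto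
      have "Gf n \<xi> t / Gf n \<xi> s \<le> exp ((1 - k) * (t - s))" unfolding k_def by (rule Gf_ratio[OF n]) (use s in auto)
      also have "... = exp (t - s) * exp (- k * (t - s))" by (simp add: exp_add[symmetric] algebra_simps)
      also have "... \<le> exp T * exp (- k * (t - s))" using s t by (intro mult_right_mono) auto
      finally have "1 / Gf n \<xi> s \<le> exp T * exp (- k * (t - s)) / Gf n \<xi> t"
        using gp by (simp add: field_simps)
      then have "(\<alpha> * \<bar>real_of_int n\<bar> * cmod (f s)) * (1 / Gf n \<xi> s) \<le> (\<alpha> * \<bar>real_of_int n\<bar> * y) * (exp T * exp (- k * (t - s)) / Gf n \<xi> t)"
        using \<alpha> y[of s] y0 s gp by (intro mult_mono) (auto intro!: mult_left_mono)
      then show "cmod (g s) \<le> A / (k * Gf n \<xi> t) * (k * exp (- k * (t - s)))"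
        using k0 gp \<alpha> by (simp add: g_def norm_mult norm_divide abs_mult A_def mult_ac)
    qed (use t in auto)
    also have "... \<le> A / (k * Gf n \<xi> t)"
      using A0 k0 Gf_pos[OF n, of \<xi> t] by simp
    finally have "cmod (integral {0..t} g) \<le> A / (k * Gf n \<xi> t)" by simp
    then have "Gf n \<xi> t * cmod (integral {0..t} g) \<le> Gf n \<xi> t * (A / (k * Gf n \<xi> t))"
      using Gf_pos[OF n, of \<xi> t] by (intro mult_left_mono) auto
    also have "... = A / k" using Gf_pos[OF n, of \<xi> t] by simp
    finally have J: "cmod (Jop 0 n \<xi> f t) \<le> A / k"
      using n Gf_pos[OF n, of \<xi> t] by (simp add: Jop_def norm_mult g_def[abs_def])
    have Ak: "A / k = \<alpha> / \<kappa> * exp T * y / \<bar>real_of_int n\<bar>"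
    proof -
      have sq: "(real_of_int n)\<^sup>2 = \<bar>real_of_int n\<bar> * \<bar>real_of_int n\<bar>" by (simp add: power2_eq_square)
      show ?thesis unfolding A_def k_def sq by (rule cancel_abs) (use n1 \<kappa> in auto)
    qed
    have "A / k \<le> \<alpha> / \<kappa> * exp T * y"
      unfolding Ak by (rule div_le_self) (use n1 \<alpha> \<kappa> y0 in auto)
    then have J2: "cmod (Jop 0 n \<xi> f t) \<le> \<alpha> / \<kappa> * exp T * y" using J by linarith
    have "\<alpha> * \<bar>real_of_int n\<bar> * cmod (Jop 0 n \<xi> f t) \<le> \<alpha> * \<bar>real_of_int n\<bar> * (A / k)"
      using \<alpha> by (intro mult_left_mono J) auto
    also have "... = \<alpha>\<^sup>2 / \<kappa> * exp T * y" unfolding Ak using n by (simp add: power2_eq_square)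
    finally show ?thesis using J2 \<alpha> by (simp add: norm_mult abs_mult)
  qed
  then show "cmod (\<i> * of_real (\<alpha> * real_of_int n) * Jop 0 n \<xi> f t) \<le> \<alpha>\<^sup>2 / \<kappa> * exp T * y"
    "cmod (Jop 0 n \<xi> f t) \<le> \<alpha> / \<kappa> * exp T * y" by auto
qed

lemma Rop_bound:
  assumes w: "\<And>m. continuous_on {0..} (w m)" and w0: "w 0 t = 0" and t: "0 \<le> t" "t \<le> T"
    and y: "\<And>m s. 0 \<le> s \<Longrightarrow> s \<le> t \<Longrightarrow> cmod (w m s) \<le> y m"
  shows "cmod (Rop (\<lambda>_. 0) \<xi> w n t) \<le> (\<alpha>\<^sup>2 / \<kappa> * exp T + c * (1 + T\<^sup>2)) * nbsum y n"
proof -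
  have y0: "0 \<le> y m" for m using y[of 0 m] t norm_ge_zero order_trans by blast
  have q: "qq m \<xi> t \<le> c * (1 + T\<^sup>2)" for m by (rule qq_le) (use t in auto)
  have "cmod (coup (\<lambda>m. w m t) n \<xi> t) \<le> qq (n - 1) \<xi> t * cmod (w (n - 1) t) + qq (n + 1) \<xi> t * cmod (w (n + 1) t)"
    by (rule coup_le) (rule w0)
  also have "... \<le> c * (1 + T\<^sup>2) * y (n - 1) + c * (1 + T\<^sup>2) * y (n + 1)"
    using t c by (intro add_mono mult_mono q y) auto
  also have "... \<le> c * (1 + T\<^sup>2) * nbsum y n"
    using c y0[of n] by (simp add: nbsum_def distrib_left)
  finally have 1: "cmod (coup (\<lambda>m. w m t) n \<xi> t) \<le> c * (1 + T\<^sup>2) * nbsum y n" .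
  have "cmod (\<i> * of_real (\<alpha> * real_of_int n) * Jop 0 n \<xi> (w n) t) \<le> \<alpha>\<^sup>2 / \<kappa> * exp T * y n"
    by (rule Jop_bound(1)[OF w t]) (rule y)
  also have "... \<le> \<alpha>\<^sup>2 / \<kappa> * exp T * nbsum y n"
    using y0 \<kappa> by (intro mult_left_mono) (auto simp: nbsum_def)
  finally have 2: "cmod (\<i> * of_real (\<alpha> * real_of_int n) * Jop 0 n \<xi> (w n) t) \<le> \<alpha>\<^sup>2 / \<kappa> * exp T * nbsum y n" .
  show ?thesis
    unfolding Rop_def using norm_triangle_le[OF add_mono[OF 2 1]] by (simp only: distrib_right)
qed

text \<open>\<open>Rop\<close> is affine in the vorticity and the initial current is its
  inhomogeneity, which cancels in differences.\<close>

lemma Rop_diff: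
  assumes w: "\<And>m. continuous_on {0..} (w m)" and v: "\<And>m. continuous_on {0..} (v m)"
  shows "Rop j \<xi> w n t - Rop j \<xi> v n t = Rop (\<lambda>_. 0) \<xi> (\<lambda>m s. w m s - v m s) n t"
proof (cases "n = 0")
  case n: False
  have "(\<lambda>s. \<i> * of_real (\<alpha> * real_of_int n) * f s / of_real (Gf n \<xi> s)) integrable_on {0..t}" if "continuous_on {0..} f" for f
    by (rule integrable_continuous_real[OF continuous_on_subset[OF Jop_integrand_continuous[OF n that]]]) auto
  from Henstock_Kurzweil_Integration.integral_diff[OF this[OF w[of n]] this[OF v[of n]]]
  have e: "integral {0..t} (\<lambda>s. \<i> * of_real (\<alpha> * real_of_int n) * (w n s - v n s) / of_real (Gf n \<xi> s)) =
      integral {0..t} (\<lambda>s. \<i> * of_real (\<alpha> * real_of_int n) * w n s / of_real (Gf n \<xi> s)) -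
      integral {0..t} (\<lambda>s. \<i> * of_real (\<alpha> * real_of_int n) * v n s / of_real (Gf n \<xi> s))"
    by (simp only: right_diff_distrib diff_divide_distrib)
  have "Jop (j n) n \<xi> (w n) t - Jop (j n) n \<xi> (v n) t = Jop 0 n \<xi> (\<lambda>s. w n s - v n s) t"
    unfolding Jop_def e if_not_P[OF n] by (simp only: distrib_left right_diff_distrib) simp
  then show ?thesis
    by (simp add: Rop_def coup_def algebra_simps diff_divide_distrib)
qed (simp add: Rop_0)

end

context mhd begin

lemma Gf_measurable [measurable]: "(\<lambda>\<xi>. Gf n \<xi> t) \<in> borel_measurable borel"
  unfolding Gf_def Th_def psym_def by measurable

lemma psym_measurable [measurable]: "(\<lambda>\<xi>. psym n \<xi> t) \<in> borel_measurable borel"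
  unfolding psym_def by measurable

lemma Jop_measurable:
  assumes j: "j \<in> borel_measurable borel" and m: "\<And>s. 0 \<le> s \<Longrightarrow> (\<lambda>\<xi>. f \<xi> s) \<in> borel_measurable borel"
    and cont: "\<And>\<xi>. continuous_on {0..} (f \<xi>)"
  shows "(\<lambda>\<xi>. Jop (j \<xi>) n \<xi> (f \<xi>) t) \<in> borel_measurable borel"
proof (cases "n = 0")
  case False
  note j[measurable]
  have [measurable]: "(\<lambda>\<xi>. integral {0..t} (\<lambda>s. \<i> * of_real (\<alpha> * real_of_int n) * f \<xi> s / of_real (Gf n \<xi> s))) \<in> borel_measurable borel"
  proof (rule integral_from_0_measurable)
    fix s :: real assume s: "0 \<le> s"
    note m[OF s, measurable]
    show "(\<lambda>\<xi>. \<i> * of_real (\<alpha> * real_of_int n) * f \<xi> s / of_real (Gf n \<xi> s)) \<in> borel_measurable borel" by measurable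
  qed (rule Jop_integrand_continuous[OF False cont])
  show ?thesis unfolding Jop_def if_not_P[OF False] by measurable
qed (simp add: Jop_def)

lemma picard_measurable:
  assumes w0: "\<And>n. w0 n \<in> borel_measurable borel" and j0: "\<And>n. j0 n \<in> borel_measurable borel"
    and z: "\<And>\<xi>. w0 0 \<xi> = 0"
  shows "(\<lambda>\<xi>. picard (\<lambda>n. w0 n \<xi>) (\<lambda>n. j0 n \<xi>) \<xi> i n t) \<in> borel_measurable borel"
proof (induction i arbitrary: n t)
  case (Suc i)
  note w0[measurable] Suc[measurable]
  have cont: "continuous_on {0..} (picard (\<lambda>n. w0 n \<xi>) (\<lambda>n. j0 n \<xi>) \<xi> i n)" for \<xi> n by (rule picard_continuous) (rule z)
  have [measurable]: "(\<lambda>\<xi>. integral {0..t} (\<lambda>s. Rop (\<lambda>n. j0 n \<xi>) \<xi> (picard (\<lambda>n. w0 n \<xi>) (\<lambda>n. j0 n \<xi>) \<xi> i) n s)) \<in> borel_measurable borel"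
  proof (rule integral_from_0_measurable)
    fix s :: real
    have [measurable]: "(\<lambda>\<xi>. Jop (j0 n \<xi>) n \<xi> (picard (\<lambda>n. w0 n \<xi>) (\<lambda>n. j0 n \<xi>) \<xi> i n) s) \<in> borel_measurable borel"
      by (rule Jop_measurable[OF j0 _ cont]) measurable
    show "(\<lambda>\<xi>. Rop (\<lambda>n. j0 n \<xi>) \<xi> (picard (\<lambda>n. w0 n \<xi>) (\<lambda>n. j0 n \<xi>) \<xi> i) n s) \<in> borel_measurable borel"
      unfolding Rop_def coup_def by (cases "n = 0") simp_all
  next
    show "continuous_on {0..} (\<lambda>s. Rop (\<lambda>n. j0 n \<xi>) \<xi> (picard (\<lambda>n. w0 n \<xi>) (\<lambda>n. j0 n \<xi>) \<xi> i) n s)" for \<xi>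
      by (rule Rop_continuous[OF cont]) (rule picard_0, rule z)
  qed
  show ?case by simp
qed simp

definition sol :: "(int \<Rightarrow> complex) \<Rightarrow> (int \<Rightarrow> complex) \<Rightarrow> real \<Rightarrow> int \<Rightarrow> real \<Rightarrow> complex" where
  "sol w0 j0 \<xi> n t = lim (\<lambda>i. picard w0 j0 \<xi> i n t)"

context
  fixes w0 j0 :: "int \<Rightarrow> complex" and \<xi> A T :: real
  assumes z: "w0 0 = 0" and A: "\<And>n. cmod (w0 n) \<le> A" "\<And>n. cmod (j0 n) \<le> A" and T: "0 \<le> T"
begin

abbreviation (input) "P \<equiv> picard w0 j0 \<xi>"

definition MT where "MT = \<alpha>\<^sup>2 / \<kappa> * exp T + c * (1 + T\<^sup>2)"

text \<open>Bounds the first iterate: the initial vorticity, and what the decaying initial current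
  feeds into it, namely \<alpha> n integrated at rate \<kappa> n^2.\<close>

definition at0 where "at0 n = cmod (w0 n) + \<alpha> / \<kappa> * exp T * cmod (j0 n)"

lemma MT_nonneg: "0 \<le> MT" using \<alpha> \<kappa> c by (simp add: MT_def)

lemma P_cont: "continuous_on {0..} (P i n)" by (rule picard_continuous[where ?w0.0=w0, OF z])

text \<open>Every iteration costs one neighbour sum, one factor \<open>MT\<close> and one
  integration in time, whence the exponential series. In the first difference only the initial data
  appear, because the zeroth iterate is zero.\<close>

lemma P_diff_bound:
  assumes t: "0 \<le> t" "t \<le> T"
  shows "cmod (P (Suc i) n t - P i n t) \<le> (MT * t) ^ i / fact i * (nbsum ^^ i) at0 n"
  using t
proof (induction i arbitrary: n t)
  case 0
  let ?r = "Rop j0 \<xi> (\<lambda>n t. 0) n"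
  have r: "?r s = \<i> * of_real (\<alpha> * real_of_int n) * Jop (j0 n) n \<xi> (\<lambda>t. 0) s" for s
    by (simp add: Rop_def coup_def)
  have P0: "P 0 = (\<lambda>n t. 0)" by (simp add: fun_eq_iff)
  have P1: "P (Suc 0) n t - P 0 n t = w0 n + integral {0..t} ?r" by (simp add: P0)
  have "cmod (integral {0..t} ?r) \<le> \<alpha> / \<kappa> * exp T * cmod (j0 n)"
  proof (cases "n = 0")
    case True
    then show ?thesis using \<alpha> \<kappa> by (simp add: Rop_0[abs_def])
  next
    case n: False
    define k where "k = \<kappa> * (real_of_int n)\<^sup>2"
    have n1: "1 \<le> \<bar>real_of_int n\<bar>" using n by (simp flip: of_int_abs)
    then have "1 \<le> (real_of_int n)\<^sup>2" using power_mono[of 1 "\<bar>real_of_int n\<bar>" 2] by simp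
    then have k0: "0 < k" using \<kappa> unfolding k_def by (intro mult_pos_pos) linarith+
    define B where "B = \<alpha> * \<bar>real_of_int n\<bar> * exp T * cmod (j0 n)"
    have B0: "0 \<le> B" using \<alpha> by (simp add: B_def)
    have rc: "continuous_on {0..} ?r" by (rule Rop_continuous) auto
    have "cmod (integral {0..t} ?r - integral {0..0} ?r) \<le> - (B / k) * exp (- k * t) - (- (B / k) * exp (- k * 0))"
    proof (rule deriv_compare_norm[where f'="?r" and g'="\<lambda>s. B * exp (- k * s)"])
      fix s assume s: "s \<in> {0..t}"
      show "((\<lambda>t. integral {0..t} ?r) has_vector_derivative ?r s) (at s within {0..})"
        by (rule integral_from_0_has_derivative[OF rc]) (use s in auto)
      show "((\<lambda>s. - (B / k) * exp (- k * s)) has_real_derivative B * exp (- k * s)) (at s within {0..})"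
        using k0 by (auto intro!: derivative_eq_intros)
      have "Gf n \<xi> s / Gf n \<xi> 0 \<le> exp ((1 - k) * (s - 0))" unfolding k_def by (rule Gf_ratio[OF n]) (use s in auto)
      also have "... = exp s * exp (- k * s)" by (simp add: exp_add[symmetric] algebra_simps)
      also have "... \<le> exp T * exp (- k * s)" using s 0 by (intro mult_right_mono) auto
      finally have "(\<alpha> * \<bar>real_of_int n\<bar> * cmod (j0 n)) * (Gf n \<xi> s / Gf n \<xi> 0) \<le> (\<alpha> * \<bar>real_of_int n\<bar> * cmod (j0 n)) * (exp T * exp (- k * s))"
        using \<alpha> by (intro mult_left_mono) auto
      then show "cmod (?r s) \<le> B * exp (- k * s)"
        using n Gf_pos[OF n, of \<xi>] \<alpha> by (simp add: r Jop_def norm_mult norm_divide abs_mult B_def mult_ac less_imp_le)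
    qed (use 0 in auto)
    also have "... \<le> B / k" using B0 k0 by simp
    also have "B / k = \<alpha> / \<kappa> * exp T * cmod (j0 n) / \<bar>real_of_int n\<bar>"
    proof -
      have sq: "(real_of_int n)\<^sup>2 = \<bar>real_of_int n\<bar> * \<bar>real_of_int n\<bar>" by (simp add: power2_eq_square)
      show ?thesis unfolding B_def k_def sq by (rule cancel_abs) (use n1 \<kappa> in auto)
    qed
    also have "... \<le> \<alpha> / \<kappa> * exp T * cmod (j0 n)"
      by (rule div_le_self) (use n1 \<alpha> \<kappa> in auto)
    finally show ?thesis by simp
  qed
  then have "cmod (P (Suc 0) n t - P 0 n t) \<le> cmod (w0 n) + \<alpha> / \<kappa> * exp T * cmod (j0 n)"
    unfolding P1 by (intro norm_triangle_le) simp
  then show ?case by (simp add: at0_def)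
next
  case (Suc i)
  let ?d = "\<lambda>m s. P (Suc i) m s - P i m s"
  have dc: "continuous_on {0..} (?d m)" for m by (intro continuous_intros P_cont)
  have d0: "?d 0 s = 0" for s by (simp only: picard_0[where ?w0.0=w0, OF z]) simp
  have rc: "continuous_on {0..} (Rop j0 \<xi> (P i) n)" for i
    by (rule Rop_continuous[OF P_cont]) (rule picard_0[where ?w0.0=w0, OF z])
  have "P (Suc (Suc i)) n s - P (Suc i) n s = integral {0..s} (Rop j0 \<xi> (P (Suc i)) n) - integral {0..s} (Rop j0 \<xi> (P i) n)" for s
    by (simp only: picard.simps) simp
  then have eq: "(\<lambda>s. P (Suc (Suc i)) n s - P (Suc i) n s) = (\<lambda>s. integral {0..s} (Rop j0 \<xi> (P (Suc i)) n) - integral {0..s} (Rop j0 \<xi> (P i) n))"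
    by (rule ext)
  define g where "g s = (MT * s) ^ Suc i / fact (Suc i) * (nbsum ^^ Suc i) at0 n" for s
  have "cmod ((\<lambda>s. P (Suc (Suc i)) n s - P (Suc i) n s) t - (\<lambda>s. P (Suc (Suc i)) n s - P (Suc i) n s) 0) \<le> g t - g 0"
  proof (rule deriv_compare_norm[where f'="\<lambda>s. Rop (\<lambda>_. 0) \<xi> ?d n s" and g'="\<lambda>s. MT * ((MT * s) ^ i / fact i) * (nbsum ^^ Suc i) at0 n"])
    fix s assume s: "s \<in> {0..t}"
    have "((\<lambda>s. integral {0..s} (Rop j0 \<xi> (P (Suc i)) n) - integral {0..s} (Rop j0 \<xi> (P i) n)) has_vector_derivative
        Rop j0 \<xi> (P (Suc i)) n s - Rop j0 \<xi> (P i) n s) (at s within {0..})"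
      by (intro has_vector_derivative_diff integral_from_0_has_derivative rc) (use s in auto)
    then show "((\<lambda>s. P (Suc (Suc i)) n s - P (Suc i) n s) has_vector_derivative Rop (\<lambda>_. 0) \<xi> ?d n s) (at s within {0..})"
      unfolding eq by (subst Rop_diff[symmetric, OF P_cont P_cont])
    show "(g has_real_derivative MT * ((MT * s) ^ i / fact i) * (nbsum ^^ Suc i) at0 n) (at s within {0..})"
      unfolding g_def[abs_def] by (intro DERIV_cmult_right power_fact_has_derivative)
    have nb: "0 \<le> (nbsum ^^ i) at0 m" for m
      by (rule nbsum_iter_nonneg) (use \<alpha> \<kappa> in \<open>simp add: at0_def\<close>)
    have "cmod (Rop (\<lambda>_. 0) \<xi> ?d n s) \<le> MT * nbsum (\<lambda>m. (MT * s) ^ i / fact i * (nbsum ^^ i) at0 m) n"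
      unfolding MT_def
    proof (rule Rop_bound[where w="?d"])
      show "continuous_on {0..} (?d m)" for m by (rule dc)
      show "?d 0 s = 0" by (rule d0)
      fix m r assume r: "0 \<le> r" "r \<le> s"
      have "cmod (?d m r) \<le> (MT * r) ^ i / fact i * (nbsum ^^ i) at0 m"
        using Suc.IH[of r m] r s Suc.prems by auto
      also have "... \<le> (MT * s) ^ i / fact i * (nbsum ^^ i) at0 m"
        using r MT_nonneg nb by (intro mult_right_mono divide_right_mono power_mono mult_left_mono) auto
      finally show "cmod (?d m r) \<le> ((\<alpha>\<^sup>2 / \<kappa> * exp T + c * (1 + T\<^sup>2)) * s) ^ i / fact i * (nbsum ^^ i) at0 m"
        unfolding MT_def .
    qed (use s Suc.prems in auto)
    also have "... = MT * ((MT * s) ^ i / fact i) * (nbsum ^^ Suc i) at0 n"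
      by (simp add: nbsum_def algebra_simps)
    finally show "cmod (Rop (\<lambda>_. 0) \<xi> ?d n s) \<le> MT * ((MT * s) ^ i / fact i) * (nbsum ^^ Suc i) at0 n" .
  qed (use Suc.prems in auto)
  moreover have "P (Suc (Suc i)) n 0 - P (Suc i) n 0 = 0" by simp
  moreover have "g 0 = 0" by (simp add: g_def)
  ultimately show ?case unfolding g_def by simp
qed

definition Ab where "Ab = A * (1 + \<alpha> / \<kappa> * exp T)"

definition bt where "bt i = Ab * ((3 * MT * T) ^ i / fact i)"

lemma A_nonneg: "0 \<le> A" using A(1)[of 0] norm_ge_zero order_trans by blast

lemma Ab_nonneg: "0 \<le> Ab" using A_nonneg \<alpha> \<kappa> by (simp add: Ab_def)

lemma bt_nonneg: "0 \<le> bt i" using Ab_nonneg MT_nonneg T by (simp add: bt_def)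

lemma bt_summable: "summable bt"
  unfolding bt_def using summable_exp[of "3 * MT * T"]
  by (intro summable_mult) (simp add: divide_inverse mult.commute)

lemma P_diff_bt:
  assumes t: "0 \<le> t" "t \<le> T"
  shows "cmod (P (Suc i) n t - P i n t) \<le> bt i"
proof -
  have a: "at0 n \<le> Ab" for n
  proof -
    have "\<alpha> / \<kappa> * exp T * cmod (j0 n) \<le> \<alpha> / \<kappa> * exp T * A" using \<alpha> \<kappa> by (intro mult_left_mono A) auto
    then show ?thesis using A(1)[of n] by (simp add: at0_def Ab_def algebra_simps)
  qed
  have "cmod (P (Suc i) n t - P i n t) \<le> (MT * t) ^ i / fact i * (nbsum ^^ i) at0 n" by (rule P_diff_bound[OF t])
  also have "... \<le> (MT * T) ^ i / fact i * (3 ^ i * Ab)"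
    using t MT_nonneg by (intro mult_mono nbsum_iter_le a divide_right_mono power_mono mult_left_mono nbsum_iter_nonneg)
      (use \<alpha> \<kappa> in \<open>auto simp: at0_def\<close>)
  also have "... = bt i" by (simp add: bt_def power_mult_distrib)
  finally show ?thesis .
qed

definition tl where "tl i = (\<Sum>j. bt (j + i))"

lemma tl_tendsto: "tl \<longlonglongrightarrow> 0"
  unfolding tl_def by (rule suminf_exist_split2[OF bt_summable])

text \<open>The error \<open>tl i\<close> depends neither on the mode nor on the time in [0, T].
  This uniformity is what allows passing to the limit inside the coupled equation in
  \<open>sol_fixed_point\<close>.\<close>

lemma P_sol:
  assumes t: "0 \<le> t" "t \<le> T"
  shows "(\<lambda>i. P i n t) \<longlonglongrightarrow> sol w0 j0 \<xi> n t" "cmod (sol w0 j0 \<xi> n t - P i n t) \<le> tl i"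
proof -
  have "summable (\<lambda>i. P (Suc i) n t - P i n t)"
    by (rule summable_comparison_test'[OF bt_summable, of 0]) (rule P_diff_bt[OF t])
  then have "convergent (\<lambda>m. \<Sum>i<m. P (Suc i) n t - P i n t)" by (simp add: summable_iff_convergent)
  then have "convergent (\<lambda>m. P m n t)"
    unfolding sum_lessThan_telescope[of "\<lambda>i. P i n t"] by simp
  then show lim: "(\<lambda>i. P i n t) \<longlonglongrightarrow> sol w0 j0 \<xi> n t"
    by (simp add: sol_def convergent_LIMSEQ_iff)
  have le: "cmod (P (m + i) n t - P i n t) \<le> tl i" for m
  proof -
    have "P (m + i) n t - P i n t = (\<Sum>j<m. P (Suc (j + i)) n t - P (j + i) n t)"
      using sum_lessThan_telescope[of "\<lambda>j. P (j + i) n t" m] by simp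
    then have "cmod (P (m + i) n t - P i n t) \<le> (\<Sum>j<m. bt (j + i))"
      by (simp only:) (intro order_trans[OF norm_sum] sum_mono P_diff_bt t)
    also have "... \<le> tl i"
      unfolding tl_def by (rule sum_le_suminf) (use bt_summable bt_nonneg in \<open>auto simp: summable_iff_shift\<close>)
    finally show ?thesis .
  qed
  have "(\<lambda>m. cmod (P (m + i) n t - P i n t)) \<longlonglongrightarrow> cmod (sol w0 j0 \<xi> n t - P i n t)"
    by (intro tendsto_intros LIMSEQ_ignore_initial_segment lim)
  then show "cmod (sol w0 j0 \<xi> n t - P i n t) \<le> tl i"
    by (rule LIMSEQ_le_const2) (use le in auto)
qed

lemma sol_bound: "0 \<le> t \<Longrightarrow> t \<le> T \<Longrightarrow> cmod (sol w0 j0 \<xi> n t) \<le> tl 0"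
  using P_sol(2)[of t n 0] by simp

lemma sol_continuous_T: "continuous_on {0..T} (sol w0 j0 \<xi> n)"
proof (rule uniform_limit_theorem)
  show "\<forall>\<^sub>F i in sequentially. continuous_on {0..T} (P i n)"
    by (intro always_eventually allI continuous_on_subset[OF P_cont]) auto
  show "uniform_limit {0..T} (\<lambda>i. P i n) (sol w0 j0 \<xi> n) sequentially"
  proof (rule uniform_limitI)
    fix e :: real assume "0 < e"
    then have "\<forall>\<^sub>F i in sequentially. tl i < e" using tl_tendsto by (intro order_tendstoD(2)) auto
    then show "\<forall>\<^sub>F i in sequentially. \<forall>t\<in>{0..T}. dist (P i n t) (sol w0 j0 \<xi> n t) < e"
    proof eventually_elim
      fix i assume "tl i < e"
      then show "\<forall>t\<in>{0..T}. dist (P i n t) (sol w0 j0 \<xi> n t) < e"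
        using P_sol(2)[of _ n i] by (force simp: dist_norm norm_minus_commute)
    qed
  qed
qed simp

end

context
  fixes w0 j0 :: "int \<Rightarrow> complex" and \<xi> A :: real
  assumes z: "w0 0 = 0" and A: "\<And>n. cmod (w0 n) \<le> A" "\<And>n. cmod (j0 n) \<le> A"
begin

lemma sol_continuous: "continuous_on {0..} (sol w0 j0 \<xi> n)"
  unfolding continuous_on_eq_continuous_within
proof
  fix t :: real assume t: "t \<in> {0..}"
  have "continuous (at t within {0..t + 1}) (sol w0 j0 \<xi> n)"
    using sol_continuous_T[where ?w0.0=w0 and ?j0.0=j0, OF z A, of "t + 1" \<xi> n] t by (simp add: continuous_on_eq_continuous_within)
  moreover have "at t within {0..t + 1} = at t within {0..}"
    by (rule at_within_nhd[where S="{..<t + 1}"]) (use t in auto)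
  ultimately show "continuous (at t within {0..}) (sol w0 j0 \<xi> n)" by (simp add: continuous_within)
qed

lemma sol_0: "sol w0 j0 \<xi> 0 t = 0"
  unfolding sol_def by (simp add: picard_0[where ?w0.0=w0, OF z])

lemma sol_fixed_point:
  assumes t: "0 \<le> t"
  shows "sol w0 j0 \<xi> n t = w0 n + integral {0..t} (Rop j0 \<xi> (sol w0 j0 \<xi>) n)"
proof -
  let ?s = "sol w0 j0 \<xi>" and ?P = "picard w0 j0 \<xi>"
  note fact = z A t
  note L = tl_tendsto[where ?w0.0=w0 and ?j0.0=j0 and T=t and A=A, OF z A t]
  define M where "M = MT t"
  let ?tl = "tl A t"
  have Pc: "continuous_on {0..} (?P i m)" for i m by (rule picard_continuous[where ?w0.0=w0, OF z])
  have rcP: "continuous_on {0..} (Rop j0 \<xi> (?P i) n)" for i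
    by (rule Rop_continuous[OF Pc]) (rule picard_0[where ?w0.0=w0, OF z])
  have rcs: "continuous_on {0..} (Rop j0 \<xi> ?s n)"
    by (rule Rop_continuous[OF sol_continuous]) (rule sol_0)
  have le: "cmod (?P (Suc i) n t - (w0 n + integral {0..t} (Rop j0 \<xi> ?s n))) \<le> 3 * M * ?tl i * t" for i
  proof -
    let ?d = "\<lambda>m s. ?P i m s - ?s m s"
    let ?F = "\<lambda>r. integral {0..r} (Rop j0 \<xi> (?P i) n) - integral {0..r} (Rop j0 \<xi> ?s n)"
    have "cmod (?F t - ?F 0) \<le> 3 * M * ?tl i * t - 3 * M * ?tl i * 0"
    proof (rule deriv_compare_norm[where f'="\<lambda>s. Rop (\<lambda>_. 0) \<xi> ?d n s" and g'="\<lambda>s. 3 * M * ?tl i"])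
      fix s assume s: "s \<in> {0..t}"
      have "(?F has_vector_derivative Rop j0 \<xi> (?P i) n s - Rop j0 \<xi> ?s n s) (at s within {0..})"
        by (intro has_vector_derivative_diff integral_from_0_has_derivative rcP rcs) (use s in auto)
      then show "(?F has_vector_derivative Rop (\<lambda>_. 0) \<xi> ?d n s) (at s within {0..})"
        by (subst Rop_diff[symmetric, OF Pc sol_continuous])
      show "((\<lambda>s. 3 * M * ?tl i * s) has_real_derivative 3 * M * ?tl i) (at s within {0..})"
        by (auto intro!: derivative_eq_intros)
      have "cmod (Rop (\<lambda>_. 0) \<xi> ?d n s) \<le> (\<alpha>\<^sup>2 / \<kappa> * exp t + c * (1 + t\<^sup>2)) * nbsum (\<lambda>m. ?tl i) n"
      proof (rule Rop_bound)
        show "continuous_on {0..} (?d m)" for m by (intro continuous_intros Pc sol_continuous)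
        show "?d 0 s = 0" by (simp add: picard_0[where ?w0.0=w0, OF z] sol_0)
        show "cmod (?d m r) \<le> ?tl i" if "0 \<le> r" "r \<le> s" for m r
        proof -
          have "cmod (?s m r - ?P i m r) \<le> ?tl i"
            by (rule P_sol(2)[where ?w0.0=w0 and ?j0.0=j0 and T=t, OF z A t]) (use that s in auto)
          then show ?thesis by (subst norm_minus_commute)
        qed
      qed (use s in auto)
      also have "... = 3 * M * ?tl i" by (simp add: nbsum_def M_def MT_def[where ?w0.0=w0 and ?j0.0=j0 and A=A, OF z A t])
      finally show "cmod (Rop (\<lambda>_. 0) \<xi> ?d n s) \<le> 3 * M * ?tl i" .
    qed (use t in auto)
    then show ?thesis by simp
  qed
  have "(\<lambda>i. 3 * M * ?tl i * t) \<longlonglongrightarrow> 3 * M * 0 * t" by (intro tendsto_mult tendsto_const L)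
  then have l0: "(\<lambda>i. 3 * M * ?tl i * t) \<longlonglongrightarrow> 0" by (simp only: mult_zero_right mult_zero_left)
  have l1: "(\<lambda>i. ?P (Suc i) n t - (w0 n + integral {0..t} (Rop j0 \<xi> ?s n))) \<longlonglongrightarrow> 0"
    by (rule Lim_null_comparison[OF always_eventually l0]) (intro allI le)
  have "(\<lambda>i. ?P (Suc i) n t) \<longlonglongrightarrow> ?s n t"
    by (rule LIMSEQ_Suc) (rule P_sol(1)[where ?w0.0=w0 and ?j0.0=j0 and T=t, OF z A t t order_refl])
  then have "(\<lambda>i. ?P (Suc i) n t - (w0 n + integral {0..t} (Rop j0 \<xi> ?s n))) \<longlonglongrightarrow> ?s n t - (w0 n + integral {0..t} (Rop j0 \<xi> ?s n))"
    by (intro tendsto_diff tendsto_const)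
  then have "?s n t - (w0 n + integral {0..t} (Rop j0 \<xi> ?s n)) = 0"
    by (rule LIMSEQ_unique) (rule l1)
  then show ?thesis by simp
qed

lemma sol_ode:
  "ode \<xi> (sol w0 j0 \<xi>) (\<lambda>n. Jop (j0 n) n \<xi> (sol w0 j0 \<xi> n))"
  unfolding ode_def
proof (intro allI impI conjI)
  fix n and t :: real assume t: "0 \<le> t"
  let ?s = "sol w0 j0 \<xi>"
  have rcs: "continuous_on {0..} (Rop j0 \<xi> ?s n)"
    by (rule Rop_continuous[OF sol_continuous]) (rule sol_0)
  have "((\<lambda>t. w0 n + integral {0..t} (Rop j0 \<xi> ?s n)) has_vector_derivative 0 + Rop j0 \<xi> ?s n t) (at t within {0..})"
    by (intro has_vector_derivative_add has_vector_derivative_const integral_from_0_has_derivative rcs t)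
  then have "(?s n has_vector_derivative 0 + Rop j0 \<xi> ?s n t) (at t within {0..})"
    by (rule has_vector_derivative_transform[rotated 2]) (use t sol_fixed_point in auto)
  then show "(?s n has_vector_derivative \<i> * of_real (\<alpha> * real_of_int n) * Jop (j0 n) n \<xi> (?s n) t + coup (\<lambda>m. ?s m t) n \<xi> t) (at t within {0..})"
    by (simp add: Rop_def)
  show "(Jop (j0 n) n \<xi> (?s n) has_vector_derivative - of_real (lam n \<xi> t) * Jop (j0 n) n \<xi> (?s n) t + \<i> * of_real (\<alpha> * real_of_int n) * ?s n t) (at t within {0..})"
    by (rule Jop_has_derivative[OF sol_continuous t])
qed

lemma sol_initial: "sol w0 j0 \<xi> n 0 = w0 n" "n \<noteq> 0 \<Longrightarrow> Jop (j0 n) n \<xi> f 0 = j0 n"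
proof -
  have "sol w0 j0 \<xi> n 0 = w0 n + integral {0..0} (Rop j0 \<xi> (sol w0 j0 \<xi>) n)" by (rule sol_fixed_point) simp
  moreover have "integral {0..0} f = 0" for f :: "real \<Rightarrow> complex"
    using integral_refl[of 0 f] by (simp only: cbox_interval)
  ultimately show "sol w0 j0 \<xi> n 0 = w0 n" by (simp only: add_0_right)
  assume "n \<noteq> 0"
  then show "Jop (j0 n) n \<xi> f 0 = j0 n" using Gf_pos[of n \<xi> 0] by (simp add: Jop_def)
qed

text \<open>Supplies the a priori bound from which \<open>energy_iter\<close> starts. The current
  splits into the propagated initial value and the response to the vorticity.\<close>

lemma sol_en_bounded:
  assumes T: "0 \<le> T"
  shows "\<exists>K. \<forall>n t. 0 \<le> t \<longrightarrow> t \<le> T \<longrightarrow> en (sol w0 j0 \<xi>) (\<lambda>n. Jop (j0 n) n \<xi> (sol w0 j0 \<xi> n)) n t \<le> K"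
proof -
  define B where "B = tl A T 0"
  have sb: "cmod (sol w0 j0 \<xi> n t) \<le> B" if "0 \<le> t" "t \<le> T" for n t
    unfolding B_def by (rule sol_bound[where ?w0.0=w0 and ?j0.0=j0, OF z A T that])
  have jb: "cmod (Jop (j0 n) n \<xi> (sol w0 j0 \<xi> n) t) \<le> exp T * A + \<alpha> / \<kappa> * exp T * B" if t: "0 \<le> t" "t \<le> T" for n t
  proof (cases "n = 0")
    case True
    have "0 \<le> A" "0 \<le> B" using A(1)[of 0] sb[of 0 0] T norm_ge_zero order_trans by blast+
    then show ?thesis using True \<alpha> \<kappa> by (simp add: Jop_def)
  next
    case n: False
    have G: "0 < Gf n \<xi> t" "0 < Gf n \<xi> 0" using Gf_pos[OF n] by auto
    have "Jop (j0 n) n \<xi> (sol w0 j0 \<xi> n) t = of_real (Gf n \<xi> t / Gf n \<xi> 0) * j0 n + Jop 0 n \<xi> (sol w0 j0 \<xi> n) t"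
      using n by (simp add: Jop_def algebra_simps)
    moreover have "cmod (of_real (Gf n \<xi> t / Gf n \<xi> 0) * j0 n) \<le> exp T * A"
    proof -
      have "Gf n \<xi> t / Gf n \<xi> 0 \<le> exp ((1 - \<kappa> * (real_of_int n)\<^sup>2) * (t - 0))" by (rule Gf_ratio[OF n]) (use t in auto)
      also have "... \<le> exp T"
      proof -
        have "(1 - \<kappa> * (real_of_int n)\<^sup>2) * (t - 0) \<le> 1 * t" using t \<kappa> by (intro mult_mono) auto
        then show ?thesis using t by simp
      qed
      finally have "Gf n \<xi> t / Gf n \<xi> 0 * cmod (j0 n) \<le> exp T * A" using G by (intro mult_mono A) auto
      then show ?thesis using G by (simp add: norm_mult norm_divide)
    qed
    moreover have "cmod (Jop 0 n \<xi> (sol w0 j0 \<xi> n) t) \<le> \<alpha> / \<kappa> * exp T * B"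
      by (rule Jop_bound(2)[OF sol_continuous t]) (use sb t in auto)
    ultimately show ?thesis by (simp add: norm_triangle_le)
  qed
  show ?thesis
  proof (intro exI allI impI)
    fix n t assume t: "0 \<le> t" "t \<le> T"
    show "en (sol w0 j0 \<xi>) (\<lambda>n. Jop (j0 n) n \<xi> (sol w0 j0 \<xi> n)) n t \<le> B\<^sup>2 + (exp T * A + \<alpha> / \<kappa> * exp T * B)\<^sup>2"
      unfolding en_def by (intro add_mono power_mono sb jb t) auto
  qed
qed

end

lemma ode_exists:
  assumes w0: "\<And>n. w0 n \<in> borel_measurable borel" and j0: "\<And>n. j0 n \<in> borel_measurable borel"
    and z: "\<And>\<xi>. w0 0 \<xi> = 0" "\<And>\<xi>. j0 0 \<xi> = 0"
  obtains W J :: "int \<Rightarrow> real \<Rightarrow> real \<Rightarrow> complex"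
  where "\<And>n t. W n t \<in> borel_measurable borel" "\<And>n t. J n t \<in> borel_measurable borel"
    "\<And>t \<xi>. W 0 t \<xi> = 0" "\<And>t \<xi>. J 0 t \<xi> = 0"
    "\<And>\<xi> A. (\<And>n. cmod (w0 n \<xi>) \<le> A) \<Longrightarrow> (\<And>n. cmod (j0 n \<xi>) \<le> A) \<Longrightarrow>
      ode_at W J \<xi> \<and> (\<forall>n. W n 0 \<xi> = w0 n \<xi> \<and> J n 0 \<xi> = j0 n \<xi>) \<and>
      modes_bounded W J \<xi>"
proof -
  \<comment> \<open>Bounding by a natural number makes this a countable union of measurable sets.
    Off \<open>good\<close> the data are replaced by zero, so the iteration converges at every
    frequency and its limit is measurable everywhere.\<close>
  define good where "good = {\<xi>. \<exists>A::nat. \<forall>n. cmod (w0 n \<xi>) \<le> real A \<and> cmod (j0 n \<xi>) \<le> real A}"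
  note w0[measurable] j0[measurable]
  have [measurable]: "good \<in> sets borel" unfolding good_def by measurable
  define w1 where "w1 n \<xi> = indicator good \<xi> * w0 n \<xi>" for n \<xi>
  define j1 where "j1 n \<xi> = indicator good \<xi> * j0 n \<xi>" for n \<xi>
  have [measurable]: "w1 n \<in> borel_measurable borel" "j1 n \<in> borel_measurable borel" for n
    unfolding w1_def j1_def by measurable
  have z1: "w1 0 \<xi> = 0" "j1 0 \<xi> = 0" for \<xi> using z by (simp_all add: w1_def j1_def)
  have bd: "\<exists>A. (\<forall>n. cmod (w1 n \<xi>) \<le> A) \<and> (\<forall>n. cmod (j1 n \<xi>) \<le> A)" for \<xi>
  proof (cases "\<xi> \<in> good")
    case True
    then show ?thesis by (auto simp: good_def w1_def j1_def)
  qed (auto simp: w1_def j1_def intro: exI[of _ 0])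
  define W where "W n t \<xi> = sol (\<lambda>n. w1 n \<xi>) (\<lambda>n. j1 n \<xi>) \<xi> n t" for n t \<xi>
  define J where "J n t \<xi> = Jop (j1 n \<xi>) n \<xi> (\<lambda>s. W n s \<xi>) t" for n t \<xi>
  have Wm [measurable]: "W n t \<in> borel_measurable borel" for n t
    unfolding W_def sol_def by (rule borel_measurable_lim_metric) (rule picard_measurable, use z1 in auto)
  have Wc: "continuous_on {0..} (\<lambda>s. W n s \<xi>)" for n \<xi>
    using bd[of \<xi>] sol_continuous[where ?w0.0="\<lambda>n. w1 n \<xi>" and ?j0.0="\<lambda>n. j1 n \<xi>" and \<xi>=\<xi> and n=n] z1 by (auto simp: W_def)
  show ?thesis
  proof (rule that[of W J])
    show "W n t \<in> borel_measurable borel" for n t by (rule Wm)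
    show "J n t \<in> borel_measurable borel" for n t
      unfolding J_def by (rule Jop_measurable[OF _ _ Wc]) measurable
    show "W 0 t \<xi> = 0" for t \<xi>
      using bd[of \<xi>] sol_0[where ?w0.0="\<lambda>n. w1 n \<xi>" and ?j0.0="\<lambda>n. j1 n \<xi>" and \<xi>=\<xi> and t=t] z1 by (auto simp: W_def)
    show "J 0 t \<xi> = 0" for t \<xi> by (simp add: J_def Jop_def)
    fix \<xi> A assume A: "\<And>n. cmod (w0 n \<xi>) \<le> A" "\<And>n. cmod (j0 n \<xi>) \<le> A"
    have "A \<le> real (nat \<lceil>A\<rceil>)" by linarith
    then have "\<xi> \<in> good" unfolding good_def using A by (blast intro: order_trans)
    then have eq: "w1 n \<xi> = w0 n \<xi>" "j1 n \<xi> = j0 n \<xi>" for n by (simp_all add: w1_def j1_def)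
    have z': "(\<lambda>n. w0 n \<xi>) 0 = 0" using z by simp
    note * = sol_ode[where ?w0.0="\<lambda>n. w0 n \<xi>" and A=A and ?j0.0="\<lambda>n. j0 n \<xi>" and \<xi>=\<xi>, OF z' A]
      sol_initial[where ?w0.0="\<lambda>n. w0 n \<xi>" and A=A and ?j0.0="\<lambda>n. j0 n \<xi>" and \<xi>=\<xi>, OF z' A]
      sol_en_bounded[where ?w0.0="\<lambda>n. w0 n \<xi>" and A=A and ?j0.0="\<lambda>n. j0 n \<xi>" and \<xi>=\<xi>, OF z' A]
    have j: "J n 0 \<xi> = j0 n \<xi>" for n
      using *(3)[of n] z(2) by (cases "n = 0") (auto simp: J_def eq Jop_def)
    show "ode_at W J \<xi> \<and> (\<forall>n. W n 0 \<xi> = w0 n \<xi> \<and> J n 0 \<xi> = j0 n \<xi>) \<and>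
      modes_bounded W J \<xi>"
    proof -
      have W: "W n t \<xi> = sol (\<lambda>n. w0 n \<xi>) (\<lambda>n. j0 n \<xi>) \<xi> n t" for n t
        unfolding W_def eq ..
      have J': "J n t \<xi> = Jop (j0 n \<xi>) n \<xi> (sol (\<lambda>n. w0 n \<xi>) (\<lambda>n. j0 n \<xi>) \<xi> n) t" for n t
        unfolding J_def W eq ..
      show ?thesis
      proof (intro conjI)
        show "ode_at W J \<xi>" unfolding W J' by (rule *(1))
        show "\<forall>n. W n 0 \<xi> = w0 n \<xi> \<and> J n 0 \<xi> = j0 n \<xi>" using j *(2) unfolding W by blast
        show "\<forall>T\<ge>0. \<exists>K. \<forall>n t. 0 \<le> t \<longrightarrow> t \<le> T \<longrightarrow> en_at W J \<xi> n t \<le> K"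
          unfolding W J' using *(4) by blast
      qed
    qed
  qed
qed

end

section \<open>Solutions and their Fourier modes\<close>

lemma has_fourier_cong_fun:
  assumes u: "u \<in> L2_cyl" and v: "v \<in> L2_cyl" and ae: "AE z in cyl. u z = v z" and U: "has_fourier u U"
  shows "has_fourier v U"
proof -
  note [measurable] = measurable_cyl
  have [measurable]: "u \<in> borel_measurable cyl" "v \<in> borel_measurable cyl" using u v by (auto simp: L2_cyl_iff)
  have "truncated_fourier R u k \<xi> = truncated_fourier R v k \<xi>" for R k \<xi>
    unfolding truncated_fourier_def
    by (intro arg_cong2[where f="(*)"] refl integral_cong_AE) (use ae in \<open>auto elim: eventually_mono\<close>)
  then show ?thesis using U unfolding has_fourier_sqn by simp
qed

text \<open>The sum over modes stands inside the frequency integral, the reverse of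
  \<open>gevrey_energy\<close>, because the equations are estimated one frequency at a time; the
  weight is left arbitrary.\<close>

definition mode_energy :: "(real \<Rightarrow> ennreal) \<Rightarrow> (int \<Rightarrow> real \<Rightarrow> complex) \<Rightarrow> (int \<Rightarrow> real \<Rightarrow> complex) \<Rightarrow> ennreal" where
  "mode_energy g W J = (\<integral>\<^sup>+\<xi>. g \<xi> * zsum (\<lambda>n. ennreal ((cmod (W n \<xi>))\<^sup>2 + (cmod (J n \<xi>))\<^sup>2)) \<partial>lborel)"

abbreviation gevrey_w :: "real \<Rightarrow> real \<Rightarrow> ennreal" where
  "gevrey_w C \<xi> \<equiv> ennreal (exp (C * sqrt \<bar>\<xi>\<bar>))"

lemma gevrey_energy_eq:
  assumes "w \<in> L2_cyl" "j \<in> L2_cyl" "has_fourier w W" "has_fourier j J"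
  shows "gevrey_energy C w j = mode_energy (\<lambda>\<xi>. gevrey_w C \<xi>) W J"
proof -
  have [measurable]: "W k \<in> borel_measurable borel" "J k \<in> borel_measurable borel" for k
    using assms by (auto simp: has_fourier_def)
  have "gevrey_energy C w j = zsum (\<lambda>k. \<integral>\<^sup>+\<xi>. gevrey_w C \<xi> * ennreal ((cmod (W k \<xi>))\<^sup>2 + (cmod (J k \<xi>))\<^sup>2) \<partial>lborel)"
    unfolding gevrey_energy_def
  proof (rule nn_integral_cong, rule nn_integral_cong_AE)
    fix k :: int
    show "AE \<xi> in lborel. ennreal (exp (C * sqrt \<bar>\<xi>\<bar>) * ((cmod (fourier w k \<xi>))\<^sup>2 + (cmod (fourier j k \<xi>))\<^sup>2)) =
        gevrey_w C \<xi> * ennreal ((cmod (W k \<xi>))\<^sup>2 + (cmod (J k \<xi>))\<^sup>2)"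
      using fourier_ae_eq[OF assms(1,3), of k] fourier_ae_eq[OF assms(2,4), of k]
      by eventually_elim (simp add: ennreal_mult)
  qed
  also have "... = mode_energy (\<lambda>\<xi>. gevrey_w C \<xi>) W J"
    unfolding mode_energy_def zsum_cmult[symmetric] by (rule zsum_swap[symmetric]) measurable
  finally show ?thesis .
qed

lemma sqn_eq_mode_energy:
  assumes [measurable]: "\<And>k. W k \<in> borel_measurable borel" "\<And>k. J k \<in> borel_measurable borel"
  shows "zsum (\<lambda>k. sqn lborel (W k)) + zsum (\<lambda>k. sqn lborel (J k)) = mode_energy (\<lambda>\<xi>. 1) W J"
proof -
  have "mode_energy (\<lambda>\<xi>. 1) W J = zsum (\<lambda>k. \<integral>\<^sup>+\<xi>. ennreal ((cmod (W k \<xi>))\<^sup>2 + (cmod (J k \<xi>))\<^sup>2) \<partial>lborel)"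
    unfolding mode_energy_def mult_1 by (rule zsum_swap) measurable
  also have "... = zsum (\<lambda>k. sqn lborel (W k) + sqn lborel (J k))"
    unfolding sqn_def by (simp add: nn_integral_add)
  finally show ?thesis by (simp add: zsum_add)
qed

text \<open>Continuity bounds the curve near each time, and Bolzano bisection glues the local
  bounds. The intersection with the half-line makes the local step meaningful also at negative
  points.\<close>

lemma L2_curve_bounded:
  fixes w :: "real \<Rightarrow> real \<times> real \<Rightarrow> real"
  assumes w: "\<And>t. 0 \<le> t \<Longrightarrow> w t \<in> L2_cyl"
    and cont: "\<And>t. 0 \<le> t \<Longrightarrow> ((\<lambda>\<tau>. L2_dist_sq (w \<tau>) (w t)) \<longlongrightarrow> 0) (at t within {0..})" and T: "0 \<le> T"
  shows "\<exists>B. \<forall>t\<in>{0..T}. sqn cyl (w t) \<le> ennreal B"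
proof -
  have "\<exists>B. \<forall>t\<in>{0..T} \<inter> {0..}. sqn cyl (w t) \<le> ennreal B"
    using T
  proof (induction rule: Bolzano[where P="\<lambda>a b :: real. \<exists>B. \<forall>t\<in>{a..b} \<inter> {0..}. sqn cyl (w t) \<le> ennreal B"])
    case (trans a b c)
    then obtain B1 B2 where B: "\<forall>t\<in>{a..b} \<inter> {0..}. sqn cyl (w t) \<le> ennreal B1" "\<forall>t\<in>{b..c} \<inter> {0..}. sqn cyl (w t) \<le> ennreal B2" by blast
    have "sqn cyl (w t) \<le> ennreal (max B1 B2)" if "t \<in> {a..c} \<inter> {0..}" for t
    proof (cases "t \<le> b")
      case True
      then have "sqn cyl (w t) \<le> ennreal B1" using B(1) that by auto
      then show ?thesis by (rule order_trans) (simp add: ennreal_leI)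
    next
      case False
      then have "sqn cyl (w t) \<le> ennreal B2" using B(2) that by auto
      then show ?thesis by (rule order_trans) (simp add: ennreal_leI)
    qed
    then show ?case by blast
  next
    case (local x)
    then have x: "0 \<le> x" by simp
    obtain b where b: "0 \<le> b" "sqn cyl (w x) = ennreal b"
      using w[OF x] by (cases "sqn cyl (w x)" rule: ennreal_cases) (auto simp: L2_cyl_iff)
    have "\<forall>\<^sub>F \<tau> in at x within {0..}. L2_dist_sq (w \<tau>) (w x) < 1" using cont[OF x] by (intro order_tendstoD(2)) auto
    then obtain d where d: "0 < d" "\<And>\<tau>. \<tau> \<in> {0..} \<Longrightarrow> \<tau> \<noteq> x \<Longrightarrow> dist \<tau> x < d \<Longrightarrow> L2_dist_sq (w \<tau>) (w x) < 1"
      unfolding eventually_at by blast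
    have *: "sqn cyl (w t) \<le> ennreal (2 + 2 * b)" if t: "0 \<le> t" "dist t x < d" for t
    proof (cases "t = x")
      case True
      have "ennreal b \<le> ennreal (2 + 2 * b)" using b by (intro ennreal_leI) simp
      then show ?thesis using True b(2) by (simp only:)
    next
      case False
      have "sqn cyl (w t) \<le> 2 * sqn cyl (\<lambda>z. w t z - w x z) + 2 * sqn cyl (w x)"
        by (rule sqn_le_of_diff) (use w t x in \<open>auto simp: L2_cyl_iff\<close>)
      also have "... \<le> 2 * 1 + 2 * sqn cyl (w x)"
        using d(2)[of t] t False by (intro add_mono mult_left_mono) (auto simp: L2_dist_sq_def sqn_def)
      also have "... = ennreal (2 + 2 * b)" using b by (simp add: ennreal_mult)
      finally show ?thesis .
    qed
    show ?case
    proof (rule exI[of _ d], intro conjI allI impI d(1))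
      fix a b' assume ab: "a \<le> x \<and> x \<le> b' \<and> b' - a < d"
      show "\<exists>B. \<forall>t\<in>{a..b'} \<inter> {0..}. sqn cyl (w t) \<le> ennreal B"
        by (rule exI[of _ "2 + 2 * b"], intro ballI *) (use ab in \<open>auto simp: dist_real_def\<close>)
    qed
  qed
  then show ?thesis by auto
qed

context mhd begin

lemma en_continuous: "ode \<xi> W J \<Longrightarrow> continuous_on {0..} (en W J n)"
  by (rule DERIV_continuous_on) (use en_has_derivative in auto)

lemma ode_continuous:
  assumes "ode \<xi> W J" shows "continuous_on {0..} (W n)" "continuous_on {0..} (J n)"
  by (rule has_vector_derivative_imp_continuous_on; use assms in \<open>auto simp: ode_def\<close>)+

text \<open>The growth of one mode is controlled by three neighbouring energies, and their time
  integral is at most three times that of the total energy. So integrability in time already gives a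
  bound uniform in the mode.\<close>

lemma en_bounded_of_integral:
  assumes o: "ode \<xi> W J" and w0: "W 0 0 = 0" and R: "0 \<le> R"
    and int: "(\<integral>\<^sup>+t. indicator {0..T} t * zsum (\<lambda>n. ennreal (en W J n t)) \<partial>lborel) \<le> ennreal R"
    and K0: "\<And>n. en W J n 0 \<le> K0" and t: "0 \<le> t" "t \<le> T"
  shows "en W J n t \<le> K0 + (2 * c * (1 + T\<^sup>2) + 2) * (3 * R)"
proof -
  define M where "M = 2 * c * (1 + T\<^sup>2) + 2"
  have M0: "0 \<le> M" using c by (simp add: M_def)
  define h where "h s = nbsum (\<lambda>m. en W J m s) n" for s
  have hc: "continuous_on {0..} h"
    unfolding h_def nbsum_def by (intro continuous_intros en_continuous[OF o])
  have h0: "0 \<le> h s" for s by (simp add: h_def nbsum_def en_nonneg)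
  have "en W J n t - en W J n 0 \<le> M * integral {0..t} h - M * integral {0..0} h"
  proof (rule deriv_compare[OF order_refl t(1)])
    fix s assume s: "s \<in> {0..t}"
    show "(en W J n has_real_derivative 2 * Re (cnj (W n s) * coup (\<lambda>m. W m s) n \<xi> s) - 2 * lam n \<xi> s * (cmod (J n s))\<^sup>2) (at s within {0..})"
      using en_has_derivative[OF o] s by simp
    have "((\<lambda>t. integral {0..t} h) has_real_derivative h s) (at s within {0..})"
      unfolding has_real_derivative_iff_has_vector_derivative
      by (rule integral_from_0_has_derivative[OF hc]) (use s in auto)
    then show "((\<lambda>t. M * integral {0..t} h) has_real_derivative M * h s) (at s within {0..})" by (rule DERIV_cmult)
    show "2 * Re (cnj (W n s) * coup (\<lambda>m. W m s) n \<xi> s) - 2 * lam n \<xi> s * (cmod (J n s))\<^sup>2 \<le> M * h s"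
      unfolding M_def h_def by (rule en_deriv_le[OF o w0]) (use s t in auto)
  qed
  moreover have "integral {0..0} h = 0" using integral_refl[of 0 h] by (simp only: cbox_interval)
  moreover have "integral {0..t} h \<le> 3 * R"
  proof -
    have si: "set_integrable lborel {0..t} h"
      by (rule borel_integrable_atLeastAtMost') (auto intro: continuous_on_subset[OF hc])
    have "ennreal (integral {0..t} h) = ennreal (LINT s|lborel. indicator {0..t} s * h s)"
      using set_borel_integral_eq_integral(2)[OF si] by (simp add: set_lebesgue_integral_def)
    also have "... = (\<integral>\<^sup>+s. ennreal (indicator {0..t} s * h s) \<partial>lborel)"
      using si h0 by (intro nn_integral_eq_integral[symmetric]) (auto simp: set_integrable_def)
    also have "... \<le> (\<integral>\<^sup>+s. 3 * (indicator {0..T} s * zsum (\<lambda>n. ennreal (en W J n s))) \<partial>lborel)"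
    proof (rule nn_integral_mono)
      fix s :: real
      have "ennreal (h s) = ennreal (en W J (n - 1) s) + ennreal (en W J n s) + ennreal (en W J (n + 1) s)"
        by (simp add: h_def nbsum_def en_nonneg)
      also have "... \<le> zsum (\<lambda>n. ennreal (en W J n s)) + zsum (\<lambda>n. ennreal (en W J n s)) + zsum (\<lambda>n. ennreal (en W J n s))"
        by (intro add_mono member_le_zsum[of "\<lambda>n. ennreal (en W J n s)"])
      also have "... = 3 * zsum (\<lambda>n. ennreal (en W J n s))"
      proof -
        have "(3::ennreal) = 1 + 1 + 1" by simp
        then show ?thesis by (simp only: distrib_right mult_1)
      qed
      finally show "ennreal (indicator {0..t} s * h s) \<le> 3 * (indicator {0..T} s * zsum (\<lambda>n. ennreal (en W J n s)))"
        using t by (auto simp: indicator_def)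
    qed
    also have "... \<le> 3 * ennreal R"
    proof -
      have [measurable]: "(\<lambda>s. indicator {0..T} s * ennreal (en W J n s)) \<in> borel_measurable borel" for n
      proof -
        have "(\<lambda>s. indicator {0..T} s *\<^sub>R en W J n s) \<in> borel_measurable borel"
          by (rule borel_measurable_continuous_on_indicator) (auto intro: continuous_on_subset[OF en_continuous[OF o]])
        then have [measurable]: "(\<lambda>s. indicator {0..T} s * en W J n s) \<in> borel_measurable borel" by simp
        have "(\<lambda>s. indicator {0..T} s * ennreal (en W J n s)) = (\<lambda>s. ennreal (indicator {0..T} s * en W J n s))"
          by (auto simp: indicator_def fun_eq_iff)
        then show ?thesis by simp
      qed
      have "(\<integral>\<^sup>+s. 3 * (indicator {0..T} s * zsum (\<lambda>n. ennreal (en W J n s))) \<partial>lborel) = 3 * (\<integral>\<^sup>+s. indicator {0..T} s * zsum (\<lambda>n. ennreal (en W J n s)) \<partial>lborel)"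
        unfolding zsum_cmult[symmetric] by (subst zsum_cmult, subst nn_integral_cmult) (auto intro!: zsum_measurable)
      also have "... \<le> 3 * ennreal R" by (intro mult_left_mono int) simp
      finally show ?thesis .
    qed
    also have "3 * ennreal R = ennreal (3 * R)" using R by (simp add: ennreal_mult)
    finally show ?thesis using R by simp
  qed
  then have "M * integral {0..t} h \<le> M * (3 * R)" by (rule mult_left_mono) (rule M0)
  ultimately show ?thesis using K0[of n] unfolding M_def by simp
qed

text \<open>Stands in for uniqueness by bringing every solution within reach of the energy estimate.
  L2 continuity bounds the total energy on [0, T], Fubini gives a finite time integral at almost
  every frequency, and \<open>en_bounded_of_integral\<close> turns this into a bound on all
  modes.\<close>

lemma solution_modes:
  assumes sol: "is_solution \<alpha> \<kappa> c w0 j0 w j"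
  obtains W J :: "int \<Rightarrow> real \<Rightarrow> real \<Rightarrow> complex" where
    "\<And>t. 0 \<le> t \<Longrightarrow> w t \<in> L2_cyl \<and> j t \<in> L2_cyl \<and> has_fourier (w t) (\<lambda>n. W n t) \<and> has_fourier (j t) (\<lambda>n. J n t)"
    "AE \<xi> in lborel. ode_at W J \<xi> \<and> W 0 0 \<xi> = 0 \<and>
      modes_bounded W J \<xi>"
proof -
  have L2: "w t \<in> L2_cyl" "j t \<in> L2_cyl" "zero_x_average (w t)"
    and cont: "((\<lambda>\<tau>. L2_dist_sq (w \<tau>) (w t)) \<longlongrightarrow> 0) (at t within {0..})"
      "((\<lambda>\<tau>. L2_dist_sq (j \<tau>) (j t)) \<longlongrightarrow> 0) (at t within {0..})" if "0 \<le> t" for t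
    using sol that unfolding is_solution_def by blast+
  obtain V I where F: "\<And>t. 0 \<le> t \<Longrightarrow> has_fourier (w t) (V t)" "\<And>t. 0 \<le> t \<Longrightarrow> has_fourier (j t) (I t)"
    and eq: "\<And>k. AE \<xi> in lborel. \<forall>t\<ge>0.
          ((\<lambda>\<tau>. V \<tau> k \<xi>) has_vector_derivative
             of_real \<alpha> * dx (I t) k \<xi>
             - nonzero_modes (\<lambda>k \<xi>. of_real (2 * c) * sin_mult (dy (lap_inv t (V t))) k \<xi>) k \<xi>)
            (at t within {0..}) \<and>
          ((\<lambda>\<tau>. I \<tau> k \<xi>) has_vector_derivative
             of_real \<kappa> * lap t (I t) k \<xi> + of_real \<alpha> * dx (V t) k \<xi>
             - 2 * dx (dyt t (lap_inv t (I t))) k \<xi>)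
            (at t within {0..})"
    using sol unfolding is_solution_def by blast
  define W where "W n t \<xi> = V t n \<xi>" for n t \<xi>
  define J where "J n t \<xi> = I t n \<xi>" for n t \<xi>
  have FW: "has_fourier (w t) (\<lambda>n. W n t)" "has_fourier (j t) (\<lambda>n. J n t)" if "0 \<le> t" for t
  proof -
    have "(\<lambda>n. W n t) = V t" "(\<lambda>n. J n t) = I t" by (simp_all add: W_def J_def fun_eq_iff)
    then show "has_fourier (w t) (\<lambda>n. W n t)" "has_fourier (j t) (\<lambda>n. J n t)" using F[OF that] by simp_all
  qed
  have WJm [measurable]: "W n t \<in> borel_measurable borel" "J n t \<in> borel_measurable borel" if "0 \<le> t" for n t
    using FW[OF that] by (auto simp: has_fourier_def)
  have aeode: "AE \<xi> in lborel. ode_at W J \<xi>"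
  proof -
    have "AE \<xi> in lborel. \<forall>k. \<forall>t\<ge>0.
        ((\<lambda>t. W k t \<xi>) has_vector_derivative \<i> * of_real (\<alpha> * real_of_int k) * J k t \<xi> + coup (\<lambda>m. W m t \<xi>) k \<xi> t) (at t within {0..}) \<and>
        ((\<lambda>t. J k t \<xi>) has_vector_derivative - of_real (lam k \<xi> t) * J k t \<xi> + \<i> * of_real (\<alpha> * real_of_int k) * W k t \<xi>) (at t within {0..})"
      unfolding AE_all_countable using eq unfolding eqn_w eqn_j W_def J_def by blast
    then show ?thesis by (simp add: ode_def)
  qed
  have ae0: "AE \<xi> in lborel. W 0 0 \<xi> = 0"
    using zero_x_average_iff[OF L2(1) FW(1)] L2(3) by simp
  have "AE \<xi> in lborel. ode_at W J \<xi> \<and> W 0 0 \<xi> = 0"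
    using aeode ae0 by eventually_elim simp
  from AE_E[OF this] obtain N where
    N0: "{\<xi> \<in> space lborel. \<not> (ode_at W J \<xi> \<and> W 0 0 \<xi> = 0)} \<subseteq> N" "emeasure lborel N = 0" "N \<in> sets lborel"
    by blast
  have N: "N \<in> null_sets lborel" using N0(2,3) by (rule null_setsI)
  define G where "G = - N"
  have [measurable]: "G \<in> sets borel" using N0(3) by (auto simp: G_def)
  have G: "ode_at W J \<xi>" "W 0 0 \<xi> = 0" if "\<xi> \<in> G" for \<xi>
    using N0(1) that by (auto simp: G_def)
  have aeG: "AE \<xi> in lborel. \<xi> \<in> G" using AE_not_in[OF N] by (simp add: G_def)
  \<comment> \<open>Cutting off on the exceptional null set makes continuity in time hold at every
    frequency, as joint measurability in time and frequency demands.\<close>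
  define W' where "W' n t \<xi> = indicator G \<xi> * W n t \<xi>" for n t \<xi>
  define J' where "J' n t \<xi> = indicator G \<xi> * J n t \<xi>" for n t \<xi>
  have W'm: "W' n t \<in> borel_measurable borel" and J'm: "J' n t \<in> borel_measurable borel" if t: "0 \<le> t" for n t
    using WJm[OF t, measurable] unfolding W'_def J'_def by measurable
  have W'c: "continuous_on {0..} (\<lambda>t. W' n t \<xi>)" and J'c: "continuous_on {0..} (\<lambda>t. J' n t \<xi>)" for n \<xi>
    using ode_continuous[OF G(1), of \<xi> n] by (cases "\<xi> \<in> G"; simp add: W'_def J'_def)+
  have [measurable]: "(\<lambda>p. W' n (max 0 (fst p)) (snd p)) \<in> borel_measurable (borel \<Otimes>\<^sub>M borel)"
    "(\<lambda>p. J' n (max 0 (fst p)) (snd p)) \<in> borel_measurable (borel \<Otimes>\<^sub>M borel)" for n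
    using caratheodory_measurable[OF W'm W'c] caratheodory_measurable[OF J'm J'c] by auto
  define D where "D p = zsum (\<lambda>n. ennreal ((cmod (W' n (max 0 (fst p)) (snd p)))\<^sup>2 + (cmod (J' n (max 0 (fst p)) (snd p)))\<^sup>2))" for p
  have D [measurable]: "D \<in> borel_measurable (borel \<Otimes>\<^sub>M borel)"
    unfolding D_def by (rule zsum_measurable) measurable
  \<comment> \<open>Natural end times only, so that a single null set serves all of them.\<close>
  have fin: "AE \<xi> in lborel. \<forall>T::nat. (\<integral>\<^sup>+t. indicator {0..real T} t * D (t, \<xi>) \<partial>lborel) < \<infinity>"
    unfolding AE_all_countable
  proof
    fix T :: nat
    obtain B1 where B1: "\<And>t. t \<in> {0..real T} \<Longrightarrow> sqn cyl (w t) \<le> ennreal B1"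
      using L2_curve_bounded[of w "real T", OF L2(1) cont(1)] by (metis of_nat_0_le_iff)
    obtain B2 where B2: "\<And>t. t \<in> {0..real T} \<Longrightarrow> sqn cyl (j t) \<le> ennreal B2"
      using L2_curve_bounded[of j "real T", OF L2(2) cont(2)] by (metis of_nat_0_le_iff)
    have "(\<lambda>(t, \<xi>). indicator {0..real T} t * D (t, \<xi>)) \<in> borel_measurable (borel \<Otimes>\<^sub>M borel)" by measurable
    then have [measurable]: "(\<lambda>(t, \<xi>). indicator {0..real T} t * D (t, \<xi>)) \<in> borel_measurable (lborel \<Otimes>\<^sub>M lborel)"
      by (simp add: measurable_cong_sets[OF sets_pair_measure_cong[OF sets_lborel sets_lborel] refl])
    have "(\<integral>\<^sup>+\<xi>. \<integral>\<^sup>+t. indicator {0..real T} t * D (t, \<xi>) \<partial>lborel \<partial>lborel) = (\<integral>\<^sup>+t. \<integral>\<^sup>+\<xi>. indicator {0..real T} t * D (t, \<xi>) \<partial>lborel \<partial>lborel)"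
      by (rule lborel_pair.Fubini') measurable
    also have "... \<le> (\<integral>\<^sup>+t. (2 * ennreal B1 + 2 * ennreal B2) * indicator {0..real T} t \<partial>lborel)"
    proof (rule nn_integral_mono)
      fix t :: real
      show "(\<integral>\<^sup>+\<xi>. indicator {0..real T} t * D (t, \<xi>) \<partial>lborel) \<le> (2 * ennreal B1 + 2 * ennreal B2) * indicator {0..real T} t"
      proof (cases "t \<in> {0..real T}")
        case True
        then have t: "0 \<le> t" by simp
        have "(\<integral>\<^sup>+\<xi>. D (t, \<xi>) \<partial>lborel) = mode_energy (\<lambda>\<xi>. 1) (\<lambda>n. W n t) (\<lambda>n. J n t)"
          unfolding mode_energy_def mult_1 D_def
          by (intro nn_integral_cong_AE) (use aeG t in \<open>auto simp: W'_def J'_def elim!: eventually_mono\<close>)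
        also have "... = zsum (\<lambda>n. sqn lborel (W n t)) + zsum (\<lambda>n. sqn lborel (J n t))"
          by (rule sqn_eq_mode_energy[symmetric]) (use WJm t in auto)
        also have "... \<le> 2 * sqn cyl (w t) + 2 * sqn cyl (j t)"
          by (intro add_mono has_fourier_bound L2 FW t)
        also have "... \<le> 2 * ennreal B1 + 2 * ennreal B2"
          by (intro add_mono mult_left_mono B1 B2 True) auto
        finally show ?thesis using True by simp
      qed simp
    qed
    also have "... < \<infinity>"
      by (subst nn_integral_cmult_indicator) (auto simp: ennreal_mult_less_top)
    finally have "AE \<xi> in lborel. (\<integral>\<^sup>+t. indicator {0..real T} t * D (t, \<xi>) \<partial>lborel) \<noteq> \<infinity>"
      by (intro nn_integral_noteq_infinite) auto
    then show "AE \<xi> in lborel. (\<integral>\<^sup>+t. indicator {0..real T} t * D (t, \<xi>) \<partial>lborel) < \<infinity>"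
      by eventually_elim (simp add: less_top)
  qed
  have init: "AE \<xi> in lborel. zsum (\<lambda>n. ennreal (en_at W J \<xi> n 0)) \<noteq> \<infinity>"
  proof -
    have "mode_energy (\<lambda>\<xi>. 1) (\<lambda>n. W n 0) (\<lambda>n. J n 0) = zsum (\<lambda>n. sqn lborel (W n 0)) + zsum (\<lambda>n. sqn lborel (J n 0))"
      by (rule sqn_eq_mode_energy[symmetric]) auto
    also have "... \<le> 2 * sqn cyl (w 0) + 2 * sqn cyl (j 0)"
      by (intro add_mono has_fourier_bound L2 FW) auto
    also have "... < \<infinity>" using L2[of 0] by (auto simp: L2_cyl_iff ennreal_mult_less_top)
    finally have "(\<integral>\<^sup>+\<xi>. zsum (\<lambda>n. ennreal (en_at W J \<xi> n 0)) \<partial>lborel) \<noteq> \<infinity>"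
      by (simp add: mode_energy_def en_def)
    then show ?thesis by (intro nn_integral_noteq_infinite) (auto simp: en_def intro!: zsum_measurable)
  qed
  have "AE \<xi> in lborel. ode_at W J \<xi> \<and> W 0 0 \<xi> = 0 \<and>
      modes_bounded W J \<xi>"
    using aeG fin init
  proof eventually_elim
    fix \<xi> assume \<xi>: "\<xi> \<in> G" and fin: "\<forall>T::nat. (\<integral>\<^sup>+t. indicator {0..real T} t * D (t, \<xi>) \<partial>lborel) < \<infinity>"
      and init: "zsum (\<lambda>n. ennreal (en_at W J \<xi> n 0)) \<noteq> \<infinity>"
    let ?e = "en_at W J \<xi>"
    obtain K0 where K0: "0 \<le> K0" "zsum (\<lambda>n. ennreal (?e n 0)) = ennreal K0"
      using init by (cases "zsum (\<lambda>n. ennreal (?e n 0))" rule: ennreal_cases) auto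
    have k0: "?e n 0 \<le> K0" for n
      using member_le_zsum[of "\<lambda>n. ennreal (?e n 0)" n] K0 by (simp add: K0(2))
    have "\<exists>K. \<forall>n t. 0 \<le> t \<longrightarrow> t \<le> T \<longrightarrow> ?e n t \<le> K" if T: "0 \<le> T" for T
    proof -
      obtain m :: nat where m: "T \<le> real m" using real_arch_simple by blast
      have "(\<integral>\<^sup>+t. indicator {0..real m} t * zsum (\<lambda>n. ennreal (?e n t)) \<partial>lborel) = (\<integral>\<^sup>+t. indicator {0..real m} t * D (t, \<xi>) \<partial>lborel)"
        by (intro nn_integral_cong) (use \<xi> in \<open>auto simp: indicator_def D_def en_def W'_def J'_def\<close>)
      then obtain R where R: "0 \<le> R" "(\<integral>\<^sup>+t. indicator {0..real m} t * zsum (\<lambda>n. ennreal (?e n t)) \<partial>lborel) = ennreal R"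
        using fin[rule_format, of m] by (cases "\<integral>\<^sup>+t. indicator {0..real m} t * D (t, \<xi>) \<partial>lborel" rule: ennreal_cases) auto
      have "?e n t \<le> K0 + (2 * c * (1 + (real m)\<^sup>2) + 2) * (3 * R)" if "0 \<le> t" "t \<le> T" for n t
        by (rule en_bounded_of_integral[OF G(1)[OF \<xi>] _ R(1) _ k0]) (use R(2) G(2)[OF \<xi>] that m in auto)
      then show ?thesis by blast
    qed
    then show "ode_at W J \<xi> \<and> W 0 0 \<xi> = 0 \<and>
      (\<forall>T\<ge>0. \<exists>K. \<forall>n t. 0 \<le> t \<longrightarrow> t \<le> T \<longrightarrow> ?e n t \<le> K)" using G[OF \<xi>] by blast
  qed
  then show ?thesis using that[of W J] L2 FW by blast
qed

lemma solution_initial: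
  assumes sol: "is_solution \<alpha> \<kappa> c w0 j0 w j" and L2: "w0 \<in> L2_cyl" "j0 \<in> L2_cyl"
    and F: "has_fourier (w 0) W" "has_fourier (j 0) J"
  shows "has_fourier w0 W" "has_fourier j0 J"
proof -
  have "AE z in cyl. w 0 z = w0 z" "AE z in cyl. j 0 z = j0 z" "w 0 \<in> L2_cyl" "j 0 \<in> L2_cyl"
    using sol unfolding is_solution_def by auto
  then show "has_fourier w0 W" "has_fourier j0 J" using has_fourier_cong_fun L2 F by blast+
qed

abbreviation energy_factor where
  "energy_factor t \<equiv> ennreal (exp (3 * ((2 * c * (1 + t\<^sup>2) + 2) * t)))"

text \<open>The energy estimate at fixed frequency has a factor free of \<xi>, so it can be
  multiplied by any weight in \<xi> and integrated.\<close>

lemma solution_gevrey_bound: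
  assumes sol: "is_solution \<alpha> \<kappa> c w0 j0 w j" and L2: "w0 \<in> L2_cyl" "j0 \<in> L2_cyl" and t: "0 \<le> t"
  shows "gevrey_energy C (w t) (j t) \<le> energy_factor t * gevrey_energy C w0 j0"
proof -
  obtain W J where F: "\<And>t. 0 \<le> t \<Longrightarrow> w t \<in> L2_cyl \<and> j t \<in> L2_cyl \<and> has_fourier (w t) (\<lambda>n. W n t) \<and> has_fourier (j t) (\<lambda>n. J n t)"
    and ae: "AE \<xi> in lborel. ode_at W J \<xi> \<and> W 0 0 \<xi> = 0 \<and>
      modes_bounded W J \<xi>"
    using solution_modes[OF sol] by blast
  have [measurable]: "W n 0 \<in> borel_measurable borel" "J n 0 \<in> borel_measurable borel" for n
    using F[of 0] by (auto simp: has_fourier_def)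
  have "gevrey_energy C (w t) (j t) = mode_energy (\<lambda>\<xi>. gevrey_w C \<xi>) (\<lambda>n. W n t) (\<lambda>n. J n t)"
    using F[OF t] by (intro gevrey_energy_eq) auto
  also have "... \<le> (\<integral>\<^sup>+\<xi>. energy_factor t * (gevrey_w C \<xi> * zsum (\<lambda>n. ennreal ((cmod (W n 0 \<xi>))\<^sup>2 + (cmod (J n 0 \<xi>))\<^sup>2))) \<partial>lborel)"
    unfolding mode_energy_def
  proof (rule nn_integral_mono_AE)
    show "AE \<xi> in lborel. gevrey_w C \<xi> * zsum (\<lambda>n. ennreal ((cmod (W n t \<xi>))\<^sup>2 + (cmod (J n t \<xi>))\<^sup>2)) \<le>
       energy_factor t * (gevrey_w C \<xi> * zsum (\<lambda>n. ennreal ((cmod (W n 0 \<xi>))\<^sup>2 + (cmod (J n 0 \<xi>))\<^sup>2)))"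
      using ae
    proof eventually_elim
      fix \<xi> assume a: "ode_at W J \<xi> \<and> W 0 0 \<xi> = 0 \<and>
        modes_bounded W J \<xi>"
      then obtain K where K: "\<And>n s. 0 \<le> s \<Longrightarrow> s \<le> t \<Longrightarrow> en_at W J \<xi> n s \<le> K"
        using t by blast
      have "zsum (\<lambda>n. ennreal (en_at W J \<xi> n t)) \<le> energy_factor t * zsum (\<lambda>n. ennreal (en_at W J \<xi> n 0))"
        by (rule energy_bound[OF _ _ K t order_refl]) (use a in auto)
      then have "gevrey_w C \<xi> * zsum (\<lambda>n. ennreal (en_at W J \<xi> n t)) \<le>
        gevrey_w C \<xi> * (energy_factor t * zsum (\<lambda>n. ennreal (en_at W J \<xi> n 0)))"
        by (rule mult_left_mono) simp
      then show "gevrey_w C \<xi> * zsum (\<lambda>n. ennreal ((cmod (W n t \<xi>))\<^sup>2 + (cmod (J n t \<xi>))\<^sup>2)) \<le>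
       energy_factor t * (gevrey_w C \<xi> * zsum (\<lambda>n. ennreal ((cmod (W n 0 \<xi>))\<^sup>2 + (cmod (J n 0 \<xi>))\<^sup>2)))"
        unfolding en_def by (simp only: mult.left_commute)
    qed
  qed
  also have "... = energy_factor t * mode_energy (\<lambda>\<xi>. gevrey_w C \<xi>) (\<lambda>n. W n 0) (\<lambda>n. J n 0)"
    unfolding mode_energy_def by (rule nn_integral_cmult) (auto intro!: borel_measurable_times_ennreal zsum_measurable)
  also have "mode_energy (\<lambda>\<xi>. gevrey_w C \<xi>) (\<lambda>n. W n 0) (\<lambda>n. J n 0) = gevrey_energy C w0 j0"
    using F[of 0] solution_initial[OF sol L2, of "\<lambda>n. W n 0" "\<lambda>n. J n 0"] L2 by (intro gevrey_energy_eq[symmetric]) auto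
  finally show ?thesis .
qed

end

section \<open>Existence of solutions for Gevrey data\<close>

lemma integrable_exp_neg_sqrt:
  assumes C: "0 < C"
  shows "(\<integral>\<^sup>+\<xi>. ennreal (exp (- C * sqrt \<bar>\<xi>\<bar>)) \<partial>lborel) < \<infinity>"
proof -
  have int: "integrable lborel (\<lambda>x::real. inverse (1 + x\<^sup>2))"
    using integrable_inverse_1_plus_square by (simp add: set_integrable_def)
  define K where "K = max 2 (512 / C ^ 4)"
  have K0: "0 \<le> K" by (simp add: K_def)
  have "exp (- C * sqrt \<bar>\<xi>\<bar>) \<le> K * (1 / (1 + \<xi>\<^sup>2))" for \<xi>
  proof -
    have pos: "0 < 1 + \<xi>\<^sup>2" by (simp add: add_pos_nonneg)
    have "exp (- C * sqrt \<bar>\<xi>\<bar>) * (1 + \<xi>\<^sup>2) \<le> K"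
    proof (cases "\<bar>\<xi>\<bar> \<le> 1")
      case True
      then have "\<xi>\<^sup>2 \<le> 1" by (simp add: abs_square_le_1)
      moreover have "exp (- C * sqrt \<bar>\<xi>\<bar>) \<le> 1" using C by simp
      ultimately have "exp (- C * sqrt \<bar>\<xi>\<bar>) * (1 + \<xi>\<^sup>2) \<le> 1 * 2" by (intro mult_mono) auto
      then show ?thesis by (simp add: K_def)
    next
      case False
      then have "1 \<le> \<xi>\<^sup>2" by (metis abs_square_le_1 less_eq_real_def linorder_not_le)
      then have le: "1 + \<xi>\<^sup>2 \<le> 2 * \<xi>\<^sup>2" by simp
      \<comment> \<open>The choice makes 4 y the exponent, and y^4 <= exp (4 y) yields decay of
        order \<xi>^(-2). The constant 512 is 4^4 doubled, since 1 + \<xi>^2 is at most twice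
        \<xi>^2 here.\<close>
      define y where "y = C * sqrt \<bar>\<xi>\<bar> / 4"
      have y0: "0 \<le> y" using C by (simp add: y_def)
      have "y ^ 4 \<le> (exp y) ^ 4" using y0 exp_ge_add_one_self[of y] by (intro power_mono) linarith+
      also have "(exp y) ^ 4 = exp (C * sqrt \<bar>\<xi>\<bar>)" by (simp add: exp_of_nat_mult[symmetric] y_def)
      finally have "y ^ 4 \<le> exp (C * sqrt \<bar>\<xi>\<bar>)" .
      moreover have "y ^ 4 = C ^ 4 * \<xi>\<^sup>2 / 256"
      proof -
        have "sqrt \<bar>\<xi>\<bar> ^ 4 = (sqrt \<bar>\<xi>\<bar> ^ 2) ^ 2" by (simp only: power_mult[symmetric]) simp
        also have "... = \<xi>\<^sup>2" by (simp only: real_sqrt_pow2 abs_ge_zero power2_abs)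
        finally show ?thesis by (simp add: y_def power_mult_distrib power_divide)
      qed
      ultimately have "\<xi>\<^sup>2 \<le> 256 / C ^ 4 * exp (C * sqrt \<bar>\<xi>\<bar>)" using C by (simp add: field_simps)
      then have "1 + \<xi>\<^sup>2 \<le> 512 / C ^ 4 * exp (C * sqrt \<bar>\<xi>\<bar>)" using le by simp
      then have "exp (- C * sqrt \<bar>\<xi>\<bar>) * (1 + \<xi>\<^sup>2) \<le> exp (- C * sqrt \<bar>\<xi>\<bar>) * (512 / C ^ 4 * exp (C * sqrt \<bar>\<xi>\<bar>))"
        by (rule mult_left_mono) simp
      also have "... = 512 / C ^ 4 * (exp (- C * sqrt \<bar>\<xi>\<bar>) * exp (C * sqrt \<bar>\<xi>\<bar>))" by (simp only: mult_ac)
      also have "exp (- C * sqrt \<bar>\<xi>\<bar>) * exp (C * sqrt \<bar>\<xi>\<bar>) = 1" by (simp add: exp_add[symmetric])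
      finally show ?thesis by (simp add: K_def)
    qed
    then show ?thesis using pos by (simp add: pos_le_divide_eq)
  qed
  then have "(\<integral>\<^sup>+\<xi>. ennreal (exp (- C * sqrt \<bar>\<xi>\<bar>)) \<partial>lborel) \<le> (\<integral>\<^sup>+\<xi>. ennreal (K * inverse (1 + \<xi>\<^sup>2)) \<partial>lborel)"
    by (intro nn_integral_mono ennreal_leI) (simp add: divide_inverse)
  also have "... < \<infinity>"
    using K0 by (subst nn_integral_eq_integral) (auto intro: int)
  finally show ?thesis .
qed

text \<open>Cauchy-Schwarz with the square root of the weight. The Gevrey weight is thus what
  provides the integrable modes that \<open>fourier_inverse\<close> requires.\<close>

lemma integrable_of_gevrey:
  fixes U :: "real \<Rightarrow> complex"
  assumes C: "0 < C" and [measurable]: "U \<in> borel_measurable borel"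
    and fin: "(\<integral>\<^sup>+\<xi>. gevrey_w C \<xi> * nsq (U \<xi>) \<partial>lborel) < \<infinity>"
  shows "integrable lborel U"
proof -
  define f where "f \<xi> = complex_of_real (exp (C / 2 * sqrt \<bar>\<xi>\<bar>)) * U \<xi>" for \<xi>
  define g where "g \<xi> = complex_of_real (exp (- (C / 2 * sqrt \<bar>\<xi>\<bar>)))" for \<xi>
  have [measurable]: "f \<in> borel_measurable borel" "g \<in> borel_measurable borel"
    unfolding f_def g_def by measurable
  have e2: "(exp (C / 2 * sqrt \<bar>\<xi>\<bar>))\<^sup>2 = exp (C * sqrt \<bar>\<xi>\<bar>)" "(exp (- (C / 2 * sqrt \<bar>\<xi>\<bar>)))\<^sup>2 = exp (- C * sqrt \<bar>\<xi>\<bar>)" for \<xi>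
    by (simp_all add: power2_eq_square exp_add[symmetric])
  have "sqn lborel f < \<infinity>"
  proof -
    have "nsq (f \<xi>) = gevrey_w C \<xi> * nsq (U \<xi>)" for \<xi>
      unfolding f_def norm_mult norm_of_real abs_exp_cancel power_mult_distrib e2 by (simp add: ennreal_mult)
    then show ?thesis using fin unfolding sqn_def by simp
  qed
  moreover have "sqn lborel g < \<infinity>"
    using integrable_exp_neg_sqrt[OF C] unfolding sqn_def g_def norm_of_real abs_exp_cancel e2 .
  ultimately have "integrable lborel (\<lambda>\<xi>. f \<xi> * g \<xi>)" by (intro integrable_mult_sqn) auto
  moreover have "f \<xi> * g \<xi> = U \<xi>" for \<xi>
  proof -
    have "exp (C / 2 * sqrt \<bar>\<xi>\<bar>) * exp (- (C / 2 * sqrt \<bar>\<xi>\<bar>)) = 1" by (simp add: exp_add[symmetric])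
    then have "complex_of_real (exp (C / 2 * sqrt \<bar>\<xi>\<bar>)) * complex_of_real (exp (- (C / 2 * sqrt \<bar>\<xi>\<bar>))) = 1"
      by (metis of_real_1 of_real_mult)
    then show ?thesis by (simp add: f_def g_def mult.commute mult.left_commute)
  qed
  ultimately show ?thesis by simp
qed

text \<open>Conjugate symmetry and the vanishing zero mode hold almost everywhere for any
  representative. Averaging with the reflection makes them hold everywhere without leaving the
  class.\<close>

lemma symmetric_fourier:
  assumes u: "u \<in> L2_cyl" and z: "zero_x_average u"
  obtains U where "has_fourier u U" "\<And>\<xi>. U 0 \<xi> = 0" "\<And>k \<xi>. U (- k) (- \<xi>) = cnj (U k \<xi>)"
proof -
  define F where "F = fourier u"
  have F: "has_fourier u F" unfolding F_def by (rule has_fourier_fourier[OF u])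
  have [measurable]: "F k \<in> borel_measurable borel" for k using F by (auto simp: has_fourier_def)
  define U where "U k \<xi> = (if k = 0 then 0 else (F k \<xi> + cnj (F (- k) (- \<xi>))) / 2)" for k \<xi>
  have "has_fourier u U"
  proof (rule has_fourier_cong_AE[OF F])
    show "U k \<in> borel_measurable borel" for k unfolding U_def by measurable
    show "AE \<xi> in lborel. F k \<xi> = U k \<xi>" for k
    proof (cases "k = 0")
      case True
      then show ?thesis using zero_x_average_iff[OF u F] z by (simp add: U_def)
    next
      case False
      show ?thesis
        using has_fourier_unique[OF u F has_fourier_reflect[OF u F], of k]
      proof eventually_elim
        fix \<xi> assume e: "F k \<xi> = cnj (F (- k) (- \<xi>))"
        show "F k \<xi> = U k \<xi>" unfolding U_def e[symmetric] using False by simp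
      qed
    qed
  qed
  then show ?thesis using that[of U] by (simp add: U_def add.commute)
qed

text \<open>Dominated convergence twice, in the frequency and then in the mode, with one majorant
  valid for all times up to T.\<close>

lemma modes_L2_continuous:
  fixes V :: "int \<Rightarrow> real \<Rightarrow> real \<Rightarrow> complex" and m :: "int \<Rightarrow> real \<Rightarrow> ennreal"
  assumes meas: "\<And>n t. 0 \<le> t \<Longrightarrow> V n t \<in> borel_measurable borel" "\<And>n. m n \<in> borel_measurable borel"
    and cont: "AE \<xi> in lborel. \<forall>n. continuous_on {0..} (\<lambda>t. V n t \<xi>)"
    and bd: "AE \<xi> in lborel. \<forall>n. \<forall>t\<in>{0..T}. nsq (V n t \<xi>) \<le> m n \<xi>"
    and fin: "zsum (\<lambda>n. \<integral>\<^sup>+\<xi>. m n \<xi> \<partial>lborel) < \<infinity>"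
    and X: "\<And>i. X i \<in> {0..T}" "X \<longlonglongrightarrow> t" and t: "t \<in> {0..T}"
  shows "(\<lambda>i. zsum (\<lambda>n. sqn lborel (\<lambda>\<xi>. V n (X i) \<xi> - V n t \<xi>))) \<longlonglongrightarrow> 0"
proof -
  note meas(2)[measurable]
  have [measurable]: "V n (X i) \<in> borel_measurable borel" "V n t \<in> borel_measurable borel" for n i
    using meas(1) X(1)[of i] t by auto
  have dom: "AE \<xi> in lborel. nsq (V n (X i) \<xi> - V n t \<xi>) \<le> 4 * m n \<xi>" for n i
    using bd
  proof eventually_elim
    fix \<xi> assume b: "\<forall>n. \<forall>t\<in>{0..T}. nsq (V n t \<xi>) \<le> m n \<xi>"
    have "nsq (V n (X i) \<xi> - V n t \<xi>) \<le> ennreal (2 * (cmod (V n (X i) \<xi>))\<^sup>2 + 2 * (cmod (V n t \<xi>))\<^sup>2)"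
      using norm_add_sq_le[of "V n (X i) \<xi>" "- V n t \<xi>"] by (intro ennreal_leI) simp
    also have "... = 2 * nsq (V n (X i) \<xi>) + 2 * nsq (V n t \<xi>)" by (simp add: ennreal_mult)
    also have "... \<le> 2 * m n \<xi> + 2 * m n \<xi>" using b X(1)[of i] t by (intro add_mono mult_left_mono) auto
    also have "... = 4 * m n \<xi>"
    proof -
      have "(4::ennreal) = 2 + 2" by simp
      then show ?thesis by (simp only: distrib_right)
    qed
    finally show "nsq (V n (X i) \<xi> - V n t \<xi>) \<le> 4 * m n \<xi>" .
  qed
  have finn: "(\<integral>\<^sup>+\<xi>. 4 * m n \<xi> \<partial>lborel) < \<infinity>" for n
    using le_less_trans[OF member_le_zsum[of "\<lambda>n. \<integral>\<^sup>+\<xi>. m n \<xi> \<partial>lborel" n] fin]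
    by (simp add: nn_integral_cmult ennreal_mult_less_top)
  have inner: "(\<lambda>i. sqn lborel (\<lambda>\<xi>. V n (X i) \<xi> - V n t \<xi>)) \<longlonglongrightarrow> 0" for n
  proof -
    have "(\<lambda>i. sqn lborel (\<lambda>\<xi>. V n (X i) \<xi> - V n t \<xi>)) \<longlonglongrightarrow> (\<integral>\<^sup>+\<xi>. 0 \<partial>(lborel :: real measure))"
      unfolding sqn_def
    proof (rule nn_integral_dominated_convergence[OF _ _ _ dom finn])
      show "AE \<xi> in lborel. (\<lambda>i. nsq (V n (X i) \<xi> - V n t \<xi>)) \<longlonglongrightarrow> 0"
        using cont
      proof eventually_elim
        fix \<xi> assume c: "\<forall>n. continuous_on {0..} (\<lambda>t. V n t \<xi>)"
        have "(\<lambda>i. V n (X i) \<xi>) \<longlonglongrightarrow> V n t \<xi>"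
          by (rule continuous_on_tendsto_compose[OF c[rule_format, of n] X(2)]) (use X(1) t in auto)
        then have "(\<lambda>i. (norm (V n (X i) \<xi> - V n t \<xi>))\<^sup>2) \<longlonglongrightarrow> (norm (V n t \<xi> - V n t \<xi>))\<^sup>2"
          by (intro tendsto_intros)
        then have "(\<lambda>i. nsq (V n (X i) \<xi> - V n t \<xi>)) \<longlonglongrightarrow> nsq (V n t \<xi> - V n t \<xi>)"
          by (rule tendsto_ennrealI)
        then show "(\<lambda>i. nsq (V n (X i) \<xi> - V n t \<xi>)) \<longlonglongrightarrow> 0" by simp
      qed
    qed measurable
    then show ?thesis by simp
  qed
  have "(\<lambda>i. zsum (\<lambda>n. sqn lborel (\<lambda>\<xi>. V n (X i) \<xi> - V n t \<xi>))) \<longlonglongrightarrow> zsum (\<lambda>n. 0)"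
  proof (rule nn_integral_dominated_convergence[where w="\<lambda>n. \<integral>\<^sup>+\<xi>. 4 * m n \<xi> \<partial>lborel"])
    show "AE n in count_space UNIV. sqn lborel (\<lambda>\<xi>. V n (X i) \<xi> - V n t \<xi>) \<le> (\<integral>\<^sup>+\<xi>. 4 * m n \<xi> \<partial>lborel)" for i
      unfolding sqn_def by (intro AE_I2 nn_integral_mono_AE dom)
    show "AE n in count_space UNIV. (\<lambda>i. sqn lborel (\<lambda>\<xi>. V n (X i) \<xi> - V n t \<xi>)) \<longlonglongrightarrow> 0"
      by (intro AE_I2 inner)
    show "zsum (\<lambda>n. \<integral>\<^sup>+\<xi>. 4 * m n \<xi> \<partial>lborel) < \<infinity>"
      using fin by (simp add: nn_integral_cmult zsum_cmult ennreal_mult_less_top)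
  qed auto
  then show ?thesis by simp
qed

context mhd begin

lemma psym_reflect: "psym (- n) (- \<xi>) t = psym n \<xi> t" "psym n (- \<xi>) t = psym (- n) \<xi> t"
  by (simp_all add: psym_def power2_eq_square algebra_simps)

text \<open>The equations are real. Reversing the signs of n and \<xi> leaves \<open>psym\<close>
  and \<open>lam\<close> unchanged, and in the coupling the sign of c \<xi> is compensated by the
  exchange of the two neighbours.\<close>

lemma ode_reflect:
  assumes o: "ode (- \<xi>) W J"
  shows "ode \<xi> (\<lambda>n t. cnj (W (- n) t)) (\<lambda>n t. cnj (J (- n) t))"
  unfolding ode_def
proof (intro allI impI conjI)
  fix n and t :: real assume t: "0 \<le> t"
  have W: "(W (- n) has_vector_derivative \<i> * of_real (\<alpha> * real_of_int (- n)) * J (- n) t + coup (\<lambda>m. W m t) (- n) (- \<xi>) t) (at t within {0..})"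
    and J: "(J (- n) has_vector_derivative - of_real (lam (- n) (- \<xi>) t) * J (- n) t + \<i> * of_real (\<alpha> * real_of_int (- n)) * W (- n) t) (at t within {0..})"
    using o[unfolded ode_def, rule_format, OF t, of "- n"] by blast+
  have l: "lam (- n) (- \<xi>) t = lam n \<xi> t" by (simp add: lam_def psym_reflect algebra_simps)
  have m: "- n - 1 = - (n + 1)" "- n + 1 = - (n - 1)" by simp_all
  have "cnj (coup (\<lambda>m. W m t) (- n) (- \<xi>) t) = coup (\<lambda>m. cnj (W (- m) t)) n \<xi> t"
    unfolding coup_def m psym_reflect(1) by (simp add: right_diff_distrib)
  then have "cnj (\<i> * of_real (\<alpha> * real_of_int (- n)) * J (- n) t + coup (\<lambda>m. W m t) (- n) (- \<xi>) t) =
      \<i> * of_real (\<alpha> * real_of_int n) * cnj (J (- n) t) + coup (\<lambda>m. cnj (W (- m) t)) n \<xi> t"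
    by simp
  then show "((\<lambda>t. cnj (W (- n) t)) has_vector_derivative \<i> * of_real (\<alpha> * real_of_int n) * cnj (J (- n) t) + coup (\<lambda>m. cnj (W (- m) t)) n \<xi> t) (at t within {0..})"
    using has_vector_derivative_cnj[OF W] by (simp add: add.commute)
  have "cnj (- of_real (lam (- n) (- \<xi>) t) * J (- n) t + \<i> * of_real (\<alpha> * real_of_int (- n)) * W (- n) t) =
      - of_real (lam n \<xi> t) * cnj (J (- n) t) + \<i> * of_real (\<alpha> * real_of_int n) * cnj (W (- n) t)"
    by (simp add: l)
  then show "((\<lambda>t. cnj (J (- n) t)) has_vector_derivative - of_real (lam n \<xi> t) * cnj (J (- n) t) + \<i> * of_real (\<alpha> * real_of_int n) * cnj (W (- n) t)) (at t within {0..})"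
    using has_vector_derivative_cnj[OF J] by (simp add: l)
qed

lemma ode_average:
  assumes o1: "ode \<xi> W J" and o2: "ode \<xi> V I"
  shows "ode \<xi> (\<lambda>n t. (W n t + V n t) / 2) (\<lambda>n t. (J n t + I n t) / 2)"
  unfolding ode_def
proof (intro allI impI conjI)
  fix n and t :: real assume t: "0 \<le> t"
  have co: "coup (\<lambda>m. (W m t + V m t) / 2) n \<xi> t = (coup (\<lambda>m. W m t) n \<xi> t + coup (\<lambda>m. V m t) n \<xi> t) / 2"
    by (simp add: coup_def add_divide_distrib diff_divide_distrib algebra_simps)
  have "((\<lambda>t. (W n t + V n t) / 2) has_vector_derivative
     ((\<i> * of_real (\<alpha> * real_of_int n) * J n t + coup (\<lambda>m. W m t) n \<xi> t) + (\<i> * of_real (\<alpha> * real_of_int n) * I n t + coup (\<lambda>m. V m t) n \<xi> t)) / 2) (at t within {0..})"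
    using o1 o2 t by (intro has_vector_derivative_divide has_vector_derivative_add) (auto simp: ode_def)
  then show "((\<lambda>t. (W n t + V n t) / 2) has_vector_derivative \<i> * of_real (\<alpha> * real_of_int n) * ((J n t + I n t) / 2) + coup (\<lambda>m. (W m t + V m t) / 2) n \<xi> t) (at t within {0..})"
    unfolding co by (simp add: add_divide_distrib diff_divide_distrib distrib_left algebra_simps)
  have "((\<lambda>t. (J n t + I n t) / 2) has_vector_derivative
     ((- of_real (lam n \<xi> t) * J n t + \<i> * of_real (\<alpha> * real_of_int n) * W n t) + (- of_real (lam n \<xi> t) * I n t + \<i> * of_real (\<alpha> * real_of_int n) * V n t)) / 2) (at t within {0..})"
    using o1 o2 t by (intro has_vector_derivative_divide has_vector_derivative_add) (auto simp: ode_def)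
  then show "((\<lambda>t. (J n t + I n t) / 2) has_vector_derivative - of_real (lam n \<xi> t) * ((J n t + I n t) / 2) + \<i> * of_real (\<alpha> * real_of_int n) * ((W n t + V n t) / 2)) (at t within {0..})"
    by (simp add: add_divide_distrib diff_divide_distrib algebra_simps)
qed

theorem solution_exists:
  assumes C: "0 < C" and L2: "w0 \<in> L2_cyl" "j0 \<in> L2_cyl" and za: "zero_x_average w0" "zero_x_average j0"
    and fin: "gevrey_energy C w0 j0 < \<infinity>"
  shows "\<exists>w j. is_solution \<alpha> \<kappa> c w0 j0 w j"
proof -
  obtain U where U: "has_fourier w0 U" "\<And>\<xi>. U 0 \<xi> = 0" "\<And>k \<xi>. U (- k) (- \<xi>) = cnj (U k \<xi>)"
    using symmetric_fourier[OF L2(1) za(1)] by blast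
  obtain V where V: "has_fourier j0 V" "\<And>\<xi>. V 0 \<xi> = 0" "\<And>k \<xi>. V (- k) (- \<xi>) = cnj (V k \<xi>)"
    using symmetric_fourier[OF L2(2) za(2)] by blast
  have mUV [measurable]: "U n \<in> borel_measurable borel" "V n \<in> borel_measurable borel" for n
    using U V by (auto simp: has_fourier_def)
  define gw where "gw \<xi> = gevrey_w C \<xi>" for \<xi>
  have [measurable]: "gw \<in> borel_measurable borel" unfolding gw_def by measurable
  have gw1: "1 \<le> gw \<xi>" for \<xi> using C by (simp add: gw_def)
  have G0: "mode_energy gw U V < \<infinity>"
    using fin gevrey_energy_eq[OF L2 U(1) V(1), of C] unfolding gw_def[abs_def] by simp
  obtain W J where m: "\<And>n t. W n t \<in> borel_measurable borel" "\<And>n t. J n t \<in> borel_measurable borel"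
    and z: "\<And>t \<xi>. W 0 t \<xi> = 0" "\<And>t \<xi>. J 0 t \<xi> = 0"
    and ex: "\<And>\<xi> A. (\<And>n. cmod (U n \<xi>) \<le> A) \<Longrightarrow> (\<And>n. cmod (V n \<xi>) \<le> A) \<Longrightarrow>
      ode_at W J \<xi> \<and> (\<forall>n. W n 0 \<xi> = U n \<xi> \<and> J n 0 \<xi> = V n \<xi>) \<and>
      modes_bounded W J \<xi>"
    using ode_exists[of U V, OF mUV U(2) V(2)] by blast
  note m[measurable]
  \<comment> \<open>By linearity the average with the reflected family solves the same equations
    with the same symmetric data. Its symmetry is exact, so real functions can be rebuilt from it,
    with no appeal to uniqueness for the chosen W and J.\<close>
  define Ws where "Ws n t \<xi> = (W n t \<xi> + cnj (W (- n) t (- \<xi>))) / 2" for n t \<xi>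
  define Js where "Js n t \<xi> = (J n t \<xi> + cnj (J (- n) t (- \<xi>))) / 2" for n t \<xi>
  have ms [measurable]: "Ws n t \<in> borel_measurable borel" "Js n t \<in> borel_measurable borel" for n t
    unfolding Ws_def Js_def by measurable
  have sym: "Ws (- n) t (- \<xi>) = cnj (Ws n t \<xi>)" "Js (- n) t (- \<xi>) = cnj (Js n t \<xi>)" for n t \<xi>
    by (simp_all add: Ws_def Js_def add.commute)
  have zs: "Ws 0 t \<xi> = 0" "Js 0 t \<xi> = 0" for t \<xi> by (simp_all add: Ws_def Js_def z)
  define e0 where "e0 \<xi> n = (cmod (U n \<xi>))\<^sup>2 + (cmod (V n \<xi>))\<^sup>2" for \<xi> n
  define P where "P \<xi> \<longleftrightarrow> ode_at Ws Js \<xi> \<and> (\<forall>n. Ws n 0 \<xi> = U n \<xi> \<and> Js n 0 \<xi> = V n \<xi>) \<and>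
      modes_bounded Ws Js \<xi>" for \<xi>
  have good: "AE \<xi> in lborel. P \<xi>"
  proof -
    have "AE \<xi> in lborel. gw \<xi> * zsum (\<lambda>n. ennreal (e0 \<xi> n)) \<noteq> \<infinity>"
      using G0 unfolding mode_energy_def e0_def
      by (intro nn_integral_noteq_infinite) (auto intro!: borel_measurable_times_ennreal zsum_measurable)
    then show ?thesis
    proof eventually_elim
      fix \<xi> assume a: "gw \<xi> * zsum (\<lambda>n. ennreal (e0 \<xi> n)) \<noteq> \<infinity>"
      have "1 * zsum (\<lambda>n. ennreal (e0 \<xi> n)) \<le> gw \<xi> * zsum (\<lambda>n. ennreal (e0 \<xi> n))" by (intro mult_right_mono gw1) simp
      then have "zsum (\<lambda>n. ennreal (e0 \<xi> n)) \<noteq> \<infinity>" using a by (auto simp: top_unique)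
      then obtain R where R: "0 \<le> R" "zsum (\<lambda>n. ennreal (e0 \<xi> n)) = ennreal R"
        by (cases "zsum (\<lambda>n. ennreal (e0 \<xi> n))" rule: ennreal_cases) auto
      have le: "e0 \<xi> n \<le> R" for n using member_le_zsum[of "\<lambda>n. ennreal (e0 \<xi> n)" n] R by (simp add: R(2))
      have bU: "cmod (U n \<xi>) \<le> sqrt R" and bV: "cmod (V n \<xi>) \<le> sqrt R" for n
        using le[of n] by (auto simp: e0_def intro!: real_le_rsqrt intro: order_trans[rotated])
      have bU': "cmod (U n (- \<xi>)) \<le> sqrt R" and bV': "cmod (V n (- \<xi>)) \<le> sqrt R" for n
        using bU[of "- n"] bV[of "- n"] U(3)[of n "- \<xi>"] V(3)[of n "- \<xi>"] by simp_all
      note E1 = ex[OF bU bV] and E2 = ex[OF bU' bV']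
      have "ode_at Ws Js \<xi>"
        unfolding Ws_def Js_def
        by (rule ode_average[of \<xi> "\<lambda>n t. W n t \<xi>" "\<lambda>n t. J n t \<xi>" "\<lambda>n t. cnj (W (- n) t (- \<xi>))" "\<lambda>n t. cnj (J (- n) t (- \<xi>))"])
           (use E1 ode_reflect[of \<xi> "\<lambda>n t. W n t (- \<xi>)" "\<lambda>n t. J n t (- \<xi>)"] E2 in auto)
      moreover have "Ws n 0 \<xi> = U n \<xi> \<and> Js n 0 \<xi> = V n \<xi>" for n
      proof -
        have "W n 0 \<xi> = U n \<xi>" "J n 0 \<xi> = V n \<xi>" "W (- n) 0 (- \<xi>) = U (- n) (- \<xi>)" "J (- n) 0 (- \<xi>) = V (- n) (- \<xi>)"
          using E1 E2 by blast+
        then show ?thesis by (simp add: Ws_def Js_def U(3) V(3))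
      qed
      moreover have "\<exists>K. \<forall>n t. 0 \<le> t \<longrightarrow> t \<le> T \<longrightarrow> en_at Ws Js \<xi> n t \<le> K" if "0 \<le> T" for T
      proof -
        obtain K1 where K1: "\<And>n t. 0 \<le> t \<Longrightarrow> t \<le> T \<Longrightarrow> en_at W J \<xi> n t \<le> K1" using E1 \<open>0 \<le> T\<close> by blast
        obtain K2 where K2: "\<And>n t. 0 \<le> t \<Longrightarrow> t \<le> T \<Longrightarrow> en (\<lambda>n t. W n t (- \<xi>)) (\<lambda>n t. J n t (- \<xi>)) n t \<le> K2" using E2 \<open>0 \<le> T\<close> by blast
        have av: "(cmod ((a + cnj b) / 2))\<^sup>2 \<le> (cmod a)\<^sup>2 + (cmod b)\<^sup>2" for a b
        proof -
          have "(cmod ((a + cnj b) / 2))\<^sup>2 = (cmod (a + cnj b))\<^sup>2 / 4" by (simp add: norm_divide power_divide)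
          then show ?thesis
            using norm_add_sq_le[of a "cnj b"] zero_le_power2[of "cmod a"] zero_le_power2[of "cmod b"]
            unfolding complex_mod_cnj by linarith
        qed
        have "en_at Ws Js \<xi> n t \<le> K1 + K2" if t: "0 \<le> t" "t \<le> T" for n t
          using av[of "W n t \<xi>" "W (- n) t (- \<xi>)"] av[of "J n t \<xi>" "J (- n) t (- \<xi>)"] K1[OF t, of n] K2[OF t, of "- n"]
          unfolding en_def Ws_def Js_def by linarith
        then show ?thesis by blast
      qed
      ultimately show "P \<xi>" unfolding P_def by blast
    qed
  qed
  define M where "M T = 2 * c * (1 + T\<^sup>2) + 2" for T
  have M0: "0 \<le> M T" for T using c by (simp add: M_def)
  \<comment> \<open>One majorant for both unknowns and all times up to T. Its sum over the modes is
    a constant times the initial energy, hence integrable against the Gevrey weight; this yields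
    regularity of the modes and continuity in time together.\<close>
  define mm where "mm T n \<xi> = maj (M T * T) (e0 \<xi>) n" for T n \<xi>
  have e0m [measurable]: "(\<lambda>\<xi>. e0 \<xi> n) \<in> borel_measurable borel" for n unfolding e0_def by measurable
  have mmm [measurable]: "mm T n \<in> borel_measurable borel" for T n
    unfolding mm_def by (rule maj_measurable) measurable
  have le_mm: "AE \<xi> in lborel. \<forall>n. \<forall>t\<in>{0..T}. ennreal (en_at Ws Js \<xi> n t) \<le> mm T n \<xi>" if T: "0 \<le> T" for T
    using good
  proof eventually_elim
    fix \<xi> assume p: "P \<xi>"
    then obtain K where K: "\<And>n t. 0 \<le> t \<Longrightarrow> t \<le> T \<Longrightarrow> en_at Ws Js \<xi> n t \<le> K"
      using T unfolding P_def by blast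
    have e: "(\<lambda>m. en_at Ws Js \<xi> m 0) = e0 \<xi>"
      using p by (simp add: P_def en_def e0_def fun_eq_iff)
    show "\<forall>n. \<forall>t\<in>{0..T}. ennreal (en_at Ws Js \<xi> n t) \<le> mm T n \<xi>"
    proof (intro allI ballI)
      fix n t assume t: "t \<in> {0..T}"
      have "ennreal (en_at Ws Js \<xi> n t) \<le> maj (M T * t) (e0 \<xi>) n"
        unfolding e[symmetric] M_def
        by (rule en_le_maj[OF _ _ K]) (use p t in \<open>auto simp: P_def zs U(2)\<close>)
      also have "... \<le> mm T n \<xi>"
        unfolding mm_def using t M0[of T] by (intro maj_mono mult_left_mono) (auto simp: e0_def)
      finally show "ennreal (en_at Ws Js \<xi> n t) \<le> mm T n \<xi>" .
    qed
  qed
  have zmm: "zsum (\<lambda>n. mm T n \<xi>) = ennreal (exp (3 * (M T * T))) * zsum (\<lambda>n. ennreal (e0 \<xi> n))" if "0 \<le> T" for T \<xi>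
    unfolding mm_def by (rule zsum_maj) (use M0 that in \<open>auto simp: e0_def\<close>)
  have gmm: "(\<integral>\<^sup>+\<xi>. gw \<xi> * zsum (\<lambda>n. mm T n \<xi>) \<partial>lborel) < \<infinity>" if T: "0 \<le> T" for T
  proof -
    have "(\<integral>\<^sup>+\<xi>. gw \<xi> * zsum (\<lambda>n. mm T n \<xi>) \<partial>lborel) = (\<integral>\<^sup>+\<xi>. ennreal (exp (3 * (M T * T))) * (gw \<xi> * zsum (\<lambda>n. ennreal (e0 \<xi> n))) \<partial>lborel)"
      by (simp only: zmm[OF T] mult.left_commute)
    also have "... = ennreal (exp (3 * (M T * T))) * mode_energy gw U V"
      unfolding mode_energy_def e0_def by (rule nn_integral_cmult) (auto intro!: borel_measurable_times_ennreal zsum_measurable)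
    finally show ?thesis using G0 by (simp add: ennreal_mult_less_top)
  qed
  have fmm: "zsum (\<lambda>n. \<integral>\<^sup>+\<xi>. mm T n \<xi> \<partial>lborel) < \<infinity>" if T: "0 \<le> T" for T
  proof -
    have "zsum (\<lambda>n. \<integral>\<^sup>+\<xi>. mm T n \<xi> \<partial>lborel) = (\<integral>\<^sup>+\<xi>. zsum (\<lambda>n. mm T n \<xi>) \<partial>lborel)"
      by (rule zsum_swap[symmetric]) measurable
    also have "... \<le> (\<integral>\<^sup>+\<xi>. gw \<xi> * zsum (\<lambda>n. mm T n \<xi>) \<partial>lborel)"
      using mult_right_mono[OF gw1] by (intro nn_integral_mono) fastforce
    finally show ?thesis using gmm[OF T] by (rule le_less_trans)
  qed
  have comp: "AE \<xi> in lborel. \<forall>n. \<forall>t\<in>{0..T}. nsq (Ws n t \<xi>) \<le> mm T n \<xi>"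
    "AE \<xi> in lborel. \<forall>n. \<forall>t\<in>{0..T}. nsq (Js n t \<xi>) \<le> mm T n \<xi>" if T: "0 \<le> T" for T
  proof -
    have le: "nsq (Ws n t \<xi>) \<le> ennreal (en_at Ws Js \<xi> n t)"
      "nsq (Js n t \<xi>) \<le> ennreal (en_at Ws Js \<xi> n t)" for n t \<xi>
      by (simp_all add: en_def ennreal_leI del: ennreal_plus)
    show "AE \<xi> in lborel. \<forall>n. \<forall>t\<in>{0..T}. nsq (Ws n t \<xi>) \<le> mm T n \<xi>"
      using le_mm[OF T] by eventually_elim (blast intro: order_trans[OF le(1)])
    show "AE \<xi> in lborel. \<forall>n. \<forall>t\<in>{0..T}. nsq (Js n t \<xi>) \<le> mm T n \<xi>"
      using le_mm[OF T] by eventually_elim (blast intro: order_trans[OF le(2)])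
  qed
  have reg: "integrable lborel (X n t)" "zsum (\<lambda>n. sqn lborel (X n t)) < \<infinity>"
    if X: "\<And>n t. X n t \<in> borel_measurable borel" and t: "0 \<le> t"
      and b: "\<And>T. 0 \<le> T \<Longrightarrow> AE \<xi> in lborel. \<forall>n. \<forall>t\<in>{0..T}. nsq (X n t \<xi>) \<le> mm T n \<xi>" for X :: "int \<Rightarrow> real \<Rightarrow> real \<Rightarrow> complex" and n t
  proof -
    note X[measurable]
    show "integrable lborel (X n t)"
    proof (rule integrable_of_gevrey[OF C X])
      have "(\<integral>\<^sup>+\<xi>. gevrey_w C \<xi> * nsq (X n t \<xi>) \<partial>lborel) \<le> (\<integral>\<^sup>+\<xi>. gw \<xi> * zsum (\<lambda>n. mm t n \<xi>) \<partial>lborel)"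
        using b[OF t]
        by (intro nn_integral_mono_AE, eventually_elim)
           (use t in \<open>auto simp: gw_def intro!: mult_left_mono order_trans[OF _ member_le_zsum[of _ n]]\<close>)
      also have "... < \<infinity>" by (rule gmm[OF t])
      finally show "(\<integral>\<^sup>+\<xi>. gevrey_w C \<xi> * nsq (X n t \<xi>) \<partial>lborel) < \<infinity>" .
    qed
    have "zsum (\<lambda>n. sqn lborel (X n t)) \<le> zsum (\<lambda>n. \<integral>\<^sup>+\<xi>. mm t n \<xi> \<partial>lborel)"
      unfolding sqn_def
      by (rule nn_integral_mono, rule nn_integral_mono_AE, rule eventually_mono[OF b[OF t]]) (use t in auto)
    then show "zsum (\<lambda>n. sqn lborel (X n t)) < \<infinity>" using fmm[OF t] by (rule le_less_trans)
  qed
  have exi: "\<exists>v. \<forall>t\<ge>0. v t \<in> L2_cyl \<and> has_fourier (v t) (\<lambda>n. X n t)"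
    if X: "\<And>n t. X n t \<in> borel_measurable borel"
      and b: "\<And>T. 0 \<le> T \<Longrightarrow> AE \<xi> in lborel. \<forall>n. \<forall>t\<in>{0..T}. nsq (X n t \<xi>) \<le> mm T n \<xi>"
      and s: "\<And>n t \<xi>. X (- n) t (- \<xi>) = cnj (X n t \<xi>)" for X :: "int \<Rightarrow> real \<Rightarrow> real \<Rightarrow> complex"
  proof -
    have "\<exists>v. v \<in> L2_cyl \<and> has_fourier v (\<lambda>n. X n t)" if t: "0 \<le> t" for t
      using fourier_inverse[of "\<lambda>n. X n t", OF reg[OF X t b] s] by blast
    then show ?thesis by metis
  qed
  obtain w where w: "\<And>t. 0 \<le> t \<Longrightarrow> w t \<in> L2_cyl" "\<And>t. 0 \<le> t \<Longrightarrow> has_fourier (w t) (\<lambda>n. Ws n t)"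
    using exi[OF ms(1) comp(1) sym(1)] by blast
  obtain j where j: "\<And>t. 0 \<le> t \<Longrightarrow> j t \<in> L2_cyl" "\<And>t. 0 \<le> t \<Longrightarrow> has_fourier (j t) (\<lambda>n. Js n t)"
    using exi[OF ms(2) comp(2) sym(2)] by blast
  have contin: "((\<lambda>\<tau>. L2_dist_sq (v \<tau>) (v t)) \<longlongrightarrow> 0) (at t within {0..})"
    if X: "\<And>n t. X n t \<in> borel_measurable borel"
      and b: "\<And>T. 0 \<le> T \<Longrightarrow> AE \<xi> in lborel. \<forall>n. \<forall>t\<in>{0..T}. nsq (X n t \<xi>) \<le> mm T n \<xi>"
      and s: "\<And>n t \<xi>. X (- n) t (- \<xi>) = cnj (X n t \<xi>)"
      and c: "AE \<xi> in lborel. \<forall>n. continuous_on {0..} (\<lambda>t. X n t \<xi>)"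
      and v: "\<And>t. 0 \<le> t \<Longrightarrow> v t \<in> L2_cyl" "\<And>t. 0 \<le> t \<Longrightarrow> has_fourier (v t) (\<lambda>n. X n t)" and t: "0 \<le> t"
    for X :: "int \<Rightarrow> real \<Rightarrow> real \<Rightarrow> complex" and v t
    unfolding tendsto_at_iff_sequentially
  proof (intro allI impI)
    fix S :: "nat \<Rightarrow> real" assume S: "\<forall>i. S i \<in> {0..} - {t}" "S \<longlonglongrightarrow> t"
    obtain B where B: "\<And>i. norm (S i) \<le> B" using convergent_imp_Bseq[of S] S(2) by (auto simp: Bseq_def convergent_def)
    define T where "T = max B t"
    have ST: "S i \<in> {0..T}" "t \<in> {0..T}" for i
      using S(1) B[of i] t by (auto simp: T_def)
    have T: "0 \<le> T" using t by (simp add: T_def)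
    have lim: "(\<lambda>i. zsum (\<lambda>n. sqn lborel (\<lambda>\<xi>. X n (S i) \<xi> - X n t \<xi>))) \<longlonglongrightarrow> 0"
      by (rule modes_L2_continuous[OF X mmm c b[OF T] fmm[OF T] ST(1) S(2) ST(2)])
    have le: "L2_dist_sq (v (S i)) (v t) \<le> 2 * zsum (\<lambda>n. sqn lborel (\<lambda>\<xi>. X n (S i) \<xi> - X n t \<xi>))" for i
    proof (rule L2_dist_le_fourier)
      have i0: "0 \<le> S i" using S(1) by simp
      show "v (S i) \<in> L2_cyl" "has_fourier (v (S i)) (\<lambda>n. X n (S i))" "v t \<in> L2_cyl" "has_fourier (v t) (\<lambda>n. X n t)"
        using v i0 t by auto
      note r1 = reg[OF X i0 b] and r2 = reg[OF X t b]
      show "integrable lborel (\<lambda>\<xi>. X k (S i) \<xi> - X k t \<xi>)" for k by (intro Bochner_Integration.integrable_diff r1 r2)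
      have "zsum (\<lambda>k. sqn lborel (\<lambda>\<xi>. X k (S i) \<xi> - X k t \<xi>)) \<le> zsum (\<lambda>k. 2 * sqn lborel (X k (S i)) + 2 * sqn lborel (X k t))"
        by (intro nn_integral_mono sqn_diff) (use X in auto)
      also have "... < \<infinity>" using r1(2) r2(2) by (simp add: zsum_add zsum_cmult ennreal_mult_less_top)
      finally show "zsum (\<lambda>k. sqn lborel (\<lambda>\<xi>. X k (S i) \<xi> - X k t \<xi>)) < \<infinity>" .
    qed (use s in auto)
    have "(\<lambda>i. 2 * zsum (\<lambda>n. sqn lborel (\<lambda>\<xi>. X n (S i) \<xi> - X n t \<xi>))) \<longlonglongrightarrow> 2 * 0"
      by (intro ennreal_tendsto_cmult lim) simp
    then have l2: "(\<lambda>i. 2 * zsum (\<lambda>n. sqn lborel (\<lambda>\<xi>. X n (S i) \<xi> - X n t \<xi>))) \<longlonglongrightarrow> 0" by simp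
    show "((\<lambda>\<tau>. L2_dist_sq (v \<tau>) (v t)) \<circ> S) \<longlonglongrightarrow> 0"
      unfolding comp_def
      by (rule tendsto_sandwich[OF _ _ tendsto_const l2]) (auto intro!: always_eventually le)
  qed
  have init: "AE z in cyl. v z = u z"
    if "u \<in> L2_cyl" "v \<in> L2_cyl" "has_fourier u Y" "has_fourier v X" "\<And>n. AE \<xi> in lborel. X n \<xi> = Y n \<xi>" for u v X Y
  proof -
    have "AE z in cyl. v z - u z = 0"
      by (rule has_fourier_injective[OF L2_cyl_diff[OF that(2,1)] has_fourier_diff[OF that(2,1,4,3)]])
         (use that(5) in \<open>auto elim: eventually_mono\<close>)
    then show ?thesis by eventually_elim simp
  qed
  have "is_solution \<alpha> \<kappa> c w0 j0 w j"
    unfolding is_solution_def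
  proof (intro conjI allI impI)
    show "AE z in cyl. w 0 z = w0 z"
      by (rule init[OF L2(1) w(1)[OF order_refl] U(1) w(2)[OF order_refl] eventually_mono[OF good]]) (simp add: P_def)
    show "AE z in cyl. j 0 z = j0 z"
      by (rule init[OF L2(2) j(1)[OF order_refl] V(1) j(2)[OF order_refl] eventually_mono[OF good]]) (simp add: P_def)
    fix t :: real assume t: "0 \<le> t"
    show "w t \<in> L2_cyl" "j t \<in> L2_cyl" using w j t by auto
    show "zero_x_average (w t)" "zero_x_average (j t)"
      using zero_x_average_iff[OF w(1)[OF t] w(2)[OF t]] zero_x_average_iff[OF j(1)[OF t] j(2)[OF t]] zs by auto
    have "AE \<xi> in lborel. \<forall>n. continuous_on {0..} (\<lambda>t. Ws n t \<xi>)" "AE \<xi> in lborel. \<forall>n. continuous_on {0..} (\<lambda>t. Js n t \<xi>)"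
      by (rule eventually_mono[OF good], use ode_continuous in \<open>force simp: P_def\<close>)+
    then show "((\<lambda>\<tau>. L2_dist_sq (w \<tau>) (w t)) \<longlongrightarrow> 0) (at t within {0..})"
      "((\<lambda>\<tau>. L2_dist_sq (j \<tau>) (j t)) \<longlongrightarrow> 0) (at t within {0..})"
      using contin[OF ms(1) comp(1) sym(1) _ w t] contin[OF ms(2) comp(2) sym(2) _ j t] by blast+
  next
    show "\<exists>W J. (\<forall>t\<ge>0. has_fourier (w t) (W t) \<and> has_fourier (j t) (J t)) \<and>
        (\<forall>k. AE \<xi> in lborel. \<forall>t\<ge>0.
          ((\<lambda>\<tau>. W \<tau> k \<xi>) has_vector_derivative
             of_real \<alpha> * dx (J t) k \<xi>
             - nonzero_modes (\<lambda>k \<xi>. of_real (2 * c) * sin_mult (dy (lap_inv t (W t))) k \<xi>) k \<xi>)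
            (at t within {0..}) \<and>
          ((\<lambda>\<tau>. J \<tau> k \<xi>) has_vector_derivative
             of_real \<kappa> * lap t (J t) k \<xi> + of_real \<alpha> * dx (W t) k \<xi>
             - 2 * dx (dyt t (lap_inv t (J t))) k \<xi>)
            (at t within {0..}))"
    proof (rule exI[of _ "\<lambda>t n. Ws n t"], rule exI[of _ "\<lambda>t n. Js n t"], intro conjI allI impI)
      show "has_fourier (w t) (\<lambda>n. Ws n t)" "has_fourier (j t) (\<lambda>n. Js n t)" if "0 \<le> t" for t using w j that by auto
      fix k
      show "AE \<xi> in lborel. \<forall>t\<ge>0.
          ((\<lambda>\<tau>. Ws k \<tau> \<xi>) has_vector_derivative
             of_real \<alpha> * dx (\<lambda>n. Js n t) k \<xi>
             - nonzero_modes (\<lambda>k \<xi>. of_real (2 * c) * sin_mult (dy (lap_inv t (\<lambda>n. Ws n t))) k \<xi>) k \<xi>)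
            (at t within {0..}) \<and>
          ((\<lambda>\<tau>. Js k \<tau> \<xi>) has_vector_derivative
             of_real \<kappa> * lap t (\<lambda>n. Js n t) k \<xi> + of_real \<alpha> * dx (\<lambda>n. Ws n t) k \<xi>
             - 2 * dx (dyt t (lap_inv t (\<lambda>n. Js n t))) k \<xi>)
            (at t within {0..})"
        unfolding eqn_w eqn_j by (rule eventually_mono[OF good]) (simp add: P_def ode_def)
    qed
  qed
  then show ?thesis by blast
qed

end

section \<open>Growth along a chain of resonances\<close>

text \<open>After the last time at which \<open>f\<close> is at most \<open>M\<close>, the function
  is nonincreasing, so its final value cannot exceed the value at that time.\<close>

lemma barrier:
  fixes f :: "real \<Rightarrow> real"
  assumes ab: "0 \<le> a" "a \<le> b"
    and f: "\<And>t. t \<in> {a..b} \<Longrightarrow> (f has_real_derivative f' t) (at t within {0..})"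
    and neg: "\<And>t. t \<in> {a..b} \<Longrightarrow> M < f t \<Longrightarrow> f' t \<le> 0"
    and fa: "f a \<le> M"
  shows "f b \<le> M"
proof (rule ccontr)
  assume "\<not> f b \<le> M"
  then have fb: "M < f b" by simp
  have cont: "continuous_on {a..b} f"
    unfolding continuous_on_eq_continuous_within
  proof
    fix x assume x: "x \<in> {a..b}"
    show "continuous (at x within {a..b}) f"
      by (rule continuous_within_subset[OF DERIV_continuous[OF f[OF x]]]) (use ab in auto)
  qed
  define A where "A = {a..b} \<inter> f -` {..M}"
  have cl: "closed A" unfolding A_def by (intro continuous_closed_preimage cont) auto
  have A: "a \<in> A" "bdd_above A" using ab fa by (auto simp: A_def intro: bdd_above_mono[of "{a..b}"])
  define s where "s = Sup A"
  have sA: "s \<in> A" unfolding s_def by (rule closed_contains_Sup) (use A cl in auto)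
  then have s: "a \<le> s" "s \<le> b" "f s \<le> M" by (auto simp: A_def)
  have "s < b" using s fb by (cases "s = b") auto
  have gt: "M < f t" if "s < t" "t \<le> b" for t
  proof (rule ccontr)
    assume "\<not> M < f t"
    then have "t \<in> A" using that s by (auto simp: A_def)
    then show False using cSup_upper[of t A] A(2) that by (simp add: s_def)
  qed
  have near: "f b \<le> f t" if "s < t" "t \<le> b" for t
  proof -
    have "f b - f t \<le> 0 - 0"
      by (rule deriv_compare[of t b f f' "\<lambda>_. 0" "\<lambda>_. 0"]) (use that s ab gt neg f in auto)
    then show ?thesis by simp
  qed
  have "f b \<le> f s"
  proof (rule tendsto_lowerbound)
    have "continuous (at_right s) f"
      using continuous_on_Icc_at_rightD[OF continuous_on_subset[OF cont] \<open>s < b\<close>] s by (auto simp: continuous_within)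
    then show "(f \<longlongrightarrow> f s) (at_right s)" by (simp add: continuous_within)
    show "\<forall>\<^sub>F t in at_right s. f b \<le> f t"
      unfolding eventually_at_right[OF \<open>s < b\<close>] using near \<open>s < b\<close> by (intro exI[of _ b]) auto
  qed simp
  then show False using s fb by simp
qed

lemma arctan_ge_pos: "0 < x \<Longrightarrow> pi / 2 - 1 / x \<le> arctan x"
proof -
  assume x: "0 < x"
  have "arctan (1 / x) = pi / 2 - arctan x" using arctan_inverse[of x] x by (simp add: sgn_if inverse_eq_divide)
  moreover have "arctan (1 / x) \<le> 1 / x" using arctan_le_self[of "1 / x"] x by simp
  ultimately show ?thesis by linarith
qed

lemma arctan_diff_le_pi: "arctan x - arctan y \<le> pi"
  using arctan_bounded[of x] arctan_bounded[of y] by linarith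

locale orbit = mhd +
  fixes \<xi> :: real and W J :: "int \<Rightarrow> real \<Rightarrow> complex"
  assumes ode: "ode \<xi> W J" and W00: "W 0 0 = 0" and \<xi>: "0 < \<xi>"
    and bounded: "\<And>T. 0 \<le> T \<Longrightarrow> \<exists>K. \<forall>n t. 0 \<le> t \<longrightarrow> t \<le> T \<longrightarrow> en W J n t \<le> K"
begin

definition ee where "ee n t = sqrt (en W J n t)"
definition LL where "LL n = c * \<xi> / (real_of_int n)\<^sup>2"
text \<open>A primitive in time of \<open>qq n\<close>. The total increment over all times is
  \<open>pi * LL n\<close>, so increments of \<open>GG\<close> tell which share of the coupling
  exerted by mode n is spent in a time interval.\<close>

definition GG where "GG n t = LL n * arctan (t - \<xi> / real_of_int n)"
definition mu where "mu n t = \<alpha> * real_of_int n / (\<kappa> * psym n \<xi> t)"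
definition dd where "dd n t = \<alpha>\<^sup>2 * (real_of_int n)\<^sup>2 / (\<kappa> * psym n \<xi> t)"
text \<open>
  Since \<open>J n\<close> relaxes fast to a multiple of \<open>W n\<close>, the combination \<open>Wt\<close> is the slow variable:
  in its equation all terms in \<open>J n\<close> cancel exactly, leaving the coupling and the damping \<open>dd n\<close>,
  whose integral across a resonance is at most \<open>\<pi>/\<beta>\<close>.
\<close>

definition Wt where "Wt n t = W n t + \<i> * of_real (mu n t) * J n t"

lemma ee_nonneg: "0 \<le> ee n t" by (simp add: ee_def en_nonneg)

lemma W_le_ee: "cmod (W n t) \<le> ee n t" and J_le_ee: "cmod (J n t) \<le> ee n t"
  using W_le_en by (simp_all add: ee_def)

lemma LL_nonneg: "0 \<le> LL n" using c \<xi> by (simp add: LL_def)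

lemma psym_factor: "n \<noteq> 0 \<Longrightarrow> psym n \<xi> t = (real_of_int n)\<^sup>2 * (1 + (t - \<xi> / real_of_int n)\<^sup>2)"
  by (simp add: psym_def power2_eq_square field_simps)

lemma GG_deriv: "(GG n has_real_derivative qq n \<xi> t) (at t within S)"
proof (cases "n = 0")
  case True
  then show ?thesis by (simp add: GG_def[abs_def] LL_def qq_def)
next
  case False
  have pos: "0 < 1 + (t - \<xi> / real_of_int n)\<^sup>2" by (simp add: add_pos_nonneg)
  have "((\<lambda>t. LL n * arctan (t - \<xi> / real_of_int n)) has_real_derivative LL n * inverse (1 + (t - \<xi> / real_of_int n)\<^sup>2)) (at t within S)"
    by (auto intro!: derivative_eq_intros)
  also have "LL n * inverse (1 + (t - \<xi> / real_of_int n)\<^sup>2) = qq n \<xi> t"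
    using False pos \<xi> by (simp add: qq_def LL_def psym_factor[OF False] divide_inverse)
  finally show ?thesis by (simp add: GG_def[abs_def])
qed

lemma GG_diff_le_pi: "GG n t - GG n s \<le> pi * LL n"
proof -
  have "GG n t - GG n s = LL n * (arctan (t - \<xi> / real_of_int n) - arctan (s - \<xi> / real_of_int n))"
    by (simp add: GG_def algebra_simps)
  also have "... \<le> LL n * pi" by (intro mult_left_mono arctan_diff_le_pi LL_nonneg)
  finally show ?thesis by (simp add: mult.commute)
qed

text \<open>If the interval stays on one side of the resonance at distance \<delta>, the arctangent
  varies there by at most its tail 1 / \<delta>.\<close>

lemma GG_gap:
  assumes n: "n \<noteq> 0" and \<delta>: "0 < \<delta>" and off: "t \<le> \<xi> / real_of_int n - \<delta> \<or> \<xi> / real_of_int n + \<delta> \<le> s"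
  shows "GG n t - GG n s \<le> LL n / \<delta>"
proof -
  let ?u = "t - \<xi> / real_of_int n" and ?v = "s - \<xi> / real_of_int n"
  have a: "pi / 2 - 1 / \<delta> \<le> arctan \<delta>" by (rule arctan_ge_pos[OF \<delta>])
  have "arctan ?u \<le> - arctan \<delta> \<or> arctan \<delta> \<le> arctan ?v"
    using off unfolding arctan_minus[symmetric] by (auto intro!: arctan_monotone')
  then have "arctan ?u - arctan ?v \<le> 1 / \<delta>"
    using a arctan_bounded[of ?u] arctan_bounded[of ?v] by linarith
  then have "LL n * (arctan ?u - arctan ?v) \<le> LL n * (1 / \<delta>)" by (rule mult_left_mono[OF _ LL_nonneg])
  then show ?thesis by (simp add: GG_def right_diff_distrib)
qed

text \<open>The gap between \<xi> / (n + 1/2) and the resonance \<xi> / n is \<xi> / (n (2 n + 1)).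
  Dividing \<open>LL n\<close> by it cancels \<xi> and one power of n, so that only a multiple of c
  remains.\<close>

lemma GG_before:
  assumes t: "t \<le> \<xi> / (real_of_int n + 1 / 2)" and n: "1 \<le> n"
  shows "GG n t - GG n s \<le> 3 * c"
proof -
  define x where "x = real_of_int n"
  have x: "1 \<le> x" using n by (simp add: x_def)
  have "GG n t - GG n s \<le> LL n / (\<xi> / (x * (2 * x + 1)))"
  proof (rule GG_gap)
    have "\<xi> / (x * (2 * x + 1)) = \<xi> / x - \<xi> / (x + 1 / 2)" using x by (simp add: field_simps)
    then show "t \<le> \<xi> / real_of_int n - \<xi> / (x * (2 * x + 1)) \<or> \<xi> / real_of_int n + \<xi> / (x * (2 * x + 1)) \<le> s"
      using t by (simp add: x_def)
  qed (use n x \<xi> in auto)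
  also have "\<dots> = c * ((2 * x + 1) / x)" using x \<xi> by (simp add: LL_def x_def[symmetric] power2_eq_square)
  also have "\<dots> \<le> c * 3" using x c by (intro mult_left_mono) (simp_all add: divide_le_eq)
  finally show ?thesis by simp
qed

text \<open>The margin is 1/4 and not 1/2 because the times will be set by N while \<xi> may exceed
  N by one; \<open>t1_ge\<close> shows that this shift costs at most a quarter of an index.\<close>

lemma GG_after:
  assumes s: "\<xi> / (real_of_int n - 1 / 4) \<le> s" and n: "1 \<le> n"
  shows "GG n t - GG n s \<le> 4 * c"
proof -
  define x where "x = real_of_int n"
  have x: "1 \<le> x" using n by (simp add: x_def)
  have "GG n t - GG n s \<le> LL n / (\<xi> / (x * (4 * x - 1)))"
  proof (rule GG_gap)
    have "\<xi> / (x * (4 * x - 1)) = \<xi> / (x - 1 / 4) - \<xi> / x" using x by (simp add: field_simps)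
    then show "t \<le> \<xi> / real_of_int n - \<xi> / (x * (4 * x - 1)) \<or> \<xi> / real_of_int n + \<xi> / (x * (4 * x - 1)) \<le> s"
      using s by (simp add: x_def)
  qed (use n x \<xi> in auto)
  also have "\<dots> = c * ((4 * x - 1) / x)" using x \<xi> by (simp add: LL_def x_def[symmetric] power2_eq_square)
  also have "\<dots> \<le> c * 4" using x c by (intro mult_left_mono) (simp_all add: divide_le_eq)
  finally show ?thesis by simp
qed

text \<open>The resonance of a negative mode lies at a negative time, at distance \<xi> /
  \<bar>n\<bar> from the half-line.\<close>

lemma GG_nonpos:
  assumes n: "n \<le> 0" and s: "0 \<le> s"
  shows "GG n t - GG n s \<le> c"
proof (cases "n = 0")
  case True
  then show ?thesis using c by (simp add: GG_def LL_def)
next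
  case False
  define x where "x = - real_of_int n"
  have "1 \<le> real_of_int (- n)" using n False by linarith
  then have x: "1 \<le> x" by (simp add: x_def)
  have nx: "real_of_int n = - x" by (simp add: x_def)
  have "GG n t - GG n s \<le> LL n / (\<xi> / x)"
    by (rule GG_gap) (use False x \<xi> s in \<open>simp_all add: nx\<close>)
  also have "\<dots> = c / x" using x \<xi> by (simp add: LL_def nx power2_eq_square)
  also have "\<dots> \<le> c" using x c by (simp add: divide_le_eq)
  finally show ?thesis .
qed

text \<open>The square root of the energy of a mode obeys an inequality that is linear in the
  neighbours and free of \<alpha> n. Nonnegative \<open>lam\<close> lets the current term be
  dropped, and constant bounds on the neighbours leave only increments of \<open>GG\<close>.\<close>

lemma ee_step:
  assumes ab: "0 \<le> a" "a \<le> b" and l: "\<And>t. t \<in> {a..b} \<Longrightarrow> 0 \<le> lam n \<xi> t"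
    and A: "\<And>t. t \<in> {a..b} \<Longrightarrow> ee (n - 1) t \<le> A" and B: "\<And>t. t \<in> {a..b} \<Longrightarrow> ee (n + 1) t \<le> B"
  shows "ee n b \<le> ee n a + (A * (GG (n - 1) b - GG (n - 1) a) + B * (GG (n + 1) b - GG (n + 1) a))"
proof -
  have A0: "0 \<le> A" "0 \<le> B" using A[of a] B[of a] ab ee_nonneg[of "n - 1" a] ee_nonneg[of "n + 1" a] by auto
  have "sqrt (en W J n b) \<le> sqrt (en W J n a) + ((A * GG (n - 1) b + B * GG (n + 1) b) - (A * GG (n - 1) a + B * GG (n + 1) a))"
  proof (rule deriv_compare_sqrt[OF ab en_nonneg])
    fix t assume t: "t \<in> {a..b}"
    then have t0: "0 \<le> t" using ab by auto
    show "(en W J n has_real_derivative 2 * Re (cnj (W n t) * coup (\<lambda>m. W m t) n \<xi> t) - 2 * lam n \<xi> t * (cmod (J n t))\<^sup>2) (at t within {0..})"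
      by (rule en_has_derivative[OF ode t0])
    show "((\<lambda>t. A * GG (n - 1) t + B * GG (n + 1) t) has_real_derivative A * qq (n - 1) \<xi> t + B * qq (n + 1) \<xi> t) (at t within {0..})"
      by (intro DERIV_add DERIV_cmult GG_deriv)
    show "0 \<le> A * qq (n - 1) \<xi> t + B * qq (n + 1) \<xi> t" using A0 by (simp add: qq_nonneg)
    have "cmod (coup (\<lambda>m. W m t) n \<xi> t) \<le> qq (n - 1) \<xi> t * cmod (W (n - 1) t) + qq (n + 1) \<xi> t * cmod (W (n + 1) t)"
      by (rule coup_le) (rule ode_w0[OF ode W00 t0])
    also have "... \<le> qq (n - 1) \<xi> t * A + qq (n + 1) \<xi> t * B"
      by (intro add_mono mult_left_mono qq_nonneg order_trans[OF W_le_ee] A B t)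
    finally have cp: "cmod (coup (\<lambda>m. W m t) n \<xi> t) \<le> A * qq (n - 1) \<xi> t + B * qq (n + 1) \<xi> t" by (simp add: mult.commute)
    have "Re (cnj (W n t) * coup (\<lambda>m. W m t) n \<xi> t) \<le> cmod (W n t) * cmod (coup (\<lambda>m. W m t) n \<xi> t)"
      using complex_Re_le_cmod[of "cnj (W n t) * coup (\<lambda>m. W m t) n \<xi> t"] by (simp add: norm_mult)
    also have "... \<le> sqrt (en W J n t) * (A * qq (n - 1) \<xi> t + B * qq (n + 1) \<xi> t)"
      by (intro mult_mono W_le_en cp) (auto simp: en_nonneg)
    finally have "2 * Re (cnj (W n t) * coup (\<lambda>m. W m t) n \<xi> t) \<le> 2 * sqrt (en W J n t) * (A * qq (n - 1) \<xi> t + B * qq (n + 1) \<xi> t)" by linarith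
    moreover have "0 \<le> lam n \<xi> t * (cmod (J n t))\<^sup>2" using l[OF t] by simp
    ultimately show "2 * Re (cnj (W n t) * coup (\<lambda>m. W m t) n \<xi> t) - 2 * lam n \<xi> t * (cmod (J n t))\<^sup>2
      \<le> 2 * sqrt (en W J n t) * (A * qq (n - 1) \<xi> t + B * qq (n + 1) \<xi> t)" by linarith
  qed
  then show ?thesis by (simp add: ee_def algebra_simps)
qed

text \<open>The current is slaved to the vorticity: above the level \<open>M\<close> its damping
  outweighs the source, so \<open>barrier\<close> applies to the squared modulus.\<close>

lemma J_step:
  assumes ab: "0 \<le> a" "a \<le> b" and l: "\<And>t. t \<in> {a..b} \<Longrightarrow> 0 \<le> lam n \<xi> t"
    and S: "\<And>t. t \<in> {a..b} \<Longrightarrow> \<alpha> * \<bar>real_of_int n\<bar> * cmod (W n t) \<le> M * lam n \<xi> t"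
    and M: "cmod (J n a) \<le> M"
  shows "cmod (J n b) \<le> M"
proof -
  have M0: "0 \<le> M" using M norm_ge_zero order_trans by blast
  have "(cmod (J n b))\<^sup>2 \<le> M\<^sup>2"
  proof (rule barrier[OF ab, where f'="\<lambda>t. 2 * Re (cnj (J n t) * (- of_real (lam n \<xi> t) * J n t + \<i> * of_real (\<alpha> * real_of_int n) * W n t))"])
    fix t assume t: "t \<in> {a..b}"
    then have t0: "0 \<le> t" using ab by auto
    show "((\<lambda>t. (cmod (J n t))\<^sup>2) has_real_derivative 2 * Re (cnj (J n t) * (- of_real (lam n \<xi> t) * J n t + \<i> * of_real (\<alpha> * real_of_int n) * W n t))) (at t within {0..})"
      using ode t0 by (intro cmod_sq_has_derivative) (simp add: ode_def)
    assume gt: "M\<^sup>2 < (cmod (J n t))\<^sup>2"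
    then have "M \<le> cmod (J n t)" using power2_less_imp_less[OF gt] by simp
    then have "M * lam n \<xi> t \<le> cmod (J n t) * lam n \<xi> t" by (rule mult_right_mono[OF _ l[OF t]])
    then have 1: "\<alpha> * \<bar>real_of_int n\<bar> * cmod (W n t) \<le> cmod (J n t) * lam n \<xi> t" using S[OF t] by linarith
    have "Re (cnj (J n t) * (\<i> * of_real (\<alpha> * real_of_int n) * W n t)) \<le> cmod (J n t) * (\<alpha> * \<bar>real_of_int n\<bar> * cmod (W n t))"
      using complex_Re_le_cmod[of "cnj (J n t) * (\<i> * of_real (\<alpha> * real_of_int n) * W n t)"] \<alpha> by (simp add: norm_mult abs_mult)
    also have "... \<le> cmod (J n t) * (cmod (J n t) * lam n \<xi> t)" by (intro mult_left_mono 1) simp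
    finally have "Re (cnj (J n t) * (\<i> * of_real (\<alpha> * real_of_int n) * W n t)) \<le> lam n \<xi> t * (cmod (J n t))\<^sup>2"
      by (simp add: power2_eq_square mult_ac)
    moreover have "Re (cnj (J n t) * (- of_real (lam n \<xi> t) * J n t)) = - (lam n \<xi> t * (cmod (J n t))\<^sup>2)"
      by (simp add: cmod_power2) (simp add: power2_eq_square algebra_simps)
    ultimately show "2 * Re (cnj (J n t) * (- of_real (lam n \<xi> t) * J n t + \<i> * of_real (\<alpha> * real_of_int n) * W n t)) \<le> 0"
      by (simp only: distrib_left plus_complex.simps)
  next
    show "(cmod (J n a))\<^sup>2 \<le> M\<^sup>2" using M by (simp add: power_mono)
  qed
  then show ?thesis using M0 by (rule power2_le_imp_le)
qed

text \<open>The bound is uniform in the mode n. For k at least 2 the time is at most 4 \<xi> / (3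
  k), and \<open>psym_ge_freq\<close> then bounds the symbol below by a multiple of k^2.\<close>

lemma psym_ge_k:
  assumes k: "2 \<le> (k::real)" "k \<le> \<xi>" and t: "0 \<le> t" "t \<le> \<xi> / (k - 1 / 2)"
  shows "k\<^sup>2 / 4 \<le> psym n \<xi> t"
proof -
  have "3 / 4 * k \<le> k - 1 / 2" using k by simp
  then have "\<xi> / (k - 1 / 2) \<le> \<xi> / (3 / 4 * k)" using k \<xi> by (intro divide_left_mono) auto
  then have "t \<le> \<xi> / (3 / 4 * k)" using t by linarith
  then have "k * t \<le> 4 / 3 * \<xi>" using k by (simp add: field_simps)
  then have "(k * t)\<^sup>2 \<le> (4 / 3 * \<xi>)\<^sup>2" using k t by (intro power_mono) auto
  moreover have "k\<^sup>2 \<le> \<xi>\<^sup>2" using k by (intro power_mono) auto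
  moreover have "0 \<le> \<xi>\<^sup>2" by simp
  ultimately have "k\<^sup>2 / 4 * (1 + t\<^sup>2) \<le> \<xi>\<^sup>2"
  proof -
    assume a: "(k * t)\<^sup>2 \<le> (4 / 3 * \<xi>)\<^sup>2" "k\<^sup>2 \<le> \<xi>\<^sup>2" "0 \<le> \<xi>\<^sup>2"
    have "k\<^sup>2 / 4 * (1 + t\<^sup>2) = k\<^sup>2 / 4 + (k * t)\<^sup>2 / 4" "(4 / 3 * \<xi>)\<^sup>2 = 16 / 9 * \<xi>\<^sup>2"
      by (simp_all add: power_mult_distrib power_divide algebra_simps)
    then show ?thesis using a by linarith
  qed
  also have "... \<le> psym n \<xi> t * (1 + t\<^sup>2)" by (rule psym_ge_freq)
  finally show ?thesis by (rule mult_right_le_imp_le) (simp add: add_pos_nonneg)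
qed

text \<open>Eight in the hypothesis makes the resistive part at least 2, so the loss of 1 in
  \<open>lam_ge\<close> is at most half of it. The second bound uses that n k is at most twice the
  symbol; it makes the source \<alpha> n a small multiple of the damping for every n.\<close>

lemma lam_large:
  assumes k: "2 \<le> (k::real)" "k \<le> \<xi>" "8 \<le> \<kappa> * k\<^sup>2" and t: "0 \<le> t" "t \<le> \<xi> / (k - 1 / 2)"
  shows "1 \<le> lam n \<xi> t" "\<alpha> * \<bar>real_of_int n\<bar> \<le> 4 * \<alpha> / (\<kappa> * k) * lam n \<xi> t"
proof -
  have p: "k\<^sup>2 / 4 \<le> psym n \<xi> t" by (rule psym_ge_k[OF k(1,2) t])
  have "\<kappa> * (k\<^sup>2 / 4) \<le> \<kappa> * psym n \<xi> t" using p \<kappa> by simp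
  then have kp: "2 \<le> \<kappa> * psym n \<xi> t" using k(3) by linarith
  then have l: "\<kappa> * psym n \<xi> t / 2 \<le> lam n \<xi> t" using lam_ge[of n \<xi> t] by linarith
  then show "1 \<le> lam n \<xi> t" using kp by linarith
  have "\<bar>real_of_int n\<bar> * k \<le> 2 * psym n \<xi> t"
  proof -
    have "2 * \<bar>real_of_int n\<bar> * (k / 2) \<le> \<bar>real_of_int n\<bar>\<^sup>2 + (k / 2)\<^sup>2" by (rule sum_squares_bound)
    also have "... \<le> psym n \<xi> t + psym n \<xi> t" using psym_ge_sq[of n \<xi> t] p by (simp add: power_divide)
    finally show ?thesis by simp
  qed
  then have "\<alpha> * (\<bar>real_of_int n\<bar> * k) \<le> \<alpha> * (2 * psym n \<xi> t)" using \<alpha> by simp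
  then have "\<alpha> * \<bar>real_of_int n\<bar> \<le> 4 * \<alpha> / (\<kappa> * k) * (\<kappa> * psym n \<xi> t / 2)"
    using k \<kappa> by (simp add: field_simps)
  also have "... \<le> 4 * \<alpha> / (\<kappa> * k) * lam n \<xi> t" using l \<alpha> \<kappa> k by (intro mult_left_mono) auto
  finally show "\<alpha> * \<bar>real_of_int n\<bar> \<le> 4 * \<alpha> / (\<kappa> * k) * lam n \<xi> t" .
qed

lemma mu_nonneg: "0 \<le> n \<Longrightarrow> 0 \<le> mu n t" using \<alpha> \<kappa> by (simp add: mu_def psym_nonneg)

lemma mu_le: "1 \<le> n \<Longrightarrow> mu n t \<le> \<alpha> / (\<kappa> * real_of_int n)"
proof -
  assume n: "1 \<le> n"
  have "\<alpha> * real_of_int n / (\<kappa> * psym n \<xi> t) \<le> \<alpha> * real_of_int n / (\<kappa> * (real_of_int n)\<^sup>2)"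
    using n \<alpha> \<kappa> psym_ge_sq[of n \<xi> t] psym_ge_1[of n \<xi> t] by (intro divide_left_mono mult_left_mono mult_pos_pos) auto
  also have "... = \<alpha> / (\<kappa> * real_of_int n)" using n by (simp add: power2_eq_square)
  finally show ?thesis by (simp add: mu_def)
qed

lemma dd_nonneg: "0 \<le> dd n t" using \<alpha> \<kappa> by (simp add: dd_def psym_nonneg)

lemma dd_eq: "n \<noteq> 0 \<Longrightarrow> dd n t = \<alpha>\<^sup>2 / \<kappa> / LL n * qq n \<xi> t"
  using \<xi> c by (simp add: dd_def LL_def qq_def)

lemma Wt_deriv:
  assumes t: "0 \<le> t" and n: "n \<noteq> 0"
  shows "(Wt n has_vector_derivative coup (\<lambda>m. W m t) n \<xi> t - of_real (dd n t) * W n t) (at t within {0..})"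
proof -
  have p: "psym n \<xi> t \<noteq> 0" using psym_ge_1[OF n, of \<xi> t] by linarith
  define x where "x = real_of_int n"
  define r where "r = \<xi> - x * t"
  define P where "P = psym n \<xi> t"
  have P: "P \<noteq> 0" using p by (simp add: P_def)
  have W: "(W n has_vector_derivative \<i> * of_real (\<alpha> * x) * J n t + coup (\<lambda>m. W m t) n \<xi> t) (at t within {0..})"
    and J: "(J n has_vector_derivative - of_real (lam n \<xi> t) * J n t + \<i> * of_real (\<alpha> * x) * W n t) (at t within {0..})"
    using ode t by (auto simp: ode_def x_def)
  have "((\<lambda>t. mu n t) has_real_derivative \<alpha> * x * (2 * x * r) / (\<kappa> * P\<^sup>2)) (at t within {0..})"
    unfolding mu_def
    by (rule derivative_eq_intros psym_has_derivative refl)+ (use p \<kappa> in \<open>auto simp: P_def x_def r_def power2_eq_square field_simps\<close>)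
  then have mu': "((\<lambda>t. of_real (mu n t) :: complex) has_vector_derivative of_real (\<alpha> * x * (2 * x * r) / (\<kappa> * P\<^sup>2))) (at t within {0..})"
    by (intro has_vector_derivative_of_real) (simp add: has_real_derivative_iff_has_vector_derivative)
  have "(Wt n has_vector_derivative (\<i> * of_real (\<alpha> * x) * J n t + coup (\<lambda>m. W m t) n \<xi> t) +
     (\<i> * of_real (mu n t) * (- of_real (lam n \<xi> t) * J n t + \<i> * of_real (\<alpha> * x) * W n t) + \<i> * of_real (\<alpha> * x * (2 * x * r) / (\<kappa> * P\<^sup>2)) * J n t)) (at t within {0..})"
    unfolding Wt_def[abs_def]
    by (intro has_vector_derivative_add has_vector_derivative_mult has_vector_derivative_mult_right W J mu')
  also have "(\<i> * of_real (\<alpha> * x) * J n t + coup (\<lambda>m. W m t) n \<xi> t) +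
     (\<i> * of_real (mu n t) * (- of_real (lam n \<xi> t) * J n t + \<i> * of_real (\<alpha> * x) * W n t) + \<i> * of_real (\<alpha> * x * (2 * x * r) / (\<kappa> * P\<^sup>2)) * J n t) =
     \<i> * of_real (\<alpha> * x - mu n t * lam n \<xi> t + \<alpha> * x * (2 * x * r) / (\<kappa> * P\<^sup>2)) * J n t + (coup (\<lambda>m. W m t) n \<xi> t - of_real (mu n t * (\<alpha> * x)) * W n t)"
    by (simp add: algebra_simps)
  \<comment> \<open>The cancellation: \<open>mu\<close> is an exact solution of mu' = mu * lam -
    \<alpha> n.\<close>
  also have "\<alpha> * x - mu n t * lam n \<xi> t + \<alpha> * x * (2 * x * r) / (\<kappa> * P\<^sup>2) = 0"
  proof -
    have "lam n \<xi> t = \<kappa> * P + 2 * x * r / P" by (simp add: lam_def P_def x_def r_def)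
    show ?thesis
      unfolding mu_def P_def[symmetric] x_def[symmetric] \<open>lam n \<xi> t = _\<close>
      using P \<kappa> by (simp add: field_simps power2_eq_square)
  qed
  also have "mu n t * (\<alpha> * x) = dd n t"
    by (simp add: mu_def dd_def x_def power2_eq_square)
  finally show ?thesis by simp
qed

end

section \<open>Numerical bounds and the parameters of one resonance\<close>

lemma arctan_ge_cubic: "0 \<le> x \<Longrightarrow> x - x ^ 3 / 3 \<le> arctan x"
proof -
  assume x: "0 \<le> x"
  have "(x - x ^ 3 / 3) - (0 - 0 ^ 3 / 3) \<le> arctan x - arctan 0"
  proof (rule deriv_compare[OF order_refl x])
    fix t :: real assume "t \<in> {0..x}"
    show "((\<lambda>x. x - x ^ 3 / 3) has_real_derivative 1 - t\<^sup>2) (at t within {0..})"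
      by (auto intro!: derivative_eq_intros)
    show "(arctan has_real_derivative inverse (1 + t\<^sup>2)) (at t within {0..})"
      by (rule DERIV_subset[OF DERIV_arctan]) simp
    have "(1 - t\<^sup>2) * (1 + t\<^sup>2) = 1 - (t\<^sup>2)\<^sup>2" by (simp add: power2_eq_square algebra_simps)
    then have "(1 - t\<^sup>2) * (1 + t\<^sup>2) \<le> 1" by simp
    moreover have "0 < 1 + t\<^sup>2" by (simp add: add_pos_nonneg)
    ultimately show "1 - t\<^sup>2 \<le> inverse (1 + t\<^sup>2)" by (simp add: inverse_eq_divide pos_le_divide_eq)
  qed
  then show ?thesis by simp
qed

text \<open>By Machin's formula. This precision is needed because in \<open>la_ge\<close> pi - 1/10
  has to exceed 3.\<close>

lemma pi_gt_31: "31 / 10 < pi"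
proof -
  have "1 / 5 - (1 / 5) ^ 3 / 3 \<le> arctan (1 / 5)" by (rule arctan_ge_cubic) simp
  moreover have "arctan (1 / 239) \<le> 1 / 239" by (rule arctan_le_self) simp
  ultimately show ?thesis using machin by (simp add: power3_eq_cube)
qed

text \<open>The bound 50 k^2 <= N keeps the resonance at least 20 time units away from both ends of
  its interval. The first part of \<open>Lb\<close> is the guaranteed amplification 14; the other
  parts bound the total strength \<open>Q\<close> from below and keep c Q small, so that everything
  not resonant is perturbative. The last two parts of \<open>large\<close> make the difference of
  \<open>Wt k\<close> and \<open>W k\<close> negligible even after multiplication by
  \<open>Q\<close> squared or by \<open>Q\<close> / \<beta>.\<close>

locale regime = orbit +
  fixes k :: int and N \<beta> :: real
  assumes k2: "2 \<le> k" and N: "50 * (real_of_int k)\<^sup>2 \<le> N" "N \<le> \<xi>" "\<xi> \<le> N + 1"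
    and \<beta>: "\<beta> = \<kappa> / \<alpha>\<^sup>2" and Lb: "14 \<le> LL k * (\<beta> * (1 - exp (- 3 / \<beta>)))" "14 / 3 \<le> LL k" "c * LL k \<le> 16 / 5000"
    and c4: "c \<le> 1 / 10 ^ 4" "c \<le> \<beta> / 5000"
    and large: "8 \<le> \<kappa> * (real_of_int k)\<^sup>2" "\<alpha> / (\<kappa> * real_of_int k) * (pi * LL k)\<^sup>2 \<le> 1 / 1000"
      "\<alpha> / (\<kappa> * real_of_int k) * (pi * LL k) / \<beta> \<le> 1 / 1000"
begin

definition Q where "Q = pi * LL k"
definition e where "e = \<alpha> / (\<kappa> * real_of_int k)"

lemma kx: "2 \<le> real_of_int k" using k2 by linarith

lemma \<beta>_pos: "0 < \<beta>" using \<beta> \<alpha> \<kappa> by simp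

lemma Q_ge: "14 \<le> Q"
proof -
  have "3 * (14 / 3) \<le> pi * LL k" by (intro mult_mono) (use pi_gt_31 Lb in auto)
  then show ?thesis by (simp add: Q_def)
qed

lemma e_pos: "0 < e" using kx \<alpha> \<kappa> by (simp add: e_def)

lemma eQ: "e * Q\<^sup>2 \<le> 1 / 1000" "e * Q / \<beta> \<le> 1 / 1000" using large by (simp_all add: e_def Q_def)

lemma eQ1: "e * Q \<le> 1 / 14000" "e \<le> 1 / 100000"
proof -
  have "e * Q * 14 \<le> e * Q * Q" using Q_ge e_pos by (intro mult_left_mono) auto
  then show 1: "e * Q \<le> 1 / 14000" using eQ(1) by (simp add: power2_eq_square mult.assoc)
  have "e * 14 \<le> e * Q" using Q_ge e_pos by (intro mult_left_mono) auto
  then show "e \<le> 1 / 100000" using 1 by linarith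
qed

lemma cQ: "c * Q \<le> 128 / 10000"
proof -
  have "pi * (c * LL k) \<le> 4 * (16 / 5000)" by (intro mult_mono Lb) (use pi_less_4 c LL_nonneg in auto)
  then show ?thesis by (simp add: Q_def mult_ac)
qed

lemma k_le_xi: "real_of_int k \<le> \<xi>"
proof -
  have "real_of_int k * 1 \<le> real_of_int k * real_of_int k" using kx by (intro mult_left_mono) auto
  then show ?thesis using N kx unfolding power2_eq_square by linarith
qed

lemma N_large: "50 * real_of_int k \<le> N" "0 < N"
proof -
  have "real_of_int k * 1 \<le> real_of_int k * real_of_int k" using kx by (intro mult_left_mono) auto
  then show "50 * real_of_int k \<le> N" "0 < N" using N kx unfolding power2_eq_square by linarith+
qed

lemma dd_k: "dd k t = qq k \<xi> t / (\<beta> * LL k)"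
proof -
  have "dd k t = \<alpha>\<^sup>2 / \<kappa> / LL k * qq k \<xi> t" using k2 by (intro dd_eq) auto
  then show ?thesis by (simp add: \<beta>)
qed

lemma Wt_W: "1 \<le> n \<Longrightarrow> cmod (Wt n t - W n t) \<le> \<alpha> / (\<kappa> * real_of_int n) * cmod (J n t)"
proof -
  assume n: "1 \<le> n"
  have "cmod (Wt n t - W n t) = mu n t * cmod (J n t)" using mu_nonneg[of n t] n by (simp add: Wt_def norm_mult)
  also have "... \<le> \<alpha> / (\<kappa> * real_of_int n) * cmod (J n t)" by (rule mult_right_mono[OF mu_le[OF n]]) simp
  finally show ?thesis .
qed


end

section \<open>Passage through the resonance of mode k\<close>

locale resonance = regime +
  fixes t1 t2 a :: real
  assumes t1_def: "t1 = N / (real_of_int k + 1 / 2)" and t2_def: "t2 = N / (real_of_int k - 1 / 2)"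
    and a_def: "a = cmod (W k t1)"
    and cone: "0 < a" "\<And>n. cmod (W n t1) \<le> 3 * a" "\<And>n. cmod (J n t1) \<le> a / 10"
begin

text \<open>A neighbour of k receives at most about Q a, the amplitude times the full coupling
  strength; the factor 3/2 is what closes the bootstrap in \<open>ee_le_S\<close>.\<close>

definition S where "S = 3 / 2 * Q * a"

lemma S_nonneg: "0 \<le> S" using Q_ge cone by (simp add: S_def)

lemma cS: "c * S \<le> 192 / 10000 * a"
proof -
  have "c * Q * (3 / 2 * a) \<le> 128 / 10000 * (3 / 2 * a)" using cone by (intro mult_right_mono cQ) auto
  then show ?thesis by (simp add: S_def mult_ac)
qed

lemma t12: "0 < t1" "t1 \<le> t2" "t2 \<le> \<xi> / (real_of_int k - 1 / 2)"
  unfolding t1_def t2_def using N N_large kx by (auto intro!: divide_left_mono divide_right_mono)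

lemma t1_ge: "\<xi> / (real_of_int k + 3 / 4) \<le> t1"
proof -
  have "\<xi> * (real_of_int k + 1 / 2) \<le> (N + 1) * (real_of_int k + 1 / 2)" using N kx by (intro mult_right_mono) auto
  also have "... = N * real_of_int k + (N / 2 + real_of_int k + 1 / 2)" by (simp add: distrib_left distrib_right)
  also have "... \<le> N * real_of_int k + 3 / 4 * N" using N_large kx by simp
  also have "... = N * (real_of_int k + 3 / 4)" by (simp add: distrib_left)
  finally show ?thesis using kx by (simp add: t1_def field_simps)
qed

lemma lam_bounds:
  assumes "t \<in> {t1..t2}"
  shows "1 \<le> lam n \<xi> t" "\<alpha> * \<bar>real_of_int n\<bar> \<le> 4 * e * lam n \<xi> t"
  using lam_large[OF kx k_le_xi large(1), of t n] assms t12 by (auto simp: e_def)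

lemma lam_nonneg: "t \<in> {t1..t2} \<Longrightarrow> 0 \<le> lam n \<xi> t" using lam_bounds(1)[of t n] by linarith

text \<open>Modes above k have resonated before \<open>t1\<close>, modes between 1 and k - 1
  resonate after \<open>t2\<close>, and the others do not resonate at positive times. So on the
  interval only mode k acts with more than 4 c.\<close>

lemma GG_off:
  assumes m: "m \<noteq> k" and s: "t1 \<le> s" and t: "t \<le> t2"
  shows "GG m t - GG m s \<le> 4 * c"
proof -
  consider "m \<le> 0" | "1 \<le> m" "m < k" | "k < m" using m by linarith
  then show ?thesis
  proof cases
    case 1
    then show ?thesis using GG_nonpos[of m s t] c s t12 by linarith
  next
    case 2
    then have "real_of_int m + 1 / 2 \<le> real_of_int k - 1 / 2" by linarith
    then have "\<xi> / (real_of_int k - 1 / 2) \<le> \<xi> / (real_of_int m + 1 / 2)"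
      using 2 \<xi> kx by (intro divide_left_mono) auto
    then show ?thesis using GG_before[of t m s] 2 t t12 c by linarith
  next
    case 3
    then have "real_of_int k + 3 / 4 \<le> real_of_int m - 1 / 4" by linarith
    then have "\<xi> / (real_of_int m - 1 / 4) \<le> \<xi> / (real_of_int k + 3 / 4)"
      using \<xi> kx by (intro divide_left_mono mult_pos_pos) auto
    then show ?thesis using GG_after[of m s t] 3 k2 s t1_ge by linarith
  qed
qed

lemma ee_t1: "ee n t1 \<le> 301 / 100 * a" "ee k t1 \<le> 101 / 100 * a"
proof -
  have "(cmod (W n t1))\<^sup>2 \<le> (3 * a)\<^sup>2" "(cmod (J n t1))\<^sup>2 \<le> (a / 10)\<^sup>2" "(cmod (J k t1))\<^sup>2 \<le> (a / 10)\<^sup>2"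
    using cone by (intro power_mono; simp)+
  moreover have "(301 / 100 * a)\<^sup>2 = 90601 / 10000 * a\<^sup>2" "(101 / 100 * a)\<^sup>2 = 10201 / 10000 * a\<^sup>2" "(3 * a)\<^sup>2 = 9 * a\<^sup>2" "(a / 10)\<^sup>2 = a\<^sup>2 / 100" "0 \<le> a\<^sup>2"
    by (simp_all add: power_mult_distrib power_divide)
  ultimately have "en W J n t1 \<le> (301 / 100 * a)\<^sup>2" "en W J k t1 \<le> (101 / 100 * a)\<^sup>2"
    unfolding en_def a_def[symmetric] by linarith+
  then show "ee n t1 \<le> 301 / 100 * a" "ee k t1 \<le> 101 / 100 * a"
    unfolding ee_def using cone by (intro real_le_lsqrt; simp add: en_nonneg)+
qed

text \<open>Mode k is not driven by itself, so it stays near \<open>a\<close> up to c S'. Feeding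
  this improved bound into its two neighbours produces \<open>Q\<close> times a quantity close to
  \<open>a\<close>; using S' there directly would give Q S', which cannot be absorbed.\<close>

lemma ee_le_S_aux:
  assumes S': "\<And>n t. t \<in> {t1..t2} \<Longrightarrow> ee n t \<le> S'" and t: "t \<in> {t1..t2}"
  shows "ee k t \<le> 101 / 100 * a + 8 * c * S'"
    and "n \<noteq> k - 1 \<Longrightarrow> n \<noteq> k + 1 \<Longrightarrow> ee n t \<le> 301 / 100 * a + 8 * c * S'"
    and "ee n t \<le> 301 / 100 * a + 101 / 100 * a * Q + (8 * c + 8 * (c * Q)) * S'"
proof -
  have S0: "0 \<le> S'" using S'[of t1 0] t12 ee_nonneg[of 0 t1] by simp
  have sub: "r \<in> {t1..t2}" if "r \<in> {t1..t}" for r using that t by auto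
  have st: "ee n t \<le> ee n t1 + (A * (GG (n - 1) t - GG (n - 1) t1) + B * (GG (n + 1) t - GG (n + 1) t1))"
    if "\<And>r. r \<in> {t1..t2} \<Longrightarrow> ee (n - 1) r \<le> A" "\<And>r. r \<in> {t1..t2} \<Longrightarrow> ee (n + 1) r \<le> B" for n A B
    by (rule ee_step) (use that sub t t12 lam_nonneg in auto)
  have G: "A * (GG m t - GG m t1) \<le> 4 * c * A" if "m \<noteq> k" "0 \<le> A" for A m
    using mult_left_mono[OF GG_off[OF that(1) order_refl, of t] that(2)] t by (simp add: mult_ac)
  have far: "ee n t \<le> ee n t1 + 8 * c * S'" if "n \<noteq> k - 1" "n \<noteq> k + 1" "t \<in> {t1..t2}" for n
    using st[OF S' S', of n] G[of "n - 1" S'] G[of "n + 1" S'] that S0 by auto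
  have fark: "ee k r \<le> 101 / 100 * a + 8 * c * S'" if r: "r \<in> {t1..t2}" for r
  proof -
    have "ee k r \<le> ee k t1 + (S' * (GG (k - 1) r - GG (k - 1) t1) + S' * (GG (k + 1) r - GG (k + 1) t1))"
      by (rule ee_step) (use S' r t12 lam_nonneg in auto)
    moreover have "S' * (GG m r - GG m t1) \<le> 4 * c * S'" if "m \<noteq> k" for m
      using mult_left_mono[OF GG_off[OF that order_refl, of r] S0] r by (simp add: mult_ac)
    from this[of "k - 1"] this[of "k + 1"]
    have "S' * (GG (k - 1) r - GG (k - 1) t1) \<le> 4 * c * S'" "S' * (GG (k + 1) r - GG (k + 1) t1) \<le> 4 * c * S'" by simp_all
    ultimately show ?thesis using ee_t1(2) by linarith
  qed
  show "ee k t \<le> 101 / 100 * a + 8 * c * S'" by (rule fark[OF t])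
  show f: "n \<noteq> k - 1 \<Longrightarrow> n \<noteq> k + 1 \<Longrightarrow> ee n t \<le> 301 / 100 * a + 8 * c * S'"
    using far[of n] ee_t1(1)[of n] t by simp
  define A where "A = 101 / 100 * a + 8 * c * S'"
  have A0: "0 \<le> A" using cone c S0 by (simp add: A_def)
  have GQ: "A * (GG k t - GG k t1) \<le> A * Q"
    unfolding Q_def by (intro mult_left_mono GG_diff_le_pi A0)
  have c0: "0 \<le> c * S'" "0 \<le> a * Q" "0 \<le> c * Q * S'" using c S0 cone Q_ge by auto
  have AQ: "A * Q = 101 / 100 * a * Q + 8 * (c * Q * S')" by (simp add: A_def algebra_simps)
  have "ee n t \<le> 301 / 100 * a + 101 / 100 * a * Q + 8 * (c * S') + 8 * (c * Q * S')"
  proof -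
    consider "n = k - 1" | "n = k + 1" | "n \<noteq> k - 1" "n \<noteq> k + 1" by blast
    then show ?thesis
    proof cases
      case 1
      then have "ee n t \<le> ee n t1 + (S' * (GG (n - 1) t - GG (n - 1) t1) + A * (GG (n + 1) t - GG (n + 1) t1))"
        using S' fark by (intro st) (auto simp: A_def)
      moreover have "S' * (GG (n - 1) t - GG (n - 1) t1) \<le> 4 * c * S'" using 1 S0 by (intro G) auto
      ultimately show ?thesis using GQ AQ ee_t1(1)[of n] c0 1 by simp
    next
      case 2
      then have "ee n t \<le> ee n t1 + (A * (GG (n - 1) t - GG (n - 1) t1) + S' * (GG (n + 1) t - GG (n + 1) t1))"
        using S' fark by (intro st) (auto simp: A_def)
      moreover have "S' * (GG (n + 1) t - GG (n + 1) t1) \<le> 4 * c * S'" using 2 S0 by (intro G) auto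
      ultimately show ?thesis using GQ AQ ee_t1(1)[of n] c0 2 by simp
    next
      case 3
      then show ?thesis using f c0 by simp
    qed
  qed
  then show "ee n t \<le> 301 / 100 * a + 101 / 100 * a * Q + (8 * c + 8 * (c * Q)) * S'"
    by (simp add: algebra_simps)
qed

text \<open>The supremum over all modes and times is finite by \<open>bounded\<close>, so its small
  multiple on the right can be absorbed.\<close>

lemma ee_le_S:
  assumes t: "t \<in> {t1..t2}" shows "ee n t \<le> S"
proof -
  obtain K where K: "\<And>n t. 0 \<le> t \<Longrightarrow> t \<le> t2 \<Longrightarrow> en W J n t \<le> K"
    using bounded[of t2] t12 by auto
  define X where "X = (\<lambda>(n, t). ee n t) ` (UNIV \<times> {t1..t2})"
  define S' where "S' = Sup X"
  have bd: "bdd_above X"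
    unfolding X_def using K t12 by (intro bdd_aboveI[of _ "sqrt K"]) (auto simp: ee_def)
  have ne: "X \<noteq> {}" using t by (auto simp: X_def)
  have up: "ee n t \<le> S'" if "t \<in> {t1..t2}" for n t
    unfolding S'_def by (rule cSup_upper[OF _ bd]) (use that in \<open>auto simp: X_def\<close>)
  have S0: "0 \<le> S'" using up[of t1 0] t12 ee_nonneg[of 0 t1] by simp
  \<comment> \<open>As \<open>Q\<close> is at least 14, the term 3.01 a is below 0.22 Q a; the
    coefficient of S' on the right is at most 0.1032, and 1.23 / 0.8968 is below 3/2.\<close>
  have "S' \<le> 301 / 100 * a + 101 / 100 * a * Q + (8 * c + 8 * (c * Q)) * S'"
    unfolding S'_def by (rule cSup_least[OF ne]) (use ee_le_S_aux(3)[OF up] in \<open>auto simp: X_def S'_def\<close>)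
  moreover have "(8 * c + 8 * (c * Q)) * S' \<le> 1032 / 10000 * S'"
    using cQ c4 by (intro mult_right_mono S0) auto
  moreover have "14 * a \<le> Q * a" using Q_ge cone by (intro mult_right_mono) auto
  moreover have "101 / 100 * a * Q = 101 / 100 * (Q * a)" "3 / 2 * Q * a = 3 / 2 * (Q * a)" by simp_all
  ultimately have "S' \<le> S" using cone(1) unfolding S_def by linarith
  then show ?thesis using up[OF t, of n] by linarith
qed

text \<open>The vorticities may reach size Q a, but slaving contributes the factor 4 e, and e Q is
  tiny; so the bound on the currents is reproduced without loss.\<close>

lemma J_bound:
  assumes t: "t \<in> {t1..t2}" shows "cmod (J n t) \<le> a / 10"
proof (rule J_step[of t1 t n])
  fix r assume "r \<in> {t1..t}"
  then have r: "r \<in> {t1..t2}" using t by auto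
  show l: "0 \<le> lam n \<xi> r" by (rule lam_nonneg[OF r])
  have "\<alpha> * \<bar>real_of_int n\<bar> * cmod (W n r) \<le> (4 * e * lam n \<xi> r) * S"
    by (rule mult_mono[OF lam_bounds(2)[OF r] order_trans[OF W_le_ee ee_le_S[OF r]]]) (use l e_pos in auto)
  also have "... = 6 * (e * Q) * a * lam n \<xi> r" by (simp add: S_def)
  also have "... \<le> a / 10 * lam n \<xi> r"
  proof (rule mult_right_mono[OF _ l])
    have "6 * (e * Q) * a \<le> 1 / 10 * a" using eQ1 cone by (intro mult_right_mono) auto
    then show "6 * (e * Q) * a \<le> a / 10" by simp
  qed
  finally show "\<alpha> * \<bar>real_of_int n\<bar> * cmod (W n r) \<le> a / 10 * lam n \<xi> r" .
qed (use t t12 cone in auto)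

text \<open>
  Variation of constants: \<open>eta\<close> solves \<open>eta' = dd k * eta - qq k\<close> with \<open>eta t2 = 0\<close>, so that in the
  derivative of \<open>Wt (k \<plusminus> 1) \<plusminus> eta * Wt k\<close> the resonant forcing of mode \<open>k \<plusminus> 1\<close> by mode \<open>k\<close> drops out.
  The initial value \<open>la = eta t1\<close> is the amplification factor.
\<close>

definition Dk where "Dk t = arctan (t - \<xi> / real_of_int k) / \<beta>"
definition eta where "eta t = LL k * \<beta> * (1 - exp (- (Dk t2 - Dk t)))"
definition la where "la = eta t1"

lemma Dk_mono: "s \<le> t \<Longrightarrow> Dk s \<le> Dk t"
  unfolding Dk_def using \<beta>_pos by (intro divide_right_mono arctan_monotone') auto

lemma eta_t2: "eta t2 = 0" by (simp add: eta_def)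

lemma eta_bounds: "t \<in> {t1..t2} \<Longrightarrow> 0 \<le> eta t" "t \<in> {t1..t2} \<Longrightarrow> eta t \<le> la"
  unfolding la_def eta_def using Dk_mono[of t t2] Dk_mono[of t1 t] LL_nonneg[of k] \<beta>_pos
  by (auto intro!: mult_left_mono mult_nonneg_nonneg)

text \<open>Half an index corresponds to a time of about N / (2 k^2), which is at least 25; the
  remainder pays for the difference between N and \<xi>.\<close>

lemma dist_ge: "20 \<le> t2 - \<xi> / real_of_int k" "20 \<le> \<xi> / real_of_int k - t1"
proof -
  define x where "x = real_of_int k"
  have x: "2 \<le> x" using kx by (simp add: x_def)
  have N': "50 * x\<^sup>2 \<le> N" "50 * x \<le> N" using N N_large by (simp_all add: x_def)
  have "(20 + \<xi> / x) * (x * (x - 1 / 2)) = 20 * x * (x - 1 / 2) + \<xi> * (x - 1 / 2)" using x by (simp add: field_simps)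
  also have "... \<le> 20 * x * (x - 1 / 2) + (N + 1) * (x - 1 / 2)" using N x by (intro add_left_mono mult_right_mono) auto
  also have "... = 20 * x\<^sup>2 - 9 * x + N * x - N / 2 - 1 / 2" by (simp add: field_simps power2_eq_square)
  also have "... \<le> N * x" using N' x by linarith
  finally have "20 + \<xi> / x \<le> N * x / (x * (x - 1 / 2))" using x by (simp add: pos_le_divide_eq)
  also have "... = t2" using x by (simp add: t2_def x_def)
  finally show "20 \<le> t2 - \<xi> / real_of_int k" by (simp add: x_def)
  have "(20 + t1) * (x * (x + 1 / 2)) = 20 * x * (x + 1 / 2) + N * x" using x by (simp add: t1_def x_def[symmetric] field_simps)
  also have "... \<le> N * (x + 1 / 2)"
  proof -
    have "2 * x \<le> x\<^sup>2" unfolding power2_eq_square using x by (intro mult_right_mono) auto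
    moreover have "20 * x * (x + 1 / 2) = 20 * x\<^sup>2 + 10 * x" "N * (x + 1 / 2) = N * x + N / 2"
      by (simp_all add: algebra_simps power2_eq_square)
    ultimately show ?thesis using N'(1) by linarith
  qed
  also have "... \<le> \<xi> * (x + 1 / 2)" using N x by (intro mult_right_mono) auto
  finally have "(20 + t1) * x * (x + 1 / 2) \<le> \<xi> * (x + 1 / 2)" by (simp add: mult.assoc)
  then have "(20 + t1) * x \<le> \<xi>" using x by (simp add: mult_le_cancel_right)
  then show "20 \<le> \<xi> / real_of_int k - t1" using x by (simp add: x_def[symmetric] field_simps)
qed

text \<open>On an interval reaching 20 beyond the resonance on both sides the arctangent increases
  by at least pi - 1/10, hence by 3. This is the 3 in exp (- 3 / \<beta>).\<close>

lemma la_ge: "14 \<le> la"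
proof -
  have "arctan (20::real) \<le> arctan (t2 - \<xi> / real_of_int k)" "arctan (20::real) \<le> arctan (\<xi> / real_of_int k - t1)"
    by (intro arctan_monotone' dist_ge)+
  moreover have "arctan (t1 - \<xi> / real_of_int k) = - arctan (\<xi> / real_of_int k - t1)" by (simp add: arctan_minus[symmetric])
  moreover have "pi / 2 - 1 / 20 \<le> arctan 20" by (rule arctan_ge_pos) simp
  ultimately have "3 \<le> arctan (t2 - \<xi> / real_of_int k) - arctan (t1 - \<xi> / real_of_int k)" using pi_gt_31 by linarith
  then have "3 / \<beta> \<le> Dk t2 - Dk t1" using \<beta>_pos by (simp add: Dk_def diff_divide_distrib[symmetric] divide_right_mono)
  then have "exp (- (Dk t2 - Dk t1)) \<le> exp (- 3 / \<beta>)" by simp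
  then have "LL k * \<beta> * (1 - exp (- 3 / \<beta>)) \<le> la"
    unfolding la_def eta_def using LL_nonneg[of k] \<beta>_pos by (intro mult_left_mono) auto
  then show ?thesis using Lb(1) by (simp add: mult.assoc)
qed

lemma eta_deriv: "(eta has_real_derivative eta t * dd k t - qq k \<xi> t) (at t within A)"
proof -
  have D: "(Dk has_real_derivative dd k t) (at t within A)"
  proof -
    have "((\<lambda>t. GG k t / (\<beta> * LL k)) has_real_derivative dd k t) (at t within A)"
      unfolding dd_k by (rule DERIV_cdivide[OF GG_deriv])
    moreover have "GG k t / (\<beta> * LL k) = Dk t" for t using Lb(2) by (simp add: GG_def Dk_def)
    ultimately show ?thesis by simp
  qed
  have "(eta has_real_derivative LL k * \<beta> * (- (exp (- (Dk t2 - Dk t)) * dd k t))) (at t within A)"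
    unfolding eta_def[abs_def] by (rule derivative_eq_intros D refl)+ simp
  also have "LL k * \<beta> * (- (exp (- (Dk t2 - Dk t)) * dd k t)) = eta t * dd k t - LL k * \<beta> * dd k t"
    by (simp add: eta_def algebra_simps)
  also have "LL k * \<beta> * dd k t = qq k \<xi> t" using Lb(2) \<beta>_pos by (simp add: dd_k)
  finally show ?thesis .
qed

text \<open>Up to errors, both neighbours end with the amplitude la * a. In the error, 3 a is what
  the neighbour may carry initially; the rest, including 0.16 la a, comes from nonresonant
  couplings, the damping of mode n and the difference between \<open>Wt\<close> and W.\<close>

lemma transfer:
  assumes n: "n = k + s" and s: "s = 1 \<or> s = - 1"
  shows "\<bar>cmod (W n t2) - la * a\<bar> \<le> (31 / 10 + 16 / 100 * la) * a"
proof -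
  have n1: "1 \<le> n" and n0: "n \<noteq> 0" and nk: "n \<noteq> k" "n + s \<noteq> k" "k - 1 \<noteq> k" "k + 1 \<noteq> k" using n s k2 by auto
  define \<sigma> :: complex where "\<sigma> = of_int s"
  have \<sigma>: "cmod \<sigma> = 1" "\<sigma> * \<sigma> = 1" using s by (auto simp: \<sigma>_def)
  let ?F = "\<lambda>t. \<sigma> * (of_real (c * \<xi>) * (W (n + s) t / of_real (psym (n + s) \<xi> t)))"
  let ?D = "\<lambda>t. of_real (dd n t) * W n t"
  let ?M = "\<lambda>t. \<sigma> * of_real (qq k \<xi> t) * (Wt k t - W k t)"
  let ?N = "\<lambda>t. \<sigma> * of_real (eta t) * (of_real (dd k t) * (Wt k t - W k t))"
  let ?K = "\<lambda>t. \<sigma> * of_real (eta t) * coup (\<lambda>m. W m t) k \<xi> t"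
  let ?Z = "\<sigma> * of_real la * W k t1"
  \<comment> \<open>At \<open>t2\<close>, where \<open>eta\<close> vanishes, this is
    \<open>Wt n\<close>; at \<open>t1\<close> it contains \<open>la * Wt k\<close>. The change in
    between consists of small terms only.\<close>
  define \<Psi> where "\<Psi> t = Wt n t + \<sigma> * of_real (eta t) * Wt k t" for t
  define \<Psi>' where "\<Psi>' t = (coup (\<lambda>m. W m t) n \<xi> t - ?D t) +
     (\<sigma> * of_real (eta t) * (coup (\<lambda>m. W m t) k \<xi> t - of_real (dd k t) * W k t) + \<sigma> * of_real (eta t * dd k t - qq k \<xi> t) * Wt k t)" for t
  \<comment> \<open>The summands are primitives of bounds for ?F, ?D, ?M, ?N and ?K, in this
    order.\<close>
  define g where "g t = S * GG (n + s) t + S * (\<alpha>\<^sup>2 / \<kappa> / LL n * GG n t) + e * (a / 10) * GG k t + la * (e * (a / 10) * (GG k t / (\<beta> * LL k)))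
     + la * (S * GG (k - 1) t + S * GG (k + 1) t)" for t
  define g' where "g' t = S * qq (n + s) \<xi> t + S * (\<alpha>\<^sup>2 / \<kappa> / LL n * qq n \<xi> t) + e * (a / 10) * qq k \<xi> t + la * (e * (a / 10) * (qq k \<xi> t / (\<beta> * LL k)))
     + la * (S * qq (k - 1) \<xi> t + S * qq (k + 1) \<xi> t)" for t
  have la0: "0 \<le> la" using la_ge by simp
  have WS: "cmod (W m t) \<le> S" if "t \<in> {t1..t2}" for m t using order_trans[OF W_le_ee ee_le_S[OF that]] .
  have Wtk: "cmod (Wt k t - W k t) \<le> e * (a / 10)" if t: "t \<in> {t1..t2}" for t
  proof -
    have "cmod (Wt k t - W k t) \<le> e * cmod (J k t)" unfolding e_def using k2 by (intro Wt_W) simp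
    also have "... \<le> e * (a / 10)" using e_pos by (intro mult_left_mono J_bound t) auto
    finally show ?thesis .
  qed
  have Wtn: "cmod (Wt n t - W n t) \<le> 2 * e * (a / 10)" if t: "t \<in> {t1..t2}" for t
  proof -
    have "\<alpha> / (\<kappa> * real_of_int n) \<le> 2 * e"
    proof -
      have "real_of_int k \<le> 2 * real_of_int n" using n s k2 by auto
      then have "\<alpha> * real_of_int k \<le> \<alpha> * (real_of_int n * 2)" using \<alpha> by simp
      then show ?thesis using \<kappa> k2 n1 by (simp add: e_def field_simps)
    qed
    then have "\<alpha> / (\<kappa> * real_of_int n) * cmod (J n t) \<le> 2 * e * (a / 10)"
      using e_pos by (intro mult_mono J_bound t) auto
    then show ?thesis using Wt_W[OF n1, of t] by linarith
  qed
  have main: "cmod (\<Psi> t2 - \<Psi> t1) \<le> g t2 - g t1"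
  proof (rule deriv_compare_norm)
    show "0 \<le> t1" "t1 \<le> t2" using t12 by auto
    fix t assume t: "t \<in> {t1..t2}"
    then have t0: "0 \<le> t" using t12 by auto
    have ek: "((\<lambda>t. of_real (eta t) :: complex) has_vector_derivative of_real (eta t * dd k t - qq k \<xi> t)) (at t within {0..})"
      using eta_deriv by (intro has_vector_derivative_of_real) (simp add: has_real_derivative_iff_has_vector_derivative)
    show "(\<Psi> has_vector_derivative \<Psi>' t) (at t within {0..})"
      unfolding \<Psi>_def[abs_def] \<Psi>'_def
      by (intro has_vector_derivative_add has_vector_derivative_mult has_vector_derivative_mult_right Wt_deriv t0 n0 ek) (use k2 in auto)
    show "(g has_real_derivative g' t) (at t within {0..})"
      unfolding g_def[abs_def] g'_def by (intro DERIV_add DERIV_cmult DERIV_cdivide GG_deriv)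
    \<comment> \<open>Mode k acts on n = k + s with sign \<sigma>, the neighbour of n on the far
      side with the opposite sign. This treats s = 1 and s = -1 at once.\<close>
    have cn: "coup (\<lambda>m. W m t) n \<xi> t = \<sigma> * of_real (qq k \<xi> t) * W k t - \<sigma> * of_real (c * \<xi>) * (W (n + s) t / of_real (psym (n + s) \<xi> t))"
      using s n0 n \<xi> k2 by (auto simp: coup_def \<sigma>_def qq_def algebra_simps)
    have eq: "\<Psi>' t = - (?F t) - of_real (dd n t) * W n t
        - \<sigma> * of_real (qq k \<xi> t) * (Wt k t - W k t) + \<sigma> * of_real (eta t) * (of_real (dd k t) * (Wt k t - W k t)) + \<sigma> * of_real (eta t) * coup (\<lambda>m. W m t) k \<xi> t"
      unfolding \<Psi>'_def cn by (simp add: algebra_simps)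
    have "cmod (\<Psi>' t) \<le> cmod (?F t) + cmod (?D t)
        + cmod (?M t) + cmod (?N t) + cmod (?K t)"
    proof -
      have tri: "cmod (- p - q - r + u + v) \<le> cmod p + cmod q + cmod r + cmod u + cmod v" for p q r u v :: complex
        using norm_triangle_ineq[of "- p - q - r + u" v] norm_triangle_ineq[of "- p - q - r" u] norm_triangle_ineq4[of "- p - q" r] norm_triangle_ineq4[of "- p" q] by simp
      show ?thesis unfolding eq by (rule tri)
    qed
    also have "... \<le> g' t"
      unfolding g'_def
    proof (intro add_mono)
      have W0: "W 0 t = 0" by (rule ode_w0[OF ode W00 t0])
      have "cmod (of_real (c * \<xi>) * (W m t / of_real (psym m \<xi> t))) = qq m \<xi> t * cmod (W m t)" for m
        using W0 c \<xi> psym_nonneg[of m \<xi> t] by (cases "m = 0") (auto simp: qq_def norm_mult norm_divide)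
      then have "cmod (?F t) = qq (n + s) \<xi> t * cmod (W (n + s) t)"
        by (simp only: norm_mult[of \<sigma>] \<sigma> mult_1)
      also have "... \<le> qq (n + s) \<xi> t * S" by (intro mult_left_mono WS t qq_nonneg)
      finally show "cmod (?F t) \<le> S * qq (n + s) \<xi> t" by (simp add: mult.commute)
      have "cmod (?D t) = dd n t * cmod (W n t)" using dd_nonneg by (simp add: norm_mult)
      also have "... \<le> dd n t * S" by (intro mult_left_mono WS t dd_nonneg)
      finally show "cmod (?D t) \<le> S * (\<alpha>\<^sup>2 / \<kappa> / LL n * qq n \<xi> t)" using n0 by (simp add: dd_eq mult.commute)
      have "cmod (?M t) = qq k \<xi> t * cmod (Wt k t - W k t)" using \<sigma> qq_nonneg by (simp add: norm_mult)
      also have "... \<le> qq k \<xi> t * (e * (a / 10))" by (intro mult_left_mono Wtk t qq_nonneg)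
      finally show "cmod (?M t) \<le> e * (a / 10) * qq k \<xi> t" by (simp add: mult.commute)
      have "cmod (?N t) = eta t * (dd k t * cmod (Wt k t - W k t))"
        using \<sigma> eta_bounds[OF t] dd_nonneg by (simp add: norm_mult)
      also have "... \<le> la * (dd k t * (e * (a / 10)))" using eta_bounds[OF t] dd_nonneg la0 by (intro mult_mono mult_left_mono Wtk t) auto
      finally show "cmod (?N t) \<le> la * (e * (a / 10) * (qq k \<xi> t / (\<beta> * LL k)))"
        by (simp add: dd_k mult.commute)
      have "cmod (coup (\<lambda>m. W m t) k \<xi> t) \<le> qq (k - 1) \<xi> t * cmod (W (k - 1) t) + qq (k + 1) \<xi> t * cmod (W (k + 1) t)"
        by (rule coup_le) (rule W0)
      also have "... \<le> qq (k - 1) \<xi> t * S + qq (k + 1) \<xi> t * S" by (intro add_mono mult_left_mono WS t qq_nonneg)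
      finally have cl: "cmod (coup (\<lambda>m. W m t) k \<xi> t) \<le> S * qq (k - 1) \<xi> t + S * qq (k + 1) \<xi> t" by (simp add: mult.commute)
      have "cmod (?K t) = eta t * cmod (coup (\<lambda>m. W m t) k \<xi> t)"
        using \<sigma> eta_bounds[OF t] by (simp add: norm_mult)
      also have "... \<le> la * (S * qq (k - 1) \<xi> t + S * qq (k + 1) \<xi> t)" using eta_bounds[OF t] la0 by (intro mult_mono cl) auto
      finally show "cmod (?K t) \<le> la * (S * qq (k - 1) \<xi> t + S * qq (k + 1) \<xi> t)" .
    qed
    finally show "cmod (\<Psi>' t) \<le> g' t" .
  qed
  define H where "H m = GG m t2 - GG m t1" for m
  have H: "H m \<le> 4 * c" if "m \<noteq> k" for m unfolding H_def by (rule GG_off[OF that]) auto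
  have Hk: "H k \<le> Q" unfolding H_def Q_def by (rule GG_diff_le_pi)
  have "g t2 - g t1 = S * H (n + s) + \<alpha>\<^sup>2 / \<kappa> / LL n * (S * H n) + e * (a / 10) * H k + la * (e * (a / 10) * (H k / (\<beta> * LL k))) + la * (S * H (k - 1) + S * H (k + 1))"
    unfolding g_def H_def by (simp add: algebra_simps diff_divide_distrib)
  also have "... \<le> 768 / 10000 * a + 12 / 1000 * a + 1 / 1000 * a + la * (1 / 1000 * a) + la * (1536 / 10000 * a)"
  proof (intro add_mono mult_left_mono[OF _ la0])
    have SH: "S * H m \<le> 768 / 10000 * a" if "m \<noteq> k" for m
    proof -
      have "S * H m \<le> S * (4 * c)" by (intro mult_left_mono H that S_nonneg)
      moreover have "S * (4 * c) = 4 * (c * S)" by simp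
      ultimately show ?thesis using cS by linarith
    qed
    show "S * H (n + s) \<le> 768 / 10000 * a" by (rule SH) (rule nk)
    show "S * H (k - 1) + S * H (k + 1) \<le> 1536 / 10000 * a" using SH[OF nk(3)] SH[OF nk(4)] by linarith
    show "e * (a / 10) * H k \<le> 1 / 1000 * a"
    proof -
      have "e * (a / 10) * H k \<le> e * (a / 10) * Q" using e_pos cone by (intro mult_left_mono Hk) auto
      also have "... = (e * Q) * (a / 10)" by simp
      also have "... \<le> 1 / 100 * (a / 10)" using eQ1 cone by (intro mult_right_mono) auto
      finally show ?thesis by simp
    qed
    show "e * (a / 10) * (H k / (\<beta> * LL k)) \<le> 1 / 1000 * a"
    proof -
      have "H k / (\<beta> * LL k) \<le> Q / (\<beta> * LL k)" using \<beta>_pos LL_nonneg by (intro divide_right_mono Hk) auto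
      also have "... = pi / \<beta>" using Lb(2) by (simp add: Q_def)
      also have "... \<le> Q / \<beta>" using Q_ge pi_less_4 \<beta>_pos by (intro divide_right_mono) auto
      finally have "e * (a / 10) * (H k / (\<beta> * LL k)) \<le> e * (a / 10) * (Q / \<beta>)" using e_pos cone by (intro mult_left_mono) auto
      also have "... = (e * Q / \<beta>) * (a / 10)" by (simp add: mult_ac)
      also have "... \<le> 1 / 1000 * (a / 10)" using eQ(2) cone by (intro mult_right_mono) auto
      finally show ?thesis using cone by simp
    qed
    show "\<alpha>\<^sup>2 / \<kappa> / LL n * (S * H n) \<le> 12 / 1000 * a"
    proof -
      have nn: "real_of_int n \<noteq> 0" using n0 by simp
      \<comment> \<open>As k is at least 2, n exceeds k by at most one half of k, so
        \<open>LL n\<close> is comparable with \<open>LL k\<close>; the damping of mode n is then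
        controlled by the smallness of c / \<beta>.\<close>
      have "real_of_int n \<le> 3 / 2 * real_of_int k" using n s kx by auto
      then have "(real_of_int n)\<^sup>2 \<le> (3 / 2 * real_of_int k)\<^sup>2" using n1 by (intro power_mono) auto
      then have "c * \<xi> * (real_of_int n)\<^sup>2 \<le> c * \<xi> * (9 / 4 * (real_of_int k)\<^sup>2)" using c \<xi> by (intro mult_left_mono) (auto simp: power_mult_distrib power_divide)
      then have LLn: "LL k \<le> 9 / 4 * LL n" using nn kx by (simp add: LL_def field_simps)
      then have LLn0: "0 < LL n" using Lb(2) by linarith
      have "S * H n \<le> S * (4 * c)" by (intro mult_left_mono H nk S_nonneg)
      then have "\<alpha>\<^sup>2 / \<kappa> / LL n * (S * H n) \<le> \<alpha>\<^sup>2 / \<kappa> / LL n * (S * (4 * c))" by (rule mult_left_mono) (use LLn0 \<kappa> in auto)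
      also have "... = 6 * a * pi * (c / \<beta>) * (LL k / LL n)" 
      proof -
        have "\<alpha>\<^sup>2 / \<kappa> = 1 / \<beta>" using \<beta> by simp
        then show ?thesis by (simp add: S_def Q_def)
      qed
      also have "... \<le> 6 * a * 4 * (1 / 5000) * (9 / 4)"
      proof (intro mult_mono)
        show "LL k / LL n \<le> 9 / 4" using LLn LLn0 by (simp add: divide_le_eq)
        show "c / \<beta> \<le> 1 / 5000" using c4(2) \<beta>_pos by (simp add: divide_le_eq)
      qed (use pi_less_4 cone c \<beta>_pos LL_nonneg LLn0 in auto)
      also have "... \<le> 12 / 1000 * a" using cone(1) by simp
      finally show ?thesis .
    qed
  qed
  finally have gd: "g t2 - g t1 \<le> 9 / 100 * a + 155 / 1000 * (la * a)"
  proof -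
    assume "g t2 - g t1 \<le> 768 / 10000 * a + 12 / 1000 * a + 1 / 1000 * a + la * (1 / 1000 * a) + la * (1536 / 10000 * a)"
    moreover have "la * (1 / 1000 * a) = 1 / 1000 * (la * a)" "la * (1536 / 10000 * a) = 1536 / 10000 * (la * a)" by simp_all
    moreover have "0 \<le> la * a" using la0 cone by simp
    ultimately show ?thesis using cone(1) by linarith
  qed
  have in12: "t1 \<in> {t1..t2}" "t2 \<in> {t1..t2}" using t12 by auto
  have ea: "e * (a / 10) \<le> a / 1000" using eQ1(2) cone by (simp add: field_simps)
  have p2: "cmod (\<Psi> t2 - W n t2) \<le> a / 500" using Wtn[OF in12(2)] ea by (simp add: \<Psi>_def eta_t2)
  have p1: "cmod (\<Psi> t1 - ?Z) \<le> 3 * a + a / 500 + la * (a / 1000)"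
  proof -
    have eq: "\<Psi> t1 - \<sigma> * of_real la * W k t1 = W n t1 + (Wt n t1 - W n t1) + \<sigma> * of_real la * (Wt k t1 - W k t1)"
      by (simp add: \<Psi>_def la_def algebra_simps)
    have "cmod (\<Psi> t1 - ?Z) \<le> cmod (W n t1) + cmod (Wt n t1 - W n t1) + cmod (\<sigma> * of_real la * (Wt k t1 - W k t1))"
      unfolding eq by (rule norm_triangle_mono[OF norm_triangle_ineq order_refl])
    also have "cmod (\<sigma> * of_real la * (Wt k t1 - W k t1)) = la * cmod (Wt k t1 - W k t1)" using \<sigma> la0 by (simp add: norm_mult)
    also have "... \<le> la * (a / 1000)" by (rule mult_left_mono[OF order_trans[OF Wtk[OF in12(1)] ea] la0])
    finally show ?thesis using cone(2)[of n] Wtn[OF in12(1)] ea by linarith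
  qed
  have nl: "cmod ?Z = la * a" using \<sigma> la0 by (simp add: norm_mult a_def)
  have "cmod (W n t2 - ?Z) \<le> cmod (\<Psi> t2 - W n t2) + cmod (\<Psi> t2 - \<Psi> t1) + cmod (\<Psi> t1 - ?Z)"
  proof -
    have "cmod (x - y) \<le> cmod (p - x) + cmod (p - q) + cmod (q - y)" for x y p q :: complex
      using norm_triangle_ineq4[of "p - q + (q - y)" "p - x"] norm_triangle_ineq[of "p - q" "q - y"] by simp
    then show ?thesis .
  qed
  moreover have "la * (a / 1000) = 1 / 1000 * (la * a)" "(31 / 10 + 16 / 100 * la) * a = 31 / 10 * a + 16 / 100 * (la * a)" "0 \<le> la * a"
    using la0 cone by (simp_all add: distrib_right)
  ultimately have "cmod (W n t2 - ?Z) \<le> (31 / 10 + 16 / 100 * la) * a"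
    using main gd p1 p2 cone(1) by linarith
  moreover have "\<bar>cmod (W n t2) - cmod ?Z\<bar> \<le> cmod (W n t2 - ?Z)" by (rule norm_triangle_ineq3)
  ultimately show ?thesis unfolding nl by linarith
qed

text \<open>With \<open>la\<close> at least 14 the new amplitude is at least 0.84 la a - 3.1 a, more
  than 8 a, while mode k + 1 has at most 1.16 la a + 3.1 a. Their quotient stays below 3, and the
  remaining modes have hardly changed. Only a doubling is recorded.\<close>

lemma next_cone:
  "2 * a \<le> cmod (W (k - 1) t2)" "cmod (W n t2) \<le> 3 * cmod (W (k - 1) t2)" "cmod (J n t2) \<le> cmod (W (k - 1) t2) / 10"
proof -
  define A where "A = cmod (W (k - 1) t2)"
  have in2: "t2 \<in> {t1..t2}" using t12 by auto
  have la14: "14 * a \<le> la * a" using la_ge cone by (intro mult_right_mono) auto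
  have tr: "\<bar>cmod (W (k + s) t2) - la * a\<bar> \<le> 31 / 10 * a + 16 / 100 * (la * a)" if "s = 1 \<or> s = - 1" for s
    using transfer[OF refl that] by (simp add: algebra_simps)
  have lo: "84 / 100 * (la * a) - 31 / 10 * a \<le> A" using tr[of "- 1"] by (simp add: A_def)
  have up: "cmod (W (k + 1) t2) \<le> 116 / 100 * (la * a) + 31 / 10 * a" using tr[of 1] by simp
  show "2 * a \<le> cmod (W (k - 1) t2)" using lo la14 cone A_def by linarith
  show "cmod (J n t2) \<le> cmod (W (k - 1) t2) / 10" using J_bound[OF in2, of n] lo la14 cone A_def by linarith
  consider "n = k - 1" | "n = k + 1" | "n \<noteq> k - 1" "n \<noteq> k + 1" by blast
  then show "cmod (W n t2) \<le> 3 * cmod (W (k - 1) t2)"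
  proof cases
    case 1 then show ?thesis by simp
  next
    case 2
    then have "cmod (W n t2) \<le> 116 / 100 * (la * a) + 31 / 10 * a" using up by simp
    then show ?thesis using lo la14 cone A_def by linarith
  next
    case 3
    have "ee n t2 \<le> 301 / 100 * a + 8 * c * S" by (rule ee_le_S_aux(2)[OF ee_le_S in2 3])
    then show ?thesis using W_le_ee[of n t2] cS lo la14 cone A_def by linarith
  qed
qed

end

section \<open>From the initial time to the first resonance of the chain\<close>

lemma nbsum_iter_geometric:
  assumes a: "\<And>n. a n \<le> A * r ^ nat \<bar>n - k\<bar>" and r: "0 < r" "r \<le> 1" and A: "0 \<le> A"
  shows "(nbsum ^^ i) a n \<le> A * (3 / r) ^ i * r ^ nat \<bar>n - k\<bar>"
proof (induction i arbitrary: n)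
  case 0
  then show ?case using a by simp
next
  case (Suc i)
  let ?C = "A * (3 / r) ^ i"
  have C0: "0 \<le> ?C" using A r by simp
  have nb: "r ^ nat \<bar>m - k\<bar> \<le> r ^ nat \<bar>n - k\<bar> / r" if "nat \<bar>n - k\<bar> \<le> Suc (nat \<bar>m - k\<bar>)" for m
  proof -
    have "r ^ Suc (nat \<bar>m - k\<bar>) \<le> r ^ nat \<bar>n - k\<bar>" by (rule power_decreasing[OF that]) (use r in auto)
    then show ?thesis using r by (simp add: pos_le_divide_eq mult.commute)
  qed
  have "(nbsum ^^ Suc i) a n = (nbsum ^^ i) a (n - 1) + (nbsum ^^ i) a n + (nbsum ^^ i) a (n + 1)" by (simp add: nbsum_def)
  also have "... \<le> ?C * (r ^ nat \<bar>n - k\<bar> / r) + ?C * (r ^ nat \<bar>n - k\<bar> / r) + ?C * (r ^ nat \<bar>n - k\<bar> / r)"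
    by (intro add_mono order_trans[OF Suc] mult_left_mono nb C0) auto
  also have "... = A * (3 / r) ^ Suc i * r ^ nat \<bar>n - k\<bar>" using r by simp
  finally show ?case .
qed

text \<open>A neighbour sum costs at most 3 / r against a profile decaying like r to the distance
  from k, so localisation around mode k persists at all times, with a constant that grows.\<close>

lemma maj_geometric:
  assumes a: "\<And>n. a n \<le> A * r ^ nat \<bar>n - k\<bar>" and r: "0 < r" "r \<le> 1" and A: "0 \<le> A" and x: "0 \<le> x"
  shows "maj x a n \<le> ennreal (A * exp (3 / r * x) * r ^ nat \<bar>n - k\<bar>)"
proof -
  let ?f = "A * r ^ nat \<bar>n - k\<bar>"
  have f0: "0 \<le> ?f" using A r by simp
  have "maj x a n \<le> (\<Sum>i. ennreal ((3 / r * x) ^ i / fact i * ?f))"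
    unfolding maj_def
  proof (rule suminf_le)
    fix i
    have "ennreal (x ^ i / fact i) * ennreal ((nbsum ^^ i) a n) \<le> ennreal (x ^ i / fact i) * ennreal (A * (3 / r) ^ i * r ^ nat \<bar>n - k\<bar>)"
      by (intro mult_left_mono ennreal_leI nbsum_iter_geometric[OF a r A]) auto
    also have "... = ennreal (x ^ i / fact i * (A * (3 / r) ^ i * r ^ nat \<bar>n - k\<bar>))"
      by (rule ennreal_mult[symmetric]) (use x A r in auto)
    also have "x ^ i / fact i * (A * (3 / r) ^ i * r ^ nat \<bar>n - k\<bar>) = (3 / r * x) ^ i / fact i * ?f"
      by (simp add: power_mult_distrib power_divide mult_ac)
    finally show "ennreal (x ^ i / fact i) * ennreal ((nbsum ^^ i) a n) \<le> ennreal ((3 / r * x) ^ i / fact i * ?f)" .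
  qed auto
  also have "... = ennreal (exp (3 / r * x) * ?f)"
  proof (rule suminf_ennreal_eq)
    show "0 \<le> (3 / r * x) ^ i / fact i * ?f" for i using f0 r x A by (intro mult_nonneg_nonneg) auto
    have "(\<lambda>i. (3 / r * x) ^ i / fact i) sums exp (3 / r * x)"
      using exp_converges[of "3 / r * x"] by (simp add: divide_inverse mult.commute scaleR_conv_of_real)
    then show "(\<lambda>i. (3 / r * x) ^ i / fact i * ?f) sums (exp (3 / r * x) * ?f)" by (rule sums_mult2)
  qed
  finally show ?thesis by (simp add: mult_ac)
qed

text \<open>The interval [0, T] ends shortly before the resonance of k but contains those of higher
  modes. These modes start empty, and their weights must reflect how little reaches them from k
  before they resonate.\<close>

locale launch = regime +
  fixes A T :: real
  assumes A: "0 < A" and T_def: "T = N / (real_of_int k + 1 / 2)"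
    and data: "\<And>n. cmod (W n 0) = (if n = k then A else 0)" "\<And>n. J n 0 = 0"
begin

text \<open>
  Before its own resonance (up to time \<open>sw n\<close>) mode \<open>n\<close> has been forced only through \<open>n - k\<close> non-resonant
  couplings; afterwards it has in addition been hit by the resonant mode \<open>n - 1\<close>, which costs a factor \<open>Q\<^sup>2\<close>.
\<close>

definition bw where "bw n = (if n < k then A / (8 * Q) else if n = k then A else A / 2 * (1 / (4 * Q)) ^ nat (n - k))"
definition sw where "sw n = (if n \<le> k then T else \<xi> / (real_of_int n - 1 / 2))"
definition hi where "hi n = (if n \<le> k then bw n else 10 * Q\<^sup>2 * bw n)"
definition YY where "YY n t = (if t \<le> sw n then bw n else hi n)"
text \<open>A primitive of \<open>qq n\<close> times the weight of mode n, with a change of weight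
  at \<open>sw n\<close>. Its increments bound what mode n passes on to a neighbour.\<close>

definition FF where "FF n t = bw n * (GG n (min t (sw n)) - GG n 0) + hi n * (GG n (max t (sw n)) - GG n (sw n))"

lemma bw_pos: "0 < bw n" using A Q_ge by (simp add: bw_def)

lemma bw_le_hi: "bw n \<le> hi n"
proof -
  have "1 \<le> Q\<^sup>2" using power_mono[of 1 Q 2] Q_ge by simp
  then have "1 * bw n \<le> 10 * Q\<^sup>2 * bw n" using bw_pos[of n] by (intro mult_right_mono) auto
  then show ?thesis by (simp add: hi_def)
qed

lemma YY_pos: "0 < YY n t" using bw_pos[of n] bw_le_hi[of n] by (simp add: YY_def)

lemma bw_le_YY: "bw n \<le> YY n t" using bw_le_hi by (simp add: YY_def)

lemma T_pos: "0 < T" "T \<le> \<xi> / (real_of_int k + 1 / 2)" "T \<le> \<xi> / (real_of_int k - 1 / 2)"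
proof -
  show "0 < T" unfolding T_def using N_large kx by simp
  show 1: "T \<le> \<xi> / (real_of_int k + 1 / 2)" unfolding T_def using N kx by (intro divide_right_mono) auto
  have "\<xi> / (real_of_int k + 1 / 2) \<le> \<xi> / (real_of_int k - 1 / 2)" using \<xi> kx by (intro divide_left_mono) auto
  then show "T \<le> \<xi> / (real_of_int k - 1 / 2)" using 1 by linarith
qed

lemma sw_pos: "0 < sw n"
proof (cases "n \<le> k")
  case False
  then have "1 < real_of_int n" using k2 by linarith
  then show ?thesis using False \<xi> by (simp add: sw_def)
qed (simp add: sw_def T_pos)

lemma T_le_sw: "T \<le> sw (k - 1)" "T \<le> sw (k + 1)"
  using T_pos by (simp_all add: sw_def add.commute)

lemma lam_init:
  assumes "t \<in> {0..T}"
  shows "1 \<le> lam n \<xi> t" "\<alpha> * \<bar>real_of_int n\<bar> \<le> 4 * e * lam n \<xi> t"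
  using lam_large[OF kx k_le_xi large(1), of t n] assms T_pos by (auto simp: e_def)

text \<open>The weights of the two neighbours change once each, so [0, t] splits into at most three
  pieces on which both are constant and \<open>ee_step\<close> applies.\<close>

lemma ee_two_switch:
  assumes t: "t \<in> {0..T}" and Z: "0 \<le> Z" and b: "\<And>n r. r \<in> {0..T} \<Longrightarrow> ee n r \<le> Z * YY n r"
  shows "ee n t \<le> ee n 0 + Z * (FF (n - 1) t + FF (n + 1) t)"
proof -
  have seg: "\<exists>c. (\<forall>r\<in>{x..y}. ee m r \<le> Z * c) \<and> FF m y - FF m x = c * (GG m y - GG m x)"
    if "0 \<le> x" "x \<le> y" "y \<le> T" "y \<le> sw m \<or> sw m \<le> x" for x y m
  proof (cases "y \<le> sw m")
    case True
    have "ee m r \<le> Z * bw m" if "r \<in> {x..y}" for r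
      using b[of r m] that True \<open>0 \<le> x\<close> \<open>y \<le> T\<close> by (simp add: YY_def)
    moreover have "FF m y - FF m x = bw m * (GG m y - GG m x)"
      using True \<open>x \<le> y\<close> by (simp add: FF_def min_def max_def algebra_simps)
    ultimately show ?thesis by blast
  next
    case False
    then have s: "sw m \<le> x" using that by auto
    have "ee m r \<le> Z * hi m" if r: "r \<in> {x..y}" for r
    proof -
      have "ee m r \<le> Z * YY m r" using b[of r m] r that \<open>0 \<le> x\<close> \<open>y \<le> T\<close> by auto
      also have "... \<le> Z * hi m" using bw_le_hi by (intro mult_left_mono Z) (auto simp: YY_def)
      finally show ?thesis .
    qed
    moreover have "FF m y - FF m x = hi m * (GG m y - GG m x)"
      using s that False by (auto simp: FF_def min_def max_def algebra_simps)
    ultimately show ?thesis by blast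
  qed
  have step: "ee n y \<le> ee n x + Z * (FF (n - 1) y - FF (n - 1) x + (FF (n + 1) y - FF (n + 1) x))"
    if xy: "0 \<le> x" "x \<le> y" "y \<le> T" and s: "y \<le> sw (n - 1) \<or> sw (n - 1) \<le> x" "y \<le> sw (n + 1) \<or> sw (n + 1) \<le> x" for x y
  proof -
    obtain c1 where c1: "\<And>r. r \<in> {x..y} \<Longrightarrow> ee (n - 1) r \<le> Z * c1" "FF (n - 1) y - FF (n - 1) x = c1 * (GG (n - 1) y - GG (n - 1) x)"
      using seg[OF xy s(1)] by blast
    obtain c2 where c2: "\<And>r. r \<in> {x..y} \<Longrightarrow> ee (n + 1) r \<le> Z * c2" "FF (n + 1) y - FF (n + 1) x = c2 * (GG (n + 1) y - GG (n + 1) x)"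
      using seg[OF xy s(2)] by blast
    have l: "0 \<le> lam n \<xi> r" if "r \<in> {x..y}" for r using lam_init(1)[of r n] that xy by auto
    have "ee n y \<le> ee n x + (Z * c1 * (GG (n - 1) y - GG (n - 1) x) + Z * c2 * (GG (n + 1) y - GG (n + 1) x))"
      by (rule ee_step[OF xy(1,2) l c1(1) c2(1)])
    then show ?thesis unfolding c1(2) c2(2) by (simp add: distrib_left mult.assoc)
  qed
  define x y where "x = min t (min (sw (n - 1)) (sw (n + 1)))" and "y = min t (max (sw (n - 1)) (sw (n + 1)))"
  have xy: "0 \<le> x" "x \<le> y" "y \<le> t" "t \<le> T" using t sw_pos[of "n - 1"] sw_pos[of "n + 1"] by (auto simp: x_def y_def)
  have F0: "FF m 0 = 0" for m using sw_pos[of m] by (simp add: FF_def)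
  have "ee n x \<le> ee n 0 + Z * (FF (n - 1) x - FF (n - 1) 0 + (FF (n + 1) x - FF (n + 1) 0))"
    by (rule step) (use xy in \<open>auto simp: x_def\<close>)
  moreover have "ee n y \<le> ee n x + Z * (FF (n - 1) y - FF (n - 1) x + (FF (n + 1) y - FF (n + 1) x))"
    by (rule step) (use xy in \<open>auto simp: x_def y_def min_def max_def\<close>)
  moreover have "ee n t \<le> ee n y + Z * (FF (n - 1) t - FF (n - 1) y + (FF (n + 1) t - FF (n + 1) y))"
    by (rule step) (use xy in \<open>auto simp: y_def min_def max_def\<close>)
  ultimately have "ee n t \<le> ee n 0 + (Z * (FF (n - 1) x - FF (n - 1) 0 + (FF (n + 1) x - FF (n + 1) 0)) +
     Z * (FF (n - 1) y - FF (n - 1) x + (FF (n + 1) y - FF (n + 1) x)) + Z * (FF (n - 1) t - FF (n - 1) y + (FF (n + 1) t - FF (n + 1) y)))" by linarith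
  also have "... = ee n 0 + Z * (FF (n - 1) t + FF (n + 1) t)" by (simp add: F0 algebra_simps)
  finally show ?thesis .
qed

lemma FF_low: "n \<le> k \<Longrightarrow> t \<in> {0..T} \<Longrightarrow> FF n t \<le> 4 * c * bw n"
proof -
  assume n: "n \<le> k" and t: "t \<in> {0..T}"
  have eq: "FF n t = bw n * (GG n t - GG n 0)" using n t by (simp add: FF_def sw_def min_def max_def)
  have "GG n t - GG n 0 \<le> 4 * c"
  proof (cases "n \<le> 0")
    case True
    then show ?thesis using GG_nonpos[of n 0 t] c by simp
  next
    case False
    then have n1: "1 \<le> n" by simp
    then have nx: "1 \<le> real_of_int n" by linarith
    have "\<xi> / (real_of_int k + 1 / 2) \<le> \<xi> / (real_of_int n + 1 / 2)"
      using n nx \<xi> by (intro divide_left_mono) auto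
    then have "t \<le> \<xi> / (real_of_int n + 1 / 2)" using t T_pos by auto
    then show ?thesis using GG_before[of t n 0] n1 c by linarith
  qed
  then have "bw n * (GG n t - GG n 0) \<le> bw n * (4 * c)" using bw_pos[of n] by (intro mult_left_mono) auto
  then show ?thesis unfolding eq by (simp add: mult.commute)
qed

lemma LL_mono: "k \<le> n \<Longrightarrow> pi * LL n \<le> Q"
proof -
  assume n: "k \<le> n"
  have "(real_of_int k)\<^sup>2 \<le> (real_of_int n)\<^sup>2" using n kx by (intro power_mono) auto
  then have "LL n \<le> LL k" unfolding LL_def using c \<xi> kx n by (intro divide_left_mono) auto
  then show ?thesis by (simp add: Q_def)
qed

text \<open>Mode n spends its resonance, of strength at most \<open>Q\<close>, with the low weight
  \<open>bw\<close>. After \<open>sw n\<close> only 4 c of coupling is left for the high weight 10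
  Q^2 bw, which gives the correction 40 (c Q) Q. The third bound concerns times before the resonance
  of n.\<close>

lemma FF_high:
  assumes n: "k < n" and t: "t \<in> {0..T}"
  shows "FF n t \<le> (Q + 40 * (c * Q) * Q) * bw n" "t \<le> sw n \<Longrightarrow> FF n t \<le> Q * bw n"
    and "t \<le> \<xi> / (real_of_int n + 1 / 2) \<Longrightarrow> FF n t \<le> 4 * c * bw n"
proof -
  have nx: "1 < real_of_int n" using n k2 by linarith
  have s: "sw n = \<xi> / (real_of_int n - 1 / 2)" using n by (simp add: sw_def)
  have g1: "GG n r - GG n 0 \<le> Q" for r using GG_diff_le_pi[of n r 0] LL_mono[of n] n by linarith
  have b1: "bw n * (GG n r - GG n 0) \<le> bw n * Q" for r using bw_pos[of n] by (intro mult_left_mono g1) auto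
  have "\<xi> / (real_of_int n - 1 / 4) \<le> sw n" unfolding s using \<xi> nx by (intro divide_left_mono) auto
  then have "GG n (max t (sw n)) - GG n (sw n) \<le> 4 * c" using nx by (intro GG_after) auto
  then have "hi n * (GG n (max t (sw n)) - GG n (sw n)) \<le> hi n * (4 * c)"
    using bw_pos[of n] bw_le_hi[of n] by (intro mult_left_mono) auto
  then have "FF n t \<le> bw n * Q + hi n * (4 * c)" unfolding FF_def using b1[of "min t (sw n)"] by linarith
  also have "... = (Q + 40 * (c * Q) * Q) * bw n" using n by (simp add: hi_def power2_eq_square algebra_simps)
  finally show "FF n t \<le> (Q + 40 * (c * Q) * Q) * bw n" .
  show 2: "t \<le> sw n \<Longrightarrow> FF n t \<le> Q * bw n" using b1[of t] by (simp add: FF_def mult.commute)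
  assume t1: "t \<le> \<xi> / (real_of_int n + 1 / 2)"
  have "\<xi> / (real_of_int n + 1 / 2) \<le> sw n" unfolding s using \<xi> nx by (intro divide_left_mono) auto
  then have "t \<le> sw n" using t1 by linarith
  moreover have "bw n * (GG n t - GG n 0) \<le> bw n * (4 * c)"
    using GG_before[OF t1, of 0] nx c bw_pos[of n] by (intro mult_left_mono) auto
  ultimately show "FF n t \<le> 4 * c * bw n" by (simp add: FF_def mult.commute)
qed

lemma bw_Suc: "k < n \<Longrightarrow> bw (n + 1) = bw n / (4 * Q)"
proof -
  assume n: "k < n"
  then have "nat (n + 1 - k) = Suc (nat (n - k))" by simp
  then show ?thesis using n by (simp add: bw_def)
qed

lemma bw_near: "bw (k - 1) = A / (8 * Q)" "bw k = A" "bw (k + 1) = A / (8 * Q)"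
  by (simp_all add: bw_def)

text \<open>Mode k + 1 acts on k with the full strength \<open>Q\<close> of its resonance; its
  weight A / (8 Q) reduces this to A / 8.\<close>

lemma FF_sum_k: "t \<in> {0..T} \<Longrightarrow> FF (k - 1) t + FF (k + 1) t \<le> 13 / 100 * A"
proof -
  assume t: "t \<in> {0..T}"
  have "FF (k - 1) t \<le> 4 * c * bw (k - 1)" by (rule FF_low) (use t in auto)
  moreover have "FF (k + 1) t \<le> Q * bw (k + 1)"
    by (rule FF_high(2)) (use t T_le_sw in auto)
  moreover have "Q * (A / (8 * Q)) = A / 8" using Q_ge by simp
  moreover have "4 * c * (A / (8 * Q)) \<le> 4 / 10 ^ 4 * A"
  proof (rule mult_mono)
    show "4 * c \<le> 4 / 10 ^ 4" using c4 by simp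
    have "A * 1 \<le> A * (8 * Q)" using A Q_ge by (intro mult_left_mono) auto
    then show "A / (8 * Q) \<le> A" using Q_ge by (simp add: divide_le_eq)
  qed (use A Q_ge in auto)
  ultimately show ?thesis unfolding bw_near using A by simp
qed

text \<open>The forcing by both neighbours stays below the weight of the forced mode by a factor
  less than one, so the weighted supremum contracts away from mode k.\<close>

lemma FF_sum:
  assumes t: "t \<in> {0..T}" and n: "n \<noteq> k"
  shows "FF (n - 1) t + FF (n + 1) t \<le> 79 / 100 * YY n t"
proof -
  have c0: "0 \<le> c * Q" using c Q_ge by simp
  have up: "FF (n + 1) t \<le> 378 / 1000 * bw n" if n: "k < n"
  proof -
    have "FF (n + 1) t \<le> (Q + 40 * (c * Q) * Q) * bw (n + 1)" by (rule FF_high(1)) (use n t in auto)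
    also have "... = (1 / 4 + 10 * (c * Q)) * bw n" unfolding bw_Suc[OF n] using Q_ge by (simp add: field_simps)
    also have "... \<le> 378 / 1000 * bw n" using cQ bw_pos[of n] by (intro mult_right_mono) auto
    finally show ?thesis .
  qed
  have kk: "4 * c * bw k \<le> 41 / 100 * (A / (8 * Q))"
  proof -
    have "4 * c * bw k = 32 * (c * Q) * (A / (8 * Q))" using Q_ge by (simp add: bw_near)
    also have "... \<le> 41 / 100 * (A / (8 * Q))" using cQ A Q_ge by (intro mult_right_mono) auto
    finally show ?thesis .
  qed
  have small: "4 * c * bw n \<le> 1 / 100 * bw n" for n using c4 bw_pos[of n] by (intro mult_right_mono) auto
  consider "n < k - 1" | "n = k - 1" | "n = k + 1" | "k + 1 < n" "t \<le> sw n" | "k + 1 < n" "sw n < t" using n by linarith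
  then show ?thesis
  proof cases
    case 1
    have "FF (n - 1) t \<le> 4 * c * bw (n - 1)" "FF (n + 1) t \<le> 4 * c * bw (n + 1)" using 1 t by (auto intro!: FF_low)
    moreover have "bw (n - 1) = bw n" "bw (n + 1) = bw n" using 1 by (simp_all add: bw_def)
    ultimately show ?thesis using small[of "n - 1"] small[of "n + 1"] bw_le_YY[of n t] bw_pos[of n] by linarith
  next
    case 2
    have "FF (n - 1) t \<le> 4 * c * bw (n - 1)" "FF (n + 1) t \<le> 4 * c * bw (n + 1)" using 2 t by (auto intro!: FF_low)
    moreover have "bw (n - 1) = bw n" "bw n = A / (8 * Q)" using 2 by (simp_all add: bw_def)
    moreover have "n + 1 = k" using 2 by simp
    ultimately show ?thesis using small[of "n - 1"] kk bw_le_YY[of n t] bw_pos[of n] by simp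
  next
    case 3
    have "FF (n - 1) t \<le> 4 * c * bw (n - 1)" using 3 t by (intro FF_low) auto
    moreover have "bw n = A / (8 * Q)" using 3 by (simp add: bw_near)
    ultimately show ?thesis using up kk bw_le_YY[of n t] bw_pos[of n] 3 by simp
  next
    \<comment> \<open>The time \<open>sw n\<close> equals \<xi> / ((n - 1) + 1/2), so before it mode
      n - 1 is not yet resonant and acts with 4 c only.\<close>
    case 4
    have b: "bw (n - 1) = 4 * Q * bw n" using bw_Suc[of "n - 1"] 4 Q_ge by simp
    have "FF (n - 1) t \<le> 4 * c * bw (n - 1)"
      by (rule FF_high(3)) (use 4 t in \<open>auto simp: sw_def\<close>)
    also have "... = 16 * (c * Q) * bw n" by (simp add: b)
    also have "... \<le> 206 / 1000 * bw n" using cQ bw_pos[of n] by (intro mult_right_mono) auto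
    finally show ?thesis using up 4 bw_le_YY[of n t] bw_pos[of n] by simp
  next
    \<comment> \<open>Now mode n - 1, whose weight is larger by 4 Q, may act with its full strength
      \<open>Q\<close>. The resulting 4 Q^2, enlarged by the correction in c Q, is what the factor
      10 Q^2 of \<open>hi\<close> absorbs.\<close>
    case 5
    have b: "bw (n - 1) = 4 * Q * bw n" using bw_Suc[of "n - 1"] 5 Q_ge by simp
    have Y: "YY n t = 10 * (Q\<^sup>2 * bw n)" using 5 by (simp add: YY_def hi_def)
    have "FF (n - 1) t \<le> (Q + 40 * (c * Q) * Q) * bw (n - 1)" by (rule FF_high(1)) (use 5 t in auto)
    also have "... = (4 + 160 * (c * Q)) * (Q\<^sup>2 * bw n)" by (simp add: b power2_eq_square algebra_simps)
    also have "... \<le> 61 / 10 * (Q\<^sup>2 * bw n)" using cQ bw_pos[of n] by (intro mult_right_mono) auto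
    finally have "FF (n - 1) t \<le> 61 / 10 * (Q\<^sup>2 * bw n)" .
    moreover have "1 * bw n \<le> Q\<^sup>2 * bw n" using power_mono[of 1 Q 2] Q_ge bw_pos[of n] by (intro mult_right_mono) auto
    moreover have "FF (n + 1) t \<le> 378 / 1000 * bw n" using up 5 by simp
    ultimately show ?thesis using bw_pos[of n] unfolding Y by linarith
  qed
qed

lemma ee_0: "ee n 0 = (if n = k then A else 0)"
  using A by (simp add: ee_def en_def data)

text \<open>Qualitative only: it makes the weighted supremum in \<open>ee_le_YY\<close> finite, with
  a constant depending on T. The profile r is the square of 1 / (4 Q) because energies are squares
  of \<open>ee\<close>.\<close>

lemma ee_weighted_bounded: "\<exists>C. \<forall>n. \<forall>t\<in>{0..T}. ee n t \<le> C * YY n t"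
proof -
  define r where "r = (1 / (4 * Q))\<^sup>2"
  have r: "0 < r" unfolding r_def using Q_ge by simp
  have r1: "r \<le> 1" unfolding r_def by (rule power_le_one) (use Q_ge in auto)
  obtain K where K: "\<And>n t. 0 \<le> t \<Longrightarrow> t \<le> T \<Longrightarrow> en W J n t \<le> K"
    using bounded[of T] T_pos by auto
  define M where "M = 2 * c * (1 + T\<^sup>2) + 2"
  have M0: "0 \<le> M" using c by (simp add: M_def)
  define C1 where "C1 = A\<^sup>2 * exp (3 / r * (M * T))"
  have C1: "0 \<le> C1" by (simp add: C1_def)
  have en0: "en W J m 0 \<le> A\<^sup>2 * r ^ nat \<bar>m - k\<bar>" for m
    using r A by (simp add: en_def data)
  have "ee n t \<le> sqrt C1 * (8 * Q / A) * YY n t" if t: "t \<in> {0..T}" for n t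
  proof -
    have "ennreal (en W J n t) \<le> maj (M * t) (\<lambda>m. en W J m 0) n"
      unfolding M_def by (rule en_le_maj[OF ode W00 K]) (use t in auto)
    also have "... \<le> ennreal (A\<^sup>2 * exp (3 / r * (M * t)) * r ^ nat \<bar>n - k\<bar>)"
      by (rule maj_geometric[OF en0 r r1]) (use M0 t in auto)
    finally have "en W J n t \<le> A\<^sup>2 * exp (3 / r * (M * t)) * r ^ nat \<bar>n - k\<bar>" using r by (simp add: ennreal_le_iff)
    also have "... \<le> C1 * r ^ nat \<bar>n - k\<bar>"
      unfolding C1_def using t M0 r by (intro mult_right_mono mult_left_mono) (auto intro!: mult_left_mono divide_right_mono)
    also have "r ^ nat \<bar>n - k\<bar> = ((1 / (4 * Q)) ^ nat \<bar>n - k\<bar>)\<^sup>2" by (simp add: r_def power_mult[symmetric] mult.commute)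
    finally have "ee n t \<le> sqrt (C1 * ((1 / (4 * Q)) ^ nat \<bar>n - k\<bar>)\<^sup>2)" unfolding ee_def by (rule real_sqrt_le_mono)
    also have "... = sqrt C1 * (1 / (4 * Q)) ^ nat \<bar>n - k\<bar>" using Q_ge by (simp add: real_sqrt_mult)
    also have "... \<le> sqrt C1 * (8 * Q / A * bw n)"
    proof (rule mult_left_mono)
      have "(1 / (4 * Q)) ^ nat \<bar>n - k\<bar> \<le> 1" using Q_ge by (intro power_le_one) auto
      moreover have "1 \<le> 4 * Q" using Q_ge by simp
      moreover from this have "(1 / (4 * Q)) ^ nat (n - k) * 1 \<le> (1 / (4 * Q)) ^ nat (n - k) * (4 * Q)" by (intro mult_left_mono) auto
      ultimately show "(1 / (4 * Q)) ^ nat \<bar>n - k\<bar> \<le> 8 * Q / A * bw n" using A Q_ge by (auto simp: bw_def)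
    qed (use C1 in simp)
    also have "... \<le> sqrt C1 * (8 * Q / A * YY n t)"
      using bw_le_YY[of n t] C1 A Q_ge by (intro mult_left_mono) auto
    finally show ?thesis by (simp add: mult.assoc)
  qed
  then show ?thesis by blast
qed

lemma ee_le_YY: "t \<in> {0..T} \<Longrightarrow> ee n t \<le> 23 / 20 * YY n t"
proof -
  assume t0: "t \<in> {0..T}"
  obtain C where C: "\<And>n t. t \<in> {0..T} \<Longrightarrow> ee n t \<le> C * YY n t" using ee_weighted_bounded by blast
  define X where "X = (\<lambda>(n, t). ee n t / YY n t) ` (UNIV \<times> {0..T})"
  define Z where "Z = Sup X"
  have bd: "bdd_above X"
    unfolding X_def using C YY_pos by (intro bdd_aboveI[of _ C]) (auto simp: divide_le_eq)
  have ne: "X \<noteq> {}" using t0 by (auto simp: X_def)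
  have up: "ee n t \<le> Z * YY n t" if "t \<in> {0..T}" for n t
  proof -
    have "ee n t / YY n t \<le> Z" unfolding Z_def by (rule cSup_upper[OF _ bd]) (use that in \<open>auto simp: X_def\<close>)
    then show ?thesis using YY_pos[of n t] by (simp add: divide_le_eq)
  qed
  have Z0: "0 \<le> Z"
  proof -
    have "0 \<le> Z * YY n t0" if "t0 \<in> {0..T}" for n t0 using up[OF that, of n] ee_nonneg[of n t0] by linarith
    from this[OF t0, of 0] show ?thesis using YY_pos[of 0 t] by (simp add: zero_le_mult_iff)
  qed
  have YA: "YY k t = A" for t by (simp add: YY_def hi_def bw_near)
  \<comment> \<open>The first alternative gives Z <= 1 / 0.87, which is below 23/20; the second
    forces Z = 0.\<close>
  have "Z \<le> max (1 + 13 / 100 * Z) (79 / 100 * Z)"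
    unfolding Z_def
  proof (rule cSup_least[OF ne])
    fix x assume "x \<in> X"
    then obtain n t where nt: "t \<in> {0..T}" "x = ee n t / YY n t" by (auto simp: X_def)
    have "ee n t \<le> max (1 + 13 / 100 * Z) (79 / 100 * Z) * YY n t"
    proof (cases "n = k")
      case True
      have "ee k t \<le> A + Z * (13 / 100 * A)"
        using ee_two_switch[OF nt(1) Z0 up, of k] mult_left_mono[OF FF_sum_k[OF nt(1)] Z0] by (simp add: ee_0)
      also have "... = (1 + 13 / 100 * Z) * A" by (simp add: algebra_simps)
      also have "... \<le> max (1 + 13 / 100 * Z) (79 / 100 * Z) * A" using A by (intro mult_right_mono) auto
      finally show ?thesis using True by (simp add: YA)
    next
      case False
      have "ee n t \<le> Z * (79 / 100 * YY n t)"
        using ee_two_switch[OF nt(1) Z0 up, of n] mult_left_mono[OF FF_sum[OF nt(1) False] Z0] False by (simp add: ee_0)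
      also have "... = (79 / 100 * Z) * YY n t" by simp
      also have "... \<le> max (1 + 13 / 100 * Z) (79 / 100 * Z) * YY n t" using YY_pos[of n t] by (intro mult_right_mono) auto
      finally show ?thesis .
    qed
    then show "x \<le> max (1 + 13 / 100 * Sup X) (79 / 100 * Sup X)"
      unfolding nt(2) Z_def[symmetric] using YY_pos[of n t] by (simp add: divide_le_eq)
  qed
  then have "Z \<le> 23 / 20" using Z0 by (auto simp: max_def split: if_splits)
  then show ?thesis using up[OF t0, of n] YY_pos[of n t] by (smt (verit) mult_right_mono)
qed

lemma YY_le: "n \<noteq> k \<Longrightarrow> t \<in> {0..T} \<Longrightarrow> YY n t \<le> 32 / 100 * A" "YY k t = A" "t \<in> {0..T} \<Longrightarrow> YY n t \<le> A"
proof -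
  show YA: "YY k t = A" by (simp add: YY_def hi_def bw_near)
  have e1: "A / (8 * Q) \<le> 32 / 100 * A"
  proof -
    have "A * 1 \<le> A * (8 * Q * 32 / 100)" using A Q_ge by (intro mult_left_mono) auto
    then show ?thesis using Q_ge by (simp add: divide_le_eq)
  qed
  have main: "YY n t \<le> 32 / 100 * A" if n: "n \<noteq> k" and t: "t \<in> {0..T}" for n
  proof -
    consider "n < k" | "n = k + 1" | "k + 1 < n" using n by linarith
    then show ?thesis
    proof cases
      case 1
      then show ?thesis using e1 t by (simp add: YY_def sw_def bw_def)
    next
      case 2
      then have "t \<le> sw n" using t T_le_sw by auto
      then show ?thesis using e1 2 by (simp add: YY_def bw_near)
    next
      case 3
      have q: "1 / (4 * Q) \<le> 1" "0 \<le> 1 / (4 * Q)" using Q_ge by auto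
      have "(1 / (4 * Q)) ^ nat (n - k) \<le> (1 / (4 * Q)) ^ 2" by (rule power_decreasing) (use 3 q in auto)
      then have "A / 2 * (1 / (4 * Q)) ^ nat (n - k) \<le> A / 2 * (1 / (4 * Q)) ^ 2" using A by (intro mult_left_mono) auto
      then have "bw n \<le> A / 2 * (1 / (4 * Q)) ^ 2" using 3 by (simp add: bw_def)
      then have "10 * Q\<^sup>2 * bw n \<le> 10 * Q\<^sup>2 * (A / 2 * (1 / (4 * Q)) ^ 2)" by (intro mult_left_mono) auto
      also have "... = 5 / 16 * A" using Q_ge by (simp add: power_divide power_mult_distrib)
      finally have "hi n \<le> 32 / 100 * A" using A 3 by (simp add: hi_def)
      then show ?thesis using bw_le_hi[of n] by (simp add: YY_def)
    qed
  qed
  show "n \<noteq> k \<Longrightarrow> t \<in> {0..T} \<Longrightarrow> YY n t \<le> 32 / 100 * A" by (rule main)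
  show "t \<in> {0..T} \<Longrightarrow> YY n t \<le> A" using main[of n] YA A by (cases "n = k") auto
qed

lemma J_init: "t \<in> {0..T} \<Longrightarrow> cmod (J n t) \<le> A / 20"
proof (rule J_step[of 0 t n])
  assume t: "t \<in> {0..T}"
  then show "0 \<le> t" by simp
  fix r assume "r \<in> {0..t}"
  then have r: "r \<in> {0..T}" using t by auto
  show l: "0 \<le> lam n \<xi> r" using lam_init(1)[OF r, of n] by simp
  have W: "cmod (W n r) \<le> 23 / 20 * A" using W_le_ee[of n r] ee_le_YY[OF r, of n] YY_le(3)[OF r, of n] by linarith
  have "\<alpha> * \<bar>real_of_int n\<bar> * cmod (W n r) \<le> (4 * e * lam n \<xi> r) * (23 / 20 * A)"
    by (rule mult_mono[OF lam_init(2)[OF r] W]) (use l e_pos in auto)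
  also have "... = (46 / 10 * e) * (A * lam n \<xi> r)" by simp
  also have "... \<le> 1 / 20 * (A * lam n \<xi> r)" using eQ1 A l by (intro mult_right_mono) auto
  finally show "\<alpha> * \<bar>real_of_int n\<bar> * cmod (W n r) \<le> A / 20 * lam n \<xi> r" by simp
qed (use A data in auto)

text \<open>A lower bound needs the slow variable. \<open>Wt k\<close> changes by at most 0.17 A,
  most of it from the resonance of mode k + 1 acting with weight A / (8 Q); replacing
  \<open>Wt k\<close> by \<open>W k\<close> at time T costs another 0.05 A.\<close>

lemma W_k_T: "A / 2 \<le> cmod (W k T)"
proof -
  have k0: "k \<noteq> 0" using k2 by auto
  have inT: "T \<in> {0..T}" "0 \<in> {0..T}" using T_pos by auto
  define B where "B = 23 / 20 * A"
  define B1 where "B1 = 23 / 20 * (A / (8 * Q))"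
  have B1: "ee (k - 1) t \<le> B1" "ee (k + 1) t \<le> B1" if t: "t \<in> {0..T}" for t
  proof -
    have "t \<le> sw (k - 1)" "t \<le> sw (k + 1)" using t T_le_sw by auto
    then show "ee (k - 1) t \<le> B1" "ee (k + 1) t \<le> B1"
      using ee_le_YY[OF t, of "k - 1"] ee_le_YY[OF t, of "k + 1"] by (simp_all add: YY_def bw_near B1_def)
  qed
  have B0: "0 \<le> B" "0 \<le> B1" using A Q_ge by (simp_all add: B_def B1_def)
  have "cmod (Wt k T - Wt k 0) \<le> (B * (GG k T / (\<beta> * LL k)) + (B1 * GG (k - 1) T + B1 * GG (k + 1) T)) - (B * (GG k 0 / (\<beta> * LL k)) + (B1 * GG (k - 1) 0 + B1 * GG (k + 1) 0))"
  proof (rule deriv_compare_norm)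
    show "0 \<le> (0::real)" "0 \<le> T" using T_pos by auto
    fix t assume t: "t \<in> {0..T}"
    then have t0: "0 \<le> t" by simp
    show "(Wt k has_vector_derivative coup (\<lambda>m. W m t) k \<xi> t - of_real (dd k t) * W k t) (at t within {0..})" by (rule Wt_deriv[OF t0 k0])
    show "((\<lambda>t. B * (GG k t / (\<beta> * LL k)) + (B1 * GG (k - 1) t + B1 * GG (k + 1) t)) has_real_derivative
      B * (qq k \<xi> t / (\<beta> * LL k)) + (B1 * qq (k - 1) \<xi> t + B1 * qq (k + 1) \<xi> t)) (at t within {0..})"
      by (intro DERIV_add DERIV_cmult DERIV_cdivide GG_deriv)
    have "cmod (coup (\<lambda>m. W m t) k \<xi> t) \<le> qq (k - 1) \<xi> t * cmod (W (k - 1) t) + qq (k + 1) \<xi> t * cmod (W (k + 1) t)"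
      by (rule coup_le) (rule ode_w0[OF ode W00 t0])
    also have "... \<le> qq (k - 1) \<xi> t * B1 + qq (k + 1) \<xi> t * B1"
      by (intro add_mono mult_left_mono order_trans[OF W_le_ee] B1 t qq_nonneg)
    finally have 1: "cmod (coup (\<lambda>m. W m t) k \<xi> t) \<le> B1 * qq (k - 1) \<xi> t + B1 * qq (k + 1) \<xi> t" by (simp add: mult.commute)
    have "cmod (W k t) \<le> B" using W_le_ee[of k t] ee_le_YY[OF t, of k] YY_le(2) by (simp add: B_def)
    then have "dd k t * cmod (W k t) \<le> dd k t * B" by (rule mult_left_mono[OF _ dd_nonneg])
    then have "cmod (of_real (dd k t) * W k t) \<le> dd k t * B" using dd_nonneg by (simp add: norm_mult)
    then have 2: "cmod (of_real (dd k t) * W k t) \<le> B * (qq k \<xi> t / (\<beta> * LL k))" by (simp add: dd_k mult.commute)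
    show "cmod (coup (\<lambda>m. W m t) k \<xi> t - of_real (dd k t) * W k t) \<le> B * (qq k \<xi> t / (\<beta> * LL k)) + (B1 * qq (k - 1) \<xi> t + B1 * qq (k + 1) \<xi> t)"
      using norm_triangle_ineq4[of "coup (\<lambda>m. W m t) k \<xi> t" "of_real (dd k t) * W k t"] 1 2 by linarith
  qed
  also have "... = B / (\<beta> * LL k) * (GG k T - GG k 0) + (B1 * (GG (k - 1) T - GG (k - 1) 0) + B1 * (GG (k + 1) T - GG (k + 1) 0))"
    by (simp add: algebra_simps diff_divide_distrib)
  also have "... \<le> 1 / 100 * A + (1 / 100 * A + 15 / 100 * A)"
  proof (intro add_mono)
    have "GG k T - GG k 0 \<le> 4 * c" using GG_before[of T k 0] T_pos k2 c by linarith
    then have "B / (\<beta> * LL k) * (GG k T - GG k 0) \<le> B / (\<beta> * LL k) * (4 * c)"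
      using B0 \<beta>_pos LL_nonneg by (intro mult_left_mono) auto
    also have "... = 46 / 10 * (c / \<beta>) * (1 / LL k) * A" by (simp add: B_def mult_ac)
    also have "... \<le> 46 / 10 * (1 / 5000) * 1 * A"
    proof (intro mult_mono)
      show "c / \<beta> \<le> 1 / 5000" using c4(2) \<beta>_pos by (simp add: divide_le_eq)
      show "1 / LL k \<le> 1" using Lb(2) by (simp add: divide_le_eq)
    qed (use A c \<beta>_pos LL_nonneg in auto)
    also have "... \<le> 1 / 100 * A" using A by simp
    finally show "B / (\<beta> * LL k) * (GG k T - GG k 0) \<le> 1 / 100 * A" .
    have bq: "B1 * Q = 23 / 160 * A" using Q_ge by (simp add: B1_def)
    have "GG (k - 1) T - GG (k - 1) 0 \<le> 4 * c"
    proof -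
      have "1 \<le> real_of_int (k - 1)" using k2 by linarith
      then have "\<xi> / (real_of_int k + 1 / 2) \<le> \<xi> / (real_of_int (k - 1) + 1 / 2)" using \<xi> by (intro divide_left_mono) auto
      then show ?thesis using GG_before[of T "k - 1" 0] T_pos k2 c by linarith
    qed
    then have "B1 * (GG (k - 1) T - GG (k - 1) 0) \<le> B1 * (4 * c)" by (rule mult_left_mono[OF _ B0(2)])
    also have "... \<le> B1 * (Q * (1 / 100))" using Q_ge c4 by (intro mult_left_mono B0) auto
    also have "... = 1 / 100 * (B1 * Q)" by simp
    also have "... \<le> 1 / 100 * A" unfolding bq using A by simp
    finally show "B1 * (GG (k - 1) T - GG (k - 1) 0) \<le> 1 / 100 * A" .
    have "GG (k + 1) T - GG (k + 1) 0 \<le> Q" using GG_diff_le_pi[of "k + 1" T 0] LL_mono[of "k + 1"] by simp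
    then have "B1 * (GG (k + 1) T - GG (k + 1) 0) \<le> B1 * Q" by (rule mult_left_mono[OF _ B0(2)])
    then show "B1 * (GG (k + 1) T - GG (k + 1) 0) \<le> 15 / 100 * A" unfolding bq using A by simp
  qed
  finally have d: "cmod (Wt k T - Wt k 0) \<le> 17 / 100 * A" by simp
  have "cmod (Wt k T - W k T) \<le> e * cmod (J k T)" unfolding e_def using k2 by (intro Wt_W) simp
  also have "... \<le> 1 * (A / 20)" using eQ1 by (intro mult_mono J_init inT) auto
  finally have 2: "cmod (Wt k T - W k T) \<le> A / 20" by simp
  have "Wt k 0 = W k 0" by (simp add: Wt_def data)
  then have "cmod (Wt k 0) = A" using data(1)[of k] by simp
  moreover have "cmod (Wt k 0) \<le> cmod (W k T) + cmod (Wt k T - Wt k 0) + cmod (Wt k T - W k T)"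
  proof -
    have "cmod x \<le> cmod z + cmod (y - x) + cmod (y - z)" for x y z :: complex
      using norm_triangle_ineq4[of "z + (y - z)" "y - x"] norm_triangle_ineq[of z "y - z"] by simp
    then show ?thesis .
  qed
  ultimately show ?thesis using d 2 A by linarith
qed

lemma launch_cone:
  "A / 2 \<le> cmod (W k T)" "cmod (W n T) \<le> 3 * cmod (W k T)" "cmod (J n T) \<le> cmod (W k T) / 10"
proof -
  have inT: "T \<in> {0..T}" using T_pos by auto
  show w: "A / 2 \<le> cmod (W k T)" by (rule W_k_T)
  show "cmod (J n T) \<le> cmod (W k T) / 10" using J_init[OF inT, of n] w by linarith
  show "cmod (W n T) \<le> 3 * cmod (W k T)"
  proof (cases "n = k")
    case False
    then show ?thesis using W_le_ee[of n T] ee_le_YY[OF inT, of n] YY_le(1)[OF False inT] w A by linarith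
  qed simp
qed

end

section \<open>The window of resonances and the growth along it\<close>

locale threshold = mhd +
  fixes \<beta> b :: real
  assumes \<beta>: "\<beta> = \<kappa> / \<alpha>\<^sup>2" and c_small: "c \<le> \<beta> powr (16 / 3) / 10 ^ 3" "c \<le> 1 / 10 ^ 4"
    and b: "b = \<beta> * (1 - exp (- 3 / \<beta>))"
begin

lemma \<beta>0: "0 < \<beta>" using \<beta> \<alpha> \<kappa> by simp

text \<open>\<open>b\<close> is the guaranteed amplification per unit of \<open>LL k\<close>. It is
  of the size of the smaller of \<beta> and 3, by exp (- x) <= 1 / (1 + x) on one side and exp (- x)
  >= 1 - x on the other.\<close>

lemma b_bounds: "3 * \<beta> / (\<beta> + 3) \<le> b" "0 < b" "b \<le> 3" "b \<le> \<beta>"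
proof -
  have "exp (- 3 / \<beta>) = 1 / exp (3 / \<beta>)" by (simp add: exp_minus inverse_eq_divide)
  also have "... \<le> 1 / (1 + 3 / \<beta>)" using \<beta>0 exp_ge_add_one_self[of "3 / \<beta>"] by (intro divide_left_mono) (auto intro!: mult_pos_pos add_pos_pos)
  finally have "\<beta> * (1 - 1 / (1 + 3 / \<beta>)) \<le> b" unfolding b using \<beta>0 by (intro mult_left_mono) auto
  moreover have "\<beta> * (1 - 1 / (1 + 3 / \<beta>)) = 3 * \<beta> / (\<beta> + 3)" using \<beta>0 by (simp add: field_simps)
  ultimately show 1: "3 * \<beta> / (\<beta> + 3) \<le> b" by simp
  have "0 < 3 * \<beta> / (\<beta> + 3)" using \<beta>0 by simp
  then show "0 < b" using 1 by linarith
  have "1 - exp (- 3 / \<beta>) \<le> 3 / \<beta>" using exp_ge_add_one_self[of "- 3 / \<beta>"] by simp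
  then have "b \<le> \<beta> * (3 / \<beta>)" unfolding b using \<beta>0 by (intro mult_left_mono) auto
  then show "b \<le> 3" using \<beta>0 by simp
  have "b \<le> \<beta> * 1" unfolding b using \<beta>0 by (intro mult_left_mono) auto
  then show "b \<le> \<beta>" by simp
qed

text \<open>For \<beta> above 3/5 the absolute bound on c suffices. Below, \<open>b\<close> is at
  least 5/6 of \<beta>, and the power 16/3 of \<beta> is bounded by its fifth power.\<close>

lemma c_le_b: "c \<le> b / 5000"
proof (cases "3 / 5 \<le> \<beta>")
  case True
  then have "1 / 2 \<le> 3 * \<beta> / (\<beta> + 3)" by (simp add: field_simps)
  then show ?thesis using b_bounds(1) c_small(2) by simp
next
  case False
  have "\<beta> powr (16 / 3) \<le> \<beta> powr 5" using \<beta>0 False by (intro powr_mono') auto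
  also have "... = \<beta> * \<beta> ^ 4" using \<beta>0 by (simp add: eval_nat_numeral)
  also have "... \<le> \<beta> * (3 / 5) ^ 4" using \<beta>0 False by (intro mult_left_mono power_mono) auto
  finally have "c \<le> \<beta> * (3 / 5) ^ 4 / 10 ^ 3" using c_small(1) by simp
  moreover have "\<beta> * (5 / 6) \<le> 3 * \<beta> / (\<beta> + 3)" using \<beta>0 False by (simp add: field_simps)
  ultimately show ?thesis using b_bounds(1) \<beta>0 by (simp add: power_divide)
qed

text \<open>
  The window \<open>251/1000 yy N \<le> k \<le> 4/15 yy N\<close> is chosen such that \<open>14 \<le> LL k * b \<le> 16\<close> on it; it
  contains \<open>KK N\<close> consecutive resonances.
\<close>

definition yy where "yy (N::nat) = sqrt (c * b * real N)"
definition k0 where "k0 N = \<lfloor>4 / 15 * yy N\<rfloor>"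
definition KK where "KK N = nat \<lfloor>yy N / 100\<rfloor>"
definition k1 where "k1 N = k0 N - int (KK N)"
definition TT where "TT N k = real N / (real_of_int k + 1 / 2)"
text \<open>A lower bound for k under which the conditions \<open>large\<close> of
  \<open>regime\<close> hold; there 64 / b is an upper bound for \<open>pi * LL k\<close>.\<close>

definition RR where "RR = 1000 * \<alpha> / \<kappa> * (64 / b)\<^sup>2 + 1000 * \<alpha> / \<kappa> * (64 / b) / \<beta> + 8 / \<kappa> + 200"

lemma yy_nonneg: "0 \<le> yy N" using c b_bounds(2) by (simp add: yy_def)

lemma yy_sq: "(yy N)\<^sup>2 = c * b * real N" using c b_bounds(2) by (simp add: yy_def)

lemma RR_ge: "200 \<le> RR" "1000 * \<alpha> / \<kappa> * (64 / b)\<^sup>2 \<le> RR" "1000 * \<alpha> / \<kappa> * (64 / b) / \<beta> \<le> RR" "8 / \<kappa> \<le> RR"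
proof -
  have "0 \<le> 1000 * \<alpha> / \<kappa> * (64 / b)\<^sup>2" "0 \<le> 1000 * \<alpha> / \<kappa> * (64 / b) / \<beta>" "0 \<le> 8 / \<kappa>"
    using \<alpha> \<kappa> b_bounds(2) \<beta>0 by simp_all
  then show "200 \<le> RR" "1000 * \<alpha> / \<kappa> * (64 / b)\<^sup>2 \<le> RR" "1000 * \<alpha> / \<kappa> * (64 / b) / \<beta> \<le> RR" "8 / \<kappa> \<le> RR"
    unfolding RR_def by linarith+
qed

text \<open>Up to rounding, \<open>LL k * b\<close> is the square of \<open>yy N\<close> / k.
  Accordingly 4/15 is slightly less than 1 / sqrt 14 and 251/1000 slightly more than 1/4. Since 4/15
  - 1/100 still exceeds 0.251, there is room for the two floors once \<open>yy N\<close> is at least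
  800.\<close>

lemma k_range:
  assumes N: "4 * RR \<le> yy N" and k: "k1 N \<le> k" "k \<le> k0 N"
  shows "251 / 1000 * yy N \<le> real_of_int k" "real_of_int k \<le> 4 / 15 * yy N"
proof -
  have y: "800 \<le> yy N" using N RR_ge(1) by linarith
  have "real_of_int (k0 N) \<le> 4 / 15 * yy N" "4 / 15 * yy N - 1 \<le> real_of_int (k0 N)" unfolding k0_def by linarith+
  moreover have "real (KK N) \<le> yy N / 100" unfolding KK_def using y of_int_floor_le[of "yy N / 100"] by simp
  moreover have "real_of_int (k1 N) = real_of_int (k0 N) - real (KK N)" by (simp add: k1_def)
  moreover have "real_of_int (k1 N) \<le> real_of_int k" "real_of_int k \<le> real_of_int (k0 N)" using k by auto
  ultimately show "251 / 1000 * yy N \<le> real_of_int k" "real_of_int k \<le> 4 / 15 * yy N" using y by linarith+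
qed

lemma regimeI:
  assumes orb: "orbit \<alpha> \<kappa> c \<xi> W J" and N: "4 * RR \<le> yy N" "real N \<le> \<xi>" "\<xi> \<le> real N + 1"
    and k: "k1 N \<le> k" "k \<le> k0 N"
  shows "regime \<alpha> \<kappa> c \<xi> W J k (real N) \<beta>"
proof -
  interpret orbit \<alpha> \<kappa> c \<xi> W J by (rule orb)
  define x where "x = real_of_int k"
  define y where "y = yy N"
  have y: "800 \<le> y" "0 < y" using N RR_ge(1) by (simp_all add: y_def)
  have x: "251 / 1000 * y \<le> x" "x \<le> 4 / 15 * y" using k_range[OF N(1) k] by (simp_all add: x_def y_def)
  have xR: "RR \<le> x" using x N(1) y by (simp add: y_def)
  have x0: "200 \<le> x" using xR RR_ge by linarith
  have x2l: "63001 / 1000000 * y\<^sup>2 \<le> x\<^sup>2"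
    using power_mono[of "251 / 1000 * y" x 2] x y by (simp add: power_mult_distrib power_divide)
  have x2u: "x\<^sup>2 \<le> 16 / 225 * y\<^sup>2"
    using power_mono[of x "4 / 15 * y" 2] x x0 by (simp add: power_mult_distrib power_divide)
  have y2: "y\<^sup>2 = c * b * real N" unfolding y_def by (rule yy_sq)
  have b0: "0 < b" "b \<le> 3" using b_bounds by auto
  have cb: "c * b \<le> 3 / 10 ^ 4" using mult_mono[OF c_small(2) b0(2)] c b0 by simp
  have "c * b * real N \<le> 3 / 10 ^ 4 * real N" by (intro mult_right_mono cb) auto
  then have N50: "50 * x\<^sup>2 \<le> real N" using x2u y2 by simp
  have "200\<^sup>2 \<le> x\<^sup>2" using x0 by (intro power_mono) auto
  then have N1: "200000 \<le> real N" using N50 by simp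
  have Lbx: "LL k * b * x\<^sup>2 = c * b * \<xi>" using x0 by (simp add: LL_def x_def[symmetric])
  have lo: "14 \<le> LL k * b"
  proof -
    have "c * b * real N \<le> c * b * \<xi>" using N c b0 by (intro mult_left_mono) auto
    then have "14 * x\<^sup>2 \<le> LL k * b * x\<^sup>2" unfolding Lbx using x2u y2 zero_le_power2[of y] by linarith
    then show ?thesis using x0 by (simp add: mult_le_cancel_right)
  qed
  have hi: "LL k * b \<le> 16"
  proof -
    have "c * b * \<xi> \<le> c * b * (real N * (1 + 1 / 200000))" using N N1 c b0 by (intro mult_left_mono) auto
    also have "... = (1 + 1 / 200000) * y\<^sup>2" unfolding y2 by simp
    also have "... \<le> 16 * (63001 / 1000000 * y\<^sup>2)" by simp
    also have "... \<le> 16 * x\<^sup>2" by (intro mult_left_mono x2l) simp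
    finally have "LL k * b * x\<^sup>2 \<le> 16 * x\<^sup>2" unfolding Lbx .
    then show ?thesis using x0 by (simp add: mult_le_cancel_right)
  qed
  have L: "14 / 3 \<le> LL k"
  proof -
    have "LL k * b \<le> LL k * 3" by (intro mult_left_mono b0 LL_nonneg)
    then show ?thesis using lo by simp
  qed
  have piL: "pi * LL k \<le> 64 / b"
  proof -
    have "pi * LL k * b \<le> 4 * 16" unfolding mult.assoc by (intro mult_mono hi) (use pi_less_4 b0 LL_nonneg in auto)
    then show ?thesis using b0 by (simp add: pos_le_divide_eq)
  qed
  have piL0: "0 \<le> pi * LL k" using LL_nonneg by simp
  have sm: "\<alpha> / (\<kappa> * x) * z \<le> 1 / 1000" if "1000 * \<alpha> / \<kappa> * z \<le> RR" for z
  proof -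
    have "1000 * \<alpha> / \<kappa> * z \<le> x" using that xR by linarith
    then show ?thesis using x0 \<kappa> by (simp add: field_simps)
  qed
  show ?thesis
  proof (unfold_locales)
    show "2 \<le> k" using x0 by (simp add: x_def)
    show "50 * (real_of_int k)\<^sup>2 \<le> real N" using N50 by (simp add: x_def)
    show "real N \<le> \<xi>" "\<xi> \<le> real N + 1" by fact+
    show "\<beta> = \<kappa> / \<alpha>\<^sup>2" by (rule \<beta>)
    show "14 \<le> LL k * (\<beta> * (1 - exp (- 3 / \<beta>)))" using lo by (simp only: b)
    show "14 / 3 \<le> LL k" by (rule L)
    have "c * LL k \<le> b / 5000 * LL k" by (intro mult_right_mono c_le_b LL_nonneg)
    also have "... = LL k * b / 5000" by simp
    finally show "c * LL k \<le> 16 / 5000" using hi by simp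
    show "c \<le> 1 / 10 ^ 4" by (rule c_small)
    show "c \<le> \<beta> / 5000" using c_le_b b_bounds(4) by simp
    have "8 / \<kappa> \<le> x" using xR RR_ge(4) by linarith
    then have "8 \<le> \<kappa> * x" using \<kappa> by (simp add: pos_divide_le_eq mult.commute)
    also have "... \<le> \<kappa> * x\<^sup>2" using \<kappa> x0 by (intro mult_left_mono) (auto simp: power2_eq_square)
    finally show "8 \<le> \<kappa> * (real_of_int k)\<^sup>2" by (simp add: x_def)
    have "1000 * \<alpha> / \<kappa> * (pi * LL k)\<^sup>2 \<le> 1000 * \<alpha> / \<kappa> * (64 / b)\<^sup>2"
      using \<alpha> \<kappa> by (intro mult_left_mono power_mono piL piL0) auto
    then show "\<alpha> / (\<kappa> * real_of_int k) * (pi * LL k)\<^sup>2 \<le> 1 / 1000"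
      using sm[of "(pi * LL k)\<^sup>2"] RR_ge(2) by (simp add: x_def)
    have "1000 * \<alpha> / \<kappa> * (pi * LL k / \<beta>) \<le> 1000 * \<alpha> / \<kappa> * (64 / b / \<beta>)"
      using \<alpha> \<kappa> \<beta>0 by (intro mult_left_mono divide_right_mono piL) auto
    then show "\<alpha> / (\<kappa> * real_of_int k) * (pi * LL k) / \<beta> \<le> 1 / 1000"
      using sm[of "pi * LL k / \<beta>"] RR_ge(3) by (simp add: x_def)
  qed
qed

text \<open>The final time of the step at k is the initial time of the step at k - 1, and
  \<open>next_cone\<close> returns the cone hypothesis for k - 1 with at least twice the amplitude.
  The base case is \<open>launch_cone\<close>.\<close>

lemma cascade:
  assumes orb: "orbit \<alpha> \<kappa> c \<xi> W J" and N: "4 * RR \<le> yy N" "real N \<le> \<xi>" "\<xi> \<le> real N + 1"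
    and A: "0 < A" and data: "\<And>n. cmod (W n 0) = (if n = k0 N then A else 0)" "\<And>n. J n 0 = 0"
    and i: "i \<le> KK N"
  shows "2 ^ i * (A / 2) \<le> cmod (W (k0 N - int i) (TT N (k0 N - int i))) \<and>
    (\<forall>n. cmod (W n (TT N (k0 N - int i))) \<le> 3 * cmod (W (k0 N - int i) (TT N (k0 N - int i))) \<and>
         cmod (J n (TT N (k0 N - int i))) \<le> cmod (W (k0 N - int i) (TT N (k0 N - int i))) / 10)"
  using i
proof (induction i)
  case 0
  interpret regime \<alpha> \<kappa> c \<xi> W J "k0 N" "real N" \<beta>
    by (rule regimeI[OF orb N]) (auto simp: k1_def)
  interpret launch \<alpha> \<kappa> c \<xi> W J "k0 N" "real N" \<beta> A "TT N (k0 N)"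
    by unfold_locales (use A data in \<open>auto simp: TT_def\<close>)
  show ?case using launch_cone by simp
next
  case (Suc i)
  define k where "k = k0 N - int i"
  have k: "k0 N - int (Suc i) = k - 1" by (simp add: k_def)
  have IH: "2 ^ i * (A / 2) \<le> cmod (W k (TT N k))" "\<And>n. cmod (W n (TT N k)) \<le> 3 * cmod (W k (TT N k))"
    "\<And>n. cmod (J n (TT N k)) \<le> cmod (W k (TT N k)) / 10"
    using Suc by (auto simp: k_def)
  interpret regime \<alpha> \<kappa> c \<xi> W J k "real N" \<beta>
    by (rule regimeI[OF orb N]) (use Suc.prems in \<open>auto simp: k1_def k_def\<close>)
  have "0 < 2 ^ i * (A / 2)" using A by simp
  then have pos: "0 < cmod (W k (TT N k))" using IH(1) by linarith
  interpret resonance \<alpha> \<kappa> c \<xi> W J k "real N" \<beta> "TT N k" "TT N (k - 1)" "cmod (W k (TT N k))"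
  proof unfold_locales
    have e: "real_of_int (k - 1) + 1 / 2 = real_of_int k - 1 / 2" by simp
    show "TT N (k - 1) = real N / (real_of_int k - 1 / 2)" unfolding TT_def e ..
  qed (use IH pos in \<open>auto simp: TT_def\<close>)
  have "2 ^ Suc i * (A / 2) \<le> 2 * cmod (W k (TT N k))" using IH(1) by simp
  then show ?case unfolding k using next_cone by (meson order_trans)
qed

text \<open>Two is at least exp (1/2), which halves the exponent \<open>yy N / 100\<close>. The loss
  exp (-2) pays for the floor in \<open>KK\<close> and for the factor 1/2 from the launch.\<close>

lemma growth:
  assumes orb: "orbit \<alpha> \<kappa> c \<xi> W J" and N: "4 * RR \<le> yy N" "real N \<le> \<xi>" "\<xi> \<le> real N + 1"
    and A: "0 < A" and data: "\<And>n. cmod (W n 0) = (if n = k0 N then A else 0)" "\<And>n. J n 0 = 0"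
  shows "A * exp (yy N / 200 - 2) \<le> cmod (W (k1 N) (TT N (k1 N)))"
proof -
  have "2 ^ KK N * (A / 2) \<le> cmod (W (k1 N) (TT N (k1 N)))"
    using cascade[OF assms order_refl] unfolding k1_def by blast
  moreover have "exp (yy N / 200 - 2) \<le> 2 ^ KK N * (1 / 2)"
  proof -
    have e2: "exp (1 / 2 :: real) \<le> 2"
    proof (rule power2_le_imp_le)
      show "(exp (1 / 2 :: real))\<^sup>2 \<le> 2\<^sup>2" using exp_le by (simp add: exp_of_nat_mult[symmetric])
    qed simp
    have "yy N / 100 - 1 \<le> real (KK N)" unfolding KK_def using yy_nonneg[of N] by linarith
    then have "exp (yy N / 200 - 2) \<le> exp (real (KK N) * (1 / 2) + - 1)" by simp
    also have "... = exp (1 / 2) ^ KK N * exp (- 1)" by (simp only: exp_add exp_of_nat_mult)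
    also have "... \<le> 2 ^ KK N * (1 / 2)"
    proof (intro mult_mono power_mono e2)
      show "exp (- 1 :: real) \<le> 1 / 2" using exp_ge_add_one_self[of "1::real"] by (simp add: exp_minus field_simps)
    qed auto
    finally show ?thesis .
  qed
  then have "A * exp (yy N / 200 - 2) \<le> A * (2 ^ KK N * (1 / 2))" using A by (intro mult_left_mono) auto
  moreover have "A * (2 ^ KK N * (1 / 2)) = 2 ^ KK N * (A / 2)" by simp
  ultimately show ?thesis by linarith
qed

lemma k0_pos: "4 * RR \<le> yy N \<Longrightarrow> 0 < k0 N"
proof -
  assume "4 * RR \<le> yy N"
  then have "800 \<le> yy N" using RR_ge(1) by linarith
  then show ?thesis unfolding k0_def by (simp add: le_floor_iff)
qed

text \<open>The final time is about N / k with k below \<open>yy N\<close>, and N is at least the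
  square of \<open>yy N\<close> because c b is at most one. So the times of growth tend to
  infinity.\<close>

lemma TT_ge: "4 * RR \<le> yy N \<Longrightarrow> yy N \<le> TT N (k1 N)"
proof -
  assume N: "4 * RR \<le> yy N"
  have y: "800 \<le> yy N" using N RR_ge(1) by linarith
  have k: "251 / 1000 * yy N \<le> real_of_int (k1 N)" "real_of_int (k1 N) \<le> 4 / 15 * yy N"
    using k_range[OF N, of "k1 N"] by (auto simp: k1_def)
  have cb: "c * b \<le> 1" using mult_mono[OF c_small(2) b_bounds(3)] c b_bounds(2) by simp
  have "yy N * (real_of_int (k1 N) + 1 / 2) \<le> yy N * yy N" using k y by (intro mult_left_mono) auto
  also have "... = c * b * real N" using yy_sq[of N] by (simp add: power2_eq_square)
  also have "... \<le> 1 * real N" by (intro mult_right_mono cb) auto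
  finally show ?thesis unfolding TT_def using k y by (simp add: pos_le_divide_eq)
qed

lemma yy_at_top: "filterlim yy at_top sequentially"
proof -
  have "filterlim (\<lambda>N. sqrt (c * b) * sqrt (real N)) at_top sequentially"
    using c b_bounds(2)
    by (intro filterlim_tendsto_pos_mult_at_top[OF tendsto_const] filterlim_compose[OF sqrt_at_top filterlim_real_sequentially]) auto
  then show ?thesis by (simp add: yy_def[abs_def] real_sqrt_mult)
qed

end

section \<open>Unstable initial data\<close>

lemma gevrey_energy_mono: "C \<le> D \<Longrightarrow> gevrey_energy C w j \<le> gevrey_energy D w j"
  unfolding gevrey_energy_def by (intro nn_integral_mono ennreal_leI mult_right_mono) (auto intro: mult_right_mono)

text \<open>One mode on a frequency interval of length one suffices, since for nonnegative s the
  Sobolev weight is at least one.\<close>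

lemma sobolev_norm_ge:
  assumes w: "w \<in> L2_cyl" "has_fourier w W" and s: "0 \<le> s" and M: "0 \<le> M" and ab: "b - a = 1"
    and ge: "AE \<xi> in lborel. \<xi> \<in> {a<..<b} \<longrightarrow> M \<le> cmod (W k \<xi>)"
  shows "ennreal M \<le> sobolev_norm s w j"
proof -
  let ?f = "\<lambda>k \<xi>. ennreal ((1 + (real_of_int k)\<^sup>2 + \<xi>\<^sup>2) powr s * ((cmod (fourier w k \<xi>))\<^sup>2 + (cmod (fourier j k \<xi>))\<^sup>2))"
  define E where "E = zsum (\<lambda>k. \<integral>\<^sup>+\<xi>. ?f k \<xi> \<partial>lborel)"
  have "ennreal (M\<^sup>2) = (\<integral>\<^sup>+\<xi>. ennreal (M\<^sup>2) * indicator {a<..<b} \<xi> \<partial>lborel)"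
    using ab by (simp add: nn_integral_cmult_indicator)
  also have "... \<le> (\<integral>\<^sup>+\<xi>. ?f k \<xi> \<partial>lborel)"
  proof (rule nn_integral_mono_AE)
    show "AE \<xi> in lborel. ennreal (M\<^sup>2) * indicator {a<..<b} \<xi> \<le> ?f k \<xi>"
      using ge fourier_ae_eq[OF w, of k]
    proof eventually_elim
      fix \<xi> assume a: "\<xi> \<in> {a<..<b} \<longrightarrow> M \<le> cmod (W k \<xi>)" "fourier w k \<xi> = W k \<xi>"
      show "ennreal (M\<^sup>2) * indicator {a<..<b} \<xi> \<le> ?f k \<xi>"
      proof (cases "\<xi> \<in> {a<..<b}")
        case True
        then have "M\<^sup>2 \<le> (cmod (fourier w k \<xi>))\<^sup>2" using a M by (simp add: power_mono)
        moreover have "1 \<le> (1 + (real_of_int k)\<^sup>2 + \<xi>\<^sup>2) powr s" using s by (intro ge_one_powr_ge_zero) (simp_all add: add.assoc)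
        ultimately have "1 * M\<^sup>2 \<le> (1 + (real_of_int k)\<^sup>2 + \<xi>\<^sup>2) powr s * ((cmod (fourier w k \<xi>))\<^sup>2 + (cmod (fourier j k \<xi>))\<^sup>2)"
          by (intro mult_mono) (auto simp: add_increasing2)
        then show ?thesis using True by (simp add: ennreal_leI)
      qed simp
    qed
  qed
  also have "... \<le> E" unfolding E_def by (rule member_le_zsum)
  finally have le: "ennreal (M\<^sup>2) \<le> E" .
  show ?thesis
  proof (cases "E = \<infinity>")
    case True
    then show ?thesis unfolding sobolev_norm_def E_def[symmetric] Let_def by simp
  next
    case False
    then have "M\<^sup>2 \<le> enn2real E" using enn2real_mono[OF le] by (simp add: less_top)
    then have "M \<le> sqrt (enn2real E)" by (rule real_le_rsqrt)
    then show ?thesis using False unfolding sobolev_norm_def E_def[symmetric] Let_def by (simp add: ennreal_leI)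
  qed
qed

lemma Limsup_eq_top:
  fixes f :: "real \<Rightarrow> ennreal"
  assumes T: "filterlim T at_top sequentially" and M: "filterlim M at_top sequentially"
    and ge: "\<forall>\<^sub>F N in sequentially. ennreal (M N) \<le> f (T N)"
  shows "Limsup at_top f = \<infinity>"
proof -
  have "(SUP t\<in>Collect P. f t) = top" if P: "eventually P at_top" for P
    unfolding SUP_eq_top_iff
  proof (intro allI impI)
    fix x :: ennreal assume "x < top"
    then obtain r where r: "0 \<le> r" "x = ennreal r" by (cases x rule: ennreal_cases) auto
    have "\<forall>\<^sub>F N in sequentially. P (T N)" by (rule eventually_compose_filterlim[OF P T])
    moreover have "\<forall>\<^sub>F N in sequentially. r < M N" using M by (simp add: filterlim_at_top_dense)
    ultimately have "\<forall>\<^sub>F N in sequentially. P (T N) \<and> r < M N \<and> ennreal (M N) \<le> f (T N)"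
      using ge by eventually_elim auto
    then obtain N where N: "P (T N)" "r < M N" "ennreal (M N) \<le> f (T N)"
      by (auto dest: eventually_happens)
    have "x < ennreal (M N)" using N(2) r by (simp add: ennreal_less_iff)
    then have "x < f (T N)" using N(3) by (rule less_le_trans)
    then show "\<exists>t\<in>Collect P. x < f t" using N(1) by auto
  qed
  then show ?thesis unfolding Limsup_def by (simp add: INF_top_conv)
qed

context threshold begin

text \<open>Half the growth rate in sqrt N: the chain gains exp (2 sg sqrt N), so amplitudes
  decaying like exp (- sg sqrt N) still end up growing.\<close>

definition sg where "sg = sqrt (c * b) / 400"

lemma sg_pos: "0 < sg" using c b_bounds(2) by (simp add: sg_def)

lemma yy_sg: "yy N / 200 = 2 * (sg * sqrt (real N))"
  by (simp add: yy_def sg_def real_sqrt_mult)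

definition cutoff where "cutoff N \<longleftrightarrow> 4 * RR \<le> yy N"

lemma cutoff_eventually: "\<forall>\<^sub>F N in sequentially. cutoff N"
  unfolding cutoff_def using yy_at_top by (simp add: filterlim_at_top)

text \<open>Each frequency excites one mode, the top \<open>k0 N\<close> of its window. Using the
  integer part N makes mode and amplitude constant on unit intervals; negative frequencies carry the
  mirror image, so that the data are real.\<close>

definition seed :: "int \<Rightarrow> real \<Rightarrow> complex" where
  "seed k \<xi> = (let N = nat \<lfloor>\<bar>\<xi>\<bar>\<rfloor> in
     if cutoff N \<and> (0 < \<xi> \<and> k = k0 N \<or> \<xi> < 0 \<and> - k = k0 N) then of_real (exp (- (sg * sqrt (real N)))) else 0)"

lemma seed_measurable [measurable]: "seed k \<in> borel_measurable borel"
proof -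
  have 1: "(\<lambda>\<xi>::real. nat \<lfloor>\<bar>\<xi>\<bar>\<rfloor>) \<in> borel \<rightarrow>\<^sub>M count_space UNIV" by measurable
  have [measurable]: "Measurable.pred borel (\<lambda>\<xi>::real. P (nat \<lfloor>\<bar>\<xi>\<bar>\<rfloor>))" for P :: "nat \<Rightarrow> bool"
    by (rule measurable_compose[OF 1]) simp
  have [measurable]: "(\<lambda>\<xi>::real. of_real (exp (- (sg * sqrt (real (nat \<lfloor>\<bar>\<xi>\<bar>\<rfloor>))))) :: complex) \<in> borel_measurable borel"
    by (rule measurable_compose[OF 1]) simp
  show ?thesis unfolding seed_def[abs_def] Let_def by measurable
qed

lemma seed_sym: "seed (- k) (- \<xi>) = cnj (seed k \<xi>)"
  by (auto simp: seed_def Let_def)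

lemma seed_0: "seed 0 \<xi> = 0"
  using k0_pos[of "nat \<lfloor>\<bar>\<xi>\<bar>\<rfloor>"] by (auto simp: seed_def Let_def cutoff_def)

lemma seed_at:
  assumes "cutoff N" "real N < \<xi>" "\<xi> < real N + 1"
  shows "seed n \<xi> = (if n = k0 N then of_real (exp (- (sg * sqrt (real N)))) else 0)"
proof -
  have "\<lfloor>\<bar>\<xi>\<bar>\<rfloor> = int N" using assms by (simp add: floor_eq_iff)
  then have "nat \<lfloor>\<bar>\<xi>\<bar>\<rfloor> = N" by simp
  moreover have "0 < \<xi>" using assms by linarith
  ultimately show ?thesis using assms by (simp add: seed_def Let_def)
qed

text \<open>The squared amplitude decays at rate 2 sg and the weight takes back sg, which leaves an
  integrable exponential. The constant exp (2 sg) pays for replacing N by \<bar>\<xi>\<bar>.\<close>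

lemma seed_energy: "mode_energy (\<lambda>\<xi>. ennreal (exp (sg * sqrt \<bar>\<xi>\<bar>))) seed (\<lambda>_ _. 0) < \<infinity>"
proof -
  have "mode_energy (\<lambda>\<xi>. ennreal (exp (sg * sqrt \<bar>\<xi>\<bar>))) seed (\<lambda>_ _. 0) \<le> (\<integral>\<^sup>+\<xi>. ennreal (exp (2 * sg)) * ennreal (exp (- sg * sqrt \<bar>\<xi>\<bar>)) \<partial>lborel)"
    unfolding mode_energy_def
  proof (rule nn_integral_mono)
    fix \<xi> :: real
    define N where "N = nat \<lfloor>\<bar>\<xi>\<bar>\<rfloor>"
    define m where "m = (if 0 < \<xi> then k0 N else - k0 N)"
    have off: "seed n \<xi> = 0" if "n \<noteq> m" for n using that by (auto simp: seed_def Let_def m_def N_def)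
    have "zsum (\<lambda>n. ennreal ((cmod (seed n \<xi>))\<^sup>2 + (cmod 0)\<^sup>2)) = (\<Sum>n\<in>{m}. ennreal ((cmod (seed n \<xi>))\<^sup>2 + (cmod 0)\<^sup>2))"
      by (rule nn_integral_count_space') (auto simp: off)
    also have "... \<le> ennreal (exp (- (2 * (sg * sqrt (real N)))))"
    proof -
      have "cmod (seed m \<xi>) \<le> exp (- (sg * sqrt (real N)))" by (auto simp: seed_def Let_def N_def)
      then have "(cmod (seed m \<xi>))\<^sup>2 \<le> (exp (- (sg * sqrt (real N))))\<^sup>2" by (intro power_mono) auto
      also have "... = exp (- (2 * (sg * sqrt (real N))))" by (simp add: exp_double[symmetric])
      finally show ?thesis by (simp add: ennreal_leI)
    qed
    finally have "ennreal (exp (sg * sqrt \<bar>\<xi>\<bar>)) * zsum (\<lambda>n. ennreal ((cmod (seed n \<xi>))\<^sup>2 + (cmod 0)\<^sup>2)) \<le>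
        ennreal (exp (sg * sqrt \<bar>\<xi>\<bar>)) * ennreal (exp (- (2 * (sg * sqrt (real N)))))" by (rule mult_left_mono) simp
    also have "... = ennreal (exp (sg * sqrt \<bar>\<xi>\<bar> - 2 * (sg * sqrt (real N))))"
      by (simp add: ennreal_mult[symmetric] exp_add[symmetric])
    also have "... \<le> ennreal (exp (2 * sg + - sg * sqrt \<bar>\<xi>\<bar>))"
    proof (intro ennreal_leI)
      have "\<bar>\<xi>\<bar> \<le> real N + 1" unfolding N_def by linarith
      then have "sqrt \<bar>\<xi>\<bar> \<le> sqrt (real N + 1)" by simp
      also have "... \<le> sqrt (real N) + 1" using sqrt_add_le_add_sqrt[of "real N" 1] by simp
      finally have "sg * sqrt \<bar>\<xi>\<bar> \<le> sg * (sqrt (real N) + 1)" using sg_pos by (intro mult_left_mono) auto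
      then show "exp (sg * sqrt \<bar>\<xi>\<bar> - 2 * (sg * sqrt (real N))) \<le> exp (2 * sg + - sg * sqrt \<bar>\<xi>\<bar>)"
        by (simp add: algebra_simps)
    qed
    also have "... = ennreal (exp (2 * sg)) * ennreal (exp (- sg * sqrt \<bar>\<xi>\<bar>))"
      by (simp add: ennreal_mult[symmetric] exp_add[symmetric])
    finally show "ennreal (exp (sg * sqrt \<bar>\<xi>\<bar>)) * zsum (\<lambda>n. ennreal ((cmod (seed n \<xi>))\<^sup>2 + (cmod 0)\<^sup>2)) \<le>
      ennreal (exp (2 * sg)) * ennreal (exp (- sg * sqrt \<bar>\<xi>\<bar>))" .
  qed
  also have "... = ennreal (exp (2 * sg)) * (\<integral>\<^sup>+\<xi>. ennreal (exp (- sg * sqrt \<bar>\<xi>\<bar>)) \<partial>lborel)"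
    by (rule nn_integral_cmult) measurable
  also have "... < \<infinity>" using integrable_exp_neg_sqrt[OF sg_pos] by (simp add: ennreal_mult_less_top)
  finally show ?thesis .
qed

lemma seed_data:
  obtains w0 j0 where "w0 \<in> L2_cyl" "j0 \<in> L2_cyl" "has_fourier w0 seed" "has_fourier j0 (\<lambda>_ _. 0)"
proof -
  let ?g = "\<lambda>\<xi>. ennreal (exp (sg * sqrt \<bar>\<xi>\<bar>))"
  have int: "integrable lborel (seed k)" for k
  proof (rule integrable_of_gevrey[OF sg_pos])
    have "(\<integral>\<^sup>+\<xi>. ?g \<xi> * nsq (seed k \<xi>) \<partial>lborel) \<le> mode_energy ?g seed (\<lambda>_ _. 0)"
      unfolding mode_energy_def
      by (intro nn_integral_mono mult_left_mono order_trans[OF _ member_le_zsum[of _ k]]) auto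
    then show "(\<integral>\<^sup>+\<xi>. ?g \<xi> * nsq (seed k \<xi>) \<partial>lborel) < \<infinity>" using seed_energy by (rule le_less_trans)
  qed simp
  have "mode_energy (\<lambda>\<xi>. 1) seed (\<lambda>_ _. 0) \<le> mode_energy ?g seed (\<lambda>_ _. 0)"
    unfolding mode_energy_def
  proof (intro nn_integral_mono mult_right_mono)
    show "1 \<le> ?g \<xi>" for \<xi> :: real using sg_pos by simp
  qed auto
  then have "mode_energy (\<lambda>\<xi>. 1) seed (\<lambda>_ _. 0) < \<infinity>" using seed_energy by (rule le_less_trans)
  then have fin: "zsum (\<lambda>k. sqn lborel (seed k)) < \<infinity>"
    using sqn_eq_mode_energy[of seed "\<lambda>_ _. 0"] by (simp add: sqn_def)
  obtain w0 where "w0 \<in> L2_cyl" "has_fourier w0 seed"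
    using fourier_inverse[of seed, OF int fin seed_sym] by blast
  moreover obtain j0 where "j0 \<in> L2_cyl" "has_fourier j0 (\<lambda>_ _. 0)"
    by (rule fourier_inverse[of "\<lambda>_ _. 0"]) (auto simp: sqn_def)
  ultimately show ?thesis using that by blast
qed

text \<open>By \<open>solution_modes\<close> almost every frequency of any solution is an
  \<open>orbit\<close>, so the growth holds for all solutions with these data. At the time
  \<open>TT N (k1 N)\<close> it holds for almost all frequencies in the unit interval above N
  together.\<close>

lemma solution_unbounded:
  assumes L2: "w0 \<in> L2_cyl" "j0 \<in> L2_cyl" and F0: "has_fourier w0 seed" "has_fourier j0 (\<lambda>_ _. 0)"
    and sol: "is_solution \<alpha> \<kappa> c w0 j0 w j" and s: "0 \<le> s"
  shows "Limsup at_top (\<lambda>t. sobolev_norm s (w t) (j t)) = \<infinity>"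
proof -
  obtain W J where F: "\<And>t. 0 \<le> t \<Longrightarrow> w t \<in> L2_cyl \<and> j t \<in> L2_cyl \<and> has_fourier (w t) (\<lambda>n. W n t) \<and> has_fourier (j t) (\<lambda>n. J n t)"
    and ae: "AE \<xi> in lborel. ode_at W J \<xi> \<and> W 0 0 \<xi> = 0 \<and>
      modes_bounded W J \<xi>"
    using solution_modes[OF sol] by blast
  have ini: "has_fourier w0 (\<lambda>n. W n 0)" "has_fourier j0 (\<lambda>n. J n 0)"
    using solution_initial[OF sol L2, of "\<lambda>n. W n 0" "\<lambda>n. J n 0"] F[of 0] by auto
  have ini_ae: "AE \<xi> in lborel. \<forall>n. W n 0 \<xi> = seed n \<xi> \<and> J n 0 \<xi> = 0"
    unfolding AE_all_countable
    using has_fourier_unique[OF L2(1) ini(1) F0(1)] has_fourier_unique[OF L2(2) ini(2) F0(2)] by auto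
  have low: "ennreal (exp (sg * sqrt (real N) - 2)) \<le> sobolev_norm s (w (TT N (k1 N))) (j (TT N (k1 N)))" if N: "cutoff N" for N
  proof -
    have T0: "0 \<le> TT N (k1 N)" using TT_ge[of N] yy_nonneg[of N] N by (simp add: cutoff_def)
    show ?thesis
    proof (rule sobolev_norm_ge[where a="real N" and b="real N + 1" and W="\<lambda>n. W n (TT N (k1 N))" and k="k1 N"])
      show "w (TT N (k1 N)) \<in> L2_cyl" "has_fourier (w (TT N (k1 N))) (\<lambda>n. W n (TT N (k1 N)))" using F[OF T0] by auto
      show "AE \<xi> in lborel. \<xi> \<in> {real N<..<real N + 1} \<longrightarrow> exp (sg * sqrt (real N) - 2) \<le> cmod (W (k1 N) (TT N (k1 N)) \<xi>)"
        using ae ini_ae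
      proof eventually_elim
        fix \<xi>
        assume o: "ode_at W J \<xi> \<and> W 0 0 \<xi> = 0 \<and>
            modes_bounded W J \<xi>"
          and i: "\<forall>n. W n 0 \<xi> = seed n \<xi> \<and> J n 0 \<xi> = 0"
        show "\<xi> \<in> {real N<..<real N + 1} \<longrightarrow> exp (sg * sqrt (real N) - 2) \<le> cmod (W (k1 N) (TT N (k1 N)) \<xi>)"
        proof
          assume \<xi>: "\<xi> \<in> {real N<..<real N + 1}"
          have orb: "orbit \<alpha> \<kappa> c \<xi> (\<lambda>n t. W n t \<xi>) (\<lambda>n t. J n t \<xi>)"
            by unfold_locales (use o \<xi> in auto)
          have "exp (- (sg * sqrt (real N))) * exp (yy N / 200 - 2) \<le> cmod (W (k1 N) (TT N (k1 N)) \<xi>)"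
            by (rule growth[OF orb]) (use N \<xi> i in \<open>auto simp: cutoff_def seed_at\<close>)
          also have "exp (- (sg * sqrt (real N))) * exp (yy N / 200 - 2) = exp (sg * sqrt (real N) - 2)"
            unfolding yy_sg by (simp add: exp_add[symmetric])
          finally show "exp (sg * sqrt (real N) - 2) \<le> cmod (W (k1 N) (TT N (k1 N)) \<xi>)" .
        qed
      qed
    qed (use s in auto)
  qed
  show ?thesis
  proof (rule Limsup_eq_top[where T="\<lambda>N. TT N (k1 N)" and M="\<lambda>N. exp (sg * sqrt (real N) - 2)"])
    show "filterlim (\<lambda>N. TT N (k1 N)) at_top sequentially"
      by (rule filterlim_at_top_mono[OF yy_at_top]) (use cutoff_eventually TT_ge in \<open>auto simp: cutoff_def elim: eventually_mono\<close>)
    have "filterlim (\<lambda>N. - 2 + sg * sqrt (real N)) at_top sequentially"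
      by (intro filterlim_tendsto_add_at_top[OF tendsto_const] filterlim_tendsto_pos_mult_at_top[OF tendsto_const sg_pos]
          filterlim_compose[OF sqrt_at_top filterlim_real_sequentially])
    then have "filterlim (\<lambda>N. sg * sqrt (real N) - 2) at_top sequentially" by simp
    then show "filterlim (\<lambda>N. exp (sg * sqrt (real N) - 2)) at_top sequentially"
      by (rule filterlim_compose[OF exp_at_top])
    show "\<forall>\<^sub>F N in sequentially. ennreal (exp (sg * sqrt (real N) - 2)) \<le> sobolev_norm s (w (TT N (k1 N))) (j (TT N (k1 N)))"
      using cutoff_eventually by (rule eventually_mono) (rule low)
  qed
qed

lemma unstable_data:
  "\<exists>w0\<in>L2_cyl. \<exists>j0\<in>L2_cyl. zero_x_average w0 \<and> zero_x_average j0 \<and> gevrey_energy sg w0 j0 < \<infinity> \<and>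
     (\<exists>w j. is_solution \<alpha> \<kappa> c w0 j0 w j) \<and>
     (\<forall>w j. is_solution \<alpha> \<kappa> c w0 j0 w j \<longrightarrow> (\<forall>s\<ge>0. Limsup at_top (\<lambda>t. sobolev_norm s (w t) (j t)) = \<infinity>))"
proof -
  obtain w0 j0 where L2: "w0 \<in> L2_cyl" "j0 \<in> L2_cyl" and F: "has_fourier w0 seed" "has_fourier j0 (\<lambda>_ _. 0)"
    by (rule seed_data)
  have z: "zero_x_average w0" "zero_x_average j0"
    using zero_x_average_iff[OF L2(1) F(1)] zero_x_average_iff[OF L2(2) F(2)] seed_0 by auto
  have fin: "gevrey_energy sg w0 j0 < \<infinity>"
    unfolding gevrey_energy_eq[OF L2 F] by (rule seed_energy)
  show ?thesis
    using L2 z fin solution_exists[OF sg_pos L2 z fin] solution_unbounded[OF L2 F] by blast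
qed

end

theorem theorem3:
  fixes \<alpha> \<kappa> \<beta> c :: real
  assumes "0 < \<alpha>" "\<alpha> < 10"
    and "0 < \<kappa>" "\<kappa> < 1"
    and "\<beta> = \<kappa> / \<alpha>\<^sup>2"
    and "0 < c" "c \<le> min (\<beta> powr (16 / 3) / 10 ^ 3) (1 / 10 ^ 4)"
  shows "\<exists>C.
    (\<forall>w0\<in>L2_cyl. \<forall>j0\<in>L2_cyl.
       zero_x_average w0 \<longrightarrow> zero_x_average j0 \<longrightarrow> gevrey_energy C w0 j0 < \<infinity> \<longrightarrow>
       (\<exists>w j. is_solution \<alpha> \<kappa> c w0 j0 w j) \<and>
       (\<forall>w j. is_solution \<alpha> \<kappa> c w0 j0 w j \<longrightarrow>
          (\<forall>t>0. gevrey_energy (C / 2) (w t) (j t) < \<infinity>))) \<and>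
    (\<exists>C'. 0 < C' \<and> C' < C \<and>
       (\<exists>w0\<in>L2_cyl. \<exists>j0\<in>L2_cyl.
          zero_x_average w0 \<and> zero_x_average j0 \<and> gevrey_energy C' w0 j0 < \<infinity> \<and>
          (\<exists>w j. is_solution \<alpha> \<kappa> c w0 j0 w j) \<and>
          (\<forall>w j. is_solution \<alpha> \<kappa> c w0 j0 w j \<longrightarrow>
             (\<forall>s\<ge>0. Limsup at_top (\<lambda>t. sobolev_norm s (w t) (j t)) = \<infinity>))))"
proof -
  interpret threshold \<alpha> \<kappa> c \<beta> "\<beta> * (1 - exp (- 3 / \<beta>))"
    by unfold_locales (use assms in auto)
  \<comment> \<open>Existence and propagation hold at every positive rate, so \<open>C\<close> only
    has to exceed the rate \<open>sg\<close> of the unstable data.\<close>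
  define C where "C = sg + 1"
  have C: "0 < C" "sg < C" "C / 2 \<le> C" using sg_pos by (auto simp: C_def)
  have "(\<exists>w j. is_solution \<alpha> \<kappa> c w0 j0 w j) \<and>
       (\<forall>w j. is_solution \<alpha> \<kappa> c w0 j0 w j \<longrightarrow> (\<forall>t>0. gevrey_energy (C / 2) (w t) (j t) < \<infinity>))"
    if L2: "w0 \<in> L2_cyl" "j0 \<in> L2_cyl" and z: "zero_x_average w0" "zero_x_average j0" and fin: "gevrey_energy C w0 j0 < \<infinity>" for w0 j0
  proof (intro conjI allI impI)
    show "\<exists>w j. is_solution \<alpha> \<kappa> c w0 j0 w j" by (rule solution_exists[OF C(1) L2 z fin])
    fix w j and t :: real assume sol: "is_solution \<alpha> \<kappa> c w0 j0 w j" and t: "0 < t"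
    have "gevrey_energy (C / 2) w0 j0 < \<infinity>" using gevrey_energy_mono[OF C(3)] fin by (rule le_less_trans)
    then show "gevrey_energy (C / 2) (w t) (j t) < \<infinity>"
      using le_less_trans[OF solution_gevrey_bound[OF sol L2, of t "C / 2"]] t by (simp add: ennreal_mult_less_top)
  qed
  then show ?thesis using sg_pos C(2) unstable_data by blast
qed

end
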